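(* Let $1\le p\le\infty$ and $n\in\mathbb N$. Let $\lambda=\mathrm{diag}(\lambda_1,\dots,\lambda_n)$ be a real-valued diagonal $(n\times n)$-matrix and $f=(f_{ij})$ an $(n\times n)$-matrix whose entries belong to $\mathcal G_{L^\infty}(\Omega,\mathbb R^2)$. Assume that $\lambda$ is uniformly bounded on strips and that $\partial_x\lambda$ and $f$ are of uniform local logarithmic type. Assume also that $g=(g_1,\dots,g_n)$ has entries in $\mathcal G_{L^p}(\Omega,\mathbb R^2)$ and let $u_0=(u_{01},\dots,u_{0n})$ have entries in $\mathcal G_{L^p}(\Omega,\mathbb R)$. Then the Cauchy problem $$(\partial_t+\lambda(x,t)\partial_x)u=f(x,t)u+g(x,t),\qquad u(x,0)=u_0(x)$$ has a unique global solution $u=(u_1,\dots,u_n)$ with entries in $\mathcal G_{L^p}(\Omega,\mathbb R^2)$. (The differential equation is understood as an equality in $\mathcal G_{L^p}(\Omega,\mathbb R^2)$ and the initial condition as an equality in $\mathcal G_{L^p}(\Omega,\mathbb R)$, componentwise.)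
   Context: $(\Omega,\Sigma,P)$ is a probability space (assumed complete whenever needed). A random field on $\mathbb R^d$ is a map $\mathbb R^d\times\Omega\to\mathbb R$, $(x,\omega)\mapsto A(x,\omega)$, such that $\omega\mapsto A(x,\omega)$ is measurable for every $x$. A family $(r_\varepsilon)_{\varepsilon\in(0,1]}$ of numbers is moderate if $\exists a\ge 0:\ |r_\varepsilon|=O(\varepsilon^{-a})$ as $\varepsilon\to0$, and negligible if $\forall b\ge0:\ |r_\varepsilon|=O(\varepsilon^{b})$ as $\varepsilon\to 0$. For $1\le p\le\infty$, $\mathcal E_{M,L^p}(\Omega,\mathbb R^d)$ (respectively $\mathcal N_{L^p}(\Omega,\mathbb R^d)$) is the set of families $(u_\varepsilon)_{\varepsilon\in(0,1]}$ of random fields on $\mathbb R^d$ such that: for almost all $\omega$ and all $\varepsilon\in(0,1]$, $x\mapsto u_\varepsilon(x,\omega)$ is in $\mathcal C^\infty(\mathbb R^d)$; for all $x,\varepsilon$, $\omega\mapsto u_\varepsilon(x,\omega)$ is measurable; for all $x\in\mathbb R^d$, $\alpha\in\mathbb N_0^d$, $\varepsilon\in(0,1]$, $\omega\mapsto\partial^\alpha u_\varepsilon(x,\omega)$ belongs to $L^p(\Omega)$ and for all compact $K\subset\mathbb R^d$, $\sup_{x\in K}\|\partial^\alpha u_\varepsilon(x)\|_{L^p(\Omega)}$ is finite; and for all compact $K$ and all $\alpha$, the family $(\sup_{x\in K}\|\partial^\alpha u_\varepsilon(x)\|_{L^p(\Omega)})_{\varepsilon}$ is moderate (respectively negligible).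 $\mathcal G_{L^p}(\Omega,\mathbb R^d)=\mathcal E_{M,L^p}(\Omega,\mathbb R^d)/\mathcal N_{L^p}(\Omega,\mathbb R^d)$. Derivatives, the product of an element of $\mathcal G_{L^\infty}$ with an element of $\mathcal G_{L^p}$ (an element of $\mathcal G_{L^p}$), and the restriction to $t=0$ (the class of $(u_\varepsilon(\cdot,0,\cdot))_\varepsilon$ in $\mathcal G_{L^p}(\Omega,\mathbb R)$) are defined on representatives. For vectors $|g|=\max_j|g_j|$, and for matrices $|f|=\max_i\sum_j|f_{ij}|$. A (scalar-, vector- or matrix-valued) process $v$ in $\mathcal G_{L^\infty}(\Omega,\mathbb R^2)$ is: - uniformly bounded on strips, if it has a representative such that for every compact time interval $I$ there is a constant $c>0$ such that, for almost all $\omega$ and all $\varepsilon\in(0,1]$, $\sup_{x\in\mathbb R,\,t\in I}|v_\varepsilon(x,t,\omega)|\le c$; - of uniform local logarithmic type, if it has a representative such that for every compact $K\subset\mathbb R^2$ there is a constant $c>0$ such that, for almost all $\omega$ and all $\varepsilon\in(0,1]$, $\sup_{(x,t)\in K}|v_\varepsilon(x,t,\omega)|\le c|\log\varepsilon|$. *)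

theory Defs
  imports
    "HOL-Probability.Essential_Supremum"
    "HOL-Probability.Probability_Measure"
    "HOL-Analysis.Complete_Measure"
    "HOL-Library.Landau_Symbols"
begin

section \<open>Smooth functions and partial derivatives\<close>

definition pd :: "'d \<Rightarrow> (real^'d \<Rightarrow> real) \<Rightarrow> real^'d \<Rightarrow> real" where
  "pd i f x = deriv (\<lambda>s. f (x + s *\<^sub>R axis i 1)) 0"

fun Ck :: "nat \<Rightarrow> (real^'d \<Rightarrow> real) \<Rightarrow> bool" where
  "Ck 0 f \<longleftrightarrow> continuous_on UNIV f"
| "Ck (Suc k) f \<longleftrightarrow> continuous_on UNIV f \<and>
     (\<forall>i x. (\<lambda>s. f (x + s *\<^sub>R axis i 1)) differentiable (at 0)) \<and> (\<forall>i. Ck k (pd i f))"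

definition C_infinity :: "(real^'d \<Rightarrow> real) \<Rightarrow> bool" where
  "C_infinity f \<longleftrightarrow> (\<forall>k. Ck k f)"

text \<open>The multi-index derivative, with a multi-index given as a function on the coordinate
  indices. The coordinates are processed in the order of the index type; on smooth functions the
  order is irrelevant.\<close>

definition mderiv :: "('d \<Rightarrow> nat) \<Rightarrow> (real^('d::{finite,linorder}) \<Rightarrow> real) \<Rightarrow>
    real^('d::{finite,linorder}) \<Rightarrow> real" where
  "mderiv \<alpha> f = foldr (\<lambda>i. pd i ^^ \<alpha> i) (sorted_list_of_set UNIV) f"

section \<open>The spaces of p-integrable random variables\<close>

text \<open>The exponent \<open>p\<close> ranges over the extended reals with \<open>1 \<le> p\<close>, where \<open>\<infinity>\<close> stands for the
  essential supremum norm. The norm takes the value \<open>\<infinity>\<close> outside of \<open>Lp_space\<close>.\<close>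

definition Lp_norm :: "'w measure \<Rightarrow> ennreal \<Rightarrow> ('w \<Rightarrow> real) \<Rightarrow> ennreal" where
  "Lp_norm M p X =
    (if p = \<infinity> then esssup M (\<lambda>\<omega>. ennreal \<bar>X \<omega>\<bar>)
     else let I = (\<integral>\<^sup>+ \<omega>. ennreal (\<bar>X \<omega>\<bar> powr enn2real p) \<partial>M)
       in if I = \<infinity> then \<infinity> else ennreal (enn2real I powr (1 / enn2real p)))"

definition Lp_space :: "'w measure \<Rightarrow> ennreal \<Rightarrow> ('w \<Rightarrow> real) set" where
  "Lp_space M p = {X \<in> borel_measurable M. Lp_norm M p X < \<infinity>}"

section \<open>Moderate and negligible families\<close>

definition moderate :: "(real \<Rightarrow> real) \<Rightarrow> bool" where
  "moderate r \<longleftrightarrow> (\<exists>a\<ge>0. r \<in> O[at_right 0](\<lambda>\<epsilon>. \<epsilon> powr (- a)))"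

definition negligible_family :: "(real \<Rightarrow> real) \<Rightarrow> bool" where
  "negligible_family r \<longleftrightarrow> (\<forall>b\<ge>0. r \<in> O[at_right 0](\<lambda>\<epsilon>. \<epsilon> powr b))"

text \<open>A family of random fields, \<open>u \<epsilon> x \<omega>\<close>. Only the parameters \<open>\<epsilon> \<in> (0,1]\<close> matter: in the
  quotient spaces below, families that agree for these parameters are identified.\<close>

type_synonym ('w, 'd) family = "real \<Rightarrow> real^'d \<Rightarrow> 'w \<Rightarrow> real"

definition fam_mderiv ::
    "('d::{finite,linorder} \<Rightarrow> nat) \<Rightarrow> ('w, 'd) family \<Rightarrow> ('w, 'd) family" where
  "fam_mderiv \<alpha> u = (\<lambda>\<epsilon> x \<omega>. mderiv \<alpha> (\<lambda>y. u \<epsilon> y \<omega>) x)"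

definition smooth_Lp_families ::
    "'w measure \<Rightarrow> ennreal \<Rightarrow> ('w, 'd::{finite,linorder}) family set" where
  "smooth_Lp_families M p = {u.
     (AE \<omega> in M. \<forall>\<epsilon>\<in>{0<..1}. C_infinity (\<lambda>x. u \<epsilon> x \<omega>)) \<and>
     (\<forall>x. \<forall>\<epsilon>\<in>{0<..1}. u \<epsilon> x \<in> borel_measurable M) \<and>
     (\<forall>x \<alpha>. \<forall>\<epsilon>\<in>{0<..1}. fam_mderiv \<alpha> u \<epsilon> x \<in> Lp_space M p) \<and>
     (\<forall>K \<alpha>. \<forall>\<epsilon>\<in>{0<..1}. compact K \<longrightarrow> (SUP x\<in>K. Lp_norm M p (fam_mderiv \<alpha> u \<epsilon> x)) < \<infinity>)}"

definition E_M :: "'w measure \<Rightarrow> ennreal \<Rightarrow> ('w, 'd::{finite,linorder}) family set" where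
  "E_M M p = {u \<in> smooth_Lp_families M p. \<forall>K \<alpha>. compact K \<longrightarrow>
     moderate (\<lambda>\<epsilon>. enn2real (SUP x\<in>K. Lp_norm M p (fam_mderiv \<alpha> u \<epsilon> x)))}"

definition N_fam :: "'w measure \<Rightarrow> ennreal \<Rightarrow> ('w, 'd::{finite,linorder}) family set" where
  "N_fam M p = {u \<in> smooth_Lp_families M p. \<forall>K \<alpha>. compact K \<longrightarrow>
     negligible_family (\<lambda>\<epsilon>. enn2real (SUP x\<in>K. Lp_norm M p (fam_mderiv \<alpha> u \<epsilon> x)))}"

section \<open>The Colombeau spaces and their operations\<close>

definition G_rel ::
    "'w measure \<Rightarrow> ennreal \<Rightarrow> (('w, 'd::{finite,linorder}) family \<times> ('w, 'd) family) set" where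
  "G_rel M p = {(u, v). u \<in> E_M M p \<and> v \<in> E_M M p \<and> (\<lambda>\<epsilon> x \<omega>. u \<epsilon> x \<omega> - v \<epsilon> x \<omega>) \<in> N_fam M p}"

definition G_space :: "'w measure \<Rightarrow> ennreal \<Rightarrow> ('w, 'd::{finite,linorder}) family set set" where
  "G_space M p = E_M M p // G_rel M p"

text \<open>The operations on classes are the unions, over all choices of representatives, of the classes
  of the results of the corresponding operations on families.\<close>

definition G_zero :: "'w measure \<Rightarrow> ennreal \<Rightarrow> ('w, 'd::{finite,linorder}) family set" where
  "G_zero M p = G_rel M p `` {\<lambda>\<epsilon> x \<omega>. 0}"

definition G_add :: "'w measure \<Rightarrow> ennreal \<Rightarrow> ('w, 'd::{finite,linorder}) family set \<Rightarrow>
    ('w, 'd) family set \<Rightarrow> ('w, 'd) family set" where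
  "G_add M p U V = (\<Union>u\<in>U. \<Union>v\<in>V. G_rel M p `` {\<lambda>\<epsilon> x \<omega>. u \<epsilon> x \<omega> + v \<epsilon> x \<omega>})"

definition G_sum :: "'w measure \<Rightarrow> ennreal \<Rightarrow> ('n::finite \<Rightarrow> ('w, 'd::{finite,linorder}) family set) \<Rightarrow>
    ('w, 'd) family set" where
  "G_sum M p U = (\<Union>u\<in>{u. \<forall>j. u j \<in> U j}. G_rel M p `` {\<lambda>\<epsilon> x \<omega>. \<Sum>j\<in>UNIV. u j \<epsilon> x \<omega>})"

text \<open>In the product, \<open>A\<close> is an element of \<open>G_space M \<infinity>\<close> and \<open>U\<close> is an element of \<open>G_space M p\<close>.\<close>

definition G_mult :: "'w measure \<Rightarrow> ennreal \<Rightarrow> ('w, 'd::{finite,linorder}) family set \<Rightarrow>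
    ('w, 'd) family set \<Rightarrow> ('w, 'd) family set" where
  "G_mult M p A U = (\<Union>a\<in>A. \<Union>u\<in>U. G_rel M p `` {\<lambda>\<epsilon> x \<omega>. a \<epsilon> x \<omega> * u \<epsilon> x \<omega>})"

definition G_pd :: "'w measure \<Rightarrow> ennreal \<Rightarrow> 'd::{finite,linorder} \<Rightarrow> ('w, 'd) family set \<Rightarrow>
    ('w, 'd) family set" where
  "G_pd M p i U = (\<Union>u\<in>U. G_rel M p `` {\<lambda>\<epsilon> x \<omega>. pd i (\<lambda>y. u \<epsilon> y \<omega>) x})"

text \<open>A point of the plane is \<open>(x, t)\<close>, with space coordinate \<open>$ 1\<close> and time coordinate \<open>$ 2\<close>.\<close>

definition G_dx :: "'w measure \<Rightarrow> ennreal \<Rightarrow> ('w, 2) family set \<Rightarrow> ('w, 2) family set" where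
  "G_dx M p = G_pd M p 1"

definition G_dt :: "'w measure \<Rightarrow> ennreal \<Rightarrow> ('w, 2) family set \<Rightarrow> ('w, 2) family set" where
  "G_dt M p = G_pd M p 2"

definition G_restrict0 :: "'w measure \<Rightarrow> ennreal \<Rightarrow> ('w, 2) family set \<Rightarrow> ('w, 1) family set" where
  "G_restrict0 M p U = (\<Union>u\<in>U. G_rel M p `` {\<lambda>\<epsilon> x \<omega>. u \<epsilon> (vector [x $ 1, 0]) \<omega>})"

section \<open>Matrices of generalized processes\<close>

definition G_diag :: "'w measure \<Rightarrow> ennreal \<Rightarrow> ('n \<Rightarrow> ('w, 'd::{finite,linorder}) family set) \<Rightarrow>
    'n \<Rightarrow> 'n \<Rightarrow> ('w, 'd) family set" where
  "G_diag M p L i j = (if i = j then L i else G_zero M p)"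

definition G_matvec :: "'w measure \<Rightarrow> ennreal \<Rightarrow>
    ('m \<Rightarrow> 'n::finite \<Rightarrow> ('w, 'd::{finite,linorder}) family set) \<Rightarrow>
    ('n \<Rightarrow> ('w, 'd) family set) \<Rightarrow> 'm \<Rightarrow> ('w, 'd) family set" where
  "G_matvec M p A U i = G_sum M p (\<lambda>j. G_mult M p (A i j) (U j))"

definition mat_norm :: "('m::finite \<Rightarrow> 'n::finite \<Rightarrow> real) \<Rightarrow> real" where
  "mat_norm a = (MAX i. \<Sum>j\<in>UNIV. \<bar>a i j\<bar>)"

text \<open>A bound on a supremum is stated as a bound at every point, as a real-valued \<open>Sup\<close> is
  unspecified for unbounded or empty sets.\<close>

definition uniformly_bounded_on_strips ::
    "'w measure \<Rightarrow> ('m::finite \<Rightarrow> 'n::finite \<Rightarrow> ('w, 2) family set) \<Rightarrow> bool" where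
  "uniformly_bounded_on_strips M V \<longleftrightarrow> (\<exists>v. (\<forall>i j. v i j \<in> V i j) \<and>
     (\<forall>a b. \<exists>c>0. AE \<omega> in M. \<forall>\<epsilon>\<in>{0<..1}. \<forall>x. \<forall>t\<in>{a..b}.
        mat_norm (\<lambda>i j. v i j \<epsilon> (vector [x, t]) \<omega>) \<le> c))"

definition uniform_local_log_type ::
    "'w measure \<Rightarrow> ('m::finite \<Rightarrow> 'n::finite \<Rightarrow> ('w, 2) family set) \<Rightarrow> bool" where
  "uniform_local_log_type M V \<longleftrightarrow> (\<exists>v. (\<forall>i j. v i j \<in> V i j) \<and>
     (\<forall>K. compact K \<longrightarrow> (\<exists>c>0. AE \<omega> in M. \<forall>\<epsilon>\<in>{0<..1}. \<forall>z\<in>K.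
        mat_norm (\<lambda>i j. v i j \<epsilon> z \<omega>) \<le> c * \<bar>ln \<epsilon>\<bar>)))"

end

theory Submission
  imports Defs "HOL-Real_Asymp.Real_Asymp"
begin

text \<open>By a Sobolev-type estimate, the \<open>L\<^sup>p\<close> norms of the derivatives of a smooth random field
  control the \<open>L\<^sup>p\<close> norm of its pathwise suprema over compact sets, so that membership in the
  Colombeau spaces can be expressed by pathwise bounds. For a fixed path and a fixed \<open>\<epsilon>\<close>, the
  maximum principle on a backward cone bounds the solution of the system by
  \<open>exp ((\<kappa> + 1) T)\<close> times the data, where \<open>\<kappa>\<close> bounds the zero-order coefficient; the logarithmic
  type makes this factor moderate. The \<open>x\<close>-derivatives solve systems of the same kind with \<open>f\<close>
  replaced by \<open>f - \<partial>\<^sub>x\<lambda>\<close>, and the \<open>t\<close>-derivatives are read off from the equation. The same linear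
  estimate gives moderateness of the solution and, applied to a difference of two solutions, its
  negligibility. For a fixed path a smooth solution is obtained by Picard iteration along the
  characteristic curves; the iteration also shows its measurability.\<close>

section \<open>Oriented integrals\<close>

definition oint :: "real \<Rightarrow> real \<Rightarrow> (real \<Rightarrow> real) \<Rightarrow> real" where
  "oint a b h = (b - a) * integral {0..1} (\<lambda>\<theta>. h (a + \<theta> * (b - a)))"

abbreviation cont2 :: "(real \<Rightarrow> real \<Rightarrow> real) \<Rightarrow> bool" where
  "cont2 f \<equiv> continuous_on UNIV (\<lambda>z. f (fst z) (snd z))"

lemma cont2D:
  assumes "cont2 f" "continuous_on S a" "continuous_on S b"
  shows "continuous_on S (\<lambda>z. f (a z) (b z))"
  using continuous_on_compose2[OF assms(1) continuous_on_Pair[OF assms(2,3)]] by simp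

lemma oint_same [simp]: "oint a a h = 0"
  by (simp add: oint_def)

lemma affine_in_segment:
  fixes a b :: real
  assumes "\<theta> \<in> {0..1}"
  shows "a + \<theta> * (b - a) \<in> closed_segment a b"
  unfolding closed_segment_def
  using assms by (auto intro!: exI[of _ \<theta>] simp: algebra_simps)

lemma oint_FTC_within:
  assumes "\<And>r. r \<in> S \<Longrightarrow> (H has_vector_derivative h r) (at r within S)"
    and "closed_segment a b \<subseteq> S"
  shows "oint a b h = H b - H a"
proof -
  have "((\<lambda>\<theta>. (b - a) * h (a + \<theta> * (b - a))) has_integral
      H (a + 1 * (b - a)) - H (a + 0 * (b - a))) {0..1}"
  proof (rule fundamental_theorem_of_calculus)
    fix \<theta> :: real assume t: "\<theta> \<in> {0..1}"
    have im: "(\<lambda>\<theta>. a + \<theta> * (b - a)) ` {0..1} \<subseteq> S"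
      using assms(2) affine_in_segment by blast
    have "(H has_vector_derivative h (a + \<theta> * (b - a)))
        (at (a + \<theta> * (b - a)) within (\<lambda>\<theta>. a + \<theta> * (b - a)) ` {0..1})"
      using has_vector_derivative_within_subset[OF assms(1) im] im t by blast
    moreover have "((\<lambda>\<theta>. a + \<theta> * (b - a)) has_vector_derivative (b - a)) (at \<theta> within {0..1})"
      by (auto intro!: derivative_eq_intros simp: has_real_derivative_iff_has_vector_derivative[symmetric])
    ultimately have "(H \<circ> (\<lambda>\<theta>. a + \<theta> * (b - a)) has_vector_derivative
        (b - a) *\<^sub>R h (a + \<theta> * (b - a))) (at \<theta> within {0..1})"
      by (rule vector_diff_chain_within[rotated])
    then show "((\<lambda>\<theta>. H (a + \<theta> * (b - a))) has_vector_derivative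
        (b - a) * h (a + \<theta> * (b - a))) (at \<theta> within {0..1})"
      by (simp add: o_def)
  qed simp
  then have "integral {0..1} (\<lambda>\<theta>. (b - a) * h (a + \<theta> * (b - a))) = H b - H a"
    by (subst integral_unique) auto
  then show ?thesis
    by (simp add: oint_def)
qed

lemma oint_FTC:
  assumes "\<And>r. (H has_field_derivative h r) (at r)"
  shows "oint a b h = H b - H a"
  by (rule oint_FTC_within[of UNIV])
    (use assms in \<open>auto simp: has_real_derivative_iff_has_vector_derivative\<close>)

lemma oint_deriv:
  assumes "continuous_on UNIV h"
  shows "((\<lambda>s. oint a s h) has_field_derivative h s) (at s)"
proof -
  define n where "n = 1 + \<bar>a\<bar> + \<bar>s\<bar>"
  obtain g where g: "\<And>x. x \<in> {-n..n} \<Longrightarrow> (g has_vector_derivative h x) (at x within {-n..n})"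
    using antiderivative_continuous[of "-n" n h] assms continuous_on_subset by blast
  have s: "s \<in> interior {-n..n}" and a: "a \<in> {-n..n}"
    by (auto simp: n_def)
  have "(g has_field_derivative h s) (at s)"
    using g[of s] s interior_subset at_within_interior[OF s]
    by (auto simp: has_real_derivative_iff_has_vector_derivative)
  then have "((\<lambda>s. g s - g a) has_field_derivative h s) (at s)"
    by (auto intro!: derivative_eq_intros)
  moreover have "g s' - g a = oint a s' h" if "s' \<in> interior {-n..n}" for s'
  proof (rule oint_FTC_within[of "{-n..n}", symmetric, OF g])
    have "s' \<in> {-n..n}" using that interior_subset by blast
    then show "closed_segment a s' \<subseteq> {-n..n}"
      using a by (intro closed_segment_subset) auto
  qed
  ultimately show ?thesis
    by (rule has_field_derivative_transform_within_open[OF _ open_interior s])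
qed

lemma oint_add:
  assumes "continuous_on UNIV h"
  shows "oint a b h + oint b c h = oint a c h"
proof -
  have "oint x y h = oint 0 y h - oint 0 x h" for x y
    by (rule oint_FTC[OF oint_deriv[OF assms]])
  from this[of a b] this[of b c] this[of a c] show ?thesis by linarith
qed

lemma integrable_oint:
  assumes "continuous_on UNIV h"
  shows "(\<lambda>\<theta>. h (a + \<theta> * (b - a)) :: real) integrable_on {0..1::real}"
  by (rule integrable_continuous_interval, rule continuous_on_compose2[OF assms])
    (auto intro!: continuous_intros)

lemma oint_diff:
  assumes "continuous_on UNIV h" "continuous_on UNIV k"
  shows "oint a b (\<lambda>r. h r - k r) = oint a b h - oint a b k"
  using integrable_oint[OF assms(1), of a b] integrable_oint[OF assms(2), of a b]
  by (simp add: oint_def integral_diff algebra_simps)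

lemma oint_cmult: "oint a b (\<lambda>r. c * h r) = c * oint a b h"
  by (simp add: oint_def)

lemma oint_bound_exp:
  assumes h: "continuous_on UNIV h" and K: "K \<ge> 0" "\<kappa> > 0"
    and le: "\<And>r. r \<in> closed_segment a b \<Longrightarrow> \<bar>h r\<bar> \<le> K * exp (\<kappa> * \<bar>r - a\<bar>)"
  shows "\<bar>oint a b h\<bar> \<le> K / \<kappa> * exp (\<kappa> * \<bar>b - a\<bar>)"
proof (cases "a = b")
  case True then show ?thesis using K by simp
next
  case False
  define d where "d = \<bar>b - a\<bar>"
  have d: "d > 0" using False by (simp add: d_def)
  have hi: "((\<lambda>\<theta>. K * exp (\<kappa> * (\<theta> * d))) has_integral
      (K / (\<kappa> * d) * exp (\<kappa> * (1 * d)) - K / (\<kappa> * d) * exp (\<kappa> * (0 * d)))) {0..1}"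
    by (rule fundamental_theorem_of_calculus)
      (use K d in \<open>auto intro!: derivative_eq_intros
        simp: has_real_derivative_iff_has_vector_derivative[symmetric] field_simps\<close>)
  have "norm (integral {0..1} (\<lambda>\<theta>. h (a + \<theta> * (b - a)))) \<le>
      integral {0..1} (\<lambda>\<theta>. K * exp (\<kappa> * (\<theta> * d)))"
  proof (rule integral_norm_bound_integral[OF integrable_oint[OF h]])
    show "(\<lambda>\<theta>. K * exp (\<kappa> * (\<theta> * d))) integrable_on {0..1}" using hi by blast
    fix \<theta> :: real assume t: "\<theta> \<in> {0..1}"
    have "a + \<theta> * (b - a) \<in> closed_segment a b"
      by (rule affine_in_segment[OF t])
    from le[OF this] show "norm (h (a + \<theta> * (b - a))) \<le> K * exp (\<kappa> * (\<theta> * d))"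
      using t by (simp add: abs_mult d_def)
  qed
  also have "\<dots> = K / (\<kappa> * d) * exp (\<kappa> * d) - K / (\<kappa> * d)"
    using integral_unique[OF hi] by simp
  also have "\<dots> \<le> K / (\<kappa> * d) * exp (\<kappa> * d)" using K d by simp
  finally have "d * \<bar>integral {0..1} (\<lambda>\<theta>. h (a + \<theta> * (b - a)))\<bar> \<le> d * (K / (\<kappa> * d) * exp (\<kappa> * d))"
    using d by (intro mult_left_mono) auto
  then show ?thesis
    using d K by (simp add: oint_def abs_mult d_def[symmetric])
qed

lemma oint_bound:
  assumes h: "continuous_on UNIV h"
    and le: "\<And>r. r \<in> closed_segment a b \<Longrightarrow> \<bar>h r\<bar> \<le> K"
  shows "\<bar>oint a b h\<bar> \<le> K * \<bar>b - a\<bar>"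
proof -
  have "norm (integral {0..1} (\<lambda>\<theta>. h (a + \<theta> * (b - a)))) \<le> integral {0..1::real} (\<lambda>\<theta>. K)"
  proof (rule integral_norm_bound_integral[OF integrable_oint[OF h]])
    fix \<theta> :: real assume t: "\<theta> \<in> {0..1}"
    have "a + \<theta> * (b - a) \<in> closed_segment a b"
      by (rule affine_in_segment[OF t])
    from le[OF this] show "norm (h (a + \<theta> * (b - a))) \<le> K" by simp
  qed auto
  then have "\<bar>integral {0..1} (\<lambda>\<theta>. h (a + \<theta> * (b - a)))\<bar> \<le> K" by simp
  then show ?thesis
    unfolding oint_def abs_mult by (subst mult.commute) (rule mult_right_mono, auto)
qed

lemma oint_nonneg:
  assumes "a \<le> b" "continuous_on UNIV h" "\<And>r. r \<in> {a..b} \<Longrightarrow> 0 \<le> h r"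
  shows "0 \<le> oint a b h"
proof -
  have "0 \<le> integral {0..1} (\<lambda>\<theta>. h (a + \<theta> * (b - a)))"
  proof (rule integral_nonneg[OF integrable_oint[OF assms(2)]])
    fix \<theta> :: real assume "\<theta> \<in> {0..1}"
    from affine_in_segment[OF this, of a b] show "0 \<le> h (a + \<theta> * (b - a))"
      using assms(1,3) by (simp add: closed_segment_eq_real_ivl)
  qed
  then show ?thesis using assms(1) by (simp add: oint_def)
qed

lemma oint_mono:
  assumes "a \<le> b" "continuous_on UNIV h" "continuous_on UNIV k" "\<And>r. r \<in> {a..b} \<Longrightarrow> h r \<le> k r"
  shows "oint a b h \<le> oint a b k"
  using oint_nonneg[OF assms(1), of "\<lambda>r. k r - h r"] oint_diff[OF assms(3,2), of a b] assms
  by (auto intro: continuous_intros)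

lemma oint_abs:
  assumes "a \<le> b" and h: "continuous_on UNIV h"
  shows "\<bar>oint a b h\<bar> \<le> oint a b (\<lambda>r. \<bar>h r\<bar>)"
proof -
  have "oint a b h \<le> oint a b (\<lambda>r. \<bar>h r\<bar>)"
    by (rule oint_mono[OF assms(1)]) (auto intro: continuous_intros h)
  moreover have "oint a b (\<lambda>r. -1 * h r) \<le> oint a b (\<lambda>r. \<bar>h r\<bar>)"
    by (rule oint_mono[OF assms(1)]) (auto intro: continuous_intros h)
  ultimately show ?thesis unfolding oint_cmult by simp
qed

lemma oint_continuous:
  fixes h :: "'a::topological_space \<Rightarrow> real \<Rightarrow> real"
  assumes h: "continuous_on UNIV (\<lambda>z. h (fst z) (snd z))"
    and a: "continuous_on UNIV a" and b: "continuous_on UNIV b"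
  shows "continuous_on UNIV (\<lambda>z. oint (a z) (b z) (h z))"
proof -
  have c: "continuous_on (UNIV \<times> cbox 0 1)
      (\<lambda>(z, \<theta>). h z (a z + \<theta> * (b z - a z)))"
    unfolding split_beta
    by (rule continuous_on_compose2[OF h, of _ "\<lambda>p. (fst p, a (fst p) + snd p * (b (fst p) - a (fst p)))", simplified])
      (auto intro!: continuous_intros continuous_on_compose2[OF a] continuous_on_compose2[OF b])
  have "continuous_on UNIV (\<lambda>z. integral {0..1} (\<lambda>\<theta>. h z (a z + \<theta> * (b z - a z))))"
    using integral_continuous_on_param[OF c] by simp
  then show ?thesis
    unfolding oint_def by (intro continuous_intros a b)
qed

lemma oint_leibniz:
  assumes d: "\<And>x r. ((\<lambda>x. h x r) has_field_derivative h' x r) (at x)"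
    and c: "cont2 h" "cont2 h'"
  shows "((\<lambda>x. oint a b (h x)) has_field_derivative oint a b (h' x)) (at x)"
proof -
  have "((\<lambda>x. integral (cbox 0 1) (\<lambda>\<theta>. h x (a + \<theta> * (b - a)))) has_field_derivative
     integral (cbox 0 1) (\<lambda>\<theta>. h' x (a + \<theta> * (b - a)))) (at x within UNIV)"
    by (rule leibniz_rule_field_derivative)
      (auto simp: split_beta d intro!: integrable_continuous_interval cont2D[OF c(1)] cont2D[OF c(2)]
        continuous_intros)
  from DERIV_cmult[OF this, of "b - a"] show ?thesis
    unfolding oint_def by simp
qed

lemma Riemann_sums:
  fixes \<phi> :: "real \<Rightarrow> real"
  assumes c: "continuous_on UNIV \<phi>"
  shows "(\<lambda>n. (\<Sum>k<Suc n. \<phi> (real k / real (Suc n))) / real (Suc n)) \<longlonglongrightarrow> integral {0..1} \<phi>"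
proof (rule LIMSEQ_I)
  fix e :: real assume e: "e > 0"
  define \<Phi> where "\<Phi> s = oint 0 s \<phi>" for s
  have \<Phi>: "(\<Phi> has_field_derivative \<phi> s) (at s)" for s
    unfolding \<Phi>_def by (rule oint_deriv[OF c])
  have I: "integral {0..1} \<phi> = \<Phi> 1" by (simp add: \<Phi>_def oint_def)
  have "uniformly_continuous_on {0..1} \<phi>"
    using c compact_uniformly_continuous continuous_on_subset by blast
  then obtain d where d: "d > 0"
    "\<And>x y. x \<in> {0..1} \<Longrightarrow> y \<in> {0..1} \<Longrightarrow> dist y x < d \<Longrightarrow> dist (\<phi> y) (\<phi> x) < e/2"
    unfolding uniformly_continuous_on_def using e by (metis half_gt_zero)
  obtain N where N: "1 / real (Suc N) < d" using nat_approx_posE d(1) by metis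
  show "\<exists>N. \<forall>n\<ge>N. norm ((\<Sum>k<Suc n. \<phi> (real k / real (Suc n))) / real (Suc n) - integral {0..1} \<phi>) < e"
  proof (intro exI allI impI)
    fix n assume n: "n \<ge> N"
    define m where "m = real (Suc n)"
    have m: "m > 0" "1/m < d"
      using n N d by (auto simp: m_def) (smt (verit) frac_le of_nat_le_iff of_nat_0_le_iff)
    have "\<bar>\<Phi> (real (Suc k) / m) - \<Phi> (real k / m) - \<phi> (real k / m) / m\<bar> \<le> e / 2 / m" if k: "k < Suc n" for k
    proof -
      have lt: "real k / m < real (Suc k) / m" using m by (simp add: divide_strict_right_mono)
      from MVT2[OF lt, of \<Phi> \<phi>] \<Phi> obtain z where z: "real k / m < z" "z < real (Suc k) / m"
        "\<Phi> (real (Suc k) / m) - \<Phi> (real k / m) = (real (Suc k) / m - real k / m) * \<phi> z" by blast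
      have w: "real (Suc k) / m - real k / m = 1 / m" by (simp add: diff_divide_distrib[symmetric])
      have kk: "real (Suc k) / m \<le> 1" "real k / m \<ge> 0" using k m by (auto simp: m_def)
      then have "0 \<le> z" "z \<le> 1" using z by linarith+
      then have "z \<in> {0..1}" "real k / m \<in> {0..1}" "dist z (real k / m) < d"
        using z w m kk lt unfolding dist_real_def atLeastAtMost_iff abs_less_iff by linarith+
      from d(2)[OF this(2,1,3)] have "\<bar>\<phi> z - \<phi> (real k / m)\<bar> \<le> e / 2" by (simp add: dist_real_def)
      then have "1 / m * \<bar>\<phi> z - \<phi> (real k / m)\<bar> \<le> 1/ m * (e / 2)"
        using m by (intro mult_left_mono) auto
      also have "1 / m * \<bar>\<phi> z - \<phi> (real k / m)\<bar> = \<bar>1 / m * (\<phi> z - \<phi> (real k / m))\<bar>"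
        using m by (simp add: abs_mult)
      finally show ?thesis using z(3) w by (simp add: right_diff_distrib)
    qed
    then have "(\<Sum>k<Suc n. \<bar>\<Phi> (real (Suc k) / m) - \<Phi> (real k / m) - \<phi> (real k / m) / m\<bar>) \<le> (\<Sum>k<Suc n. e / 2 / m)"
      by (intro sum_mono) auto
    also have "\<dots> = e / 2" using m by (simp add: m_def del: of_nat_Suc)
    finally have 1: "\<bar>\<Sum>k<Suc n. (\<Phi> (real (Suc k) / m) - \<Phi> (real k / m)) - \<phi> (real k / m) / m\<bar> \<le> e / 2"
      by (rule order_trans[OF sum_abs])
    have "(\<Sum>k<Suc n. \<Phi> (real (Suc k) / m) - \<Phi> (real k / m)) = \<Phi> (real (Suc n) / m) - \<Phi> (real 0 / m)"
      by (rule sum_lessThan_telescope)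
    also have "\<dots> = \<Phi> 1" using m by (simp add: m_def \<Phi>_def del: of_nat_Suc)
    finally have "\<bar>\<Phi> 1 - (\<Sum>k<Suc n. \<phi> (real k / m)) / m\<bar> \<le> e / 2"
      using 1 by (simp add: sum_subtractf sum_divide_distrib del: sum.lessThan_Suc)
    then show "norm ((\<Sum>k<Suc n. \<phi> (real k / real (Suc n))) / real (Suc n) - integral {0..1} \<phi>) < e"
      using e by (simp add: I m_def abs_minus_commute del: sum.lessThan_Suc of_nat_Suc)
  qed
qed

lemma oint_measurable:
  fixes h :: "'w \<Rightarrow> real \<Rightarrow> real"
  assumes c: "\<And>\<omega>. \<omega> \<in> space M \<Longrightarrow> continuous_on UNIV (h \<omega>)"
    and m: "\<And>r. (\<lambda>\<omega>. h \<omega> r) \<in> borel_measurable M"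
  shows "(\<lambda>\<omega>. oint a b (h \<omega>)) \<in> borel_measurable M"
proof -
  have "(\<lambda>\<omega>. integral {0..1} (\<lambda>\<theta>. h \<omega> (a + \<theta> * (b - a)))) \<in> borel_measurable M"
  proof (rule borel_measurable_LIMSEQ_real)
    fix \<omega> assume w: "\<omega> \<in> space M"
    show "(\<lambda>n. (\<Sum>k<Suc n. h \<omega> (a + real k / real (Suc n) * (b - a))) / real (Suc n))
      \<longlonglongrightarrow> integral {0..1} (\<lambda>\<theta>. h \<omega> (a + \<theta> * (b - a)))"
      by (rule Riemann_sums[of "\<lambda>\<theta>. h \<omega> (a + \<theta> * (b - a))"])
        (auto intro!: continuous_on_compose2[OF c[OF w]] continuous_intros)
  qed (use m in measurable)
  then show ?thesis unfolding oint_def by measurable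
qed

lemma measurable_at_random_point:
  fixes h :: "real \<Rightarrow> 'w \<Rightarrow> real"
  assumes c: "\<And>\<omega>. \<omega> \<in> space M \<Longrightarrow> continuous_on UNIV (\<lambda>x. h x \<omega>)"
    and m: "\<And>x. h x \<in> borel_measurable M" and X: "X \<in> borel_measurable M"
  shows "(\<lambda>\<omega>. h (X \<omega>) \<omega>) \<in> borel_measurable M"
proof (rule borel_measurable_LIMSEQ_real)
  fix n
  have "(\<lambda>\<omega>. h (real_of_int i / real (Suc n)) \<omega>) \<in> borel_measurable M" for i
    by (rule m)
  moreover have "(\<lambda>\<omega>. \<lfloor>X \<omega> * real (Suc n)\<rfloor>) \<in> M \<rightarrow>\<^sub>M count_space UNIV"
    using X by measurable
  ultimately show "(\<lambda>\<omega>. h (real_of_int \<lfloor>X \<omega> * real (Suc n)\<rfloor> / real (Suc n)) \<omega>) \<in> borel_measurable M"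
    by (rule measurable_compose_countable[where f = "\<lambda>i \<omega>. h (real_of_int i / real (Suc n)) \<omega>"])
next
  fix \<omega> assume w: "\<omega> \<in> space M"
  have "(\<lambda>n. real_of_int \<lfloor>X \<omega> * real (Suc n)\<rfloor> / real (Suc n)) \<longlonglongrightarrow> X \<omega>"
  proof (rule real_tendsto_sandwich)
    show "\<forall>\<^sub>F n in sequentially. X \<omega> - 1 / real (Suc n) \<le> real_of_int \<lfloor>X \<omega> * real (Suc n)\<rfloor> / real (Suc n)"
    proof (rule always_eventually, rule allI)
      fix n
      have "X \<omega> * real (Suc n) - 1 \<le> real_of_int \<lfloor>X \<omega> * real (Suc n)\<rfloor>" by linarith
      then have "(X \<omega> * real (Suc n) - 1) / real (Suc n) \<le> real_of_int \<lfloor>X \<omega> * real (Suc n)\<rfloor> / real (Suc n)"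
        by (rule divide_right_mono) simp
      then show "X \<omega> - 1 / real (Suc n) \<le> real_of_int \<lfloor>X \<omega> * real (Suc n)\<rfloor> / real (Suc n)"
        by (simp add: diff_divide_distrib del: of_nat_Suc)
    qed
    show "\<forall>\<^sub>F n in sequentially. real_of_int \<lfloor>X \<omega> * real (Suc n)\<rfloor> / real (Suc n) \<le> X \<omega>"
      by (rule always_eventually, rule allI) (simp add: divide_le_eq del: of_nat_Suc)
    have "(\<lambda>n. X \<omega> - 1 / real (Suc n)) \<longlonglongrightarrow> X \<omega> - 0"
      by (intro tendsto_intros LIMSEQ_Suc[OF lim_1_over_n])
    then show "(\<lambda>n. X \<omega> - 1 / real (Suc n)) \<longlonglongrightarrow> X \<omega>" by simp
  qed simp
  then show "(\<lambda>n. h (real_of_int \<lfloor>X \<omega> * real (Suc n)\<rfloor> / real (Suc n)) \<omega>) \<longlonglongrightarrow> h (X \<omega>) \<omega>"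
    using continuous_on_tendsto_compose[OF c[OF w]] by auto
qed

lemma geometric_Cauchy:
  fixes w :: "nat \<Rightarrow> real"
  assumes "\<And>k. \<bar>w (Suc k) - w k\<bar> \<le> C / 2 ^ k"
  shows "\<exists>l. w \<longlonglongrightarrow> l \<and> (\<forall>k. \<bar>l - w k\<bar> \<le> 2 * C / 2 ^ k)"
proof -
  have C: "C \<ge> 0" using assms[of 0] by simp
  have le: "\<bar>w (k + j) - w k\<bar> \<le> 2 * C / 2 ^ k - 2 * C / 2 ^ (k + j)" for k j
  proof (induction j)
    case (Suc j)
    have "\<bar>w (k + Suc j) - w k\<bar> \<le> C / 2 ^ (k + j) + (2 * C / 2 ^ k - 2 * C / 2 ^ (k + j))"
      using assms[of "k + j"] Suc unfolding add_Suc_right by linarith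
    also have "\<dots> = 2 * C / 2 ^ k - 2 * C / 2 ^ (k + Suc j)" by (simp add: field_simps)
    finally show ?case .
  qed simp
  have le2: "\<bar>w (k + j) - w k\<bar> \<le> 2 * C / 2 ^ k" for k j
  proof -
    have "2 * C / 2 ^ (k + j) \<ge> 0" using C by simp
    then show ?thesis using le[of k j] by linarith
  qed
  have z: "(\<lambda>k. 2 * C / 2 ^ k) \<longlonglongrightarrow> 0" by real_asymp
  have "Cauchy w"
  proof (rule metric_CauchyI)
    fix e :: real assume "e > 0"
    then obtain N where N: "2 * C / 2 ^ N < e / 2"
      using order_tendstoD(2)[OF z, of "e/2"] eventually_sequentially by fastforce
    have "dist (w m) (w n) < e" if "m \<ge> N" "n \<ge> N" for m n
      using le2[of N "m - N"] le2[of N "n - N"] that N by (simp add: dist_real_def)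
    then show "\<exists>N. \<forall>m\<ge>N. \<forall>n\<ge>N. dist (w m) (w n) < e" by blast
  qed
  then obtain l where l: "w \<longlonglongrightarrow> l" using Cauchy_convergent convergent_def by blast
  have "\<bar>l - w k\<bar> \<le> 2 * C / 2 ^ k" for k
  proof (rule LIMSEQ_le_const2)
    show "(\<lambda>j. \<bar>w (j + k) - w k\<bar>) \<longlonglongrightarrow> \<bar>l - w k\<bar>"
      by (intro tendsto_intros LIMSEQ_ignore_initial_segment l)
    show "\<exists>N. \<forall>n\<ge>N. \<bar>w (n + k) - w k\<bar> \<le> 2 * C / 2 ^ k"
      using le2[of k] by (auto simp: add.commute[of _ k])
  qed
  then show ?thesis using l by blast
qed

lemma LIMSEQ_geometric_bound:
  assumes "\<And>n. \<bar>l - w n\<bar> \<le> C / 2 ^ n"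
  shows "w \<longlonglongrightarrow> (l::real)"
proof -
  have "(\<lambda>n. l - w n) \<longlonglongrightarrow> 0"
  proof (rule tendsto_rabs_zero_cancel, rule tendsto_sandwich[OF _ _ tendsto_const])
    show "\<forall>\<^sub>F n in sequentially. \<bar>l - w n\<bar> \<le> C / 2 ^ n" by (intro always_eventually allI assms)
    show "(\<lambda>n. C / 2 ^ n) \<longlonglongrightarrow> 0" by real_asymp
  qed simp
  from tendsto_diff[OF tendsto_const[of l] this] show ?thesis by simp
qed

section \<open>Divided differences\<close>

definition divdiff :: "(real \<Rightarrow> real \<Rightarrow> real) \<Rightarrow> real \<Rightarrow> real \<Rightarrow> real \<Rightarrow> real" where
  "divdiff fx x y t = integral {0..1} (\<lambda>\<theta>. fx (y + \<theta> * (x - y)) t)"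

lemma divdiff_same [simp]: "divdiff fx x x t = fx x t"
  by (simp add: divdiff_def)

lemma divdiff_eq:
  assumes "\<And>x. ((\<lambda>x. f x t) has_field_derivative fx x t) (at x)"
  shows "f x t - f y t = divdiff fx x y t * (x - y)"
  using oint_FTC[of "\<lambda>x. f x t" "\<lambda>x. fx x t" y x, OF assms] by (simp add: oint_def divdiff_def mult.commute)

lemma divdiff_continuous:
  fixes a b c :: "'a::topological_space \<Rightarrow> real"
  assumes fx: "cont2 fx" and "continuous_on UNIV a" "continuous_on UNIV b" "continuous_on UNIV c"
  shows "continuous_on UNIV (\<lambda>z. divdiff fx (a z) (b z) (c z))"
proof -
  have c: "continuous_on (UNIV \<times> cbox 0 1) (\<lambda>(z, \<theta>). fx (b z + \<theta> * (a z - b z)) (c z))"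
    unfolding split_beta
    by (intro cont2D[OF fx] continuous_intros continuous_on_compose2[OF assms(2)]
      continuous_on_compose2[OF assms(3)] continuous_on_compose2[OF assms(4)]) auto
  show ?thesis unfolding divdiff_def using integral_continuous_on_param[OF c] by simp
qed

lemma DERIV_mult_vanishing:
  fixes A B :: "real \<Rightarrow> real"
  assumes A: "isCont A s" and B: "(B has_field_derivative b) (at s)" "B s = 0"
  shows "((\<lambda>r. A r * B r) has_field_derivative A s * b) (at s)"
proof -
  obtain g where g: "\<forall>z. B z - B s = g z * (z - s)" "isCont g s" "g s = b"
    using B(1) CARAT_DERIV by metis
  show ?thesis
    unfolding CARAT_DERIV
    by (rule exI[of _ "\<lambda>z. A z * g z"]) (use A B g in \<open>auto intro!: continuous_intros\<close>)
qed

lemma DERIV_along_curve: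
  assumes "\<And>x t. ((\<lambda>x. f x t) has_field_derivative fx x t) (at x)" and "cont2 fx"
    and p: "(p has_field_derivative a) (at t)" "continuous_on UNIV p" "p t = x"
  shows "((\<lambda>s. f (p s) s - f x s) has_field_derivative fx x t * a) (at t)"
proof -
  have "continuous_on UNIV (\<lambda>s. divdiff fx (p s) x s)"
    by (intro divdiff_continuous assms continuous_intros)
  then have "isCont (\<lambda>s. divdiff fx (p s) x s) t"
    by (simp add: continuous_on_eq_continuous_at)
  moreover have "((\<lambda>s. p s - x) has_field_derivative a) (at t)"
    using p(1) by (auto intro!: derivative_eq_intros)
  ultimately have "((\<lambda>s. divdiff fx (p s) x s * (p s - x)) has_field_derivative
      divdiff fx (p t) x t * a) (at t)"
    by (rule DERIV_mult_vanishing) (simp add: p(3))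
  then have "((\<lambda>s. divdiff fx (p s) x s * (p s - x)) has_field_derivative fx x t * a) (at t)"
    by (simp only: p(3) divdiff_same)
  then show ?thesis using divdiff_eq[of f _ fx, OF assms(1)] by simp
qed

section \<open>Iterated partial derivatives\<close>

abbreviation pds :: "'d list \<Rightarrow> (real^'d \<Rightarrow> real) \<Rightarrow> real^'d \<Rightarrow> real" where
  "pds w f \<equiv> foldr pd w f"

lemma Ck_continuous: "Ck k f \<Longrightarrow> continuous_on UNIV f"
  by (cases k) auto

lemma Ck_Suc_imp_Ck: "Ck (Suc k) f \<Longrightarrow> Ck k f"
  by (induction k arbitrary: f) (auto simp: Ck_continuous)

lemma C_infinity_continuous: "C_infinity f \<Longrightarrow> continuous_on UNIV f"
  unfolding C_infinity_def using Ck_continuous by blast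

lemma C_infinity_pd: "C_infinity f \<Longrightarrow> C_infinity (pd i f)"
  unfolding C_infinity_def by (metis Ck.simps(2))

lemma C_infinity_pds: "C_infinity f \<Longrightarrow> C_infinity (pds w f)"
  by (induction w) (auto intro: C_infinity_pd)

lemma pd_eqI: "((\<lambda>s. f (x + s *\<^sub>R axis i 1)) has_field_derivative D) (at 0) \<Longrightarrow> pd i f x = D"
  unfolding pd_def by (rule DERIV_imp_deriv)

lemma Ck_Suc_DERIV:
  assumes "Ck (Suc k) f"
  shows "((\<lambda>s. f (x + s *\<^sub>R axis i 1)) has_field_derivative pd i f x) (at 0)"
  using assms unfolding pd_def by (simp add: DERIV_deriv_iff_real_differentiable)

lemma C_infinity_DERIV:
  assumes "C_infinity f"
  shows "((\<lambda>s. f (x + s *\<^sub>R axis i 1)) has_field_derivative pd i f (x + r *\<^sub>R axis i 1)) (at r)"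
proof -
  have "Ck (Suc 0) f" using assms C_infinity_def by blast
  from Ck_Suc_DERIV[OF this, of "x + r *\<^sub>R axis i 1" i]
  have "((\<lambda>s. f (x + (s + r) *\<^sub>R axis i 1)) has_field_derivative pd i f (x + r *\<^sub>R axis i 1)) (at 0)"
    by (simp add: algebra_simps)
  then show ?thesis
    using DERIV_shift[of "\<lambda>s. f (x + s *\<^sub>R axis i 1)" _ 0 r] by simp
qed

lemma C_infinity_DERIV0:
  "C_infinity f \<Longrightarrow> ((\<lambda>s. f (x + s *\<^sub>R axis i 1)) has_field_derivative pd i f x) (at 0)"
  using C_infinity_DERIV[of f x i 0] by simp

lemma Ck_SucI:
  assumes "continuous_on UNIV f"
    and "\<And>i x. ((\<lambda>s. f (x + s *\<^sub>R axis i 1)) has_field_derivative D i x) (at 0)"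
    and "\<And>i. Ck k (D i)"
  shows "Ck (Suc k) f"
proof -
  have "pd i f = D i" for i using assms(2) by (intro ext pd_eqI)
  then show ?thesis
    using assms by (auto simp: real_differentiable_def)
qed

lemma Ck_const: "Ck k (\<lambda>x. c)"
proof (induction k arbitrary: c)
  case (Suc k)
  show ?case by (rule Ck_SucI[where D="\<lambda>_ _. 0"]) (auto intro!: derivative_eq_intros Suc)
qed simp

lemma Ck_add: "Ck k f \<Longrightarrow> Ck k g \<Longrightarrow> Ck k (\<lambda>x. f x + g x)"
proof (induction k arbitrary: f g)
  case 0 then show ?case by (auto intro: continuous_intros)
next
  case (Suc k)
  show ?case
    by (rule Ck_SucI[where D="\<lambda>i x. pd i f x + pd i g x"])
      (use Suc in \<open>auto intro!: continuous_intros DERIV_add Ck_Suc_DERIV[of k]\<close>)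
qed

lemma Ck_mult: "Ck k f \<Longrightarrow> Ck k g \<Longrightarrow> Ck k (\<lambda>x. f x * g x)"
proof (induction k arbitrary: f g)
  case 0 then show ?case by (auto intro: continuous_intros)
next
  case (Suc k)
  show ?case
  proof (rule Ck_SucI[where D="\<lambda>i x. pd i f x * g x + f x * pd i g x"])
    show "continuous_on UNIV (\<lambda>x. f x * g x)"
      using Suc.prems Ck_continuous by (intro continuous_intros) auto
    show "((\<lambda>s. f (x + s *\<^sub>R axis i 1) * g (x + s *\<^sub>R axis i 1)) has_field_derivative
        pd i f x * g x + f x * pd i g x) (at 0)" for i x
      using DERIV_mult[OF Ck_Suc_DERIV[OF Suc.prems(1), of x i] Ck_Suc_DERIV[OF Suc.prems(2), of x i]]
      by (simp add: algebra_simps)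
    show "Ck k (\<lambda>x. pd i f x * g x + f x * pd i g x)" for i
      using Suc.prems Ck_Suc_imp_Ck by (intro Ck_add Suc.IH) auto
  qed
qed

lemma Ck_sum: "(\<And>j. j \<in> A \<Longrightarrow> Ck k (f j)) \<Longrightarrow> Ck k (\<lambda>x. \<Sum>j\<in>A. f j x)"
  by (induction A rule: infinite_finite_induct) (auto intro: Ck_const Ck_add)

lemma C_infinity_const: "C_infinity (\<lambda>x. c)"
  by (simp add: C_infinity_def Ck_const)

lemma C_infinity_add: "C_infinity f \<Longrightarrow> C_infinity g \<Longrightarrow> C_infinity (\<lambda>x. f x + g x)"
  by (simp add: C_infinity_def Ck_add)

lemma C_infinity_mult: "C_infinity f \<Longrightarrow> C_infinity g \<Longrightarrow> C_infinity (\<lambda>x. f x * g x)"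
  by (simp add: C_infinity_def Ck_mult)

lemma C_infinity_minus: "C_infinity f \<Longrightarrow> C_infinity (\<lambda>x. - f x)"
  using C_infinity_mult[OF C_infinity_const[of "-1"]] by simp

lemma C_infinity_diff: "C_infinity f \<Longrightarrow> C_infinity g \<Longrightarrow> C_infinity (\<lambda>x. f x - g x)"
  using C_infinity_add[OF _ C_infinity_minus] by simp

lemma C_infinity_sum: "(\<And>j. j \<in> A \<Longrightarrow> C_infinity (f j)) \<Longrightarrow> C_infinity (\<lambda>x. \<Sum>j\<in>A. f j x)"
  by (simp add: C_infinity_def Ck_sum)

lemmas C_infinity_intros =
  C_infinity_const C_infinity_add C_infinity_mult C_infinity_minus C_infinity_diff C_infinity_sum
  C_infinity_pd C_infinity_pds

lemma pd_const: "pd i (\<lambda>x. c) = (\<lambda>x. 0)"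
  by (intro ext pd_eqI) auto

lemma pd_add:
  "C_infinity f \<Longrightarrow> C_infinity g \<Longrightarrow> pd i (\<lambda>x. f x + g x) = (\<lambda>x. pd i f x + pd i g x)"
  by (intro ext pd_eqI DERIV_add C_infinity_DERIV0)

lemma pd_diff:
  "C_infinity f \<Longrightarrow> C_infinity g \<Longrightarrow> pd i (\<lambda>x. f x - g x) = (\<lambda>x. pd i f x - pd i g x)"
  by (intro ext pd_eqI DERIV_diff C_infinity_DERIV0)

lemma pd_mult:
  assumes "C_infinity f" "C_infinity g"
  shows "pd i (\<lambda>x. f x * g x) = (\<lambda>x. pd i f x * g x + f x * pd i g x)"
  using DERIV_mult[OF C_infinity_DERIV0[OF assms(1)] C_infinity_DERIV0[OF assms(2)]]
  by (intro ext pd_eqI) (simp add: algebra_simps)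

lemma pd_sum:
  "(\<And>j. j \<in> A \<Longrightarrow> C_infinity (f j)) \<Longrightarrow> pd i (\<lambda>x. \<Sum>j\<in>A. f j x) = (\<lambda>x. \<Sum>j\<in>A. pd i (f j) x)"
  by (intro ext pd_eqI DERIV_sum C_infinity_DERIV0)

lemma pds_const: "pds w (\<lambda>x. c) = (\<lambda>x. if w = [] then c else 0)"
proof (induction w)
  case (Cons i w)
  have "pd i (\<lambda>x. if w = [] then c else 0) = (\<lambda>x. 0)" by (cases "w = []") (simp_all add: pd_const)
  then show ?case using Cons by simp
qed simp

lemma pds_add:
  "C_infinity f \<Longrightarrow> C_infinity g \<Longrightarrow> pds w (\<lambda>x. f x + g x) = (\<lambda>x. pds w f x + pds w g x)"
  by (induction w) (auto simp: pd_add C_infinity_pds)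

lemma pds_sum:
  "(\<And>j. j \<in> A \<Longrightarrow> C_infinity (f j)) \<Longrightarrow> pds w (\<lambda>x. \<Sum>j\<in>A. f j x) = (\<lambda>x. \<Sum>j\<in>A. pds w (f j) x)"
  by (induction w) (auto simp: pd_sum C_infinity_pds)

text \<open>Differentiating \<open>f(x + s e\<^sub>i + t e\<^sub>j) - f(x + s e\<^sub>i) = \<integral>\<^sub>0\<^sup>t \<partial>\<^sub>j f(x + s e\<^sub>i + \<tau> e\<^sub>j) d\<tau>\<close>
  first in \<open>s\<close> and then in \<open>t\<close> gives the symmetry of second derivatives.\<close>

lemma pd_commute:
  assumes f: "C_infinity f"
  shows "pd i (pd j f) = pd j (pd i f)"
proof
  fix x
  let ?e = "\<lambda>i. axis i (1::real)"
  have c: "continuous_on UNIV (\<lambda>z. g (x + fst z *\<^sub>R ?e i + snd z *\<^sub>R ?e j))" if "C_infinity g" for g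
    by (rule continuous_on_compose2[OF C_infinity_continuous[OF that]]) (auto intro!: continuous_intros)
  have fj: "C_infinity (pd j f)" and fij: "C_infinity (pd i (pd j f))"
    using f by (auto intro: C_infinity_intros)
  have d1: "((\<lambda>s. pd j f (x + s *\<^sub>R ?e i + \<tau> *\<^sub>R ?e j)) has_field_derivative
      pd i (pd j f) (x + r *\<^sub>R ?e i + \<tau> *\<^sub>R ?e j)) (at r)" for r \<tau>
    using C_infinity_DERIV[OF fj, of "x + \<tau> *\<^sub>R ?e j" i r] by (simp add: add.commute add.left_commute)
  have *: "pd i f (x + t *\<^sub>R ?e j) - pd i f x = oint 0 t (\<lambda>\<tau>. pd i (pd j f) (x + \<tau> *\<^sub>R ?e j))" for t
  proof -
    have "oint 0 t (\<lambda>\<tau>. pd j f (x + s *\<^sub>R ?e i + \<tau> *\<^sub>R ?e j)) = f (x + s *\<^sub>R ?e i + t *\<^sub>R ?e j) - f (x + s *\<^sub>R ?e i + 0 *\<^sub>R ?e j)" for s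
      by (rule oint_FTC, rule C_infinity_DERIV[OF f])
    moreover have "((\<lambda>s. oint 0 t (\<lambda>\<tau>. pd j f (x + s *\<^sub>R ?e i + \<tau> *\<^sub>R ?e j))) has_field_derivative
        oint 0 t (\<lambda>\<tau>. pd i (pd j f) (x + 0 *\<^sub>R ?e i + \<tau> *\<^sub>R ?e j))) (at 0)"
      by (rule oint_leibniz[OF d1 c[OF fj] c[OF fij]])
    moreover have "((\<lambda>s. f (x + s *\<^sub>R ?e i + t *\<^sub>R ?e j) - f (x + s *\<^sub>R ?e i + 0 *\<^sub>R ?e j))
        has_field_derivative pd i f (x + t *\<^sub>R ?e j) - pd i f x) (at 0)"
      using DERIV_diff[OF C_infinity_DERIV0[OF f, of "x + t *\<^sub>R ?e j" i] C_infinity_DERIV0[OF f, of x i]]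
      by (simp add: add.commute add.left_commute)
    ultimately show ?thesis using DERIV_unique by fastforce
  qed
  have "continuous_on UNIV (\<lambda>\<tau>. pd i (pd j f) (x + \<tau> *\<^sub>R ?e j))"
    by (rule continuous_on_compose2[OF C_infinity_continuous[OF fij]]) (auto intro!: continuous_intros)
  from oint_deriv[OF this, of 0 0]
  have "((\<lambda>t. pd i f (x + t *\<^sub>R ?e j) - pd i f x) has_field_derivative pd i (pd j f) x) (at 0)"
    by (simp add: *)
  from DERIV_add[OF this DERIV_const[of "pd i f x"]]
  have "((\<lambda>t. pd i f (x + t *\<^sub>R ?e j)) has_field_derivative pd i (pd j f) x) (at 0)" by simp
  then show "pd i (pd j f) x = pd j (pd i f) x" by (simp add: pd_eqI)
qed

lemma pds_pd_commute: "C_infinity f \<Longrightarrow> pds w (pd i f) = pd i (pds w f)"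
proof (induction w)
  case (Cons j w)
  then show ?case by (simp add: pd_commute[of "pds w f" j i] C_infinity_pds)
qed simp

lemma pds_permute: "C_infinity f \<Longrightarrow> mset w = mset w' \<Longrightarrow> pds w f = pds w' f"
proof (induction w arbitrary: w')
  case (Cons i w)
  then have "i \<in> set w'" by (metis list.set_intros(1) set_mset_mset)
  then obtain a b where w': "w' = a @ i # b" by (meson split_list)
  then have "mset w = mset (a @ b)" using Cons.prems by simp
  then have "pds w f = pds a (pds b f)" using Cons by (metis foldr_append)
  then show ?case
    using pds_pd_commute[of "pds b f" a i] Cons.prems by (simp add: w' C_infinity_pds)
qed simp

definition index_word :: "('d::{finite,linorder} \<Rightarrow> nat) \<Rightarrow> 'd list" where
  "index_word \<alpha> = concat (map (\<lambda>i. replicate (\<alpha> i) i) (sorted_list_of_set UNIV))"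

lemma mderiv_eq_pds: "mderiv \<alpha> f = pds (index_word \<alpha>) f"
proof -
  have "foldr (\<lambda>i. pd i ^^ \<alpha> i) xs f = pds (concat (map (\<lambda>i. replicate (\<alpha> i) i) xs)) f" for xs
    by (induction xs) (auto simp: foldr_replicate)
  then show ?thesis unfolding mderiv_def index_word_def .
qed

lemma pds_eq_mderiv:
  assumes "C_infinity f"
  shows "pds w f = mderiv (count (mset w)) f"
proof -
  have "count (mset (concat (map (\<lambda>i. replicate (\<alpha> i) i) xs))) j = (if j \<in> set xs then \<alpha> j else 0)"
    if "distinct xs" for xs :: "'a list" and \<alpha> j
    using that by (induction xs) auto
  from this[of "sorted_list_of_set UNIV"]
  have "mset w = mset (index_word (count (mset w)))"
    by (intro multiset_eqI) (simp add: index_word_def)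
  from pds_permute[OF assms this] show ?thesis by (simp add: mderiv_eq_pds)
qed

section \<open>Functions on the plane\<close>

lemma vector2_components: "vector [z $ 1, z $ 2] = (z :: real^2)"
  by (simp add: vec_eq_iff forall_2)

lemma vector1_component: "vector [x $ 1] = (x :: real^1)"
  by (simp add: vec_eq_iff forall_1)

lemma vector2_shift1: "vector [x, t] + s *\<^sub>R axis 1 1 = (vector [x + s, t] :: real^2)"
  by (simp add: vec_eq_iff forall_2 axis_def)

lemma vector2_shift2: "vector [x, t] + s *\<^sub>R axis 2 1 = (vector [x, t + s] :: real^2)"
  by (simp add: vec_eq_iff forall_2 axis_def)

lemma vector1_shift: "vector [x] + s *\<^sub>R axis i 1 = (vector [x + s] :: real^1)"
  using num1_eq1[of i] by (simp add: vec_eq_iff forall_1 axis_def)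

lemma axis_component [simp]:
  "(axis i 1 :: real^1) $ 1 = 1"
  "(axis 1 1 :: real^2) $ 1 = 1" "(axis 1 1 :: real^2) $ 2 = 0"
  "(axis 2 1 :: real^2) $ 1 = 0" "(axis 2 1 :: real^2) $ 2 = 1"
  using num1_eq1[of i] by (simp_all add: axis_def)

lemma continuous_on_vector2:
  fixes a b :: "'a::topological_space \<Rightarrow> real"
  assumes "continuous_on S a" "continuous_on S b"
  shows "continuous_on S (\<lambda>z. vector [a z, b z] :: real^2)"
proof -
  have "(\<lambda>z. vector [a z, b z] :: real^2) = (\<lambda>z. \<chi> i. (if i = 1 then a else b) z)"
    by (intro ext) (simp add: vec_eq_iff forall_2)
  then show ?thesis
    by (rule ssubst, intro continuous_on_vec_lambda) (auto simp: assms if_distrib)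
qed

lemma continuous_on_vector1:
  fixes a :: "'a::topological_space \<Rightarrow> real"
  assumes "continuous_on S a"
  shows "continuous_on S (\<lambda>z. vector [a z] :: real^1)"
proof -
  have "(\<lambda>z. vector [a z] :: real^1) = (\<lambda>z. \<chi> i. a z)"
    by (intro ext) (simp add: vec_eq_iff forall_1)
  then show ?thesis
    by (rule ssubst, intro continuous_on_vec_lambda) (use assms in auto)
qed

lemma cont2_vector:
  fixes f :: "real^2 \<Rightarrow> real"
  assumes "continuous_on UNIV f"
  shows "cont2 (\<lambda>x t. f (vector [x, t]))"
  by (rule continuous_on_compose2[OF assms continuous_on_vector2]) (auto intro!: continuous_intros)

lemma continuous_on_components:
  assumes "cont2 F"
  shows "continuous_on UNIV (\<lambda>z::real^2. F (z $ 1) (z $ 2))"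
  by (rule cont2D[OF assms]) (auto intro!: continuous_intros)

lemma DERIV_vector1:
  fixes f :: "real^2 \<Rightarrow> real"
  assumes "C_infinity f"
  shows "((\<lambda>x. f (vector [x, t])) has_field_derivative pd 1 f (vector [x, t])) (at x)"
  using C_infinity_DERIV[OF assms, of "vector [0, t]" 1 x] by (simp add: vector2_shift1)

lemma DERIV_vector2:
  fixes f :: "real^2 \<Rightarrow> real"
  assumes "C_infinity f"
  shows "((\<lambda>t. f (vector [x, t])) has_field_derivative pd 2 f (vector [x, t])) (at t)"
  using C_infinity_DERIV[OF assms, of "vector [x, 0]" 2 t] by (simp add: vector2_shift2)

lemma DERIV_axis_components:
  fixes F :: "real \<Rightarrow> real \<Rightarrow> real" and z :: "real^2"
  shows "((\<lambda>x. F x (z $ 2)) has_field_derivative A) (at (z $ 1)) \<Longrightarrow>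
      ((\<lambda>s. F ((z + s *\<^sub>R axis 1 1) $ 1) ((z + s *\<^sub>R axis 1 1) $ 2)) has_field_derivative A) (at 0)"
    and "((\<lambda>t. F (z $ 1) t) has_field_derivative B) (at (z $ 2)) \<Longrightarrow>
      ((\<lambda>s. F ((z + s *\<^sub>R axis 2 1) $ 1) ((z + s *\<^sub>R axis 2 1) $ 2)) has_field_derivative B) (at 0)"
  using DERIV_shift[of "\<lambda>x. F x (z $ 2)" A 0 "z $ 1"] DERIV_shift[of "\<lambda>t. F (z $ 1) t" B 0 "z $ 2"]
  by (simp_all add: add.commute)

lemma Ck_restrict:
  fixes f :: "real^2 \<Rightarrow> real"
  shows "Ck k f \<Longrightarrow> Ck k (\<lambda>x::real^1. f (vector [x $ 1, 0]))"
proof (induction k arbitrary: f)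
  case 0
  then show ?case
    by (auto intro!: continuous_on_compose2[OF _ continuous_on_vector2] continuous_intros)
next
  case (Suc k)
  show ?case
  proof (rule Ck_SucI[where D="\<lambda>i x. pd 1 f (vector [x $ 1, 0])"])
    show "continuous_on UNIV (\<lambda>x::real^1. f (vector [x $ 1, 0]))"
      using Ck_continuous[OF Suc.prems]
      by (auto intro!: continuous_on_compose2[OF _ continuous_on_vector2] continuous_intros)
    show "((\<lambda>s. f (vector [(x + s *\<^sub>R axis i 1) $ 1, 0])) has_field_derivative pd 1 f (vector [x $ 1, 0])) (at 0)"
      for x :: "real^1" and i
      using Ck_Suc_DERIV[OF Suc.prems, of "vector [x $ 1, 0]" 1]
      by (simp add: vector2_shift1)
    show "Ck k (\<lambda>x::real^1. pd 1 f (vector [x $ 1, 0]))" for i :: 1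
      using Suc by simp
  qed
qed

lemma pd_restrict:
  fixes f :: "real^2 \<Rightarrow> real"
  assumes "C_infinity f"
  shows "pd i (\<lambda>x::real^1. f (vector [x $ 1, 0])) = (\<lambda>x. pd 1 f (vector [x $ 1, 0]))"
proof (intro ext pd_eqI)
  fix x :: "real^1"
  show "((\<lambda>s. f (vector [(x + s *\<^sub>R axis i 1) $ 1, 0])) has_field_derivative pd 1 f (vector [x $ 1, 0])) (at 0)"
    using C_infinity_DERIV0[OF assms, of "vector [x $ 1, 0]" 1]
    by (simp add: vector2_shift1)
qed

lemma pds_restrict:
  fixes f :: "real^2 \<Rightarrow> real"
  assumes "C_infinity f"
  shows "pds w (\<lambda>x::real^1. f (vector [x $ 1, 0])) = (\<lambda>x. pds (replicate (length w) 1) f (vector [x $ 1, 0]))"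
proof (induction w)
  case (Cons i w)
  then show ?case
    using pd_restrict[OF C_infinity_pds[OF assms], of i "replicate (length w) 1"] by simp
qed simp

lemma DERIV_extend:
  fixes f :: "real^1 \<Rightarrow> real" and x :: "real^2"
  assumes "\<And>y. ((\<lambda>s. f (y + s *\<^sub>R axis 1 1)) has_field_derivative g y) (at 0)"
  shows "((\<lambda>s. f (vector [(x + s *\<^sub>R axis i 1) $ 1])) has_field_derivative
    (if i = 1 then g (vector [x $ 1]) else 0)) (at 0)"
proof -
  consider "i = 1" | "i = 2" using exhaust_2 by blast
  then show ?thesis
    by cases (use assms[of "vector [x $ 1]"] in \<open>auto simp: vector1_shift\<close>)
qed

lemma Ck_extend:
  fixes f :: "real^1 \<Rightarrow> real"
  shows "Ck k f \<Longrightarrow> Ck k (\<lambda>x::real^2. f (vector [x $ 1]))"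
proof (induction k arbitrary: f)
  case 0
  then show ?case
    by (auto intro!: continuous_on_compose2[OF _ continuous_on_vector1] continuous_intros)
next
  case (Suc k)
  show ?case
  proof (rule Ck_SucI[where D="\<lambda>i x. if i = 1 then pd 1 f (vector [x $ 1]) else 0"])
    show "continuous_on UNIV (\<lambda>x::real^2. f (vector [x $ 1]))"
      using Ck_continuous[OF Suc.prems]
      by (auto intro!: continuous_on_compose2[OF _ continuous_on_vector1] continuous_intros)
    show "((\<lambda>s. f (vector [(x + s *\<^sub>R axis i 1) $ 1])) has_field_derivative
        (if i = 1 then pd 1 f (vector [x $ 1]) else 0)) (at 0)" for x :: "real^2" and i
      by (rule DERIV_extend[OF Ck_Suc_DERIV[OF Suc.prems]])
    show "Ck k (\<lambda>x::real^2. if i = 1 then pd 1 f (vector [x $ 1]) else 0)" for i :: 2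
      using Suc by (cases "i = 1") (auto simp: Ck_const)
  qed
qed

lemma pd_extend:
  fixes f :: "real^1 \<Rightarrow> real"
  assumes "C_infinity f"
  shows "pd i (\<lambda>x::real^2. f (vector [x $ 1])) = (if i = 1 then (\<lambda>x. pd 1 f (vector [x $ 1])) else (\<lambda>x. 0))"
  using DERIV_extend[OF C_infinity_DERIV0[OF assms], of _ i]
  by (intro ext pd_eqI) (auto split: if_splits)

lemma pds_extend:
  fixes f :: "real^1 \<Rightarrow> real"
  assumes "C_infinity f"
  shows "pds w (\<lambda>x::real^2. f (vector [x $ 1])) =
    (if set w \<subseteq> {1} then (\<lambda>x. pds (replicate (length w) 1) f (vector [x $ 1])) else (\<lambda>x. 0))"
proof (induction w)
  case (Cons i w)
  show ?case
  proof (cases "set w \<subseteq> {1}")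
    case True
    then show ?thesis
      using Cons pd_extend[OF C_infinity_pds[OF assms], of i "replicate (length w) 1"] by auto
  next
    case False
    then show ?thesis using Cons by (simp add: pd_const)
  qed
qed simp

section \<open>Lp norms of random variables\<close>

lemma Lp_norm_le_iff:
  assumes p: "1 \<le> p" and c: "0 \<le> c" and X: "X \<in> borel_measurable M"
  shows "Lp_norm M p X \<le> ennreal c \<longleftrightarrow>
    (if p = \<infinity> then AE \<omega> in M. \<bar>X \<omega>\<bar> \<le> c
     else (\<integral>\<^sup>+ \<omega>. ennreal (\<bar>X \<omega>\<bar> powr enn2real p) \<partial>M) \<le> ennreal (c powr enn2real p))"
proof (cases "p = \<infinity>")
  case True
  have "esssup M (\<lambda>\<omega>. ennreal \<bar>X \<omega>\<bar>) \<le> ennreal c \<longleftrightarrow> (AE \<omega> in M. \<bar>X \<omega>\<bar> \<le> c)"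
  proof
    assume le: "esssup M (\<lambda>\<omega>. ennreal \<bar>X \<omega>\<bar>) \<le> ennreal c"
    show "AE \<omega> in M. \<bar>X \<omega>\<bar> \<le> c"
      using esssup_AE[of "\<lambda>\<omega>. ennreal \<bar>X \<omega>\<bar>" M]
    proof eventually_elim
      case (elim \<omega>)
      then have "ennreal \<bar>X \<omega>\<bar> \<le> ennreal c" using le by (rule order_trans)
      then show ?case using c by (simp add: ennreal_le_iff)
    qed
  next
    assume "AE \<omega> in M. \<bar>X \<omega>\<bar> \<le> c"
    then show "esssup M (\<lambda>\<omega>. ennreal \<bar>X \<omega>\<bar>) \<le> ennreal c"
      using X c by (intro esssup_I) (auto simp: ennreal_le_iff elim: eventually_mono)
  qed
  then show ?thesis using True by (simp add: Lp_norm_def)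
next
  case False
  define q where "q = enn2real p"
  have q: "q \<ge> 1" unfolding q_def using p False
    by (metis enn2real_1 enn2real_mono ennreal_less_top infinity_ennreal_def less_top)
  define I where "I = (\<integral>\<^sup>+ \<omega>. ennreal (\<bar>X \<omega>\<bar> powr q) \<partial>M)"
  have "(if I = \<infinity> then \<infinity> else ennreal (enn2real I powr (1 / q))) \<le> ennreal c \<longleftrightarrow> I \<le> ennreal (c powr q)"
  proof (cases I)
    case (real r)
    have "r powr (1 / q) \<le> c \<longleftrightarrow> r \<le> c powr q"
    proof
      assume "r powr (1 / q) \<le> c"
      then have "(r powr (1 / q)) powr q \<le> c powr q" using q by (intro powr_mono2) auto
      then show "r \<le> c powr q" using q real by (simp add: powr_powr)
    next
      assume "r \<le> c powr q"
      then have "r powr (1 / q) \<le> (c powr q) powr (1 / q)" using q real by (intro powr_mono2) auto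
      then show "r powr (1 / q) \<le> c" using q c by (simp add: powr_powr)
    qed
    then show ?thesis using real c by (simp add: ennreal_le_iff)
  next
    case top
    then show ?thesis by (simp add: top_unique)
  qed
  then show ?thesis unfolding Lp_norm_def Let_def I_def q_def by (simp only: False if_False)
qed

lemma Lp_norm_mono:
  assumes p: "1 \<le> p" and "X \<in> borel_measurable M" "Y \<in> borel_measurable M"
    and le: "AE \<omega> in M. \<bar>X \<omega>\<bar> \<le> \<bar>Y \<omega>\<bar>"
  shows "Lp_norm M p X \<le> Lp_norm M p Y"
proof (cases "Lp_norm M p Y")
  case (real c)
  then have Y: "Lp_norm M p Y \<le> ennreal c" by simp
  have "Lp_norm M p X \<le> ennreal c"
  proof (cases "p = \<infinity>")
    case True
    then have "AE \<omega> in M. \<bar>Y \<omega>\<bar> \<le> c" using Y assms Lp_norm_le_iff[of p c Y M] real by simp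
    with le have "AE \<omega> in M. \<bar>X \<omega>\<bar> \<le> c" by eventually_elim simp
    then show ?thesis using True assms Lp_norm_le_iff[of p c X M] real by simp
  next
    case False
    have "(\<integral>\<^sup>+ \<omega>. ennreal (\<bar>X \<omega>\<bar> powr enn2real p) \<partial>M) \<le> (\<integral>\<^sup>+ \<omega>. ennreal (\<bar>Y \<omega>\<bar> powr enn2real p) \<partial>M)"
      by (rule nn_integral_mono_AE) (use le in \<open>auto intro!: ennreal_leI powr_mono2 elim!: eventually_mono\<close>)
    also have "\<dots> \<le> ennreal (c powr enn2real p)"
      using Y False assms Lp_norm_le_iff[of p c Y M] real by simp
    finally show ?thesis using False assms Lp_norm_le_iff[of p c X M] real by simp
  qed
  then show ?thesis using real by simp
qed simp

lemma powr_sum_le: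
  fixes a :: "'k \<Rightarrow> real"
  assumes F: "finite F" "F \<noteq> {}" and a: "\<And>k. k \<in> F \<Longrightarrow> 0 \<le> a k" and q: "1 \<le> q"
  shows "(\<Sum>k\<in>F. a k) powr q \<le> real (card F) powr (q - 1) * (\<Sum>k\<in>F. a k powr q)"
proof -
  define G where "G = {k \<in> F. a k > 0}"
  have G: "finite G" "G \<subseteq> F" using F by (auto simp: G_def)
  have sum: "(\<Sum>k\<in>F. a k) = (\<Sum>k\<in>G. a k)" "(\<Sum>k\<in>F. a k powr q) = (\<Sum>k\<in>G. a k powr q)"
    using F a by (auto simp: G_def intro!: sum.mono_neutral_right) (metis less_eq_real_def)+
  show ?thesis
  proof (cases "G = {}")
    case True
    then show ?thesis using sum by simp
  next
    case False
    define n where "n = real (card G)"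
    have n: "n > 0" "n \<le> real (card F)"
      using G F False by (auto simp: n_def card_gt_0_iff card_mono)
    have "(\<Sum>k\<in>G. (1 / n) *\<^sub>R a k) powr q \<le> (\<Sum>k\<in>G. (1 / n) * (a k powr q))"
      by (rule convex_on_sum[OF G(1) False powr_convex[OF q], of "\<lambda>_. 1 / n"])
        (use n in \<open>auto simp: n_def G_def\<close>)
    then have "((1 / n) * (\<Sum>k\<in>G. a k)) powr q \<le> (1 / n) * (\<Sum>k\<in>G. a k powr q)"
      by (simp add: sum_distrib_left)
    moreover have "((1 / n) * (\<Sum>k\<in>G. a k)) powr q = (1 / n) powr q * (\<Sum>k\<in>G. a k) powr q"
      by (rule powr_mult)
    ultimately have "n powr q * ((1 / n) powr q * (\<Sum>k\<in>G. a k) powr q) \<le> n powr q * ((1 / n) * (\<Sum>k\<in>G. a k powr q))"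
      by (intro mult_left_mono) auto
    moreover have "n powr q * (1 / n) powr q = 1" using n by (simp flip: powr_mult)
    moreover have "n powr q * (1 / n) = n powr (q - 1)" using n by (simp add: powr_diff)
    ultimately have "(\<Sum>k\<in>G. a k) powr q \<le> n powr (q - 1) * (\<Sum>k\<in>G. a k powr q)"
      by (metis mult.assoc mult_1)
    also have "\<dots> \<le> real (card F) powr (q - 1) * (\<Sum>k\<in>G. a k powr q)"
      using n q by (intro mult_right_mono powr_mono2) (auto intro!: sum_nonneg)
    finally show ?thesis using sum by simp
  qed
qed

lemma Lp_norm_sum:
  fixes c :: real
  assumes p: "1 \<le> p" and c: "0 \<le> c" and F: "finite F"
    and X: "\<And>k. k \<in> F \<Longrightarrow> X k \<in> borel_measurable M" "\<And>k. k \<in> F \<Longrightarrow> Lp_norm M p (X k) \<le> ennreal c"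
  shows "Lp_norm M p (\<lambda>\<omega>. \<Sum>k\<in>F. \<bar>X k \<omega>\<bar>) \<le> ennreal (card F * c)"
proof -
  have m: "(\<lambda>\<omega>. \<Sum>k\<in>F. \<bar>X k \<omega>\<bar>) \<in> borel_measurable M"
    using X by measurable
  show ?thesis
  proof (cases "p = \<infinity>")
    case True
    have "AE \<omega> in M. \<forall>k\<in>F. \<bar>X k \<omega>\<bar> \<le> c"
      using X p c True Lp_norm_le_iff[of p c _ M] F by (intro AE_finite_allI) auto
    then have "AE \<omega> in M. \<bar>\<Sum>k\<in>F. \<bar>X k \<omega>\<bar>\<bar> \<le> card F * c"
    proof eventually_elim
      case (elim \<omega>)
      then have "(\<Sum>k\<in>F. \<bar>X k \<omega>\<bar>) \<le> (\<Sum>k\<in>F. c)" by (intro sum_mono) auto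
      then show ?case by (simp add: abs_of_nonneg sum_nonneg)
    qed
    then show ?thesis using Lp_norm_le_iff[OF p _ m, of "card F * c"] True c by simp
  next
    case False
    define q where "q = enn2real p"
    have q: "q \<ge> 1" unfolding q_def using p False
      by (metis enn2real_1 enn2real_mono ennreal_less_top infinity_ennreal_def less_top)
    have Xq: "(\<integral>\<^sup>+ \<omega>. ennreal (\<bar>X k \<omega>\<bar> powr q) \<partial>M) \<le> ennreal (c powr q)" if "k \<in> F" for k
      using X[OF that] p c False Lp_norm_le_iff[of p c "X k" M] by (simp add: q_def)
    show ?thesis
    proof (cases "F = {}")
      case True
      then show ?thesis using Lp_norm_le_iff[OF p order_refl m] False by (simp add: powr_0)
    next
      case ne: False
      define n where "n = real (card F)"
      have n: "n > 0" using F ne by (simp add: n_def card_gt_0_iff)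
      have "(\<integral>\<^sup>+ \<omega>. ennreal (\<bar>\<Sum>k\<in>F. \<bar>X k \<omega>\<bar>\<bar> powr q) \<partial>M) \<le>
        (\<integral>\<^sup>+ \<omega>. ennreal (n powr (q - 1)) * (\<Sum>k\<in>F. ennreal (\<bar>X k \<omega>\<bar> powr q)) \<partial>M)"
      proof (rule nn_integral_mono)
        fix \<omega>
        have "\<bar>\<Sum>k\<in>F. \<bar>X k \<omega>\<bar>\<bar> powr q \<le> n powr (q - 1) * (\<Sum>k\<in>F. \<bar>X k \<omega>\<bar> powr q)"
          using powr_sum_le[OF F ne _ q, of "\<lambda>k. \<bar>X k \<omega>\<bar>"] by (simp add: n_def abs_of_nonneg sum_nonneg)
        then have "ennreal (\<bar>\<Sum>k\<in>F. \<bar>X k \<omega>\<bar>\<bar> powr q) \<le> ennreal (n powr (q - 1) * (\<Sum>k\<in>F. \<bar>X k \<omega>\<bar> powr q))"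
          by (rule ennreal_leI)
        then show "ennreal (\<bar>\<Sum>k\<in>F. \<bar>X k \<omega>\<bar>\<bar> powr q) \<le> ennreal (n powr (q - 1)) * (\<Sum>k\<in>F. ennreal (\<bar>X k \<omega>\<bar> powr q))"
          by (simp add: ennreal_mult sum_nonneg)
      qed
      also have "\<dots> = ennreal (n powr (q - 1)) * (\<Sum>k\<in>F. \<integral>\<^sup>+ \<omega>. ennreal (\<bar>X k \<omega>\<bar> powr q) \<partial>M)"
        using X by (subst nn_integral_cmult, measurable, subst nn_integral_sum) auto
      also have "\<dots> \<le> ennreal (n powr (q - 1)) * (\<Sum>k\<in>F. ennreal (c powr q))"
        by (intro mult_left_mono sum_mono Xq) auto
      also have "\<dots> = ennreal (n powr (q - 1)) * (ennreal n * ennreal (c powr q))"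
        by (simp add: n_def ennreal_of_nat_eq_real_of_nat)
      also have "\<dots> = ennreal (n powr (q - 1) * n * c powr q)"
        using n by (simp add: ennreal_mult mult.assoc)
      also have "n powr (q - 1) * n * c powr q = (n * c) powr q"
        using n c by (simp add: powr_diff powr_mult)
      finally show ?thesis
        using Lp_norm_le_iff[OF p _ m, of "card F * c"] False c by (simp add: q_def n_def)
    qed
  qed
qed

lemma Lp_norm_cmult:
  assumes p: "1 \<le> p" and c: "0 \<le> c" and X: "X \<in> borel_measurable M" "Lp_norm M p X \<le> ennreal c"
  shows "Lp_norm M p (\<lambda>\<omega>. a * X \<omega>) \<le> ennreal (\<bar>a\<bar> * c)"
proof -
  have m: "(\<lambda>\<omega>. a * X \<omega>) \<in> borel_measurable M" using X by measurable
  show ?thesis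
  proof (cases "p = \<infinity>")
    case True
    then have "AE \<omega> in M. \<bar>X \<omega>\<bar> \<le> c" using Lp_norm_le_iff[OF p c X(1)] X(2) by simp
    then have "AE \<omega> in M. \<bar>a * X \<omega>\<bar> \<le> \<bar>a\<bar> * c"
      by eventually_elim (simp add: abs_mult mult_left_mono)
    then show ?thesis using Lp_norm_le_iff[OF p _ m, of "\<bar>a\<bar> * c"] True c by simp
  next
    case False
    have "(\<integral>\<^sup>+ \<omega>. ennreal (\<bar>a * X \<omega>\<bar> powr enn2real p) \<partial>M) =
        (\<integral>\<^sup>+ \<omega>. ennreal (\<bar>a\<bar> powr enn2real p) * ennreal (\<bar>X \<omega>\<bar> powr enn2real p) \<partial>M)"
      by (intro nn_integral_cong) (simp add: abs_mult powr_mult ennreal_mult)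
    also have "\<dots> = ennreal (\<bar>a\<bar> powr enn2real p) * (\<integral>\<^sup>+ \<omega>. ennreal (\<bar>X \<omega>\<bar> powr enn2real p) \<partial>M)"
      using X by (intro nn_integral_cmult) measurable
    also have "\<dots> \<le> ennreal (\<bar>a\<bar> powr enn2real p) * ennreal (c powr enn2real p)"
      using Lp_norm_le_iff[OF p c X(1)] X(2) False by (intro mult_left_mono) auto
    also have "\<dots> = ennreal ((\<bar>a\<bar> * c) powr enn2real p)"
      using c by (simp add: powr_mult ennreal_mult)
    finally show ?thesis
      using Lp_norm_le_iff[OF p _ m, of "\<bar>a\<bar> * c"] False c by simp
  qed
qed

lemma Lp_norm_add:
  assumes p: "1 \<le> p" and c: "0 \<le> c"
    and X: "X \<in> borel_measurable M" "Lp_norm M p X \<le> ennreal c"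
    and Y: "Y \<in> borel_measurable M" "Lp_norm M p Y \<le> ennreal c"
  shows "Lp_norm M p (\<lambda>\<omega>. X \<omega> + Y \<omega>) \<le> ennreal (2 * c)"
proof -
  let ?Z = "\<lambda>b. if b then X else Y"
  have "Lp_norm M p (\<lambda>\<omega>. \<Sum>b\<in>UNIV. \<bar>?Z b \<omega>\<bar>) \<le> ennreal (card (UNIV::bool set) * c)"
    by (rule Lp_norm_sum[OF p c]) (use X Y in auto)
  moreover have "Lp_norm M p (\<lambda>\<omega>. X \<omega> + Y \<omega>) \<le> Lp_norm M p (\<lambda>\<omega>. \<Sum>b\<in>UNIV. \<bar>?Z b \<omega>\<bar>)"
    by (rule Lp_norm_mono[OF p]) (use X Y in \<open>auto simp: UNIV_bool\<close>)
  ultimately show ?thesis by (auto simp: UNIV_bool)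
qed

lemma Lp_norm_Fatou:
  assumes p: "1 \<le> p" and c: "0 \<le> c"
    and X: "\<And>n. X n \<in> borel_measurable M" "\<And>n. Lp_norm M p (X n) \<le> ennreal c"
    and Y: "Y \<in> borel_measurable M" and lim: "AE \<omega> in M. (\<lambda>n. X n \<omega>) \<longlonglongrightarrow> Y \<omega>"
  shows "Lp_norm M p Y \<le> ennreal c"
proof (cases "p = \<infinity>")
  case True
  have "AE \<omega> in M. \<forall>n. \<bar>X n \<omega>\<bar> \<le> c"
    using Lp_norm_le_iff[OF p c X(1)] X(2) True by (auto simp: AE_all_countable)
  with lim have "AE \<omega> in M. \<bar>Y \<omega>\<bar> \<le> c"
  proof eventually_elim
    case (elim \<omega>)
    show ?case by (rule LIMSEQ_le_const2[OF tendsto_rabs[OF elim(1)]]) (use elim(2) in auto)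
  qed
  then show ?thesis using Lp_norm_le_iff[OF p c Y] True by simp
next
  case False
  define q where "q = enn2real p"
  have q: "q \<ge> 1" unfolding q_def using p False
    by (metis enn2real_1 enn2real_mono ennreal_less_top infinity_ennreal_def less_top)
  have "(\<integral>\<^sup>+ \<omega>. ennreal (\<bar>Y \<omega>\<bar> powr q) \<partial>M) = (\<integral>\<^sup>+ \<omega>. liminf (\<lambda>n. ennreal (\<bar>X n \<omega>\<bar> powr q)) \<partial>M)"
  proof (rule nn_integral_cong_AE)
    show "AE \<omega> in M. ennreal (\<bar>Y \<omega>\<bar> powr q) = liminf (\<lambda>n. ennreal (\<bar>X n \<omega>\<bar> powr q))"
      using lim
    proof eventually_elim
      case (elim \<omega>)
      have "(\<lambda>n. ennreal (\<bar>X n \<omega>\<bar> powr q)) \<longlonglongrightarrow> ennreal (\<bar>Y \<omega>\<bar> powr q)"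
        using q by (intro tendsto_ennrealI tendsto_powr' tendsto_rabs elim tendsto_const) auto
      then show ?case using lim_imp_Liminf by (metis sequentially_bot)
    qed
  qed
  also have "\<dots> \<le> liminf (\<lambda>n. \<integral>\<^sup>+ \<omega>. ennreal (\<bar>X n \<omega>\<bar> powr q) \<partial>M)"
    using X by (intro nn_integral_liminf) measurable
  also have "\<dots> \<le> liminf (\<lambda>n. ennreal (c powr q))"
    using Lp_norm_le_iff[OF p c X(1)] X(2) False
    by (intro Liminf_mono always_eventually) (auto simp: q_def)
  also have "\<dots> = ennreal (c powr q)" by (simp add: Liminf_const)
  finally show ?thesis using Lp_norm_le_iff[OF p c Y] False by (simp add: q_def)
qed

lemma (in complete_measure) borel_measurable_AE_eq:
  fixes X Y :: "'a \<Rightarrow> real"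
  assumes X: "X \<in> borel_measurable M" and eq: "AE \<omega> in M. X \<omega> = Y \<omega>"
  shows "Y \<in> borel_measurable M"
proof (rule measurableI)
  fix A :: "real set" assume A: "A \<in> sets borel"
  then have "X -` A \<inter> space M \<in> sets M" using X by (rule measurable_sets[rotated])
  moreover have "AE \<omega> in M. \<omega> \<in> X -` A \<inter> space M \<longleftrightarrow> \<omega> \<in> Y -` A \<inter> space M"
    using eq by eventually_elim auto
  ultimately show "Y -` A \<inter> space M \<in> sets M"
    using in_sets_AE[of "X -` A \<inter> space M" "Y -` A \<inter> space M"] by simp
qed auto

lemma (in complete_measure) borel_measurable_AE_LIMSEQ:
  fixes Y :: "'a \<Rightarrow> real"
  assumes X: "\<And>n. X n \<in> borel_measurable M" and lim: "AE \<omega> in M. (\<lambda>n. X n \<omega>) \<longlonglongrightarrow> Y \<omega>"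
  shows "Y \<in> borel_measurable M"
proof (rule borel_measurable_AE_eq)
  show "(\<lambda>\<omega>. lim (\<lambda>n. X n \<omega>)) \<in> borel_measurable M" using X by (rule borel_measurable_lim_metric)
  show "AE \<omega> in M. lim (\<lambda>n. X n \<omega>) = Y \<omega>"
    using lim by eventually_elim (rule limI)
qed

lemma (in complete_measure) Lp_norm_oint:
  assumes p: "1 \<le> p" and c: "0 \<le> c" and ab: "a \<le> b"
    and cont: "AE \<omega> in M. continuous_on UNIV (\<lambda>s. h s \<omega>)"
    and h: "\<And>s. s \<in> {a..b} \<Longrightarrow> h s \<in> borel_measurable M"
      "\<And>s. s \<in> {a..b} \<Longrightarrow> Lp_norm M p (h s) \<le> ennreal c"
  shows "(\<lambda>\<omega>. oint a b (\<lambda>s. \<bar>h s \<omega>\<bar>)) \<in> borel_measurable M" (is "?J \<in> _")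
    and "Lp_norm M p (\<lambda>\<omega>. oint a b (\<lambda>s. \<bar>h s \<omega>\<bar>)) \<le> ennreal ((b - a) * c)"
proof -
  define s where "s n k = a + real k / real (Suc n) * (b - a)" for n k
  have s: "s n k \<in> {a..b}" if "k < Suc n" for n k
  proof -
    have "real k / real (Suc n) * (b - a) \<le> 1 * (b - a)" "real k / real (Suc n) * (b - a) \<ge> 0"
      using that ab by (intro mult_right_mono, auto)
    then show ?thesis by (simp add: s_def)
  qed
  define X where "X n \<omega> = (b - a) * (1 / real (Suc n) * (\<Sum>k<Suc n. \<bar>h (s n k) \<omega>\<bar>))" for n \<omega>
  have hm: "h (s n k) \<in> borel_measurable M" if "k \<in> {..<Suc n}" for n k using h s that by auto
  have Sm: "(\<lambda>\<omega>. \<Sum>k<Suc n. \<bar>h (s n k) \<omega>\<bar>) \<in> borel_measurable M" for n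
    by (intro borel_measurable_sum borel_measurable_abs hm)
  have Xm: "X n \<in> borel_measurable M" for n
    unfolding X_def by (intro borel_measurable_times borel_measurable_const Sm)
  have Xn: "Lp_norm M p (X n) \<le> ennreal ((b - a) * c)" for n
  proof -
    have "Lp_norm M p (\<lambda>\<omega>. \<Sum>k\<in>{..<Suc n}. \<bar>h (s n k) \<omega>\<bar>) \<le> ennreal (card {..<Suc n} * c)"
      by (rule Lp_norm_sum[OF p c finite_lessThan hm h(2)[OF s]]) auto
    from Lp_norm_cmult[OF p _ Sm this, of "(b - a) * (1 / real (Suc n))"] c ab
    show ?thesis unfolding X_def by (simp add: mult.assoc abs_mult del: of_nat_Suc sum.lessThan_Suc)
  qed
  have lim: "AE \<omega> in M. (\<lambda>n. X n \<omega>) \<longlonglongrightarrow> ?J \<omega>"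
    using cont
  proof eventually_elim
    case (elim \<omega>)
    have "continuous_on UNIV (\<lambda>\<theta>. \<bar>h (a + \<theta> * (b - a)) \<omega>\<bar>)"
      by (rule continuous_on_compose2[OF continuous_on_rabs[OF elim]]) (auto intro!: continuous_intros)
    from tendsto_mult_left[OF Riemann_sums[OF this], of "b - a"] show ?case
      unfolding X_def s_def oint_def by (simp del: of_nat_Suc sum.lessThan_Suc)
  qed
  show m: "?J \<in> borel_measurable M" by (rule borel_measurable_AE_LIMSEQ[OF Xm lim])
  show "Lp_norm M p ?J \<le> ennreal ((b - a) * c)"
    by (rule Lp_norm_Fatou[OF p _ Xm Xn m lim]) (use ab c in simp)
qed

section \<open>Moderate and negligible families of numbers\<close>

lemma powr_neg_bigo_mono:
  "a \<le> b \<Longrightarrow> (\<lambda>\<epsilon>::real. \<epsilon> powr (- a)) \<in> O[at_right 0](\<lambda>\<epsilon>. \<epsilon> powr (- b))"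
  by (rule bigoI[of _ 1], unfold eventually_at_right_field, rule exI[of _ 1])
    (auto intro: powr_mono')

lemma eventually_unit_interval: "\<forall>\<^sub>F \<epsilon>::real in at_right 0. \<epsilon> \<in> {0<..1}"
  unfolding eventually_at_right_field by (rule exI[of _ 1]) auto

lemma moderate_mono:
  assumes "moderate d" "\<And>\<epsilon>. \<epsilon> \<in> {0<..1} \<Longrightarrow> \<bar>c \<epsilon>\<bar> \<le> \<bar>d \<epsilon>\<bar>"
  shows "moderate c"
proof -
  have "c \<in> O[at_right 0](d)"
    by (rule bigoI[of _ 1]) (use assms(2) in \<open>auto intro: eventually_mono[OF eventually_unit_interval]\<close>)
  then show ?thesis using assms(1) unfolding moderate_def by (meson landau_o.big_trans)
qed

lemma negligible_mono:
  assumes "negligible_family d" "\<And>\<epsilon>. \<epsilon> \<in> {0<..1} \<Longrightarrow> \<bar>c \<epsilon>\<bar> \<le> \<bar>d \<epsilon>\<bar>"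
  shows "negligible_family c"
proof -
  have "c \<in> O[at_right 0](d)"
    by (rule bigoI[of _ 1]) (use assms(2) in \<open>auto intro: eventually_mono[OF eventually_unit_interval]\<close>)
  then show ?thesis using assms(1) unfolding negligible_family_def by (meson landau_o.big_trans)
qed

lemma moderate_add:
  assumes "moderate c" "moderate d"
  shows "moderate (\<lambda>\<epsilon>. c \<epsilon> + d \<epsilon>)"
proof -
  obtain a b where ab: "a \<ge> 0" "c \<in> O[at_right 0](\<lambda>\<epsilon>. \<epsilon> powr (- a))"
    "b \<ge> 0" "d \<in> O[at_right 0](\<lambda>\<epsilon>. \<epsilon> powr (- b))"
    using assms unfolding moderate_def by auto
  have "c \<in> O[at_right 0](\<lambda>\<epsilon>. \<epsilon> powr (- (a + b)))" "d \<in> O[at_right 0](\<lambda>\<epsilon>. \<epsilon> powr (- (a + b)))"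
    using landau_o.big_trans[OF ab(2) powr_neg_bigo_mono[of a "a + b"]]
      landau_o.big_trans[OF ab(4) powr_neg_bigo_mono[of b "a + b"]] ab(1,3) by auto
  then show ?thesis unfolding moderate_def using ab(1,3)
    by (intro exI[of _ "a + b"]) (auto intro: sum_in_bigo)
qed

lemma moderate_mult:
  assumes "moderate c" "moderate d"
  shows "moderate (\<lambda>\<epsilon>. c \<epsilon> * d \<epsilon>)"
proof -
  obtain a b where ab: "a \<ge> 0" "c \<in> O[at_right 0](\<lambda>\<epsilon>. \<epsilon> powr (- a))"
    "b \<ge> 0" "d \<in> O[at_right 0](\<lambda>\<epsilon>. \<epsilon> powr (- b))"
    using assms unfolding moderate_def by auto
  have "(\<lambda>\<epsilon>::real. \<epsilon> powr (- (a + b))) = (\<lambda>\<epsilon>. \<epsilon> powr (- a) * \<epsilon> powr (- b))"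
    by (simp add: powr_add[symmetric])
  then have "(\<lambda>\<epsilon>. c \<epsilon> * d \<epsilon>) \<in> O[at_right 0](\<lambda>\<epsilon>. \<epsilon> powr (- (a + b)))"
    using landau_o.big.mult[OF ab(2,4)] by simp
  then show ?thesis unfolding moderate_def using ab(1,3) by (intro exI[of _ "a + b"]) auto
qed

lemma moderate_const: "moderate (\<lambda>\<epsilon>. c)"
  unfolding moderate_def
proof (intro exI conjI)
  show "(\<lambda>\<epsilon>. c) \<in> O[at_right 0](\<lambda>\<epsilon>. \<epsilon> powr (- 0))"
    by (rule bigoI[of _ "\<bar>c\<bar>"], rule eventually_mono[OF eventually_unit_interval]) simp
qed simp

lemma negligible_add:
  "negligible_family c \<Longrightarrow> negligible_family d \<Longrightarrow> negligible_family (\<lambda>\<epsilon>. c \<epsilon> + d \<epsilon>)"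
  unfolding negligible_family_def by (auto intro: sum_in_bigo)

lemma negligible_moderate_mult:
  assumes "negligible_family c" "moderate d"
  shows "negligible_family (\<lambda>\<epsilon>. c \<epsilon> * d \<epsilon>)"
  unfolding negligible_family_def
proof (intro allI impI)
  fix b :: real assume b: "b \<ge> 0"
  obtain a where a: "a \<ge> 0" "d \<in> O[at_right 0](\<lambda>\<epsilon>. \<epsilon> powr (- a))"
    using assms unfolding moderate_def by auto
  have "c \<in> O[at_right 0](\<lambda>\<epsilon>. \<epsilon> powr (b + a))"
    using assms(1) a(1) b unfolding negligible_family_def by auto
  moreover have "(\<lambda>\<epsilon>::real. \<epsilon> powr b) = (\<lambda>\<epsilon>. \<epsilon> powr (b + a) * \<epsilon> powr (- a))"
    by (simp add: powr_add[symmetric])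
  ultimately show "(\<lambda>\<epsilon>. c \<epsilon> * d \<epsilon>) \<in> O[at_right 0](\<lambda>\<epsilon>. \<epsilon> powr b)"
    using landau_o.big.mult[OF _ a(2)] by simp
qed

text \<open>The two classes of families are treated simultaneously: an estimate that is linear in the
  data, with a moderate constant, transfers either of them from the data to the solution.\<close>

definition growth_class :: "((real \<Rightarrow> real) \<Rightarrow> bool) \<Rightarrow> bool" where
  "growth_class F \<longleftrightarrow> F = moderate \<or> F = negligible_family"

lemma growth_class_mono:
  "growth_class F \<Longrightarrow> F d \<Longrightarrow> (\<And>\<epsilon>. \<epsilon> \<in> {0<..1} \<Longrightarrow> \<bar>c \<epsilon>\<bar> \<le> \<bar>d \<epsilon>\<bar>) \<Longrightarrow> F c"
  unfolding growth_class_def using moderate_mono negligible_mono by metis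

lemma growth_class_zero: "growth_class F \<Longrightarrow> F (\<lambda>\<epsilon>. 0)"
  unfolding growth_class_def using moderate_const by (auto simp: negligible_family_def)

lemma growth_class_add:
  "growth_class F \<Longrightarrow> F c \<Longrightarrow> F d \<Longrightarrow> F (\<lambda>\<epsilon>. c \<epsilon> + d \<epsilon>)"
  unfolding growth_class_def using moderate_add negligible_add by auto

lemma growth_class_sum:
  "growth_class F \<Longrightarrow> (\<And>j. j \<in> J \<Longrightarrow> F (c j)) \<Longrightarrow> F (\<lambda>\<epsilon>. \<Sum>j\<in>J. c j \<epsilon>)"
  by (induction J rule: infinite_finite_induct) (auto intro: growth_class_zero growth_class_add)

definition product_class ::
    "((real \<Rightarrow> real) \<Rightarrow> bool) \<Rightarrow> ((real \<Rightarrow> real) \<Rightarrow> bool) \<Rightarrow> ((real \<Rightarrow> real) \<Rightarrow> bool) \<Rightarrow> bool" where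
  "product_class F1 F2 F \<longleftrightarrow> growth_class F1 \<and> growth_class F2 \<and> growth_class F \<and>
     (\<forall>c d. F1 c \<longrightarrow> F2 d \<longrightarrow> F (\<lambda>\<epsilon>. c \<epsilon> * d \<epsilon>))"

lemma product_class_moderate: "growth_class F \<Longrightarrow> product_class moderate F F"
  unfolding product_class_def growth_class_def
  using moderate_mult negligible_moderate_mult by (auto, subst mult.commute, auto)

lemma product_class_negligible: "product_class negligible_family moderate negligible_family"
  unfolding product_class_def growth_class_def using negligible_moderate_mult by auto

lemma growth_class_cmult: "growth_class F \<Longrightarrow> F c \<Longrightarrow> F (\<lambda>\<epsilon>. a * c \<epsilon>)"
  using product_class_moderate moderate_const unfolding product_class_def by blast

definition log_growth :: "(real \<Rightarrow> real) \<Rightarrow> bool" where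
  "log_growth \<kappa> \<longleftrightarrow> (\<forall>T\<ge>0. moderate (\<lambda>\<epsilon>. exp (T * \<kappa> \<epsilon>)))"

lemma log_growth_add: "log_growth \<kappa> \<Longrightarrow> log_growth \<mu> \<Longrightarrow> log_growth (\<lambda>\<epsilon>. \<kappa> \<epsilon> + \<mu> \<epsilon>)"
  unfolding log_growth_def by (auto simp: ring_distribs exp_add intro: moderate_mult)

lemma log_growth_const: "log_growth (\<lambda>\<epsilon>. c)"
  unfolding log_growth_def by (auto intro: moderate_const)

lemma log_growth_sum: "(\<And>j. j \<in> J \<Longrightarrow> log_growth (\<kappa> j)) \<Longrightarrow> log_growth (\<lambda>\<epsilon>. \<Sum>j\<in>J. \<kappa> j \<epsilon>)"
  by (induction J rule: infinite_finite_induct) (auto intro: log_growth_const log_growth_add)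

lemma log_growth_ln: 
  assumes "c \<ge> 0"
  shows "log_growth (\<lambda>\<epsilon>. c * \<bar>ln \<epsilon>\<bar>)"
  unfolding log_growth_def
proof (intro allI impI)
  fix T :: real assume T: "T \<ge> 0"
  have "moderate (\<lambda>\<epsilon>. \<epsilon> powr (- (T * c)))"
    unfolding moderate_def using T assms by (intro exI[of _ "T * c"]) auto
  then show "moderate (\<lambda>\<epsilon>. exp (T * (c * \<bar>ln \<epsilon>\<bar>)))"
  proof (rule moderate_mono)
    fix \<epsilon> :: real assume "\<epsilon> \<in> {0<..1}"
    then show "\<bar>exp (T * (c * \<bar>ln \<epsilon>\<bar>))\<bar> \<le> \<bar>\<epsilon> powr (- (T * c))\<bar>"
      by (simp add: powr_def)
  qed
qed

lemma log_growth_negligible: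
  assumes "negligible_family c"
  shows "log_growth c"
  unfolding log_growth_def
proof (intro allI impI)
  fix T :: real assume T: "T \<ge> 0"
  have "c \<in> O[at_right 0](\<lambda>\<epsilon>. \<epsilon> powr 0)" using assms unfolding negligible_family_def by blast
  then obtain C where C: "\<forall>\<^sub>F \<epsilon> in at_right 0. norm (c \<epsilon>) \<le> C * norm (\<epsilon> powr 0)"
    by (rule landau_o.bigE)
  have "(\<lambda>\<epsilon>. exp (T * c \<epsilon>)) \<in> O[at_right 0](\<lambda>\<epsilon>. \<epsilon> powr (- 0))"
  proof (rule bigoI[of _ "exp (T * C)"])
    show "\<forall>\<^sub>F \<epsilon> in at_right 0. norm (exp (T * c \<epsilon>)) \<le> exp (T * C) * norm (\<epsilon> powr - 0)"
      using C eventually_unit_interval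
    proof eventually_elim
      case (elim \<epsilon>)
      then have "c \<epsilon> \<le> C" by simp
      then show ?case using elim T by (simp add: mult_left_mono)
    qed
  qed
  then show "moderate (\<lambda>\<epsilon>. exp (T * c \<epsilon>))" unfolding moderate_def by blast
qed

section \<open>Pathwise domination of random fields\<close>

definition fam_pds :: "'d list \<Rightarrow> ('w, 'd::finite) family \<Rightarrow> ('w, 'd) family" where
  "fam_pds w u = (\<lambda>\<epsilon> x \<omega>. pds w (\<lambda>y. u \<epsilon> y \<omega>) x)"

definition smooth_field :: "'w measure \<Rightarrow> ('w, 'd::finite) family \<Rightarrow> bool" where
  "smooth_field M u \<longleftrightarrow> (AE \<omega> in M. \<forall>\<epsilon>\<in>{0<..1}. C_infinity (\<lambda>x. u \<epsilon> x \<omega>)) \<and>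
     (\<forall>x. \<forall>\<epsilon>\<in>{0<..1}. u \<epsilon> x \<in> borel_measurable M)"

definition dominated_by ::
    "'w measure \<Rightarrow> ennreal \<Rightarrow> ('w, 'd::finite) family \<Rightarrow> (real^'d) set \<Rightarrow> (real \<Rightarrow> 'w \<Rightarrow> real) \<Rightarrow> (real \<Rightarrow> real) \<Rightarrow> bool" where
  "dominated_by M p v K B c \<longleftrightarrow> (\<forall>\<epsilon>\<in>{0<..1}. 0 \<le> c \<epsilon> \<and>
     B \<epsilon> \<in> borel_measurable M \<and> Lp_norm M p (B \<epsilon>) \<le> ennreal (c \<epsilon>) \<and>
     (AE \<omega> in M. \<forall>x\<in>K. \<bar>v \<epsilon> x \<omega>\<bar> \<le> B \<epsilon> \<omega>))"

definition loc_dom ::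
    "'w measure \<Rightarrow> ennreal \<Rightarrow> ((real \<Rightarrow> real) \<Rightarrow> bool) \<Rightarrow> ('w, 'd::finite) family \<Rightarrow> bool" where
  "loc_dom M p F v \<longleftrightarrow> (\<forall>K. compact K \<longrightarrow> (\<exists>B c. F c \<and> dominated_by M p v K B c))"

definition dom_fam ::
    "'w measure \<Rightarrow> ennreal \<Rightarrow> ((real \<Rightarrow> real) \<Rightarrow> bool) \<Rightarrow> ('w, 'd::finite) family \<Rightarrow> bool" where
  "dom_fam M p F u \<longleftrightarrow> smooth_field M u \<and> (\<forall>w. loc_dom M p F (fam_pds w u))"

lemma dominated_byD:
  assumes "dominated_by M p v K B c" "\<epsilon> \<in> {0<..1}"
  shows "0 \<le> c \<epsilon>" "B \<epsilon> \<in> borel_measurable M" "Lp_norm M p (B \<epsilon>) \<le> ennreal (c \<epsilon>)"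
    "AE \<omega> in M. \<forall>x\<in>K. \<bar>v \<epsilon> x \<omega>\<bar> \<le> B \<epsilon> \<omega>"
  using assms unfolding dominated_by_def by simp_all

lemma loc_domE:
  assumes "loc_dom M p F v" "compact K"
  obtains B c where "F c" "dominated_by M p v K B c"
proof -
  from mp[OF spec[OF assms(1)[unfolded loc_dom_def]] assms(2)] obtain B c where
    "F c \<and> dominated_by M p v K B c" by (elim exE)
  then show thesis by (intro that[of c B]) simp_all
qed

lemma smooth_fieldD: "smooth_field M u \<Longrightarrow> AE \<omega> in M. \<forall>\<epsilon>\<in>{0<..1}. C_infinity (\<lambda>x. u \<epsilon> x \<omega>)"
  by (simp add: smooth_field_def)

lemma smooth_field_at:
  assumes "smooth_field M u" "\<epsilon> \<in> {0<..1}"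
  shows "AE \<omega> in M. C_infinity (\<lambda>x. u \<epsilon> x \<omega>)"
  using smooth_fieldD[OF assms(1)] by eventually_elim (use assms(2) in auto)

lemma smooth_field_measurable:
  "smooth_field M u \<Longrightarrow> \<epsilon> \<in> {0<..1} \<Longrightarrow> u \<epsilon> x \<in> borel_measurable M"
  by (simp add: smooth_field_def)

lemma smooth_field_const: "smooth_field M (\<lambda>\<epsilon> x \<omega>. c)"
  by (simp add: smooth_field_def C_infinity_const)

lemma smooth_field_add:
  assumes u: "smooth_field M u" and v: "smooth_field M v"
  shows "smooth_field M (\<lambda>\<epsilon> x \<omega>. u \<epsilon> x \<omega> + v \<epsilon> x \<omega>)"
  unfolding smooth_field_def
proof
  show "AE \<omega> in M. \<forall>\<epsilon>\<in>{0<..1}. C_infinity (\<lambda>x. u \<epsilon> x \<omega> + v \<epsilon> x \<omega>)"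
    using smooth_fieldD[OF u] smooth_fieldD[OF v] by eventually_elim (auto intro: C_infinity_intros)
qed (use u v in \<open>auto simp: smooth_field_def intro!: borel_measurable_add borel_measurable_times\<close>)

lemma smooth_field_mult:
  assumes u: "smooth_field M u" and v: "smooth_field M v"
  shows "smooth_field M (\<lambda>\<epsilon> x \<omega>. u \<epsilon> x \<omega> * v \<epsilon> x \<omega>)"
  unfolding smooth_field_def
proof
  show "AE \<omega> in M. \<forall>\<epsilon>\<in>{0<..1}. C_infinity (\<lambda>x. u \<epsilon> x \<omega> * v \<epsilon> x \<omega>)"
    using smooth_fieldD[OF u] smooth_fieldD[OF v] by eventually_elim (auto intro: C_infinity_intros)
qed (use u v in \<open>auto simp: smooth_field_def intro!: borel_measurable_add borel_measurable_times\<close>)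

lemma smooth_field_diff:
  assumes u: "smooth_field M u" and v: "smooth_field M v"
  shows "smooth_field M (\<lambda>\<epsilon> x \<omega>. u \<epsilon> x \<omega> - v \<epsilon> x \<omega>)"
  using smooth_field_add[OF u smooth_field_mult[OF smooth_field_const[of M "-1"] v]] by simp

lemma smooth_field_sum:
  assumes u: "\<And>j. j \<in> J \<Longrightarrow> smooth_field M (u j)"
  shows "smooth_field M (\<lambda>\<epsilon> x \<omega>. \<Sum>j\<in>J. u j \<epsilon> x \<omega>)"
  using u by (induction J rule: infinite_finite_induct)
    (auto intro!: smooth_field_const smooth_field_add)

lemma fam_pds_Nil [simp]: "fam_pds [] u = u"
  by (simp add: fam_pds_def)

lemma fam_pds_append: "fam_pds (w @ w') u = fam_pds w (fam_pds w' u)"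
  by (simp add: fam_pds_def)

lemma fam_pds_singleton: "fam_pds [i] u = (\<lambda>\<epsilon> x \<omega>. pd i (\<lambda>y. u \<epsilon> y \<omega>) x)"
  by (simp add: fam_pds_def)

lemma DERIV_imp_LIMSEQ_quotient:
  assumes "(f has_field_derivative D) (at (0::real))"
  shows "(\<lambda>n. (f (1 / real (Suc n)) - f 0) * real (Suc n)) \<longlonglongrightarrow> D"
proof -
  have "((\<lambda>h. (f h - f 0) / h) \<longlongrightarrow> D) (at 0)"
    using assms by (simp add: DERIV_def)
  moreover have "filterlim (\<lambda>n. 1 / real (Suc n)) (at 0) sequentially"
    unfolding filterlim_at using LIMSEQ_Suc[OF lim_1_over_n] by auto
  ultimately have "(\<lambda>n. (f (1 / real (Suc n)) - f 0) / (1 / real (Suc n))) \<longlonglongrightarrow> D"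
    by (rule filterlim_compose)
  then show ?thesis by simp
qed

context complete_measure
begin

lemma smooth_field_pd:
  assumes u: "smooth_field M u"
  shows "smooth_field M (fam_pds [i] u)"
  unfolding smooth_field_def fam_pds_singleton
proof (intro conjI allI ballI)
  show "AE \<omega> in M. \<forall>\<epsilon>\<in>{0<..1}. C_infinity (\<lambda>x. pd i (\<lambda>y. u \<epsilon> y \<omega>) x)"
    using smooth_fieldD[OF u] by eventually_elim (auto intro: C_infinity_pd)
  fix x :: "real^'b" and \<epsilon> :: real assume e: "\<epsilon> \<in> {0<..1}"
  show "(\<lambda>\<omega>. pd i (\<lambda>y. u \<epsilon> y \<omega>) x) \<in> borel_measurable M"
  proof (rule borel_measurable_AE_LIMSEQ)
    show "AE \<omega> in M. (\<lambda>n. (u \<epsilon> (x + (1 / real (Suc n)) *\<^sub>R axis i 1) \<omega> - u \<epsilon> (x + 0 *\<^sub>R axis i 1) \<omega>) * real (Suc n))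
        \<longlonglongrightarrow> pd i (\<lambda>y. u \<epsilon> y \<omega>) x"
      using smooth_field_at[OF u e]
    proof eventually_elim
      case (elim \<omega>)
      show ?case
        using DERIV_imp_LIMSEQ_quotient[OF C_infinity_DERIV0[OF elim, of x i]] .
    qed
  qed (use smooth_field_measurable[OF u e] in measurable)
qed

lemma smooth_field_pds:
  assumes "smooth_field M u"
  shows "smooth_field M (fam_pds w u)"
proof (induction w)
  case (Cons i w)
  have "fam_pds (i # w) u = fam_pds [i] (fam_pds w u)" by (simp add: fam_pds_def)
  then show ?case using smooth_field_pd[OF Cons] by simp
qed (use assms in simp)

end

lemma loc_dom_linear:
  fixes u :: "('w, 'd::finite) family" and v :: "'j \<Rightarrow> ('w, 'e::finite) family"
  assumes p: "1 \<le> p" and F: "product_class F1 F2 F" and J: "finite J"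
    and v: "\<And>j. j \<in> J \<Longrightarrow> loc_dom M p F2 (v j)"
    and le: "\<And>K. compact K \<Longrightarrow> \<exists>K' c. compact K' \<and> F1 c \<and> (\<forall>\<epsilon>\<in>{0<..1}. 0 \<le> c \<epsilon> \<and>
      (AE \<omega> in M. \<forall>b\<ge>0. (\<forall>j\<in>J. \<forall>y\<in>K'. \<bar>v j \<epsilon> y \<omega>\<bar> \<le> b) \<longrightarrow> (\<forall>x\<in>K. \<bar>u \<epsilon> x \<omega>\<bar> \<le> c \<epsilon> * b)))"
  shows "loc_dom M p F u"
  unfolding loc_dom_def
proof (intro allI impI)
  fix K :: "(real^'d) set" assume "compact K"
  from le[OF this] obtain K' c where K': "compact K'" and c: "F1 c"
    "\<And>\<epsilon>. \<epsilon> \<in> {0<..1} \<Longrightarrow> 0 \<le> c \<epsilon>"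
    "\<And>\<epsilon>. \<epsilon> \<in> {0<..1} \<Longrightarrow> AE \<omega> in M. \<forall>b\<ge>0. (\<forall>j\<in>J. \<forall>y\<in>K'. \<bar>v j \<epsilon> y \<omega>\<bar> \<le> b) \<longrightarrow> (\<forall>x\<in>K. \<bar>u \<epsilon> x \<omega>\<bar> \<le> c \<epsilon> * b)"
    by blast
  have "\<forall>j\<in>J. \<exists>B d. F2 d \<and> dominated_by M p (v j) K' B d"
    by (intro ballI mp[OF spec[OF v[unfolded loc_dom_def]] K'])
  from bchoice[OF this] obtain B where "\<forall>j\<in>J. \<exists>d. F2 d \<and> dominated_by M p (v j) K' (B j) d"
    by (elim exE)
  from bchoice[OF this] obtain d where "\<forall>j\<in>J. F2 (d j) \<and> dominated_by M p (v j) K' (B j) (d j)"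
    by (elim exE)
  then have Bd: "\<And>j. j \<in> J \<Longrightarrow> F2 (d j)" "\<And>j. j \<in> J \<Longrightarrow> dominated_by M p (v j) K' (B j) (d j)"
    by simp_all
  note Bd' = dominated_byD[OF Bd(2)]
  define D where "D \<epsilon> = (\<Sum>j\<in>J. d j \<epsilon>)" for \<epsilon>
  have gF: "growth_class F2" "growth_class F" using F by (auto simp: product_class_def)
  have FD: "F2 D" unfolding D_def by (rule growth_class_sum[OF gF(1) Bd(1)])
  have Fc: "F (\<lambda>\<epsilon>. real (card J) * (c \<epsilon> * D \<epsilon>))"
    using F c(1) FD unfolding product_class_def by (auto intro: growth_class_cmult)
  show "\<exists>B c. F c \<and> dominated_by M p u K B c"
    unfolding dominated_by_def
  proof (rule exI[of _ "\<lambda>\<epsilon> \<omega>. c \<epsilon> * (\<Sum>j\<in>J. \<bar>B j \<epsilon> \<omega>\<bar>)"],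
      rule exI[of _ "\<lambda>\<epsilon>. real (card J) * (c \<epsilon> * D \<epsilon>)"], intro conjI ballI Fc)
    fix \<epsilon> :: real assume e: "\<epsilon> \<in> {0<..1}"
    have D: "0 \<le> D \<epsilon>" unfolding D_def using Bd'(1) e by (intro sum_nonneg) auto
    show "0 \<le> real (card J) * (c \<epsilon> * D \<epsilon>)" using D c(2)[OF e] by simp
    have m: "(\<lambda>\<omega>. \<Sum>j\<in>J. \<bar>B j \<epsilon> \<omega>\<bar>) \<in> borel_measurable M" using Bd'(2)[OF _ e] by measurable
    then show "(\<lambda>\<omega>. c \<epsilon> * (\<Sum>j\<in>J. \<bar>B j \<epsilon> \<omega>\<bar>)) \<in> borel_measurable M" by measurable
    have "Lp_norm M p (B j \<epsilon>) \<le> ennreal (D \<epsilon>)" if "j \<in> J" for j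
    proof -
      have "d j \<epsilon> \<le> D \<epsilon>" unfolding D_def using that J Bd'(1) e by (intro member_le_sum) auto
      then show ?thesis using Bd'(3)[OF that e] by (meson ennreal_leI order_trans)
    qed
    then have "Lp_norm M p (\<lambda>\<omega>. \<Sum>j\<in>J. \<bar>B j \<epsilon> \<omega>\<bar>) \<le> ennreal (card J * D \<epsilon>)"
      using Bd'(2)[OF _ e] by (intro Lp_norm_sum[OF p D J]) auto
    from Lp_norm_cmult[OF p _ m this, of "c \<epsilon>"] D c(2)[OF e]
    show "Lp_norm M p (\<lambda>\<omega>. c \<epsilon> * (\<Sum>j\<in>J. \<bar>B j \<epsilon> \<omega>\<bar>)) \<le> ennreal (real (card J) * (c \<epsilon> * D \<epsilon>))"
      by (simp add: mult.left_commute)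
    have "AE \<omega> in M. \<forall>j\<in>J. \<forall>x\<in>K'. \<bar>v j \<epsilon> x \<omega>\<bar> \<le> B j \<epsilon> \<omega>"
      by (intro AE_finite_allI[OF J] Bd'(4)[OF _ e])
    with c(3)[OF e] show "AE \<omega> in M. \<forall>x\<in>K. \<bar>u \<epsilon> x \<omega>\<bar> \<le> c \<epsilon> * (\<Sum>j\<in>J. \<bar>B j \<epsilon> \<omega>\<bar>)"
    proof eventually_elim
      case (elim \<omega>)
      have "\<forall>j\<in>J. \<forall>y\<in>K'. \<bar>v j \<epsilon> y \<omega>\<bar> \<le> (\<Sum>j\<in>J. \<bar>B j \<epsilon> \<omega>\<bar>)"
      proof (intro ballI)
        fix j y assume j: "j \<in> J" and y: "y \<in> K'"
        have "\<bar>B j \<epsilon> \<omega>\<bar> \<le> (\<Sum>j\<in>J. \<bar>B j \<epsilon> \<omega>\<bar>)" using j J by (intro member_le_sum) auto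
        then show "\<bar>v j \<epsilon> y \<omega>\<bar> \<le> (\<Sum>j\<in>J. \<bar>B j \<epsilon> \<omega>\<bar>)" using elim(2) j y by fastforce
      qed
      then show ?case using elim(1) by (auto intro: sum_nonneg)
    qed
  qed
qed

lemma loc_dom_cong_imp:
  fixes u v :: "('w, 'd::finite) family"
  assumes v: "loc_dom M p F v" and eq: "\<And>\<epsilon>. \<epsilon> \<in> {0<..1} \<Longrightarrow> AE \<omega> in M. \<forall>x. u \<epsilon> x \<omega> = v \<epsilon> x \<omega>"
  shows "loc_dom M p F u"
  unfolding loc_dom_def
proof (intro allI impI)
  fix K :: "(real^'d) set" assume "compact K"
  from v this obtain B c where c: "F c" and B: "dominated_by M p v K B c"
    by (rule loc_domE) (rule that)
  have "AE \<omega> in M. \<forall>x\<in>K. \<bar>u \<epsilon> x \<omega>\<bar> \<le> B \<epsilon> \<omega>" if e: "\<epsilon> \<in> {0<..1}" for \<epsilon>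
    using eq[OF e] dominated_byD(4)[OF B e] by eventually_elim auto
  then show "\<exists>B c. F c \<and> dominated_by M p u K B c"
    unfolding dominated_by_def using c dominated_byD(1-3)[OF B] by (intro exI[of _ B] exI[of _ c]) simp
qed

lemma loc_dom_pointwise:
  fixes u :: "('w, 'd::finite) family" and v :: "'j \<Rightarrow> ('w, 'd) family"
  assumes p: "1 \<le> p" and F: "growth_class F" and J: "finite J"
    and v: "\<And>j. j \<in> J \<Longrightarrow> loc_dom M p F (v j)" and C: "0 \<le> C"
    and le: "\<And>\<epsilon>. \<epsilon> \<in> {0<..1} \<Longrightarrow> AE \<omega> in M. \<forall>x b. b \<ge> 0 \<longrightarrow> (\<forall>j\<in>J. \<bar>v j \<epsilon> x \<omega>\<bar> \<le> b) \<longrightarrow> \<bar>u \<epsilon> x \<omega>\<bar> \<le> C * b"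
  shows "loc_dom M p F u"
proof (rule loc_dom_linear[OF p product_class_moderate[OF F] J v])
  fix K :: "(real^'d) set" assume K: "compact K"
  show "\<exists>K' c. compact K' \<and> moderate c \<and> (\<forall>\<epsilon>\<in>{0<..1}. 0 \<le> c \<epsilon> \<and>
      (AE \<omega> in M. \<forall>b\<ge>0. (\<forall>j\<in>J. \<forall>y\<in>K'. \<bar>v j \<epsilon> y \<omega>\<bar> \<le> b) \<longrightarrow> (\<forall>x\<in>K. \<bar>u \<epsilon> x \<omega>\<bar> \<le> c \<epsilon> * b)))"
  proof (intro exI[of _ K] exI[of _ "\<lambda>_. C"] conjI K moderate_const ballI C)
    fix \<epsilon> :: real assume "\<epsilon> \<in> {0<..1}"
    from le[OF this] show "AE \<omega> in M. \<forall>b\<ge>0. (\<forall>j\<in>J. \<forall>y\<in>K. \<bar>v j \<epsilon> y \<omega>\<bar> \<le> b) \<longrightarrow> (\<forall>x\<in>K. \<bar>u \<epsilon> x \<omega>\<bar> \<le> C * b)"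
      by eventually_elim blast
  qed
qed

lemma loc_dom_zero:
  assumes "1 \<le> p" "growth_class F"
  shows "loc_dom M p F (\<lambda>\<epsilon> x \<omega>. 0)"
  by (rule loc_dom_pointwise[OF assms, of "{}" _ _ 0]) auto

lemma loc_dom_sum:
  assumes "1 \<le> p" "growth_class F" "finite J" "\<And>j. j \<in> J \<Longrightarrow> loc_dom M p F (v j)"
  shows "loc_dom M p F (\<lambda>\<epsilon> x \<omega>. \<Sum>j\<in>J. v j \<epsilon> x \<omega>)"
proof (rule loc_dom_pointwise[OF assms(1-4), where C = "real (card J)"])
  have "\<bar>\<Sum>j\<in>J. v j \<epsilon> x \<omega>\<bar> \<le> real (card J) * b" if "\<forall>j\<in>J. \<bar>v j \<epsilon> x \<omega>\<bar> \<le> b" for b \<epsilon> x \<omega>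
    by (rule order_trans[OF sum_abs sum_bounded_above]) (use that in auto)
  then show "AE \<omega> in M. \<forall>x b. b \<ge> 0 \<longrightarrow> (\<forall>j\<in>J. \<bar>v j \<epsilon> x \<omega>\<bar> \<le> b) \<longrightarrow> \<bar>\<Sum>j\<in>J. v j \<epsilon> x \<omega>\<bar> \<le> real (card J) * b" for \<epsilon>
    by auto
qed auto

lemma loc_dom_add:
  assumes "1 \<le> p" "growth_class F" "loc_dom M p F u" "loc_dom M p F v"
  shows "loc_dom M p F (\<lambda>\<epsilon> x \<omega>. u \<epsilon> x \<omega> + v \<epsilon> x \<omega>)"
proof -
  have "loc_dom M p F (\<lambda>\<epsilon> x \<omega>. \<Sum>b\<in>UNIV. (if b then u else v) \<epsilon> x \<omega>)"
    by (rule loc_dom_sum) (use assms in auto)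
  then show ?thesis by (simp add: UNIV_bool add.commute)
qed

lemma loc_dom_uminus:
  assumes "1 \<le> p" "growth_class F" "loc_dom M p F u"
  shows "loc_dom M p F (\<lambda>\<epsilon> x \<omega>. - u \<epsilon> x \<omega>)"
  by (rule loc_dom_pointwise[OF assms(1,2), of "{()}" _ "\<lambda>_. u" 1]) (use assms(3) in auto)

lemma loc_dom_infinity:
  fixes a :: "('w, 'd::finite) family"
  assumes a: "loc_dom M \<infinity> F a" "compact K"
  obtains c where "F c" "\<And>\<epsilon>. \<epsilon> \<in> {0<..1} \<Longrightarrow> 0 \<le> c \<epsilon>"
    "\<And>\<epsilon>. \<epsilon> \<in> {0<..1} \<Longrightarrow> AE \<omega> in M. \<forall>x\<in>K. \<bar>a \<epsilon> x \<omega>\<bar> \<le> c \<epsilon>"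
proof -
  from a obtain B c where c: "F c" and B: "dominated_by M \<infinity> a K B c"
    by (rule loc_domE) (rule that)
  have "AE \<omega> in M. \<forall>x\<in>K. \<bar>a \<epsilon> x \<omega>\<bar> \<le> c \<epsilon>" if e: "\<epsilon> \<in> {0<..1}" for \<epsilon>
  proof -
    have "AE \<omega> in M. \<bar>B \<epsilon> \<omega>\<bar> \<le> c \<epsilon>"
      using dominated_byD(1-3)[OF B e] Lp_norm_le_iff[of \<infinity> "c \<epsilon>" "B \<epsilon>" M] by simp
    with dominated_byD(4)[OF B e] show ?thesis by eventually_elim fastforce
  qed
  then show ?thesis using that[of c] c dominated_byD(1)[OF B] by simp
qed

lemma loc_dom_mult:
  fixes u a :: "('w, 'd::finite) family"
  assumes p: "1 \<le> p" and F: "product_class F1 F2 F" and a: "loc_dom M \<infinity> F1 a" and u: "loc_dom M p F2 u"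
  shows "loc_dom M p F (\<lambda>\<epsilon> x \<omega>. a \<epsilon> x \<omega> * u \<epsilon> x \<omega>)"
proof (rule loc_dom_linear[OF p F, of "{()}" _ "\<lambda>_. u"])
  fix K :: "(real^'d) set" assume K: "compact K"
  from a K obtain c where c: "F1 c" "\<And>\<epsilon>. \<epsilon> \<in> {0<..1} \<Longrightarrow> 0 \<le> c \<epsilon>"
    "\<And>\<epsilon>. \<epsilon> \<in> {0<..1} \<Longrightarrow> AE \<omega> in M. \<forall>x\<in>K. \<bar>a \<epsilon> x \<omega>\<bar> \<le> c \<epsilon>"
    by (rule loc_dom_infinity) (rule that)
  have "AE \<omega> in M. \<forall>b\<ge>0. (\<forall>j\<in>{()}. \<forall>y\<in>K. \<bar>u \<epsilon> y \<omega>\<bar> \<le> b) \<longrightarrow> (\<forall>x\<in>K. \<bar>a \<epsilon> x \<omega> * u \<epsilon> x \<omega>\<bar> \<le> c \<epsilon> * b)"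
    if e: "\<epsilon> \<in> {0<..1}" for \<epsilon>
    using c(3)[OF e]
    by eventually_elim (auto simp: abs_mult intro!: mult_mono c(2)[OF e])
  then show "\<exists>K' c. compact K' \<and> F1 c \<and> (\<forall>\<epsilon>\<in>{0<..1}. 0 \<le> c \<epsilon> \<and>
      (AE \<omega> in M. \<forall>b\<ge>0. (\<forall>j\<in>{()}. \<forall>y\<in>K'. \<bar>u \<epsilon> y \<omega>\<bar> \<le> b) \<longrightarrow> (\<forall>x\<in>K. \<bar>a \<epsilon> x \<omega> * u \<epsilon> x \<omega>\<bar> \<le> c \<epsilon> * b)))"
    using K c(1,2) by (intro exI[of _ K] exI[of _ c]) simp
qed (use u in auto)

context complete_measure
begin

lemma loc_dom_pds_mult:
  assumes p: "1 \<le> p" and F: "product_class F1 F2 F"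
  shows "smooth_field M a \<Longrightarrow> smooth_field M u \<Longrightarrow> (\<And>w'. mset w' \<subseteq># mset w \<Longrightarrow> loc_dom M \<infinity> F1 (fam_pds w' a)) \<Longrightarrow>
    (\<And>w'. mset w' \<subseteq># mset w \<Longrightarrow> loc_dom M p F2 (fam_pds w' u)) \<Longrightarrow>
    loc_dom M p F (fam_pds w (\<lambda>\<epsilon> x \<omega>. a \<epsilon> x \<omega> * u \<epsilon> x \<omega>))"
proof (induction w arbitrary: a u rule: rev_induct)
  case Nil
  from Nil(3,4)[of "[]"] show ?case using loc_dom_mult[OF p F] by simp
next
  case (snoc i w)
  have gF: "growth_class F" using F by (simp add: product_class_def)
  let ?v1 = "\<lambda>\<epsilon> x \<omega>. fam_pds [i] a \<epsilon> x \<omega> * u \<epsilon> x \<omega>"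
  let ?v2 = "\<lambda>\<epsilon> x \<omega>. a \<epsilon> x \<omega> * fam_pds [i] u \<epsilon> x \<omega>"
  have sub: "mset w' \<subseteq># mset (w @ [i])" "mset (w' @ [i]) \<subseteq># mset (w @ [i])" if "mset w' \<subseteq># mset w" for w'
    using that by (auto intro: subset_mset.order_trans)
  have 1: "loc_dom M p F (fam_pds w ?v1)"
  proof (rule snoc.IH[OF smooth_field_pd[OF snoc.prems(1)] snoc.prems(2)])
    fix w' assume "mset w' \<subseteq># mset w"
    note s = sub[OF this]
    show "loc_dom M \<infinity> F1 (fam_pds w' (fam_pds [i] a))"
      using snoc.prems(3)[OF s(2)] by (simp add: fam_pds_append)
    show "loc_dom M p F2 (fam_pds w' u)" using snoc.prems(4)[OF s(1)] .
  qed
  have 2: "loc_dom M p F (fam_pds w ?v2)"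
  proof (rule snoc.IH[OF snoc.prems(1) smooth_field_pd[OF snoc.prems(2)]])
    fix w' assume "mset w' \<subseteq># mset w"
    note s = sub[OF this]
    show "loc_dom M p F2 (fam_pds w' (fam_pds [i] u))"
      using snoc.prems(4)[OF s(2)] by (simp add: fam_pds_append)
    show "loc_dom M \<infinity> F1 (fam_pds w' a)" using snoc.prems(3)[OF s(1)] .
  qed
  show ?case
  proof (rule loc_dom_cong_imp[OF loc_dom_add[OF p gF 1 2]])
    fix \<epsilon> :: real assume e: "\<epsilon> \<in> {0<..1}"
    show "AE \<omega> in M. \<forall>x. fam_pds (w @ [i]) (\<lambda>\<epsilon> x \<omega>. a \<epsilon> x \<omega> * u \<epsilon> x \<omega>) \<epsilon> x \<omega> =
        fam_pds w ?v1 \<epsilon> x \<omega> + fam_pds w ?v2 \<epsilon> x \<omega>"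
      using smooth_field_at[OF snoc.prems(1) e] smooth_field_at[OF snoc.prems(2) e]
    proof eventually_elim
      case (elim \<omega>)
      then show ?case
        by (simp add: fam_pds_def pd_mult pds_add C_infinity_mult C_infinity_pd)
    qed
  qed
qed

end

lemma loc_dom_pds_add:
  assumes p: "1 \<le> p" and F: "growth_class F" and u: "smooth_field M u" and v: "smooth_field M v"
    and "loc_dom M p F (fam_pds w u)" "loc_dom M p F (fam_pds w v)"
  shows "loc_dom M p F (fam_pds w (\<lambda>\<epsilon> x \<omega>. u \<epsilon> x \<omega> + v \<epsilon> x \<omega>))"
proof (rule loc_dom_cong_imp[OF loc_dom_add[OF p F assms(5,6)]])
  fix \<epsilon> :: real assume e: "\<epsilon> \<in> {0<..1}"
  show "AE \<omega> in M. \<forall>x. fam_pds w (\<lambda>\<epsilon> x \<omega>. u \<epsilon> x \<omega> + v \<epsilon> x \<omega>) \<epsilon> x \<omega> = fam_pds w u \<epsilon> x \<omega> + fam_pds w v \<epsilon> x \<omega>"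
    using smooth_field_at[OF u e] smooth_field_at[OF v e]
    by eventually_elim (simp add: fam_pds_def pds_add)
qed

lemma loc_dom_pds_sum:
  assumes p: "1 \<le> p" and F: "growth_class F" and J: "finite J" and u: "\<And>j. j \<in> J \<Longrightarrow> smooth_field M (u j)"
    and d: "\<And>j. j \<in> J \<Longrightarrow> loc_dom M p F (fam_pds w (u j))"
  shows "loc_dom M p F (fam_pds w (\<lambda>\<epsilon> x \<omega>. \<Sum>j\<in>J. u j \<epsilon> x \<omega>))"
proof (rule loc_dom_cong_imp[OF loc_dom_sum[OF p F J d]])
  fix \<epsilon> :: real assume e: "\<epsilon> \<in> {0<..1}"
  have "AE \<omega> in M. \<forall>j\<in>J. C_infinity (\<lambda>x. u j \<epsilon> x \<omega>)"
    using smooth_field_at[OF u e] J by (intro AE_finite_allI) auto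
  then show "AE \<omega> in M. \<forall>x. fam_pds w (\<lambda>\<epsilon> x \<omega>. \<Sum>j\<in>J. u j \<epsilon> x \<omega>) \<epsilon> x \<omega> = (\<Sum>j\<in>J. fam_pds w (u j) \<epsilon> x \<omega>)"
    by eventually_elim (simp add: fam_pds_def pds_sum)
qed

lemma dom_fam_smooth: "dom_fam M p F u \<Longrightarrow> smooth_field M u"
  by (simp add: dom_fam_def)

lemma dom_fam_cong:
  fixes u v :: "('w, 'd::finite) family"
  assumes v: "dom_fam M p F v" and u: "smooth_field M u"
    and eq: "\<And>\<epsilon>. \<epsilon> \<in> {0<..1} \<Longrightarrow> AE \<omega> in M. \<forall>x. u \<epsilon> x \<omega> = v \<epsilon> x \<omega>"
  shows "dom_fam M p F u"
  unfolding dom_fam_def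
proof (intro conjI allI u)
  fix w
  have "loc_dom M p F (fam_pds w v)" using v by (simp add: dom_fam_def)
  then show "loc_dom M p F (fam_pds w u)"
  proof (rule loc_dom_cong_imp)
    fix \<epsilon> :: real assume "\<epsilon> \<in> {0<..1}"
    from eq[OF this] show "AE \<omega> in M. \<forall>x. fam_pds w u \<epsilon> x \<omega> = fam_pds w v \<epsilon> x \<omega>"
      by eventually_elim (simp add: fam_pds_def)
  qed
qed

lemma dom_fam_const0: "1 \<le> p \<Longrightarrow> growth_class F \<Longrightarrow> dom_fam M p F (\<lambda>\<epsilon> x \<omega>. 0)"
  unfolding dom_fam_def fam_pds_def using loc_dom_zero
  by (auto simp: smooth_field_const pds_const)

lemma dom_fam_add:
  "1 \<le> p \<Longrightarrow> growth_class F \<Longrightarrow> dom_fam M p F u \<Longrightarrow> dom_fam M p F v \<Longrightarrow> dom_fam M p F (\<lambda>\<epsilon> x \<omega>. u \<epsilon> x \<omega> + v \<epsilon> x \<omega>)"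
  unfolding dom_fam_def by (auto intro: smooth_field_add loc_dom_pds_add)

lemma dom_fam_sum:
  "1 \<le> p \<Longrightarrow> growth_class F \<Longrightarrow> finite J \<Longrightarrow> (\<And>j. j \<in> J \<Longrightarrow> dom_fam M p F (u j)) \<Longrightarrow>
    dom_fam M p F (\<lambda>\<epsilon> x \<omega>. \<Sum>j\<in>J. u j \<epsilon> x \<omega>)"
  unfolding dom_fam_def by (auto intro: smooth_field_sum loc_dom_pds_sum)

lemma dom_fam_uminus:
  assumes "1 \<le> p" "growth_class F" "dom_fam M p F u"
  shows "dom_fam M p F (\<lambda>\<epsilon> x \<omega>. - u \<epsilon> x \<omega>)"
  unfolding dom_fam_def
proof (intro conjI allI)
  show "smooth_field M (\<lambda>\<epsilon> x \<omega>. - u \<epsilon> x \<omega>)"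
    using smooth_field_diff[OF smooth_field_const[of M 0] dom_fam_smooth[OF assms(3)]] by simp
  fix w
  have "loc_dom M p F (\<lambda>\<epsilon> x \<omega>. - fam_pds w u \<epsilon> x \<omega>)"
    using assms by (intro loc_dom_uminus) (auto simp: dom_fam_def)
  then show "loc_dom M p F (fam_pds w (\<lambda>\<epsilon> x \<omega>. - u \<epsilon> x \<omega>))"
  proof (rule loc_dom_cong_imp)
    fix \<epsilon> :: real assume e: "\<epsilon> \<in> {0<..1}"
    show "AE \<omega> in M. \<forall>x. fam_pds w (\<lambda>\<epsilon> x \<omega>. - u \<epsilon> x \<omega>) \<epsilon> x \<omega> = - fam_pds w u \<epsilon> x \<omega>"
      using smooth_field_at[OF dom_fam_smooth[OF assms(3)] e]
    proof eventually_elim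
      case (elim \<omega>)
      have "pds w (\<lambda>x. u \<epsilon> x \<omega> + - u \<epsilon> x \<omega>) = (\<lambda>x. pds w (\<lambda>x. u \<epsilon> x \<omega>) x + pds w (\<lambda>x. - u \<epsilon> x \<omega>) x)"
        by (intro pds_add C_infinity_minus elim)
      then have "0 = pds w (\<lambda>x. u \<epsilon> x \<omega>) x + pds w (\<lambda>x. - u \<epsilon> x \<omega>) x" for x
        using pds_const[of w 0] by (simp add: fun_eq_iff)
      then show ?case by (simp add: fam_pds_def eq_neg_iff_add_eq_0 add.commute)
    qed
  qed
qed

lemma dom_fam_diff:
  assumes "1 \<le> p" "growth_class F" "dom_fam M p F u" "dom_fam M p F v"
  shows "dom_fam M p F (\<lambda>\<epsilon> x \<omega>. u \<epsilon> x \<omega> - v \<epsilon> x \<omega>)"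
  using dom_fam_add[OF assms(1-3) dom_fam_uminus[OF assms(1,2,4)]] by simp

lemma (in complete_measure) dom_fam_mult:
  "1 \<le> p \<Longrightarrow> product_class F1 F2 F \<Longrightarrow> dom_fam M \<infinity> F1 a \<Longrightarrow> dom_fam M p F2 u \<Longrightarrow>
    dom_fam M p F (\<lambda>\<epsilon> x \<omega>. a \<epsilon> x \<omega> * u \<epsilon> x \<omega>)"
  unfolding dom_fam_def by (auto intro: smooth_field_mult loc_dom_pds_mult)

lemma (in complete_measure) dom_fam_pds: "dom_fam M p F u \<Longrightarrow> dom_fam M p F (fam_pds w u)"
  unfolding dom_fam_def by (auto simp: smooth_field_pds fam_pds_append[symmetric])

lemma loc_dom_compose:
  fixes v :: "('w, 'd::finite) family" and h :: "real^'e \<Rightarrow> real^'d"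
  assumes v: "loc_dom M p F v" and h: "continuous_on UNIV h"
  shows "loc_dom M p F (\<lambda>\<epsilon> x \<omega>. v \<epsilon> (h x) \<omega>)"
unfolding loc_dom_def
proof (intro allI impI)
  fix K :: "(real^'e) set" assume "compact K"
  then have "compact (h ` K)" using h compact_continuous_image continuous_on_subset by blast
  with v obtain B c where "F c" "dominated_by M p v (h ` K) B c"
    by (rule loc_domE) (rule that)
  then show "\<exists>B c. F c \<and> dominated_by M p (\<lambda>\<epsilon> x \<omega>. v \<epsilon> (h x) \<omega>) K B c"
    by (intro exI[of _ B] exI[of _ c]) (simp add: dominated_by_def)
qed

lemma dom_fam_restrict:
  fixes u :: "('w, 2) family"
  assumes "dom_fam M p F u"
  shows "dom_fam M p F (\<lambda>\<epsilon> (x::real^1) \<omega>. u \<epsilon> (vector [x $ 1, 0]) \<omega>)"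
  unfolding dom_fam_def
proof (intro conjI allI)
  note u = dom_fam_smooth[OF assms]
  show "smooth_field M (\<lambda>\<epsilon> (x::real^1) \<omega>. u \<epsilon> (vector [x $ 1, 0]) \<omega>)"
    unfolding smooth_field_def
  proof
    show "AE \<omega> in M. \<forall>\<epsilon>\<in>{0<..1}. C_infinity (\<lambda>x::real^1. u \<epsilon> (vector [x $ 1, 0]) \<omega>)"
      using smooth_fieldD[OF u] by eventually_elim (auto simp: C_infinity_def intro: Ck_restrict)
  qed (use u in \<open>auto simp: smooth_field_def\<close>)
  fix w :: "1 list"
  let ?h = "\<lambda>x::real^1. vector [x $ 1, 0] :: real^2"
  have h: "continuous_on UNIV ?h" by (intro continuous_on_vector2 continuous_intros)
  have "loc_dom M p F (fam_pds (replicate (length w) 1) u)" using assms by (simp add: dom_fam_def)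
  from loc_dom_compose[OF this h]
  show "loc_dom M p F (fam_pds w (\<lambda>\<epsilon> x \<omega>. u \<epsilon> (?h x) \<omega>))"
  proof (rule loc_dom_cong_imp)
    fix \<epsilon> :: real assume e: "\<epsilon> \<in> {0<..1}"
    show "AE \<omega> in M. \<forall>x. fam_pds w (\<lambda>\<epsilon> x \<omega>. u \<epsilon> (?h x) \<omega>) \<epsilon> x \<omega> = fam_pds (replicate (length w) 1) u \<epsilon> (?h x) \<omega>"
      using smooth_field_at[OF u e]
    proof eventually_elim
      case (elim \<omega>)
      show ?case using pds_restrict[OF elim, of w] by (simp add: fam_pds_def)
    qed
  qed
qed

lemma dom_fam_extend:
  fixes u :: "('w, 1) family"
  assumes p: "1 \<le> p" and F: "growth_class F" and "dom_fam M p F u"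
  shows "dom_fam M p F (\<lambda>\<epsilon> (x::real^2) \<omega>. u \<epsilon> (vector [x $ 1]) \<omega>)"
  unfolding dom_fam_def
proof (intro conjI allI)
  note u = dom_fam_smooth[OF assms(3)]
  show "smooth_field M (\<lambda>\<epsilon> (x::real^2) \<omega>. u \<epsilon> (vector [x $ 1]) \<omega>)"
    unfolding smooth_field_def
  proof
    show "AE \<omega> in M. \<forall>\<epsilon>\<in>{0<..1}. C_infinity (\<lambda>x::real^2. u \<epsilon> (vector [x $ 1]) \<omega>)"
      using smooth_fieldD[OF u] by eventually_elim (auto simp: C_infinity_def intro: Ck_extend)
  qed (use u in \<open>auto simp: smooth_field_def\<close>)
  fix w :: "2 list"
  let ?h = "\<lambda>x::real^2. vector [x $ 1] :: real^1"
  have h: "continuous_on UNIV ?h" by (intro continuous_on_vector1 continuous_intros)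
  have "loc_dom M p F (fam_pds (replicate (length w) 1) u)" using assms by (simp add: dom_fam_def)
  note d = loc_dom_compose[OF this h]
  have "loc_dom M p F (if set w \<subseteq> {1} then (\<lambda>\<epsilon> x \<omega>. fam_pds (replicate (length w) 1) u \<epsilon> (?h x) \<omega>) else (\<lambda>\<epsilon> x \<omega>. 0))"
    using d loc_dom_zero[OF p F] by auto
  then show "loc_dom M p F (fam_pds w (\<lambda>\<epsilon> x \<omega>. u \<epsilon> (?h x) \<omega>))"
  proof (rule loc_dom_cong_imp)
    fix \<epsilon> :: real assume e: "\<epsilon> \<in> {0<..1}"
    show "AE \<omega> in M. \<forall>x. fam_pds w (\<lambda>\<epsilon> x \<omega>. u \<epsilon> (?h x) \<omega>) \<epsilon> x \<omega> =
      (if set w \<subseteq> {1} then (\<lambda>\<epsilon> x \<omega>. fam_pds (replicate (length w) 1) u \<epsilon> (?h x) \<omega>) else (\<lambda>\<epsilon> x \<omega>. 0)) \<epsilon> x \<omega>"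
      using smooth_field_at[OF u e]
    proof eventually_elim
      case (elim \<omega>)
      show ?case using pds_extend[OF elim, of w] by (simp add: fam_pds_def)
    qed
  qed
qed

section \<open>Moderate families are dominated pathwise\<close>

definition set_coord :: "real^'d \<Rightarrow> 'd \<Rightarrow> real \<Rightarrow> real^'d" where
  "set_coord x i s = (\<chi> j. if j = i then s else x $ j)"

lemma set_coord_nth [simp]: "set_coord x i s $ j = (if j = i then s else x $ j)"
  by (simp add: set_coord_def)

lemma set_coord_same [simp]: "set_coord x i (x $ i) = x"
  by (simp add: vec_eq_iff)

lemma set_coord_shift: "set_coord x i (s + r) = set_coord x i s + r *\<^sub>R axis i 1"
  by (simp add: vec_eq_iff axis_def)

lemma continuous_on_set_coord [continuous_intros]:
  fixes a :: "'a::topological_space \<Rightarrow> real^'d" and b :: "'a \<Rightarrow> real"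
  assumes "continuous_on S a" "continuous_on S b"
  shows "continuous_on S (\<lambda>z. set_coord (a z) i (b z))"
proof -
  have "continuous_on S (\<lambda>z. if j = i then b z else a z $ j)" for j
    using assms by (cases "j = i") (auto intro: continuous_intros)
  then show ?thesis unfolding set_coord_def by (rule continuous_on_vec_lambda)
qed

lemma DERIV_set_coord:
  assumes "C_infinity v"
  shows "((\<lambda>s. v (set_coord x i s)) has_field_derivative pd i v (set_coord x i s)) (at s)"
  using C_infinity_DERIV[OF assms, of "set_coord x i 0" i s]
  unfolding set_coord_shift[of x i 0, symmetric] by simp

text \<open>The Sobolev-type bound for the supremum of a smooth function over the faces of the cube
  \<open>[-R, R]\<^sup>d\<close> spanned by the listed coordinates: integrate one mixed derivative over every
  subface.\<close>

fun face_bound :: "real \<Rightarrow> 'd list \<Rightarrow> (real^'d \<Rightarrow> real) \<Rightarrow> real^'d \<Rightarrow> real" where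
  "face_bound R [] v x = \<bar>v x\<bar>"
| "face_bound R (i # is) v x = face_bound R is v (set_coord x i (- R)) +
     oint (- R) R (\<lambda>s. \<bar>face_bound R is (pd i v) (set_coord x i s)\<bar>)"

lemma face_bound_continuous:
  "C_infinity v \<Longrightarrow> continuous_on UNIV (face_bound R is v)"
proof (induction "is" arbitrary: v)
  case Nil
  then show ?case by (simp add: continuous_on_rabs C_infinity_continuous)
next
  case (Cons i "is")
  have c: "continuous_on UNIV (\<lambda>z. face_bound R is w (set_coord (fst z) i (snd z)))" if "C_infinity w" for w
    by (rule continuous_on_compose2[OF Cons.IH[OF that]]) (auto intro!: continuous_intros)
  have "continuous_on UNIV (\<lambda>x. face_bound R is v (set_coord x i (- R)))"
    by (rule continuous_on_compose2[OF Cons.IH[OF Cons.prems]]) (auto intro!: continuous_intros)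
  moreover have "continuous_on UNIV (\<lambda>x. oint (- R) R (\<lambda>s. \<bar>face_bound R is (pd i v) (set_coord x i s)\<bar>))"
    by (rule oint_continuous) (use c[OF C_infinity_pd[OF Cons.prems]] in \<open>auto intro!: continuous_intros\<close>)
  ultimately show ?case by (simp add: continuous_on_add)
qed

lemma face_bound_dominates:
  assumes R: "0 \<le> R"
  shows "C_infinity v \<Longrightarrow> (\<And>j. \<bar>y $ j\<bar> \<le> R) \<Longrightarrow> (\<And>j. j \<notin> set is \<Longrightarrow> y $ j = x $ j) \<Longrightarrow> \<bar>v y\<bar> \<le> face_bound R is v x"
proof (induction "is" arbitrary: v x y)
  case Nil
  then have "y = x" by (simp add: vec_eq_iff)
  then show ?case by simp
next
  case (Cons i "is")
  note v = Cons.prems(1) and dv = C_infinity_pd[OF Cons.prems(1), of i]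
  have c: "continuous_on UNIV (\<lambda>s. w (set_coord y i s))" if "C_infinity w" for w
    by (rule continuous_on_compose2[OF C_infinity_continuous[OF that]]) (auto intro!: continuous_intros)
  have c': "continuous_on UNIV (\<lambda>s. face_bound R is w (set_coord x i s))" if "C_infinity w" for w
    by (rule continuous_on_compose2[OF face_bound_continuous[OF that]]) (auto intro!: continuous_intros)
  have yi: "- R \<le> y $ i" "y $ i \<le> R" using Cons.prems(2)[of i] by auto
  have 1: "\<bar>v (set_coord y i (- R))\<bar> \<le> face_bound R is v (set_coord x i (- R))"
    by (rule Cons.IH[OF v]) (use Cons.prems R in auto)
  have 2: "\<bar>pd i v (set_coord y i s)\<bar> \<le> \<bar>face_bound R is (pd i v) (set_coord x i s)\<bar>" if "s \<in> {-R..R}" for s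
    by (rule order_trans[OF Cons.IH[OF dv] abs_ge_self]) (use Cons.prems that in auto)
  let ?h = "\<lambda>s. \<bar>pd i v (set_coord y i s)\<bar>"
  have h: "continuous_on UNIV ?h" by (intro continuous_intros c dv)
  have "v y - v (set_coord y i (- R)) = oint (- R) (y $ i) (\<lambda>s. pd i v (set_coord y i s))"
    using oint_FTC[OF DERIV_set_coord[OF v], of "- R" "y $ i"] by simp
  then have "\<bar>v y\<bar> \<le> \<bar>v (set_coord y i (- R))\<bar> + \<bar>oint (- R) (y $ i) (\<lambda>s. pd i v (set_coord y i s))\<bar>"
    by linarith
  also have "\<bar>oint (- R) (y $ i) (\<lambda>s. pd i v (set_coord y i s))\<bar> \<le> oint (- R) (y $ i) ?h"
    by (rule oint_abs[OF yi(1) c[OF dv]])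
  also have "\<dots> \<le> oint (- R) R ?h"
    using oint_add[OF h, of "- R" "y $ i" R] oint_nonneg[OF yi(2) h] by simp
  also have "\<dots> \<le> oint (- R) R (\<lambda>s. \<bar>face_bound R is (pd i v) (set_coord x i s)\<bar>)"
    using R 2 by (intro oint_mono h continuous_intros c' dv) auto
  finally show ?case using 1 by simp
qed

lemma (in complete_measure) face_bound_Lp:
  fixes V :: "real^'d \<Rightarrow> 'a \<Rightarrow> real"
  assumes p: "1 \<le> p" and c: "0 \<le> c" and R: "0 \<le> R"
  shows "AE \<omega> in M. C_infinity (\<lambda>x. V x \<omega>) \<Longrightarrow>
    (\<And>w x. (\<lambda>\<omega>. pds w (\<lambda>y. V y \<omega>) x) \<in> borel_measurable M) \<Longrightarrow>
    (\<And>w x. length w \<le> length is \<Longrightarrow> (\<And>j. \<bar>x $ j\<bar> \<le> R) \<Longrightarrow> Lp_norm M p (\<lambda>\<omega>. pds w (\<lambda>y. V y \<omega>) x) \<le> ennreal c) \<Longrightarrow>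
    (\<And>j. \<bar>x $ j\<bar> \<le> R) \<Longrightarrow>
    (\<lambda>\<omega>. face_bound R is (\<lambda>y. V y \<omega>) x) \<in> borel_measurable M \<and>
    Lp_norm M p (\<lambda>\<omega>. face_bound R is (\<lambda>y. V y \<omega>) x) \<le> ennreal ((2 * (1 + 2 * R)) ^ length is * c)"
proof (induction "is" arbitrary: V x)
  case Nil
  have m: "V x \<in> borel_measurable M" using Nil(2)[of "[]" x] by simp
  have "Lp_norm M p (\<lambda>\<omega>. \<bar>V x \<omega>\<bar>) \<le> Lp_norm M p (V x)"
    using m by (intro Lp_norm_mono[OF p]) auto
  also have "\<dots> \<le> ennreal c" using Nil(3)[of "[]" x] Nil(4) by simp
  finally show ?case using m by simp
next
  case (Cons i "is")
  define q where "q = (2 * (1 + 2 * R)) ^ length is * c"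
  have q: "0 \<le> q" using R c by (simp add: q_def)
  let ?A = "\<lambda>\<omega>. face_bound R is (\<lambda>y. V y \<omega>) (set_coord x i (- R))"
  have A: "?A \<in> borel_measurable M \<and> Lp_norm M p ?A \<le> ennreal q"
    unfolding q_def by (rule Cons.IH[OF Cons.prems(1,2)]) (use Cons.prems(3,4) R in auto)
  let ?B = "\<lambda>s \<omega>. face_bound R is (\<lambda>y. pd i (\<lambda>y. V y \<omega>) y) (set_coord x i s)"
  have B: "?B s \<in> borel_measurable M \<and> Lp_norm M p (?B s) \<le> ennreal q" if "s \<in> {-R..R}" for s
    unfolding q_def
  proof (rule Cons.IH)
    show "AE \<omega> in M. C_infinity (\<lambda>x. pd i (\<lambda>y. V y \<omega>) x)"
      using Cons.prems(1) by eventually_elim (simp add: C_infinity_pd)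
    show "(\<lambda>\<omega>. pds w (\<lambda>y. pd i (\<lambda>y. V y \<omega>) y) x) \<in> borel_measurable M" for w x
      using Cons.prems(2)[of "w @ [i]" x] by simp
    show "Lp_norm M p (\<lambda>\<omega>. pds w (\<lambda>y. pd i (\<lambda>y. V y \<omega>) y) x) \<le> ennreal c"
      if "length w \<le> length is" "\<And>j. \<bar>x $ j\<bar> \<le> R" for w x
      using Cons.prems(3)[of "w @ [i]" x] that by simp
    show "\<bar>set_coord x i s $ j\<bar> \<le> R" for j using Cons.prems(4) that by auto
  qed
  let ?J = "\<lambda>\<omega>. oint (- R) R (\<lambda>s. \<bar>?B s \<omega>\<bar>)"
  have cont: "AE \<omega> in M. continuous_on UNIV (\<lambda>s. ?B s \<omega>)"
    using Cons.prems(1)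
  proof eventually_elim
    case (elim \<omega>)
    show ?case
      by (rule continuous_on_compose2[OF face_bound_continuous[OF C_infinity_pd[OF elim]]])
        (auto intro!: continuous_intros)
  qed
  have RR: "- R \<le> R" using R by simp
  have J: "?J \<in> borel_measurable M" "Lp_norm M p ?J \<le> ennreal ((R - - R) * q)"
    using Lp_norm_oint[OF p q RR cont] B by blast+
  have "q \<le> (1 + 2 * R) * q" "(R - - R) * q \<le> (1 + 2 * R) * q"
    using R q by (auto intro: mult_right_mono simp: algebra_simps)
  then have "Lp_norm M p ?A \<le> ennreal ((1 + 2 * R) * q)" "Lp_norm M p ?J \<le> ennreal ((1 + 2 * R) * q)"
    using A J(2) by (meson ennreal_leI order_trans)+
  then have "Lp_norm M p (\<lambda>\<omega>. ?A \<omega> + ?J \<omega>) \<le> ennreal (2 * ((1 + 2 * R) * q))"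
    using A J(1) R q by (intro Lp_norm_add[OF p]) auto
  moreover have "2 * ((1 + 2 * R) * q) = (2 * (1 + 2 * R)) ^ length (i # is) * c"
    by (simp add: q_def)
  moreover have "(\<lambda>\<omega>. ?A \<omega> + ?J \<omega>) \<in> borel_measurable M"
    using A J(1) by (intro borel_measurable_add) auto
  ultimately show ?case unfolding face_bound.simps by metis
qed

theorem (in complete_measure) smooth_Lp_families_eq_dom_fam:
  fixes F :: "(real \<Rightarrow> real) \<Rightarrow> bool"
  assumes p: "1 \<le> p" and F: "growth_class F"
  shows "{u \<in> smooth_Lp_families M p. \<forall>K \<alpha>. compact K \<longrightarrow>
      F (\<lambda>\<epsilon>. enn2real (SUP x\<in>K. Lp_norm M p (fam_mderiv \<alpha> u \<epsilon> x)))} =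
    {u :: ('a, 'd::{finite,linorder}) family. dom_fam M p F u}"
proof (intro set_eqI iffI; (elim CollectE)?; (intro CollectI)?)
  fix u :: "('a, 'd::{finite,linorder}) family"
  assume u: "dom_fam M p F u"
  have md: "fam_mderiv \<alpha> u = fam_pds (index_word \<alpha>) u" for \<alpha>
    by (simp add: fam_mderiv_def fam_pds_def mderiv_eq_pds)
  have meas: "fam_mderiv \<alpha> u \<epsilon> x \<in> borel_measurable M" if "\<epsilon> \<in> {0<..1}" for \<alpha> \<epsilon> x
    unfolding md using smooth_field_measurable[OF smooth_field_pds[OF dom_fam_smooth[OF u]] that] .
  have bound: "\<exists>c. F c \<and> (\<forall>\<epsilon>\<in>{0<..1}. 0 \<le> c \<epsilon> \<and> (SUP x\<in>K. Lp_norm M p (fam_mderiv \<alpha> u \<epsilon> x)) \<le> ennreal (c \<epsilon>))"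
    if K: "compact K" for K :: "(real^('d::{finite,linorder})) set" and \<alpha>
  proof -
    have "loc_dom M p F (fam_mderiv \<alpha> u)" using u by (simp add: md dom_fam_def)
    from this K obtain B c where c: "F c" and B: "dominated_by M p (fam_mderiv \<alpha> u) K B c"
      by (rule loc_domE) (rule that)
    note Bc = dominated_byD[OF B]
    have "(SUP x\<in>K. Lp_norm M p (fam_mderiv \<alpha> u \<epsilon> x)) \<le> ennreal (c \<epsilon>)" if e: "\<epsilon> \<in> {0<..1}" for \<epsilon>
    proof (rule SUP_least)
      fix x assume x: "x \<in> K"
      have "AE \<omega> in M. \<bar>fam_mderiv \<alpha> u \<epsilon> x \<omega>\<bar> \<le> \<bar>B \<epsilon> \<omega>\<bar>"
        using Bc(4)[OF e] by eventually_elim (use x in fastforce)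
      then have "Lp_norm M p (fam_mderiv \<alpha> u \<epsilon> x) \<le> Lp_norm M p (B \<epsilon>)"
        by (intro Lp_norm_mono[OF p] meas e Bc(2))
      also have "\<dots> \<le> ennreal (c \<epsilon>)" by (rule Bc(3)[OF e])
      finally show "Lp_norm M p (fam_mderiv \<alpha> u \<epsilon> x) \<le> ennreal (c \<epsilon>)" .
    qed
    then show ?thesis using c Bc(1) by (intro exI[of _ c]) simp
  qed
  have fin: "(SUP x\<in>K. Lp_norm M p (fam_mderiv \<alpha> u \<epsilon> x)) < \<infinity>"
    if K: "compact K" and e: "\<epsilon> \<in> {0<..1}" for K :: "(real^('d::{finite,linorder})) set" and \<alpha> \<epsilon>
  proof -
    obtain c where "(SUP x\<in>K. Lp_norm M p (fam_mderiv \<alpha> u \<epsilon> x)) \<le> ennreal (c \<epsilon>)"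
      using bound[OF K, of \<alpha>] e by blast
    then show ?thesis by (rule le_less_trans) simp
  qed
  show "u \<in> smooth_Lp_families M p \<and> (\<forall>K \<alpha>. compact K \<longrightarrow>
      F (\<lambda>\<epsilon>. enn2real (SUP x\<in>K. Lp_norm M p (fam_mderiv \<alpha> u \<epsilon> x))))"
    unfolding smooth_Lp_families_def
  proof (intro conjI CollectI allI ballI impI)
    show "AE \<omega> in M. \<forall>\<epsilon>\<in>{0<..1}. C_infinity (\<lambda>x. u \<epsilon> x \<omega>)"
      using dom_fam_smooth[OF u] by (rule smooth_fieldD)
    show "u \<epsilon> x \<in> borel_measurable M" if "\<epsilon> \<in> {0<..1}" for x \<epsilon>
      using dom_fam_smooth[OF u] that by (rule smooth_field_measurable)
    show "fam_mderiv \<alpha> u \<epsilon> x \<in> Lp_space M p" if "\<epsilon> \<in> {0<..1}" for x \<alpha> \<epsilon>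
      using meas[OF that] fin[of "{x}" \<epsilon> \<alpha>] that by (simp add: Lp_space_def)
    show "(SUP x\<in>K. Lp_norm M p (fam_mderiv \<alpha> u \<epsilon> x)) < \<infinity>"
      if "\<epsilon> \<in> {0<..1}" "compact K" for K \<alpha> \<epsilon> by (rule fin[OF that(2,1)])
    fix K :: "(real^('d::{finite,linorder})) set" and \<alpha> assume K: "compact K"
    obtain c where c: "F c" "\<And>\<epsilon>. \<epsilon> \<in> {0<..1} \<Longrightarrow> 0 \<le> c \<epsilon>"
      "\<And>\<epsilon>. \<epsilon> \<in> {0<..1} \<Longrightarrow> (SUP x\<in>K. Lp_norm M p (fam_mderiv \<alpha> u \<epsilon> x)) \<le> ennreal (c \<epsilon>)"
      using bound[OF K, of \<alpha>] by blast
    show "F (\<lambda>\<epsilon>. enn2real (SUP x\<in>K. Lp_norm M p (fam_mderiv \<alpha> u \<epsilon> x)))"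
    proof (rule growth_class_mono[OF F c(1)])
      fix \<epsilon> :: real assume e: "\<epsilon> \<in> {0<..1}"
      show "\<bar>enn2real (SUP x\<in>K. Lp_norm M p (fam_mderiv \<alpha> u \<epsilon> x))\<bar> \<le> \<bar>c \<epsilon>\<bar>"
        using enn2real_mono[OF c(3)[OF e]] c(2)[OF e] by simp
    qed
  qed
next
  fix u :: "('a, 'd::{finite,linorder}) family"
  assume u: "u \<in> smooth_Lp_families M p \<and> (\<forall>K \<alpha>. compact K \<longrightarrow>
      F (\<lambda>\<epsilon>. enn2real (SUP x\<in>K. Lp_norm M p (fam_mderiv \<alpha> u \<epsilon> x))))"
  have sm: "smooth_field M u"
    using u by (simp add: smooth_Lp_families_def smooth_field_def)
  define S where "S K w \<epsilon> = enn2real (SUP x\<in>K. Lp_norm M p (fam_mderiv (count (mset w)) u \<epsilon> x))"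
    for K :: "(real^('d::{finite,linorder})) set" and w \<epsilon>
  have S: "F (S K w)" if "compact K" for K w
  proof -
    have "S K w = (\<lambda>\<epsilon>. enn2real (SUP x\<in>K. Lp_norm M p (fam_mderiv (count (mset w)) u \<epsilon> x)))"
      by (simp add: S_def fun_eq_iff)
    then show ?thesis using u that by simp
  qed
  have le: "Lp_norm M p (fam_pds w u \<epsilon> x) \<le> ennreal (S K w \<epsilon>)"
    if K: "compact K" and x: "x \<in> K" and e: "\<epsilon> \<in> {0<..1}" for K w x \<epsilon>
  proof -
    have "Lp_norm M p (fam_pds w u \<epsilon> x) \<le> Lp_norm M p (fam_mderiv (count (mset w)) u \<epsilon> x)"
    proof (rule Lp_norm_mono[OF p])
      show "fam_pds w u \<epsilon> x \<in> borel_measurable M"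
        by (rule smooth_field_measurable[OF smooth_field_pds[OF sm] e])
      show "fam_mderiv (count (mset w)) u \<epsilon> x \<in> borel_measurable M"
        using u e by (simp add: smooth_Lp_families_def Lp_space_def)
      show "AE \<omega> in M. \<bar>fam_pds w u \<epsilon> x \<omega>\<bar> \<le> \<bar>fam_mderiv (count (mset w)) u \<epsilon> x \<omega>\<bar>"
        using smooth_field_at[OF sm e]
        by eventually_elim (simp add: fam_pds_def fam_mderiv_def pds_eq_mderiv)
    qed
    also have "\<dots> \<le> (SUP x\<in>K. Lp_norm M p (fam_mderiv (count (mset w)) u \<epsilon> x))"
      by (rule SUP_upper[OF x])
    also have "\<dots> = ennreal (S K w \<epsilon>)"
      using u K e by (simp add: S_def smooth_Lp_families_def less_top[symmetric])
    finally show ?thesis .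
  qed
  show "dom_fam M p F u"
    unfolding dom_fam_def
  proof (intro conjI allI sm, unfold loc_dom_def, intro allI impI)
    fix w and K :: "(real^('d::{finite,linorder})) set" assume K: "compact K"
    then obtain R where R: "\<And>x. x \<in> K \<Longrightarrow> norm x \<le> R"
      using compact_imp_bounded bounded_iff by metis
    define Q where "Q = cbox (\<chi> j. - \<bar>R\<bar>) ((\<chi> j. \<bar>R\<bar>) :: real^('d::{finite,linorder}))"
    have Q: "compact Q" "\<And>x. x \<in> Q \<longleftrightarrow> (\<forall>j. \<bar>x $ j\<bar> \<le> \<bar>R\<bar>)"
      by (auto simp: Q_def mem_box_cart abs_le_iff) (smt (verit))+
    define l where "l = sorted_list_of_set (UNIV :: 'd set)"
    define W where "W = {w' :: 'd list. length w' \<le> length l}"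
    have W: "finite W" unfolding W_def using finite_lists_length_le[of "UNIV :: 'd set"] by simp
    define c where "c \<epsilon> = (\<Sum>w'\<in>W. S Q (w' @ w) \<epsilon>)" for \<epsilon>
    define q where "q = (2 * (1 + 2 * \<bar>R\<bar>)) ^ length l"
    have c: "F c" unfolding c_def by (intro growth_class_sum[OF F] S Q)
    have c0: "0 \<le> c \<epsilon>" for \<epsilon> by (simp add: c_def S_def sum_nonneg)
    define B where "B \<epsilon> \<omega> = face_bound \<bar>R\<bar> l (\<lambda>y. fam_pds w u \<epsilon> y \<omega>) 0" for \<epsilon> \<omega>
    have B: "B \<epsilon> \<in> borel_measurable M \<and> Lp_norm M p (B \<epsilon>) \<le> ennreal (q * c \<epsilon>)" if e: "\<epsilon> \<in> {0<..1}" for \<epsilon>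
      unfolding B_def q_def
    proof (rule face_bound_Lp[OF p c0])
      show "AE \<omega> in M. C_infinity (\<lambda>x. fam_pds w u \<epsilon> x \<omega>)"
        by (rule smooth_field_at[OF smooth_field_pds[OF sm] e])
      have eq: "(\<lambda>\<omega>. pds w' (\<lambda>y. fam_pds w u \<epsilon> y \<omega>) x) = fam_pds (w' @ w) u \<epsilon> x" for w' x
        by (simp add: fam_pds_def)
      show "(\<lambda>\<omega>. pds w' (\<lambda>y. fam_pds w u \<epsilon> y \<omega>) x) \<in> borel_measurable M" for w' x
        unfolding eq by (rule smooth_field_measurable[OF smooth_field_pds[OF sm] e])
      fix w' :: "'d list" and x :: "real^('d::{finite,linorder})" assume w': "length w' \<le> length l" and x: "\<And>j. \<bar>x $ j\<bar> \<le> \<bar>R\<bar>"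
      have "Lp_norm M p (fam_pds (w' @ w) u \<epsilon> x) \<le> ennreal (S Q (w' @ w) \<epsilon>)"
        by (rule le[OF Q(1) _ e]) (simp add: Q x)
      also have "S Q (w' @ w) \<epsilon> \<le> c \<epsilon>"
        unfolding c_def using w' W by (intro member_le_sum) (auto simp: W_def S_def)
      finally show "Lp_norm M p (\<lambda>\<omega>. pds w' (\<lambda>y. fam_pds w u \<epsilon> y \<omega>) x) \<le> ennreal (c \<epsilon>)"
        unfolding eq by (simp add: ennreal_leI)
    qed auto
    show "\<exists>B c. F c \<and> dominated_by M p (fam_pds w u) K B c"
      unfolding dominated_by_def
    proof (intro exI[of _ B] exI[of _ "\<lambda>\<epsilon>. q * c \<epsilon>"] conjI ballI)
      show "F (\<lambda>\<epsilon>. q * c \<epsilon>)" by (rule growth_class_cmult[OF F c])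
      fix \<epsilon> :: real assume e: "\<epsilon> \<in> {0<..1}"
      show "0 \<le> q * c \<epsilon>" using c0 by (simp add: q_def)
      show "B \<epsilon> \<in> borel_measurable M" "Lp_norm M p (B \<epsilon>) \<le> ennreal (q * c \<epsilon>)" using B[OF e] by auto
      show "AE \<omega> in M. \<forall>x\<in>K. \<bar>fam_pds w u \<epsilon> x \<omega>\<bar> \<le> B \<epsilon> \<omega>"
        using smooth_field_at[OF smooth_field_pds[OF sm] e, of w]
      proof eventually_elim
        case (elim \<omega>)
        show ?case
        proof
          fix x assume "x \<in> K"
          then have "\<bar>x $ j\<bar> \<le> \<bar>R\<bar>" for j
            using component_le_norm_cart[of x j] R[of x] by linarith
          then show "\<bar>fam_pds w u \<epsilon> x \<omega>\<bar> \<le> B \<epsilon> \<omega>"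
            unfolding B_def by (intro face_bound_dominates elim) (auto simp: l_def)
        qed
      qed
    qed
  qed
qed

lemma (in complete_measure) E_M_iff: "1 \<le> p \<Longrightarrow> u \<in> E_M M p \<longleftrightarrow> dom_fam M p moderate u"
  using smooth_Lp_families_eq_dom_fam[of p moderate] unfolding E_M_def growth_class_def
  by (auto simp: set_eq_iff)

lemma (in complete_measure) N_fam_iff: "1 \<le> p \<Longrightarrow> u \<in> N_fam M p \<longleftrightarrow> dom_fam M p negligible_family u"
  using smooth_Lp_families_eq_dom_fam[of p negligible_family] unfolding N_fam_def growth_class_def
  by (auto simp: set_eq_iff)

section \<open>Operations on classes\<close>

abbreviation gcls :: "'w measure \<Rightarrow> ennreal \<Rightarrow> ('w, 'd::{finite,linorder}) family \<Rightarrow> ('w, 'd) family set" where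
  "gcls M p u \<equiv> G_rel M p `` {u}"

lemma UN_eq_const:
  assumes "x \<in> A" "\<And>a. a \<in> A \<Longrightarrow> f a = c"
  shows "(\<Union>a\<in>A. f a) = c"
proof -
  have "f ` A = {c}" using assms(1) assms(2)[OF assms(1)] by (auto simp: assms(2) intro!: image_eqI[of _ f x])
  then show ?thesis by simp
qed

locale lp_exponent = complete_measure M for M :: "'w measure" +
  fixes p :: ennreal
  assumes p: "1 \<le> p"
begin

lemma growth_moderate: "growth_class moderate" and growth_negligible: "growth_class negligible_family"
  by (auto simp: growth_class_def)

lemma G_rel_iff:
  "(u, v) \<in> G_rel M p \<longleftrightarrow> dom_fam M p moderate u \<and> dom_fam M p moderate v \<and>
    dom_fam M p negligible_family (\<lambda>\<epsilon> x \<omega>. u \<epsilon> x \<omega> - v \<epsilon> x \<omega>)"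
  by (simp add: G_rel_def E_M_iff[OF p] N_fam_iff[OF p])

lemma mem_gcls_iff:
  "v \<in> gcls M p u \<longleftrightarrow> dom_fam M p moderate u \<and> dom_fam M p moderate v \<and>
    dom_fam M p negligible_family (\<lambda>\<epsilon> x \<omega>. u \<epsilon> x \<omega> - v \<epsilon> x \<omega>)"
  by (simp add: G_rel_iff)

lemma equiv_G_rel: "equiv (E_M M p) (G_rel M p)"
proof (rule equivI)
  show "refl_on (E_M M p) (G_rel M p)"
    by (rule refl_onI) (simp add: G_rel_iff E_M_iff[OF p] dom_fam_const0[OF p growth_negligible])
  show "G_rel M p \<subseteq> E_M M p \<times> E_M M p"
    by (auto simp: G_rel_def)
  show "sym (G_rel M p)"
  proof (rule symI)
    fix u v assume "(u, v) \<in> G_rel M p"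
    then show "(v, u) \<in> G_rel M p"
      using dom_fam_uminus[OF p growth_negligible, of M "\<lambda>\<epsilon> x \<omega>. u \<epsilon> x \<omega> - v \<epsilon> x \<omega>"] by (simp add: G_rel_iff)
  qed
  show "trans (G_rel M p)"
  proof (rule transI)
    fix u v w assume "(u, v) \<in> G_rel M p" "(v, w) \<in> G_rel M p"
    then show "(u, w) \<in> G_rel M p"
      using dom_fam_add[OF p growth_negligible, of M "\<lambda>\<epsilon> x \<omega>. u \<epsilon> x \<omega> - v \<epsilon> x \<omega>" "\<lambda>\<epsilon> x \<omega>. v \<epsilon> x \<omega> - w \<epsilon> x \<omega>"]
      by (simp add: G_rel_iff)
  qed
qed

lemma gcls_self: "dom_fam M p moderate u \<Longrightarrow> u \<in> gcls M p u"
  unfolding mem_gcls_iff by (simp add: dom_fam_const0[OF p growth_negligible])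

lemma gcls_eq_iff:
  "dom_fam M p moderate u \<Longrightarrow> dom_fam M p moderate v \<Longrightarrow>
    gcls M p u = gcls M p v \<longleftrightarrow> dom_fam M p negligible_family (\<lambda>\<epsilon> x \<omega>. u \<epsilon> x \<omega> - v \<epsilon> x \<omega>)"
  using equiv_class_eq_iff[OF equiv_G_rel, of u v] by (simp add: G_rel_iff E_M_iff[OF p])

lemma gcls_eqI:
  "dom_fam M p moderate u \<Longrightarrow> dom_fam M p moderate v \<Longrightarrow>
    dom_fam M p negligible_family (\<lambda>\<epsilon> x \<omega>. u \<epsilon> x \<omega> - v \<epsilon> x \<omega>) \<Longrightarrow> gcls M p u = gcls M p v"
  by (simp only: gcls_eq_iff)

lemma mem_gcls_eq: "v \<in> gcls M p u \<Longrightarrow> gcls M p v = gcls M p u"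
  using equiv_class_eq[OF equiv_G_rel] by (metis Image_singleton_iff)

lemma G_space_gcls: "dom_fam M p moderate u \<Longrightarrow> gcls M p u \<in> G_space M p"
  unfolding G_space_def by (rule quotientI) (simp add: E_M_iff[OF p])

lemma G_spaceD:
  assumes "U \<in> G_space M p" "u \<in> U"
  shows "dom_fam M p moderate u" "U = gcls M p u"
proof -
  from assms(1) obtain v where "U = gcls M p v" unfolding G_space_def by (rule quotientE)
  then show "dom_fam M p moderate u" "U = gcls M p u" using assms(2) mem_gcls_iff mem_gcls_eq by blast+
qed

lemma G_space_nonempty:
  assumes "U \<in> G_space M p"
  obtains u where "u \<in> U"
proof -
  from assms obtain v where "U = gcls M p v" "v \<in> E_M M p" unfolding G_space_def by (rule quotientE)
  then show ?thesis using gcls_self[of v] E_M_iff[OF p] that by auto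
qed

lemma G_add_gcls:
  assumes u: "dom_fam M p moderate u" and v: "dom_fam M p moderate v"
  shows "G_add M p (gcls M p u) (gcls M p v) = gcls M p (\<lambda>\<epsilon> x \<omega>. u \<epsilon> x \<omega> + v \<epsilon> x \<omega>)"
proof -
  have eq: "gcls M p (\<lambda>\<epsilon> x \<omega>. u' \<epsilon> x \<omega> + v' \<epsilon> x \<omega>) = gcls M p (\<lambda>\<epsilon> x \<omega>. u \<epsilon> x \<omega> + v \<epsilon> x \<omega>)"
    if "u' \<in> gcls M p u" "v' \<in> gcls M p v" for u' v'
  proof (rule sym, rule gcls_eqI)
    note uv = that[unfolded mem_gcls_iff]
    show "dom_fam M p moderate (\<lambda>\<epsilon> x \<omega>. u \<epsilon> x \<omega> + v \<epsilon> x \<omega>)" "dom_fam M p moderate (\<lambda>\<epsilon> x \<omega>. u' \<epsilon> x \<omega> + v' \<epsilon> x \<omega>)"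
      using uv by (auto intro: dom_fam_add[OF p growth_moderate])
    have "dom_fam M p negligible_family (\<lambda>\<epsilon> x \<omega>. (u \<epsilon> x \<omega> - u' \<epsilon> x \<omega>) + (v \<epsilon> x \<omega> - v' \<epsilon> x \<omega>))"
      using uv by (intro dom_fam_add[OF p growth_negligible]) auto
    then show "dom_fam M p negligible_family (\<lambda>\<epsilon> x \<omega>. u \<epsilon> x \<omega> + v \<epsilon> x \<omega> - (u' \<epsilon> x \<omega> + v' \<epsilon> x \<omega>))"
      by (simp add: algebra_simps)
  qed
  have "(\<Union>v'\<in>gcls M p v. gcls M p (\<lambda>\<epsilon> x \<omega>. u' \<epsilon> x \<omega> + v' \<epsilon> x \<omega>)) = gcls M p (\<lambda>\<epsilon> x \<omega>. u \<epsilon> x \<omega> + v \<epsilon> x \<omega>)"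
    if "u' \<in> gcls M p u" for u'
    by (rule UN_eq_const[OF gcls_self[OF v]]) (rule eq[OF that])
  then show ?thesis
    unfolding G_add_def by (rule UN_eq_const[OF gcls_self[OF u]])
qed

lemma G_sum_gcls:
  fixes u :: "'n::finite \<Rightarrow> ('w, 'd::{finite,linorder}) family"
  assumes u: "\<And>j. dom_fam M p moderate (u j)"
  shows "G_sum M p (\<lambda>j. gcls M p (u j)) = gcls M p (\<lambda>\<epsilon> x \<omega>. \<Sum>j\<in>UNIV. u j \<epsilon> x \<omega>)"
  unfolding G_sum_def
proof (rule UN_eq_const)
  show "u \<in> {v. \<forall>j. v j \<in> gcls M p (u j)}" using gcls_self[OF u] by blast
  fix v assume "v \<in> {v. \<forall>j. v j \<in> gcls M p (u j)}"
  then have v: "\<And>j. v j \<in> gcls M p (u j)" by blast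
  note uv = v[unfolded mem_gcls_iff]
  show "gcls M p (\<lambda>\<epsilon> x \<omega>. \<Sum>j\<in>UNIV. v j \<epsilon> x \<omega>) = gcls M p (\<lambda>\<epsilon> x \<omega>. \<Sum>j\<in>UNIV. u j \<epsilon> x \<omega>)"
  proof (rule sym, rule gcls_eqI)
    show "dom_fam M p moderate (\<lambda>\<epsilon> x \<omega>. \<Sum>j\<in>UNIV. u j \<epsilon> x \<omega>)" "dom_fam M p moderate (\<lambda>\<epsilon> x \<omega>. \<Sum>j\<in>UNIV. v j \<epsilon> x \<omega>)"
      using uv by (auto intro: dom_fam_sum[OF p growth_moderate])
    have "dom_fam M p negligible_family (\<lambda>\<epsilon> x \<omega>. \<Sum>j\<in>UNIV. u j \<epsilon> x \<omega> - v j \<epsilon> x \<omega>)"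
      using uv by (intro dom_fam_sum[OF p growth_negligible]) auto
    then show "dom_fam M p negligible_family (\<lambda>\<epsilon> x \<omega>. (\<Sum>j\<in>UNIV. u j \<epsilon> x \<omega>) - (\<Sum>j\<in>UNIV. v j \<epsilon> x \<omega>))"
      by (simp add: sum_subtractf)
  qed
qed

lemma G_pd_gcls:
  assumes u: "dom_fam M p moderate u"
  shows "G_pd M p i (gcls M p u) = gcls M p (fam_pds [i] u)"
  unfolding G_pd_def fam_pds_singleton[symmetric]
proof (rule UN_eq_const[OF gcls_self[OF u]])
  fix v assume "v \<in> gcls M p u"
  note uv = this[unfolded mem_gcls_iff]
  show "gcls M p (fam_pds [i] v) = gcls M p (fam_pds [i] u)"
  proof (rule sym, rule gcls_eqI)
    show "dom_fam M p moderate (fam_pds [i] u)" "dom_fam M p moderate (fam_pds [i] v)"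
      using uv by (auto intro: dom_fam_pds)
    have "dom_fam M p negligible_family (fam_pds [i] (\<lambda>\<epsilon> x \<omega>. u \<epsilon> x \<omega> - v \<epsilon> x \<omega>))"
      using uv by (auto intro: dom_fam_pds)
    then show "dom_fam M p negligible_family (\<lambda>\<epsilon> x \<omega>. fam_pds [i] u \<epsilon> x \<omega> - fam_pds [i] v \<epsilon> x \<omega>)"
    proof (rule dom_fam_cong)
      show "smooth_field M (\<lambda>\<epsilon> x \<omega>. fam_pds [i] u \<epsilon> x \<omega> - fam_pds [i] v \<epsilon> x \<omega>)"
        using uv by (intro smooth_field_diff smooth_field_pds) (auto dest: dom_fam_smooth)
      fix \<epsilon> :: real assume e: "\<epsilon> \<in> {0<..1}"
      have "smooth_field M u" "smooth_field M v" using uv dom_fam_smooth by blast+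
      from smooth_field_at[OF this(1) e] smooth_field_at[OF this(2) e]
      show "AE \<omega> in M. \<forall>x. fam_pds [i] u \<epsilon> x \<omega> - fam_pds [i] v \<epsilon> x \<omega> =
          fam_pds [i] (\<lambda>\<epsilon> x \<omega>. u \<epsilon> x \<omega> - v \<epsilon> x \<omega>) \<epsilon> x \<omega>"
        by eventually_elim (simp add: fam_pds_singleton pd_diff)
    qed
  qed
qed

lemma G_mult_gcls:
  assumes a: "dom_fam M \<infinity> moderate a" and u: "dom_fam M p moderate u"
  shows "G_mult M p (gcls M \<infinity> a) (gcls M p u) = gcls M p (\<lambda>\<epsilon> x \<omega>. a \<epsilon> x \<omega> * u \<epsilon> x \<omega>)"
proof -
  interpret inf: lp_exponent M \<infinity> by unfold_locales simp
  note mm = product_class_moderate[OF growth_moderate] and mn = product_class_moderate[OF growth_negligible]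
    and nm = product_class_negligible
  have eq: "gcls M p (\<lambda>\<epsilon> x \<omega>. a' \<epsilon> x \<omega> * u' \<epsilon> x \<omega>) = gcls M p (\<lambda>\<epsilon> x \<omega>. a \<epsilon> x \<omega> * u \<epsilon> x \<omega>)"
    if "a' \<in> gcls M \<infinity> a" "u' \<in> gcls M p u" for a' u'
  proof (rule sym, rule gcls_eqI)
    note av = that(1)[unfolded inf.mem_gcls_iff] and uv = that(2)[unfolded mem_gcls_iff]
    show "dom_fam M p moderate (\<lambda>\<epsilon> x \<omega>. a \<epsilon> x \<omega> * u \<epsilon> x \<omega>)" "dom_fam M p moderate (\<lambda>\<epsilon> x \<omega>. a' \<epsilon> x \<omega> * u' \<epsilon> x \<omega>)"
      using uv av by (auto intro: dom_fam_mult[OF p mm])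
    have "dom_fam M p negligible_family (\<lambda>\<epsilon> x \<omega>. (a \<epsilon> x \<omega> - a' \<epsilon> x \<omega>) * u \<epsilon> x \<omega>)"
      using uv av by (intro dom_fam_mult[OF p nm]) auto
    moreover have "dom_fam M p negligible_family (\<lambda>\<epsilon> x \<omega>. a' \<epsilon> x \<omega> * (u \<epsilon> x \<omega> - u' \<epsilon> x \<omega>))"
      using uv av by (intro dom_fam_mult[OF p mn]) auto
    ultimately have "dom_fam M p negligible_family (\<lambda>\<epsilon> x \<omega>. (a \<epsilon> x \<omega> - a' \<epsilon> x \<omega>) * u \<epsilon> x \<omega> + a' \<epsilon> x \<omega> * (u \<epsilon> x \<omega> - u' \<epsilon> x \<omega>))"
      by (rule dom_fam_add[OF p growth_negligible])
    then show "dom_fam M p negligible_family (\<lambda>\<epsilon> x \<omega>. a \<epsilon> x \<omega> * u \<epsilon> x \<omega> - a' \<epsilon> x \<omega> * u' \<epsilon> x \<omega>)"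
      by (simp add: algebra_simps)
  qed
  have "(\<Union>u'\<in>gcls M p u. gcls M p (\<lambda>\<epsilon> x \<omega>. a' \<epsilon> x \<omega> * u' \<epsilon> x \<omega>)) = gcls M p (\<lambda>\<epsilon> x \<omega>. a \<epsilon> x \<omega> * u \<epsilon> x \<omega>)"
    if "a' \<in> gcls M \<infinity> a" for a'
    by (rule UN_eq_const[OF gcls_self[OF u]]) (rule eq[OF that])
  then show ?thesis
    unfolding G_mult_def by (rule UN_eq_const[OF inf.gcls_self[OF a]])
qed

lemma G_restrict0_gcls:
  assumes u: "dom_fam M p moderate u"
  shows "G_restrict0 M p (gcls M p u) = gcls M p (\<lambda>\<epsilon> x \<omega>. u \<epsilon> (vector [x $ 1, 0]) \<omega>)"
  unfolding G_restrict0_def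
proof (rule UN_eq_const[OF gcls_self[OF u]])
  fix v assume "v \<in> gcls M p u"
  note uv = this[unfolded mem_gcls_iff]
  show "gcls M p (\<lambda>\<epsilon> (x::real^1) \<omega>. v \<epsilon> (vector [x $ 1, 0]) \<omega>) = gcls M p (\<lambda>\<epsilon> x \<omega>. u \<epsilon> (vector [x $ 1, 0]) \<omega>)"
  proof -
    have u: "dom_fam M p moderate u" and v: "dom_fam M p moderate v"
      and d: "dom_fam M p negligible_family (\<lambda>\<epsilon> x \<omega>. u \<epsilon> x \<omega> - v \<epsilon> x \<omega>)" using uv by auto
    show ?thesis
      by (rule sym, rule gcls_eqI) (fact dom_fam_restrict[OF u] dom_fam_restrict[OF v] dom_fam_restrict[OF d])+
  qed
qed

lemma G_zero_gcls: "G_zero M p = gcls M p (\<lambda>\<epsilon> x \<omega>. 0)"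
  by (simp add: G_zero_def)

lemma G_diag_gcls:
  "G_diag M p (\<lambda>i. gcls M p (l i)) i j = gcls M p (\<lambda>\<epsilon> x \<omega>. if i = j then l i \<epsilon> x \<omega> else 0)"
  by (simp add: G_diag_def G_zero_gcls)

lemma G_matvec_gcls:
  fixes u :: "'n::finite \<Rightarrow> ('w, 'd::{finite,linorder}) family"
  assumes a: "\<And>i j. dom_fam M \<infinity> moderate (a i j)" and u: "\<And>j. dom_fam M p moderate (u j)"
  shows "G_matvec M p (\<lambda>i j. gcls M \<infinity> (a i j)) (\<lambda>j. gcls M p (u j)) i =
    gcls M p (\<lambda>\<epsilon> x \<omega>. \<Sum>j\<in>UNIV. a i j \<epsilon> x \<omega> * u j \<epsilon> x \<omega>)"
  unfolding G_matvec_def G_mult_gcls[OF a u]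
  by (rule G_sum_gcls) (rule dom_fam_mult[OF p product_class_moderate[OF growth_moderate] a u])

end

section \<open>A priori estimates\<close>

text \<open>At an interior maximum of \<open>exp (-(\<kappa> + 1) t) \<bar>u\<^sub>i(x, t)\<bar>\<close> over the backward cone, the derivative
  along the \<open>i\<close>-th characteristic direction would be negative if the maximum exceeded \<open>G\<close>; so no
  characteristic curves are needed.\<close>

lemma cone_estimate_forward:
  fixes U :: "'n::finite \<Rightarrow> real \<Rightarrow> real \<Rightarrow> real"
  assumes T: "0 \<le> T" and c: "0 \<le> c" and R: "0 \<le> R" and \<kappa>: "0 \<le> \<kappa>" and G: "0 \<le> G"
    and cont: "\<And>i. cont2 (U i)" and init: "\<And>i x. U i x 0 = 0"
    and D: "\<And>i x t. 0 \<le> t \<Longrightarrow> t \<le> T \<Longrightarrow> \<bar>x\<bar> \<le> R + c * (T - t) \<Longrightarrow>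
      ((\<lambda>s. U i (x + l i x t * s) (t + s)) has_field_derivative
        (\<Sum>j\<in>UNIV. f i j x t * U j x t) + g i x t) (at 0)"
    and l: "\<And>i x t. 0 \<le> t \<Longrightarrow> t \<le> T \<Longrightarrow> \<bar>x\<bar> \<le> R + c * (T - t) \<Longrightarrow> \<bar>l i x t\<bar> \<le> c"
    and f: "\<And>i x t. 0 \<le> t \<Longrightarrow> t \<le> T \<Longrightarrow> \<bar>x\<bar> \<le> R + c * (T - t) \<Longrightarrow> (\<Sum>j\<in>UNIV. \<bar>f i j x t\<bar>) \<le> \<kappa>"
    and g: "\<And>i x t. 0 \<le> t \<Longrightarrow> t \<le> T \<Longrightarrow> \<bar>x\<bar> \<le> R + c * (T - t) \<Longrightarrow> \<bar>g i x t\<bar> \<le> G"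
    and xt: "0 \<le> t" "t \<le> T" "\<bar>x\<bar> \<le> R + c * (T - t)"
  shows "\<bar>U i x t\<bar> \<le> exp ((\<kappa> + 1) * t) * G"
proof -
  define S where "S = {z::real \<times> real. 0 \<le> snd z \<and> snd z \<le> T \<and> \<bar>fst z\<bar> \<le> R + c * (T - snd z)}"
  have S: "compact S"
  proof -
    have "closed S" unfolding S_def by (intro closed_Collect_conj closed_Collect_le continuous_intros)
    moreover have "S \<subseteq> cbox (- (R + c * T), 0) (R + c * T, T)"
    proof
      fix z assume z: "z \<in> S"
      then have "c * (T - snd z) \<le> c * T" using c by (intro mult_left_mono) (auto simp: S_def)
      with z show "z \<in> cbox (- (R + c * T), 0) (R + c * T, T)"
        by (cases z) (auto simp: S_def cbox_Pair_eq abs_le_iff)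
    qed
    ultimately show ?thesis by (meson bounded_cbox bounded_subset compact_eq_bounded_closed)
  qed
  have Sne: "S \<noteq> {}" using xt by (auto simp: S_def intro: exI[of _ "(x, t)"])
  define \<phi> where "\<phi> i z = exp (- (\<kappa> + 1) * snd z) * \<bar>U i (fst z) (snd z)\<bar>" for i z
  have \<phi>: "continuous_on S (\<phi> i)" for i
    unfolding \<phi>_def by (intro continuous_intros continuous_on_subset[OF cont]) auto
  have "\<exists>z\<in>S. \<forall>y\<in>S. \<phi> i y \<le> \<phi> i z" for i by (rule continuous_attains_sup[OF S Sne \<phi>])
  then obtain Z where Z: "\<And>i. Z i \<in> S" "\<And>i y. y \<in> S \<Longrightarrow> \<phi> i y \<le> \<phi> i (Z i)" by metis
  define m where "m = Max (range (\<lambda>i. \<phi> i (Z i)))"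
  have m: "\<phi> i (Z i) \<le> m" for i unfolding m_def by (rule Max_ge) auto
  have "m \<in> range (\<lambda>i. \<phi> i (Z i))" unfolding m_def by (rule Max_in) auto
  then obtain k where k: "m = \<phi> k (Z k)" by blast
  have "m \<le> G"
  proof (rule ccontr)
    assume "\<not> m \<le> G"
    then have mG: "G < m" by simp
    define x t where "x = fst (Z k)" and "t = snd (Z k)"
    have xt: "0 \<le> t" "t \<le> T" "\<bar>x\<bar> \<le> R + c * (T - t)" using Z(1)[of k] by (auto simp: S_def x_def t_def)
    have mk: "m = exp (- (\<kappa> + 1) * t) * \<bar>U k x t\<bar>" by (simp add: k \<phi>_def x_def t_def)
    have "t \<noteq> 0" using mk mG G init by auto
    then have t: "0 < t" using xt by simp
    define e where "e = exp (- (\<kappa> + 1) * t)"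
    have e1: "e \<le> 1" unfolding e_def using \<kappa> t by (simp add: mult_nonpos_nonneg)
    define \<sigma> where "\<sigma> = sgn (U k x t)"
    have \<sigma>: "\<sigma> * U k x t = \<bar>U k x t\<bar>" "\<bar>\<sigma>\<bar> \<le> 1" by (auto simp: \<sigma>_def sgn_if)
    define \<psi> where "\<psi> s = exp (- (\<kappa> + 1) * (t + s)) * (\<sigma> * U k (x + l k x t * s) (t + s))" for s
    define h where "h = (\<Sum>j\<in>UNIV. f k j x t * U j x t) + g k x t"
    have "(\<psi> has_field_derivative exp (- (\<kappa> + 1) * (t + 0)) * (\<sigma> * h) +
        exp (- (\<kappa> + 1) * (t + 0)) * (- (\<kappa> + 1)) * (\<sigma> * U k (x + l k x t * 0) (t + 0))) (at 0)"
      unfolding \<psi>_def h_def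
      by (rule DERIV_mult' DERIV_cmult D[OF xt] | rule derivative_eq_intros refl | simp)+
    then have d: "(\<psi> has_field_derivative e * (\<sigma> * h) - (\<kappa> + 1) * m) (at 0)"
      by (simp add: e_def mk \<sigma>(1) algebra_simps)
    have eU: "e * \<bar>U j x t\<bar> \<le> m" for j
    proof -
      have "\<phi> j (Z k) \<le> m" using Z(2)[OF Z(1)] m by (rule order_trans)
      then show ?thesis by (simp add: \<phi>_def e_def x_def t_def)
    qed
    have "e * (\<sigma> * h) \<le> e * \<bar>h\<bar>"
    proof (rule mult_left_mono)
      have "\<sigma> * h \<le> \<bar>\<sigma>\<bar> * \<bar>h\<bar>" by (metis abs_ge_self abs_mult)
      also have "\<dots> \<le> 1 * \<bar>h\<bar>" using \<sigma>(2) by (intro mult_right_mono) auto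
      finally show "\<sigma> * h \<le> \<bar>h\<bar>" by simp
    qed (simp add: e_def)
    also have "\<dots> \<le> e * ((\<Sum>j\<in>UNIV. \<bar>f k j x t\<bar> * \<bar>U j x t\<bar>) + G)"
    proof (rule mult_left_mono)
      have "\<bar>h\<bar> \<le> \<bar>\<Sum>j\<in>UNIV. f k j x t * U j x t\<bar> + \<bar>g k x t\<bar>" unfolding h_def by (rule abs_triangle_ineq)
      also have "\<dots> \<le> (\<Sum>j\<in>UNIV. \<bar>f k j x t\<bar> * \<bar>U j x t\<bar>) + G"
        using g[OF xt, of k] sum_abs[of "\<lambda>j. f k j x t * U j x t" UNIV] by (simp add: abs_mult)
      finally show "\<bar>h\<bar> \<le> (\<Sum>j\<in>UNIV. \<bar>f k j x t\<bar> * \<bar>U j x t\<bar>) + G" .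
    qed (simp add: e_def)
    also have "\<dots> = (\<Sum>j\<in>UNIV. \<bar>f k j x t\<bar> * (e * \<bar>U j x t\<bar>)) + e * G"
      by (simp add: distrib_left sum_distrib_left mult.left_commute)
    also have "\<dots> \<le> (\<Sum>j\<in>UNIV. \<bar>f k j x t\<bar> * m) + 1 * G"
      using eU G e1 by (intro add_mono sum_mono mult_left_mono mult_right_mono) auto
    also have "(\<Sum>j\<in>UNIV. \<bar>f k j x t\<bar> * m) \<le> \<kappa> * m"
      using f[OF xt, of k] mG G by (simp add: sum_distrib_right[symmetric] mult_right_mono)
    finally have neg: "e * (\<sigma> * h) - (\<kappa> + 1) * m < 0" using mG by (simp add: algebra_simps)
    from DERIV_neg_dec_left[OF d neg] obtain d where d: "0 < d" "\<And>h. 0 < h \<Longrightarrow> h < d \<Longrightarrow> \<psi> 0 < \<psi> (0 - h)"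
      by blast
    define h' where "h' = min (d / 2) t"
    have h': "0 < h'" "h' < d" "h' \<le> t" using d(1) t by (auto simp: h'_def)
    have "\<psi> 0 < \<psi> (- h')" using d(2)[OF h'(1,2)] by simp
    have inS: "(x - l k x t * h', t - h') \<in> S"
    proof -
      have "\<bar>l k x t * h'\<bar> \<le> c * h'" using l[OF xt, of k] h' by (simp add: abs_mult mult_right_mono)
      then have "\<bar>x - l k x t * h'\<bar> \<le> R + c * (T - t) + c * h'" using xt(3) by linarith
      then show ?thesis using h' xt by (simp add: S_def algebra_simps)
    qed
    have "\<psi> (- h') \<le> \<phi> k (x - l k x t * h', t - h')"
    proof -
      have "\<sigma> * U k (x - l k x t * h') (t - h') \<le> \<bar>\<sigma>\<bar> * \<bar>U k (x - l k x t * h') (t - h')\<bar>"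
        by (metis abs_ge_self abs_mult)
      also have "\<dots> \<le> 1 * \<bar>U k (x - l k x t * h') (t - h')\<bar>" using \<sigma>(2) by (intro mult_right_mono) auto
      finally show ?thesis by (simp add: \<psi>_def \<phi>_def)
    qed
    also have "\<dots> \<le> m" using Z(2)[OF inS, of k] k by simp
    also have "m = \<psi> 0" by (simp add: \<psi>_def mk \<sigma>(1))
    finally show False using \<open>\<psi> 0 < \<psi> (- h')\<close> by simp
  qed
  moreover have "\<phi> i (x, t) \<le> \<phi> i (Z i)" using Z(2)[of "(x, t)" i] xt by (simp add: S_def)
  ultimately have "exp (- (\<kappa> + 1) * t) * \<bar>U i x t\<bar> \<le> G" using m[of i] by (simp add: \<phi>_def)
  then have "exp ((\<kappa> + 1) * t) * (exp (- (\<kappa> + 1) * t) * \<bar>U i x t\<bar>) \<le> exp ((\<kappa> + 1) * t) * G"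
    by (intro mult_left_mono) auto
  moreover have "exp ((\<kappa> + 1) * t) * exp (- (\<kappa> + 1) * t) = 1"
    by (simp add: exp_add[symmetric] distrib_right[symmetric])
  ultimately show ?thesis by (simp only: mult.assoc[symmetric] mult_1)
qed

lemma DERIV_direction:
  fixes u :: "real^2 \<Rightarrow> real"
  assumes u: "C_infinity u"
  shows "((\<lambda>s. u (vector [x + a * s, t + s])) has_field_derivative
    pd 2 u (vector [x, t]) + a * pd 1 u (vector [x, t])) (at 0)"
proof -
  let ?p = "\<lambda>s. x + a * (s - t)"
  have p: "(?p has_field_derivative a) (at t)" by (auto intro!: derivative_eq_intros)
  have pc: "continuous_on UNIV ?p" by (intro continuous_intros)
  have "((\<lambda>s. u (vector [?p s, s]) - u (vector [x, s])) has_field_derivative pd 1 u (vector [x, t]) * a) (at t)"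
    by (rule DERIV_along_curve[where f = "\<lambda>x s. u (vector [x, s])", OF DERIV_vector1[OF u] _ p pc])
      (auto intro: cont2_vector C_infinity_continuous C_infinity_pd u)
  from DERIV_add[OF this DERIV_vector2[OF u, of x t]]
  have "((\<lambda>s. u (vector [?p s, s])) has_field_derivative pd 1 u (vector [x, t]) * a + pd 2 u (vector [x, t])) (at (0 + t))"
    by simp
  then have "((\<lambda>s. u (vector [?p (s + t), s + t])) has_field_derivative pd 1 u (vector [x, t]) * a + pd 2 u (vector [x, t])) (at 0)"
    by (simp only: DERIV_shift)
  then show ?thesis by (simp add: add.commute mult.commute)
qed

lemma cone_estimate:
  fixes u :: "'n::finite \<Rightarrow> real^2 \<Rightarrow> real"
  assumes T: "0 \<le> T" and c: "0 \<le> c" and R: "0 \<le> R" and \<kappa>: "0 \<le> \<kappa>" and G: "0 \<le> G"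
    and u: "\<And>i. C_infinity (u i)" and init: "\<And>i x. u i (vector [x, 0]) = 0"
    and pde: "\<And>i z. pd 2 (u i) z + l i z * pd 1 (u i) z = (\<Sum>j\<in>UNIV. f i j z * u j z) + g i z"
    and l: "\<And>i z. \<bar>z $ 1\<bar> \<le> R + c * T \<Longrightarrow> \<bar>z $ 2\<bar> \<le> T \<Longrightarrow> \<bar>l i z\<bar> \<le> c"
    and f: "\<And>i z. \<bar>z $ 1\<bar> \<le> R + c * T \<Longrightarrow> \<bar>z $ 2\<bar> \<le> T \<Longrightarrow> (\<Sum>j\<in>UNIV. \<bar>f i j z\<bar>) \<le> \<kappa>"
    and g: "\<And>i z. \<bar>z $ 1\<bar> \<le> R + c * T \<Longrightarrow> \<bar>z $ 2\<bar> \<le> T \<Longrightarrow> \<bar>g i z\<bar> \<le> G"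
    and z: "\<bar>z $ 1\<bar> \<le> R" "\<bar>z $ 2\<bar> \<le> T"
  shows "\<bar>u i z\<bar> \<le> exp ((\<kappa> + 1) * T) * G"
proof -
  have box: "\<bar>x\<bar> \<le> R + c * T" "\<bar>t\<bar> \<le> T" if "0 \<le> t" "t \<le> T" "\<bar>x\<bar> \<le> R + c * (T - t)" for x t
  proof -
    have "c * (T - t) \<le> c * T" using that c by (intro mult_left_mono) auto
    then show "\<bar>x\<bar> \<le> R + c * T" "\<bar>t\<bar> \<le> T" using that by auto
  qed
  have d: "((\<lambda>s. u i (vector [x + l i (vector [x, t]) * s, t + s])) has_field_derivative
        (\<Sum>j\<in>UNIV. f i j (vector [x, t]) * u j (vector [x, t])) + g i (vector [x, t])) (at 0)" for i x t
    using DERIV_direction[OF u[of i], of x "l i (vector [x, t])" t] by (simp add: pde)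
  have c1: "cont2 (\<lambda>x t. u i (vector [x, t]))" for i by (intro cont2_vector C_infinity_continuous u)
  have "\<bar>u i (vector [x, t])\<bar> \<le> exp ((\<kappa> + 1) * t) * G" if "0 \<le> t" "t \<le> T" "\<bar>x\<bar> \<le> R" for x t
  proof (rule cone_estimate_forward[where U = "\<lambda>i x t. u i (vector [x, t])" and l = "\<lambda>i x t. l i (vector [x, t])"
      and f = "\<lambda>i j x t. f i j (vector [x, t])" and g = "\<lambda>i x t. g i (vector [x, t])", OF T c R \<kappa> G c1 init d])
    show "\<bar>x\<bar> \<le> R + c * (T - t)" using that c by (simp add: add_increasing2)
  qed (use that box l f g in auto)
  moreover have "\<bar>u i (vector [x, - t])\<bar> \<le> exp ((\<kappa> + 1) * t) * G" if "0 \<le> t" "t \<le> T" "\<bar>x\<bar> \<le> R" for x t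
  proof (rule cone_estimate_forward[where U = "\<lambda>i x t. u i (vector [x, - t])" and l = "\<lambda>i x t. - l i (vector [x, - t])"
      and f = "\<lambda>i j x t. - f i j (vector [x, - t])" and g = "\<lambda>i x t. - g i (vector [x, - t])", OF T c R \<kappa> G])
    show "\<bar>x\<bar> \<le> R + c * (T - t)" using that c by (simp add: add_increasing2)
    show "cont2 (\<lambda>x t. u i (vector [x, - t]))" for i
      by (rule cont2D[OF c1]) (auto intro!: continuous_intros)
    fix i x t
    have "((\<lambda>s. u i (vector [x + l i (vector [x, - t]) * s, - t + s])) has_field_derivative
        (\<Sum>j\<in>UNIV. f i j (vector [x, - t]) * u j (vector [x, - t])) + g i (vector [x, - t])) (at (- 0))"
      using d[of i x "- t"] by simp
    from this[unfolded DERIV_mirror]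
    show "((\<lambda>s. u i (vector [x + - l i (vector [x, - t]) * s, - (t + s)])) has_field_derivative
        (\<Sum>j\<in>UNIV. - f i j (vector [x, - t]) * u j (vector [x, - t])) + - g i (vector [x, - t])) (at 0)"
      by (simp add: sum_negf)
  qed (use that box l f g init in auto)
  ultimately have "\<bar>u i (vector [z $ 1, \<bar>z $ 2\<bar>])\<bar> \<le> exp ((\<kappa> + 1) * \<bar>z $ 2\<bar>) * G"
    "\<bar>u i (vector [z $ 1, - \<bar>z $ 2\<bar>])\<bar> \<le> exp ((\<kappa> + 1) * \<bar>z $ 2\<bar>) * G"
    using z by simp_all
  then have "\<bar>u i (vector [z $ 1, z $ 2])\<bar> \<le> exp ((\<kappa> + 1) * \<bar>z $ 2\<bar>) * G"
    by (cases "0 \<le> z $ 2") simp_all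
  also have "\<dots> \<le> exp ((\<kappa> + 1) * T) * G"
    using z \<kappa> G by (intro mult_right_mono) (auto intro: mult_left_mono)
  finally show ?thesis by (simp add: vector2_components)
qed

definition log_bounded :: "'w measure \<Rightarrow> ('w, 'd::finite) family \<Rightarrow> bool" where
  "log_bounded M a \<longleftrightarrow> (\<forall>K. compact K \<longrightarrow> (\<exists>\<kappa>. log_growth \<kappa> \<and>
     (\<forall>\<epsilon>\<in>{0<..1}. 0 \<le> \<kappa> \<epsilon> \<and> (AE \<omega> in M. \<forall>x\<in>K. \<bar>a \<epsilon> x \<omega>\<bar> \<le> \<kappa> \<epsilon>))))"

lemma log_boundedE:
  fixes a :: "('w, 'd::finite) family"
  assumes "log_bounded M a" "compact K"
  obtains \<kappa> where "log_growth \<kappa>" "\<And>\<epsilon>. \<epsilon> \<in> {0<..1} \<Longrightarrow> 0 \<le> \<kappa> \<epsilon>"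
    "\<And>\<epsilon>. \<epsilon> \<in> {0<..1} \<Longrightarrow> AE \<omega> in M. \<forall>x\<in>K. \<bar>a \<epsilon> x \<omega>\<bar> \<le> \<kappa> \<epsilon>"
proof -
  from assms(1)[unfolded log_bounded_def] assms(2) obtain \<kappa> where
    "log_growth \<kappa> \<and> (\<forall>\<epsilon>\<in>{0<..1}. 0 \<le> \<kappa> \<epsilon> \<and> (AE \<omega> in M. \<forall>x\<in>K. \<bar>a \<epsilon> x \<omega>\<bar> \<le> \<kappa> \<epsilon>))"
    by (elim allE impE exE)
  then show thesis by (intro that[of \<kappa>]) simp_all
qed

lemma log_bounded_diff:
  fixes a b :: "('w, 'd::finite) family"
  assumes a: "log_bounded M a" and b: "log_bounded M b"
  shows "log_bounded M (\<lambda>\<epsilon> x \<omega>. a \<epsilon> x \<omega> - b \<epsilon> x \<omega>)"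
  unfolding log_bounded_def
proof (intro allI impI)
  fix K :: "(real^'d) set" assume K: "compact K"
  from a K obtain \<kappa> where \<kappa>: "log_growth \<kappa>" "\<And>\<epsilon>. \<epsilon> \<in> {0<..1} \<Longrightarrow> 0 \<le> \<kappa> \<epsilon>"
    "\<And>\<epsilon>. \<epsilon> \<in> {0<..1} \<Longrightarrow> AE \<omega> in M. \<forall>x\<in>K. \<bar>a \<epsilon> x \<omega>\<bar> \<le> \<kappa> \<epsilon>" by (rule log_boundedE) (rule that)
  from b K obtain \<mu> where \<mu>: "log_growth \<mu>" "\<And>\<epsilon>. \<epsilon> \<in> {0<..1} \<Longrightarrow> 0 \<le> \<mu> \<epsilon>"
    "\<And>\<epsilon>. \<epsilon> \<in> {0<..1} \<Longrightarrow> AE \<omega> in M. \<forall>x\<in>K. \<bar>b \<epsilon> x \<omega>\<bar> \<le> \<mu> \<epsilon>" by (rule log_boundedE) (rule that)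
  have "AE \<omega> in M. \<forall>x\<in>K. \<bar>a \<epsilon> x \<omega> - b \<epsilon> x \<omega>\<bar> \<le> \<kappa> \<epsilon> + \<mu> \<epsilon>" if e: "\<epsilon> \<in> {0<..1}" for \<epsilon>
    using \<kappa>(3)[OF e] \<mu>(3)[OF e] by eventually_elim fastforce
  then show "\<exists>\<kappa>. log_growth \<kappa> \<and> (\<forall>\<epsilon>\<in>{0<..1}. 0 \<le> \<kappa> \<epsilon> \<and>
      (AE \<omega> in M. \<forall>x\<in>K. \<bar>a \<epsilon> x \<omega> - b \<epsilon> x \<omega>\<bar> \<le> \<kappa> \<epsilon>))"
    using \<kappa>(1,2) \<mu>(1,2) by (intro exI[of _ "\<lambda>\<epsilon>. \<kappa> \<epsilon> + \<mu> \<epsilon>"]) (simp add: log_growth_add)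
qed

lemma log_bounded_zero: "log_bounded M (\<lambda>\<epsilon> x \<omega>. 0)"
  unfolding log_bounded_def using log_growth_const[of 0] by (auto intro!: exI[of _ "\<lambda>_. 0"])

definition strip_bounded :: "'w measure \<Rightarrow> ('w, 2) family \<Rightarrow> bool" where
  "strip_bounded M l \<longleftrightarrow> (\<forall>T. \<exists>c. \<forall>\<epsilon>\<in>{0<..1}. AE \<omega> in M. \<forall>z. \<bar>z $ 2\<bar> \<le> T \<longrightarrow> \<bar>l \<epsilon> z \<omega>\<bar> \<le> c)"

definition solves_cauchy ::
    "'w measure \<Rightarrow> ('n \<Rightarrow> ('w, 2) family) \<Rightarrow> ('n::finite \<Rightarrow> 'n \<Rightarrow> ('w, 2) family) \<Rightarrow>
      ('n \<Rightarrow> ('w, 2) family) \<Rightarrow> ('n \<Rightarrow> ('w, 2) family) \<Rightarrow> ('n \<Rightarrow> ('w, 2) family) \<Rightarrow> bool" where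
  "solves_cauchy M l f g E u \<longleftrightarrow> (\<forall>\<epsilon>\<in>{0<..1}. AE \<omega> in M.
     (\<forall>i z. fam_pds [2] (u i) \<epsilon> z \<omega> + l i \<epsilon> z \<omega> * fam_pds [1] (u i) \<epsilon> z \<omega> =
       (\<Sum>j\<in>UNIV. f i j \<epsilon> z \<omega> * u j \<epsilon> z \<omega>) + g i \<epsilon> z \<omega>) \<and>
     (\<forall>i x. u i \<epsilon> (vector [x, 0]) \<omega> = E i \<epsilon> (vector [x, 0]) \<omega>))"

abbreviation solves_transport ::
    "'w measure \<Rightarrow> ('n \<Rightarrow> ('w, 2) family) \<Rightarrow> ('n::finite \<Rightarrow> 'n \<Rightarrow> ('w, 2) family) \<Rightarrow>
      ('n \<Rightarrow> ('w, 2) family) \<Rightarrow> ('n \<Rightarrow> ('w, 2) family) \<Rightarrow> bool" where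
  "solves_transport M l f g u \<equiv> solves_cauchy M l f g (\<lambda>_ _ _ _. 0) u"

lemmas solves_cauchyD = bspec[OF solves_cauchy_def[THEN iffD1]]

lemma AE_all_finite: "(\<And>i::'n::finite. AE \<omega> in M. P i \<omega>) \<Longrightarrow> AE \<omega> in M. \<forall>i. P i \<omega>"
proof -
  assume "\<And>i. AE \<omega> in M. P i \<omega>"
  then have "AE \<omega> in M. \<forall>i\<in>UNIV. P i \<omega>" by (intro AE_finite_allI) auto
  then show ?thesis by simp
qed

lemma loc_dom_transport:
  fixes l g u :: "'n::finite \<Rightarrow> ('w, 2) family"
  assumes p: "1 \<le> p" and F: "growth_class F"
    and u: "\<And>i. smooth_field M (u i)" and l: "\<And>i. strip_bounded M (l i)"
    and f: "\<And>i j. log_bounded M (f i j)" and g: "\<And>i. loc_dom M p F (g i)"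
    and s: "solves_transport M l f g u"
  shows "loc_dom M p F (u k)"
proof (rule loc_dom_linear[OF p product_class_moderate[OF F], where J = UNIV and v = g])
  fix K :: "(real^2) set" assume "compact K"
  then obtain R0 where R0: "\<And>x. x \<in> K \<Longrightarrow> norm x \<le> R0"
    using compact_imp_bounded bounded_iff by metis
  define R where "R = \<bar>R0\<bar>"
  have R: "0 \<le> R" and KR: "\<And>x j. x \<in> K \<Longrightarrow> \<bar>x $ j\<bar> \<le> R"
  proof -
    show "\<bar>x $ j\<bar> \<le> R" if "x \<in> K" for x j
      using R0[OF that] component_le_norm_cart[of x j] by (simp add: R_def)
  qed (simp add: R_def)
  define c0 where "c0 i = (SOME c. \<forall>\<epsilon>\<in>{0<..1}. AE \<omega> in M. \<forall>z. \<bar>z $ 2\<bar> \<le> R \<longrightarrow> \<bar>l i \<epsilon> z \<omega>\<bar> \<le> c)" for i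
  have c0: "AE \<omega> in M. \<forall>z. \<bar>z $ 2\<bar> \<le> R \<longrightarrow> \<bar>l i \<epsilon> z \<omega>\<bar> \<le> c0 i" if "\<epsilon> \<in> {0<..1}" for i \<epsilon>
    using someI_ex[OF spec[OF l[unfolded strip_bounded_def], of R]] that unfolding c0_def by (rule bspec)
  define c where "c = (\<Sum>i\<in>UNIV. \<bar>c0 i\<bar>)"
  have c: "0 \<le> c" "\<And>i. c0 i \<le> c"
    using member_le_sum[of _ UNIV "\<lambda>i. \<bar>c0 i\<bar>"] by (auto simp: c_def sum_nonneg intro: order_trans[OF abs_ge_self])
  define Q where "Q = cbox (vector [- (R + c * R), - R]) (vector [R + c * R, R] :: real^2)"
  have Q: "compact Q" "\<And>z. z \<in> Q \<longleftrightarrow> \<bar>z $ 1\<bar> \<le> R + c * R \<and> \<bar>z $ 2\<bar> \<le> R"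
    by (auto simp: Q_def mem_box_cart forall_2 abs_le_iff)
  define \<kappa>0 where "\<kappa>0 i j = (SOME \<kappa>. log_growth \<kappa> \<and>
    (\<forall>\<epsilon>\<in>{0<..1}. 0 \<le> \<kappa> \<epsilon> \<and> (AE \<omega> in M. \<forall>x\<in>Q. \<bar>f i j \<epsilon> x \<omega>\<bar> \<le> \<kappa> \<epsilon>)))" for i j
  have "log_growth (\<kappa>0 i j) \<and> (\<forall>\<epsilon>\<in>{0<..1}. 0 \<le> \<kappa>0 i j \<epsilon> \<and> (AE \<omega> in M. \<forall>x\<in>Q. \<bar>f i j \<epsilon> x \<omega>\<bar> \<le> \<kappa>0 i j \<epsilon>))" for i j
    using someI_ex[OF mp[OF spec[OF f[of i j, unfolded log_bounded_def]] Q(1)]] unfolding \<kappa>0_def by this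
  then have \<kappa>0: "\<And>i j. log_growth (\<kappa>0 i j)"
    "\<And>i j \<epsilon>. \<epsilon> \<in> {0<..1} \<Longrightarrow> 0 \<le> \<kappa>0 i j \<epsilon>"
    "\<And>i j \<epsilon>. \<epsilon> \<in> {0<..1} \<Longrightarrow> AE \<omega> in M. \<forall>x\<in>Q. \<bar>f i j \<epsilon> x \<omega>\<bar> \<le> \<kappa>0 i j \<epsilon>" by simp_all
  define \<kappa> where "\<kappa> \<epsilon> = (\<Sum>i\<in>UNIV. \<Sum>j\<in>UNIV. \<kappa>0 i j \<epsilon>)" for \<epsilon>
  have \<kappa>: "log_growth \<kappa>" unfolding \<kappa>_def by (intro log_growth_sum \<kappa>0)
  have \<kappa>1: "0 \<le> \<kappa> \<epsilon>" "(\<Sum>j\<in>UNIV. \<kappa>0 i j \<epsilon>) \<le> \<kappa> \<epsilon>" if "\<epsilon> \<in> {0<..1}" for i \<epsilon>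
    unfolding \<kappa>_def using \<kappa>0(2)[OF that]
    by (auto intro!: sum_nonneg member_le_sum[of i UNIV "\<lambda>i. \<Sum>j\<in>UNIV. \<kappa>0 i j \<epsilon>"])
  show "\<exists>K' c. compact K' \<and> moderate c \<and> (\<forall>\<epsilon>\<in>{0<..1}. 0 \<le> c \<epsilon> \<and>
      (AE \<omega> in M. \<forall>b\<ge>0. (\<forall>j\<in>UNIV. \<forall>y\<in>K'. \<bar>g j \<epsilon> y \<omega>\<bar> \<le> b) \<longrightarrow> (\<forall>x\<in>K. \<bar>u k \<epsilon> x \<omega>\<bar> \<le> c \<epsilon> * b)))"
  proof (intro exI[of _ Q] exI[of _ "\<lambda>\<epsilon>. exp ((\<kappa> \<epsilon> + 1) * R)"] conjI ballI Q(1))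
    have "moderate (\<lambda>\<epsilon>. exp (R * \<kappa> \<epsilon>) * exp R)"
      using \<kappa> R unfolding log_growth_def by (intro moderate_mult moderate_const) auto
    then show "moderate (\<lambda>\<epsilon>. exp ((\<kappa> \<epsilon> + 1) * R))"
      by (simp add: ring_distribs exp_add mult.commute)
    fix \<epsilon> :: real assume e: "\<epsilon> \<in> {0<..1}"
    show "0 \<le> exp ((\<kappa> \<epsilon> + 1) * R)" by simp
    have 1: "AE \<omega> in M. \<forall>i. C_infinity (\<lambda>x. u i \<epsilon> x \<omega>)" by (intro AE_all_finite smooth_field_at[OF u e])
    have 2: "AE \<omega> in M. \<forall>i z. \<bar>z $ 2\<bar> \<le> R \<longrightarrow> \<bar>l i \<epsilon> z \<omega>\<bar> \<le> c0 i" by (intro AE_all_finite c0 e)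
    have 3: "AE \<omega> in M. \<forall>i j. \<forall>x\<in>Q. \<bar>f i j \<epsilon> x \<omega>\<bar> \<le> \<kappa>0 i j \<epsilon>" by (intro AE_all_finite \<kappa>0 e)
    from 1 2 3 solves_cauchyD[OF s e] show "AE \<omega> in M. \<forall>b\<ge>0. (\<forall>j\<in>UNIV. \<forall>y\<in>Q. \<bar>g j \<epsilon> y \<omega>\<bar> \<le> b) \<longrightarrow>
        (\<forall>x\<in>K. \<bar>u k \<epsilon> x \<omega>\<bar> \<le> exp ((\<kappa> \<epsilon> + 1) * R) * b)"
    proof eventually_elim
      case (elim \<omega>)
      show ?case
      proof (intro allI impI ballI)
        fix b :: real and x :: "real^2" assume b: "0 \<le> b" and gb: "\<forall>j\<in>UNIV. \<forall>y\<in>Q. \<bar>g j \<epsilon> y \<omega>\<bar> \<le> b" and x: "x \<in> K"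
        show "\<bar>u k \<epsilon> x \<omega>\<bar> \<le> exp ((\<kappa> \<epsilon> + 1) * R) * b"
        proof (rule cone_estimate[where u = "\<lambda>i z. u i \<epsilon> z \<omega>" and l = "\<lambda>i z. l i \<epsilon> z \<omega>"
            and f = "\<lambda>i j z. f i j \<epsilon> z \<omega>" and g = "\<lambda>i z. g i \<epsilon> z \<omega>", OF R c(1) R \<kappa>1(1)[OF e] b])
          fix i and z :: "real^2"
          show "pd 2 (\<lambda>z. u i \<epsilon> z \<omega>) z + l i \<epsilon> z \<omega> * pd 1 (\<lambda>z. u i \<epsilon> z \<omega>) z =
            (\<Sum>j\<in>UNIV. f i j \<epsilon> z \<omega> * u j \<epsilon> z \<omega>) + g i \<epsilon> z \<omega>"
            using elim(4) by (simp add: fam_pds_singleton)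
          assume z: "\<bar>z $ 1\<bar> \<le> R + c * R" "\<bar>z $ 2\<bar> \<le> R"
          show "\<bar>l i \<epsilon> z \<omega>\<bar> \<le> c" using elim(2) z(2) c(2)[of i] by (meson order_trans)
          have "(\<Sum>j\<in>UNIV. \<bar>f i j \<epsilon> z \<omega>\<bar>) \<le> (\<Sum>j\<in>UNIV. \<kappa>0 i j \<epsilon>)"
            using elim(3) z by (intro sum_mono) (auto simp: Q)
          then show "(\<Sum>j\<in>UNIV. \<bar>f i j \<epsilon> z \<omega>\<bar>) \<le> \<kappa> \<epsilon>" using \<kappa>1(2)[OF e] by (rule order_trans)
          show "\<bar>g i \<epsilon> z \<omega>\<bar> \<le> b" using gb z by (simp add: Q)
        qed (use elim KR[OF x] in auto)
      qed
    qed
  qed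
qed (use g in auto)

lemma differentiated_system:
  fixes l g u :: "'n::finite \<Rightarrow> real^'d \<Rightarrow> real"
  assumes u: "\<And>i. C_infinity (u i)" and l: "\<And>i. C_infinity (l i)" and f: "\<And>i j. C_infinity (f i j)"
    and g: "\<And>i. C_infinity (g i)"
    and pde: "\<And>i z. pd b (u i) z + l i z * pd a (u i) z = (\<Sum>j\<in>UNIV. f i j z * u j z) + g i z"
  shows "pd b (pd a (u i)) z + l i z * pd a (pd a (u i)) z =
    (\<Sum>j\<in>UNIV. (f i j z - (if i = j then pd a (l i) z else 0)) * pd a (u j) z) +
    ((\<Sum>j\<in>UNIV. pd a (f i j) z * u j z) + pd a (g i) z)"
proof -
  have fu: "C_infinity (\<lambda>z. f i j z * u j z)" for j by (intro C_infinity_mult f u)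
  have "(\<lambda>z. pd b (u i) z + l i z * pd a (u i) z) = (\<lambda>z. (\<Sum>j\<in>UNIV. f i j z * u j z) + g i z)"
    using pde by blast
  then have "pd a (\<lambda>z. pd b (u i) z + l i z * pd a (u i) z) z = pd a (\<lambda>z. (\<Sum>j\<in>UNIV. f i j z * u j z) + g i z) z"
    by simp
  moreover have "pd a (\<lambda>z. pd b (u i) z + l i z * pd a (u i) z) z =
    pd a (pd b (u i)) z + (pd a (l i) z * pd a (u i) z + l i z * pd a (pd a (u i)) z)"
    using pd_add[OF C_infinity_pd[OF u[of i], of b] C_infinity_mult[OF l[of i] C_infinity_pd[OF u[of i], of a]], of a]
      pd_mult[OF l[of i] C_infinity_pd[OF u[of i], of a], of a] by simp
  moreover have "pd a (\<lambda>z. (\<Sum>j\<in>UNIV. f i j z * u j z) + g i z) z =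
    (\<Sum>j\<in>UNIV. pd a (f i j) z * u j z + f i j z * pd a (u j) z) + pd a (g i) z"
  proof -
    have "pd a (\<lambda>z. \<Sum>j\<in>UNIV. f i j z * u j z) = (\<lambda>z. \<Sum>j\<in>UNIV. pd a (\<lambda>z. f i j z * u j z) z)"
      by (rule pd_sum[OF fu])
    then show ?thesis
      using pd_add[OF C_infinity_sum[of UNIV "\<lambda>j z. f i j z * u j z", OF fu] g[of i], of a]
      by (simp add: pd_mult[OF f u])
  qed
  moreover have "pd a (pd b (u i)) = pd b (pd a (u i))" by (rule pd_commute[OF u])
  moreover have "(\<Sum>j\<in>UNIV. (f i j z - (if i = j then pd a (l i) z else 0)) * pd a (u j) z) =
      (\<Sum>j\<in>UNIV. f i j z * pd a (u j) z) - pd a (l i) z * pd a (u i) z"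
    by (simp add: left_diff_distrib sum_subtractf if_distrib[of "\<lambda>y. y * _"] cong: if_cong)
  ultimately show ?thesis by (simp add: sum.distrib)
qed

context lp_exponent
begin

lemma x_derivatives_dominated:
  fixes l :: "'n::finite \<Rightarrow> ('w, 2) family"
  assumes F: "growth_class F"
    and l: "\<And>i. dom_fam M \<infinity> moderate (l i)" "\<And>i. strip_bounded M (l i)" "\<And>i. log_bounded M (fam_pds [1] (l i))"
  shows "(\<And>i j. dom_fam M \<infinity> moderate (f i j)) \<Longrightarrow> (\<And>i j. log_bounded M (f i j)) \<Longrightarrow>
    (\<And>i. smooth_field M (u i)) \<Longrightarrow> (\<And>i. smooth_field M (g i)) \<Longrightarrow> solves_transport M l f g u \<Longrightarrow>
    (\<And>i m. m \<le> k \<Longrightarrow> loc_dom M p F (fam_pds (replicate m 1) (g i))) \<Longrightarrow>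
    m \<le> k \<Longrightarrow> loc_dom M p F (fam_pds (replicate m 1) (u i))"
proof (induction k arbitrary: f g u m i)
  case 0
  have "loc_dom M p F (u i)"
    by (rule loc_dom_transport[OF p F 0(3) l(2) 0(2) _ 0(5)]) (use 0(6)[of 0] in simp)
  then show ?case using 0(7) by simp
next
  case (Suc k)
  note f = Suc.prems(1) and flog = Suc.prems(2) and u = Suc.prems(3) and g = Suc.prems(4)
    and s = Suc.prems(5) and gd = Suc.prems(6)
  have ud: "loc_dom M p F (fam_pds (replicate m 1) (u i))" if "m \<le> k" for m i
    by (rule Suc.IH[OF f flog u g s _ that]) (use gd in auto)
  define d where "d i j = (if i = j then fam_pds [1] (l i) else (\<lambda>\<epsilon> z \<omega>. 0))" for i j
  define f' where "f' i j = (\<lambda>\<epsilon> z \<omega>. f i j \<epsilon> z \<omega> - d i j \<epsilon> z \<omega>)" for i j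
  define g' where "g' i = (\<lambda>\<epsilon> z \<omega>. (\<Sum>j\<in>UNIV. fam_pds [1] (f i j) \<epsilon> z \<omega> * u j \<epsilon> z \<omega>) + fam_pds [1] (g i) \<epsilon> z \<omega>)" for i
  note fs = dom_fam_smooth[OF f] and ls = dom_fam_smooth[OF l(1)]
  have f': "dom_fam M \<infinity> moderate (f' i j)" "log_bounded M (f' i j)" for i j
  proof -
    have d: "dom_fam M \<infinity> moderate (d i j)" "log_bounded M (d i j)"
      using dom_fam_pds[OF l(1)] l(3) log_bounded_zero dom_fam_const0[OF _ growth_moderate, of \<infinity> M]
      by (auto simp: d_def)
    show "dom_fam M \<infinity> moderate (f' i j)" unfolding f'_def
      by (rule dom_fam_diff[OF _ growth_moderate f d(1)]) simp
    show "log_bounded M (f' i j)" unfolding f'_def by (rule log_bounded_diff[OF flog d(2)])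
  qed
  have u': "smooth_field M (fam_pds [1] (u i))" for i by (rule smooth_field_pds[OF u])
  have prod_s: "smooth_field M (\<lambda>\<epsilon> z \<omega>. fam_pds [1] (f i j) \<epsilon> z \<omega> * u j \<epsilon> z \<omega>)" for i j
    by (intro smooth_field_mult smooth_field_pds fs u)
  have sum_s: "smooth_field M (\<lambda>\<epsilon> z \<omega>. \<Sum>j\<in>UNIV. fam_pds [1] (f i j) \<epsilon> z \<omega> * u j \<epsilon> z \<omega>)" for i
    by (intro smooth_field_sum prod_s)
  have g': "smooth_field M (g' i)" for i
    unfolding g'_def by (intro smooth_field_add sum_s smooth_field_pds g)
  have s': "solves_transport M l f' g' (\<lambda>i. fam_pds [1] (u i))"
    unfolding solves_cauchy_def
  proof
    fix \<epsilon> :: real assume e: "\<epsilon> \<in> {0<..1}"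
    have 1: "AE \<omega> in M. \<forall>i. C_infinity (\<lambda>x. u i \<epsilon> x \<omega>)" by (intro AE_all_finite smooth_field_at[OF u e])
    have 2: "AE \<omega> in M. \<forall>i. C_infinity (\<lambda>x. l i \<epsilon> x \<omega>)" by (intro AE_all_finite smooth_field_at[OF ls e])
    have 3: "AE \<omega> in M. \<forall>i j. C_infinity (\<lambda>x. f i j \<epsilon> x \<omega>)" by (intro AE_all_finite smooth_field_at[OF fs e])
    have 4: "AE \<omega> in M. \<forall>i. C_infinity (\<lambda>x. g i \<epsilon> x \<omega>)" by (intro AE_all_finite smooth_field_at[OF g e])
    from 1 2 3 4 solves_cauchyD[OF s e] show "AE \<omega> in M.
     (\<forall>i z. fam_pds [2] (fam_pds [1] (u i)) \<epsilon> z \<omega> + l i \<epsilon> z \<omega> * fam_pds [1] (fam_pds [1] (u i)) \<epsilon> z \<omega> =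
       (\<Sum>j\<in>UNIV. f' i j \<epsilon> z \<omega> * fam_pds [1] (u j) \<epsilon> z \<omega>) + g' i \<epsilon> z \<omega>) \<and>
     (\<forall>i x. fam_pds [1] (u i) \<epsilon> (vector [x, 0]) \<omega> = 0)"
    proof eventually_elim
      case (elim \<omega>)
      show ?case
      proof (intro conjI allI)
        fix i and z :: "real^2"
        have "pd 2 (pd 1 (\<lambda>z. u i \<epsilon> z \<omega>)) z + l i \<epsilon> z \<omega> * pd 1 (pd 1 (\<lambda>z. u i \<epsilon> z \<omega>)) z =
          (\<Sum>j\<in>UNIV. (f i j \<epsilon> z \<omega> - (if i = j then pd 1 (\<lambda>z. l i \<epsilon> z \<omega>) z else 0)) * pd 1 (\<lambda>z. u j \<epsilon> z \<omega>) z) +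
          ((\<Sum>j\<in>UNIV. pd 1 (\<lambda>z. f i j \<epsilon> z \<omega>) z * u j \<epsilon> z \<omega>) + pd 1 (\<lambda>z. g i \<epsilon> z \<omega>) z)"
          by (rule differentiated_system[where u = "\<lambda>i z. u i \<epsilon> z \<omega>" and l = "\<lambda>i z. l i \<epsilon> z \<omega>"
            and f = "\<lambda>i j z. f i j \<epsilon> z \<omega>" and g = "\<lambda>i z. g i \<epsilon> z \<omega>"])
            (use elim in \<open>auto simp: fam_pds_singleton\<close>)
        moreover have "f' i j \<epsilon> z \<omega> = f i j \<epsilon> z \<omega> - (if i = j then pd 1 (\<lambda>z. l i \<epsilon> z \<omega>) z else 0)" for j
          by (simp add: f'_def d_def fam_pds_singleton)
        ultimately show "fam_pds [2] (fam_pds [1] (u i)) \<epsilon> z \<omega> + l i \<epsilon> z \<omega> * fam_pds [1] (fam_pds [1] (u i)) \<epsilon> z \<omega> =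
          (\<Sum>j\<in>UNIV. f' i j \<epsilon> z \<omega> * fam_pds [1] (u j) \<epsilon> z \<omega>) + g' i \<epsilon> z \<omega>"
          by (simp add: g'_def fam_pds_singleton)
      next
        fix i x
        have "((\<lambda>x. u i \<epsilon> (vector [x, 0]) \<omega>) has_field_derivative pd 1 (\<lambda>z. u i \<epsilon> z \<omega>) (vector [x, 0])) (at x)"
          using elim(1) by (intro DERIV_vector1[where f = "\<lambda>z. u i \<epsilon> z \<omega>"]) auto
        moreover have "((\<lambda>x. u i \<epsilon> (vector [x, 0]) \<omega>) has_field_derivative 0) (at x)"
          using elim(5) by simp
        ultimately have "pd 1 (\<lambda>z. u i \<epsilon> z \<omega>) (vector [x, 0]) = 0" by (rule DERIV_unique)
        then show "fam_pds [1] (u i) \<epsilon> (vector [x, 0]) \<omega> = 0" by (simp add: fam_pds_singleton)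
      qed
    qed
  qed
  have gd': "loc_dom M p F (fam_pds (replicate m 1) (g' i))" if m: "m \<le> k" for m i
    unfolding g'_def
  proof (intro loc_dom_pds_add[OF p F sum_s smooth_field_pds[OF g]] loc_dom_pds_sum[OF p F finite prod_s])
    show "loc_dom M p F (fam_pds (replicate m 1) (\<lambda>\<epsilon> z \<omega>. fam_pds [1] (f i j) \<epsilon> z \<omega> * u j \<epsilon> z \<omega>))" for j
    proof (rule loc_dom_pds_mult[OF p product_class_moderate[OF F] smooth_field_pds[OF fs] u])
      fix w' :: "2 list" assume w': "mset w' \<subseteq># mset (replicate m 1)"
      show "loc_dom M \<infinity> moderate (fam_pds w' (fam_pds [1] (f i j)))"
        using dom_fam_pds[OF f, of "[1]" i j] by (simp add: dom_fam_def)
      have "set w' \<subseteq> {1}" using set_mset_mono[OF w'] by (auto split: if_splits)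
      then have "w' = replicate (length w') 1" by (metis replicate_length_same singletonD subsetD)
      moreover have "length w' \<le> m" using size_mset_mono[OF w'] by simp
      ultimately show "loc_dom M p F (fam_pds w' (u j))" using ud[of "length w'" j] m by simp
    qed
    show "loc_dom M p F (fam_pds (replicate m 1) (fam_pds [1] (g i)))"
      using gd[of "Suc m" i] m by (simp add: fam_pds_append[symmetric] replicate_append_same)
  qed
  show ?case
  proof (cases m)
    case 0
    then show ?thesis using ud[of 0 i] by simp
  next
    case (Suc m')
    have "loc_dom M p F (fam_pds (replicate m' 1) (fam_pds [1] (u i)))"
      by (rule Suc.IH[OF f' u' g' s' gd']) (use Suc Suc.prems(7) in auto)
    then show ?thesis using Suc by (simp add: fam_pds_append[symmetric] replicate_append_same)
  qed
qed

theorem dom_fam_transport: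
  fixes l g u :: "'n::finite \<Rightarrow> ('w, 2) family"
  assumes F: "growth_class F"
    and l: "\<And>i. dom_fam M \<infinity> moderate (l i)" "\<And>i. strip_bounded M (l i)" "\<And>i. log_bounded M (fam_pds [1] (l i))"
    and f: "\<And>i j. dom_fam M \<infinity> moderate (f i j)" "\<And>i j. log_bounded M (f i j)"
    and u: "\<And>i. smooth_field M (u i)" and g: "\<And>i. dom_fam M p F (g i)"
    and s: "solves_transport M l f g u"
  shows "dom_fam M p F (u i)"
proof -
  note gs = dom_fam_smooth[OF g] and fs = dom_fam_smooth[OF f(1)] and ls = dom_fam_smooth[OF l(1)]
  note pc = product_class_moderate[OF F]
  have dx: "loc_dom M p F (fam_pds (replicate m 1) (u i))" for m i
    by (rule x_derivatives_dominated[OF F l f u gs s, of m m]) (use g in \<open>auto simp: dom_fam_def\<close>)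
  have "loc_dom M p F (fam_pds w (u i))" if "count (mset w) 2 \<le> m" for w m i
    using that
  proof (induction m arbitrary: w i)
    case 0
    then have "2 \<notin> set w" by (simp add: count_eq_zero_iff)
    then have "w = replicate (length w) 1" by (metis exhaust_2 replicate_length_same)
    then show ?case using dx[of "length w" i] by simp
  next
    case (Suc m)
    show ?case
    proof (cases "2 \<in> set w")
      case False
      then show ?thesis by (intro Suc.IH) (metis count_eq_zero_iff le0 set_mset_mset)
    next
      case True
      define w' where "w' = remove1 2 w"
      have mw: "mset w = mset (w' @ [2])" using True by (simp add: w'_def)
      then have cw': "count (mset w') 2 \<le> m" using Suc.prems by simp
      have sub: "loc_dom M p F (fam_pds w'' (u j))" "loc_dom M p F (fam_pds w'' (fam_pds [1] (u j)))"
        if "mset w'' \<subseteq># mset w'" for w'' j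
      proof -
        have "count (mset w'') 2 \<le> m" using mset_subset_eq_count[OF that, of 2] cw' by simp
        then show "loc_dom M p F (fam_pds w'' (u j))" "loc_dom M p F (fam_pds w'' (fam_pds [1] (u j)))"
          using Suc.IH[of w'' j] Suc.IH[of "w'' @ [1]" j] by (auto simp: fam_pds_append)
      qed
      have fu: "smooth_field M (\<lambda>\<epsilon> z \<omega>. f i j \<epsilon> z \<omega> * u j \<epsilon> z \<omega>)" for j by (intro smooth_field_mult fs u)
      have sfu: "smooth_field M (\<lambda>\<epsilon> z \<omega>. \<Sum>j\<in>UNIV. f i j \<epsilon> z \<omega> * u j \<epsilon> z \<omega>)" by (intro smooth_field_sum fu)
      have nl: "dom_fam M \<infinity> moderate (\<lambda>\<epsilon> z \<omega>. - l i \<epsilon> z \<omega>)" by (intro dom_fam_uminus[OF _ growth_moderate] l) simp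
      have lu: "smooth_field M (\<lambda>\<epsilon> z \<omega>. - l i \<epsilon> z \<omega> * fam_pds [1] (u i) \<epsilon> z \<omega>)"
        by (intro smooth_field_mult dom_fam_smooth[OF nl] smooth_field_pds u)
      let ?r = "\<lambda>\<epsilon> z \<omega>. (\<Sum>j\<in>UNIV. f i j \<epsilon> z \<omega> * u j \<epsilon> z \<omega>) + (g i \<epsilon> z \<omega> + - l i \<epsilon> z \<omega> * fam_pds [1] (u i) \<epsilon> z \<omega>)"
      have "loc_dom M p F (fam_pds w' ?r)"
      proof (intro loc_dom_pds_add[OF p F sfu smooth_field_add[OF gs lu]] loc_dom_pds_add[OF p F gs lu]
          loc_dom_pds_sum[OF p F finite fu])
        show "loc_dom M p F (fam_pds w' (\<lambda>\<epsilon> z \<omega>. f i j \<epsilon> z \<omega> * u j \<epsilon> z \<omega>))" for j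
          by (rule loc_dom_pds_mult[OF p pc fs u]) (use f(1) sub in \<open>auto simp: dom_fam_def\<close>)
        show "loc_dom M p F (fam_pds w' (g i))" using g by (simp add: dom_fam_def)
        show "loc_dom M p F (fam_pds w' (\<lambda>\<epsilon> z \<omega>. - l i \<epsilon> z \<omega> * fam_pds [1] (u i) \<epsilon> z \<omega>))"
          by (rule loc_dom_pds_mult[OF p pc dom_fam_smooth[OF nl] smooth_field_pds[OF u]])
            (use nl sub in \<open>auto simp: dom_fam_def\<close>)
      qed
      then show ?thesis
      proof (rule loc_dom_cong_imp)
        fix \<epsilon> :: real assume e: "\<epsilon> \<in> {0<..1}"
        from smooth_field_at[OF u[of i] e] solves_cauchyD[OF s e] show "AE \<omega> in M. \<forall>x. fam_pds w (u i) \<epsilon> x \<omega> = fam_pds w' ?r \<epsilon> x \<omega>"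
        proof eventually_elim
          case (elim \<omega>)
          have "fam_pds [2] (u i) \<epsilon> z \<omega> = ?r \<epsilon> z \<omega>" for z using elim(2) by (simp add: algebra_simps)
          then have "pd 2 (\<lambda>z. u i \<epsilon> z \<omega>) = (\<lambda>z. ?r \<epsilon> z \<omega>)" by (simp add: fam_pds_singleton fun_eq_iff)
          moreover have "pds w (\<lambda>z. u i \<epsilon> z \<omega>) = pds w' (pd 2 (\<lambda>z. u i \<epsilon> z \<omega>))"
            using pds_permute[OF elim(1) mw] by simp
          ultimately show ?case by (simp add: fam_pds_def)
        qed
      qed
    qed
  qed
  then show ?thesis using u by (auto simp: dom_fam_def)
qed

end

section \<open>Characteristic curves\<close>

abbreviation cont3 :: "(real \<Rightarrow> real \<Rightarrow> real \<Rightarrow> real) \<Rightarrow> bool" where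
  "cont3 f \<equiv> continuous_on UNIV (\<lambda>z. f (fst z) (fst (snd z)) (snd (snd z)))"

lemma cont3D:
  assumes "cont3 f" "continuous_on S a" "continuous_on S b" "continuous_on S c"
  shows "continuous_on S (\<lambda>z. f (a z) (b z) (c z))"
  using continuous_on_compose2[OF assms(1) continuous_on_Pair[OF assms(2) continuous_on_Pair[OF assms(3,4)]]] by simp

lemma continuous_on_geometric_limit:
  fixes w :: "nat \<Rightarrow> 'a::real_normed_vector \<Rightarrow> real" and l :: "'a \<Rightarrow> real"
  assumes w: "\<And>n. continuous_on UNIV (w n)"
    and le: "\<And>N. \<exists>C. \<forall>n z. norm z \<le> N \<longrightarrow> \<bar>l z - w n z\<bar> \<le> C / 2 ^ n"
  shows "continuous_on UNIV l"
proof -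
  have "isCont l z" for z
  proof -
    obtain C where C: "\<And>n y. norm y \<le> norm z + 1 \<Longrightarrow> \<bar>l y - w n y\<bar> \<le> C / 2 ^ n"
      using le[of "norm z + 1"] by blast
    have lim: "(\<lambda>n. C / 2 ^ n) \<longlonglongrightarrow> 0" by real_asymp
    have "uniform_limit (ball 0 (norm z + 1)) w l sequentially"
    proof (rule uniform_limitI)
      fix e :: real assume "e > 0"
      then have "\<forall>\<^sub>F n in sequentially. C / 2 ^ n < e" using lim by (simp add: order_tendstoD)
      then show "\<forall>\<^sub>F n in sequentially. \<forall>y\<in>ball 0 (norm z + 1). dist (w n y) (l y) < e"
      proof eventually_elim
        case (elim n)
        show ?case
        proof
          fix y :: 'a assume "y \<in> ball 0 (norm z + 1)"
          then have "\<bar>l y - w n y\<bar> \<le> C / 2 ^ n" by (intro C) simp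
          then show "dist (w n y) (l y) < e" using elim by (simp add: dist_real_def abs_minus_commute)
        qed
      qed
    qed
    then have "continuous_on (ball 0 (norm z + 1)) l"
      by (rule uniform_limit_theorem[rotated])
        (auto intro!: always_eventually continuous_on_subset[OF w])
    then show ?thesis by (simp add: continuous_on_eq_continuous_at)
  qed
  then show ?thesis by (simp add: continuous_on_eq_continuous_at)
qed

lemma cont2_bounded:
  assumes "cont2 f"
  shows "\<exists>C\<ge>0. \<forall>x t. \<bar>x\<bar> \<le> R \<longrightarrow> \<bar>t\<bar> \<le> T \<longrightarrow> \<bar>f x t\<bar> \<le> C"
proof -
  have "compact ((\<lambda>z. f (fst z) (snd z)) ` ({- R..R} \<times> {- T..T}))"
    using continuous_on_subset[OF assms] by (intro compact_continuous_image compact_Times) auto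
  from compact_imp_bounded[OF this, unfolded bounded_iff]
  obtain C where C: "\<forall>y\<in>(\<lambda>z. f (fst z) (snd z)) ` ({- R..R} \<times> {- T..T}). norm y \<le> C"
    by (elim exE)
  have "\<bar>f x t\<bar> \<le> \<bar>C\<bar>" if "\<bar>x\<bar> \<le> R" "\<bar>t\<bar> \<le> T" for x t
  proof -
    have "f x t \<in> (\<lambda>z. f (fst z) (snd z)) ` ({- R..R} \<times> {- T..T})"
      by (rule image_eqI[of _ _ "(x, t)"]) (use that in auto)
    from bspec[OF C this] show ?thesis by simp
  qed
  then show ?thesis by (intro exI[of _ "\<bar>C\<bar>"]) simp
qed

lemma cont3_bounded:
  assumes "cont3 f"
  shows "\<exists>C\<ge>0. \<forall>s x t. \<bar>s\<bar> \<le> S \<longrightarrow> \<bar>x\<bar> \<le> R \<longrightarrow> \<bar>t\<bar> \<le> T \<longrightarrow> \<bar>f s x t\<bar> \<le> C"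
proof -
  let ?K = "{- S..S} \<times> {- R..R} \<times> {- T..T}"
  have "compact ((\<lambda>z. f (fst z) (fst (snd z)) (snd (snd z))) ` ?K)"
    using continuous_on_subset[OF assms] by (intro compact_continuous_image compact_Times) auto
  from compact_imp_bounded[OF this, unfolded bounded_iff]
  obtain C where C: "\<forall>y\<in>(\<lambda>z. f (fst z) (fst (snd z)) (snd (snd z))) ` ?K. norm y \<le> C"
    by (elim exE)
  have "\<bar>f s x t\<bar> \<le> \<bar>C\<bar>" if "\<bar>s\<bar> \<le> S" "\<bar>x\<bar> \<le> R" "\<bar>t\<bar> \<le> T" for s x t
  proof -
    have "f s x t \<in> (\<lambda>z. f (fst z) (fst (snd z)) (snd (snd z))) ` ?K"
      by (rule image_eqI[of _ _ "(s, x, t)"]) (use that in auto)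
    from bspec[OF C this] show ?thesis by simp
  qed
  then show ?thesis by (intro exI[of _ "\<bar>C\<bar>"]) simp
qed

lemma closed_segment_abs_le:
  fixes a b r :: real
  assumes "r \<in> closed_segment a b" "\<bar>a\<bar> \<le> T" "\<bar>b\<bar> \<le> T"
  shows "\<bar>r\<bar> \<le> T" "\<bar>r - a\<bar> \<le> \<bar>b - a\<bar>"
  using assms by (auto simp: closed_segment_eq_real_ivl split: if_splits)

primrec flow_iter :: "(real \<Rightarrow> real \<Rightarrow> real) \<Rightarrow> nat \<Rightarrow> real \<Rightarrow> real \<Rightarrow> real \<Rightarrow> real" where
  "flow_iter lam 0 s x t = x"
| "flow_iter lam (Suc k) s x t = x + oint t s (\<lambda>r. lam (flow_iter lam k r x t) r)"

definition flow :: "(real \<Rightarrow> real \<Rightarrow> real) \<Rightarrow> real \<Rightarrow> real \<Rightarrow> real \<Rightarrow> real" where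
  "flow lam s x t = lim (\<lambda>k. flow_iter lam k s x t)"

definition flow_deriv :: "(real \<Rightarrow> real \<Rightarrow> real) \<Rightarrow> (real \<Rightarrow> real \<Rightarrow> real) \<Rightarrow> real \<Rightarrow> real \<Rightarrow> real \<Rightarrow> real" where
  "flow_deriv lam lamx s x t = exp (oint t s (\<lambda>r. lamx (flow lam r x t) r))"

locale speed =
  fixes lam lamx :: "real \<Rightarrow> real \<Rightarrow> real"
  assumes lam: "cont2 lam" and lamx: "cont2 lamx"
    and lam_DERIV: "\<And>x t. ((\<lambda>x. lam x t) has_field_derivative lamx x t) (at x)"
    and lam_bounded: "\<And>T. \<exists>c. \<forall>x t. \<bar>t\<bar> \<le> T \<longrightarrow> \<bar>lam x t\<bar> \<le> c"
begin

lemma flow_iter_cont: "cont3 (flow_iter lam k)"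
proof (induction k)
  case 0
  show ?case by (auto intro!: continuous_intros)
next
  case (Suc k)
  have "continuous_on UNIV (\<lambda>z::real \<times> real \<times> real. oint (snd (snd z)) (fst z)
      (\<lambda>r. lam (flow_iter lam k r (fst (snd z)) (snd (snd z))) r))"
    by (rule oint_continuous) (auto intro!: continuous_intros cont2D[OF lam] cont3D[OF Suc])
  then show ?case by (auto intro!: continuous_intros)
qed

lemma lam_flow_iter_cont: "continuous_on UNIV (\<lambda>r. lam (flow_iter lam k r x t) r)"
  by (intro cont2D[OF lam] cont3D[OF flow_iter_cont] continuous_intros)

lemma flow_iter_speed:
  assumes c: "\<And>x t. \<bar>t\<bar> \<le> T \<Longrightarrow> \<bar>lam x t\<bar> \<le> c" and st: "\<bar>s\<bar> \<le> T" "\<bar>t\<bar> \<le> T"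
  shows "\<bar>flow_iter lam k s x t - x\<bar> \<le> c * \<bar>s - t\<bar>"
proof (cases k)
  case 0
  have "0 \<le> c" using c[OF st(1)] abs_ge_zero order_trans by blast
  then show ?thesis using 0 by simp
next
  case (Suc j)
  have "\<bar>oint t s (\<lambda>r. lam (flow_iter lam j r x t) r)\<bar> \<le> c * \<bar>s - t\<bar>"
    by (rule oint_bound[OF lam_flow_iter_cont]) (use closed_segment_abs_le(1)[OF _ st(2,1)] c in blast)
  then show ?thesis using Suc by simp
qed

lemma lam_Lipschitz: "\<exists>L>0. \<forall>x y t. \<bar>x\<bar> \<le> R \<longrightarrow> \<bar>y\<bar> \<le> R \<longrightarrow> \<bar>t\<bar> \<le> T \<longrightarrow> \<bar>lam x t - lam y t\<bar> \<le> L * \<bar>x - y\<bar>"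
proof -
  obtain C where C: "C \<ge> 0" "\<And>x t. \<bar>x\<bar> \<le> R \<Longrightarrow> \<bar>t\<bar> \<le> T \<Longrightarrow> \<bar>lamx x t\<bar> \<le> C"
    using cont2_bounded[OF lamx, of R T] by blast
  have "\<bar>lam x t - lam y t\<bar> \<le> (C + 1) * \<bar>x - y\<bar>" if xyt: "\<bar>x\<bar> \<le> R" "\<bar>y\<bar> \<le> R" "\<bar>t\<bar> \<le> T" for x y t
  proof -
    have "lam x t - lam y t = oint y x (\<lambda>x. lamx x t)"
      by (rule oint_FTC[symmetric, OF lam_DERIV])
    moreover have "\<bar>oint y x (\<lambda>x. lamx x t)\<bar> \<le> C * \<bar>x - y\<bar>"
    proof (rule oint_bound)
      show "continuous_on UNIV (\<lambda>x. lamx x t)" by (intro cont2D[OF lamx] continuous_intros)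
      show "\<bar>lamx r t\<bar> \<le> C" if "r \<in> closed_segment y x" for r
        using C(2)[OF closed_segment_abs_le(1)[OF that xyt(2,1)] xyt(3)] .
    qed
    moreover have "C * \<bar>x - y\<bar> \<le> (C + 1) * \<bar>x - y\<bar>" by (intro mult_right_mono) auto
    ultimately show ?thesis by linarith
  qed
  then show ?thesis using C(1) by (intro exI[of _ "C + 1"]) auto
qed

lemma flow_iter_converges:
  "\<exists>C. \<forall>k s x t. \<bar>s\<bar> \<le> N \<longrightarrow> \<bar>x\<bar> \<le> N \<longrightarrow> \<bar>t\<bar> \<le> N \<longrightarrow>
    (\<lambda>k. flow_iter lam k s x t) \<longlonglongrightarrow> flow lam s x t \<and> \<bar>flow lam s x t - flow_iter lam k s x t\<bar> \<le> C / 2 ^ k"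
proof -
  obtain c0 where c0: "\<And>x t. \<bar>t\<bar> \<le> N \<Longrightarrow> \<bar>lam x t\<bar> \<le> c0" using lam_bounded[of N] by blast
  define c where "c = \<bar>c0\<bar>"
  have c: "0 \<le> c" "\<And>x t. \<bar>t\<bar> \<le> N \<Longrightarrow> \<bar>lam x t\<bar> \<le> c" using order_trans[OF c0 abs_ge_self] by (auto simp: c_def)
  define R where "R = N + c * (2 * N)"
  obtain L where L: "L > 0" "\<And>x y t. \<bar>x\<bar> \<le> R \<Longrightarrow> \<bar>y\<bar> \<le> R \<Longrightarrow> \<bar>t\<bar> \<le> N \<Longrightarrow> \<bar>lam x t - lam y t\<bar> \<le> L * \<bar>x - y\<bar>"
    using lam_Lipschitz[of R N] by blast
  define C where "C = c * (2 * N)"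
  have inR: "\<bar>flow_iter lam k s x t\<bar> \<le> R" if "\<bar>s\<bar> \<le> N" "\<bar>x\<bar> \<le> N" "\<bar>t\<bar> \<le> N" for k s x t
  proof -
    have "c * \<bar>s - t\<bar> \<le> c * (2 * N)" using that c(1) by (intro mult_left_mono) auto
    then show ?thesis using flow_iter_speed[OF c(2) that(1,3), of k x] that(2) by (simp add: R_def)
  qed
  have step: "\<bar>flow_iter lam (Suc k) s x t - flow_iter lam k s x t\<bar> \<le> C / 2 ^ k * exp (2 * L * \<bar>s - t\<bar>)"
    if "\<bar>s\<bar> \<le> N" "\<bar>x\<bar> \<le> N" "\<bar>t\<bar> \<le> N" for k s x t
    using that(1)
  proof (induction k arbitrary: s)
    case 0
    have "\<bar>flow_iter lam 1 s x t - x\<bar> \<le> c * \<bar>s - t\<bar>" by (rule flow_iter_speed[OF c(2) 0 that(3)])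
    also have "\<dots> \<le> C" unfolding C_def using 0 that c(1) by (intro mult_left_mono) auto
    also have "C * 1 \<le> C * exp (2 * L * \<bar>s - t\<bar>)"
      using L(1) 0 c(1) by (intro mult_left_mono) (auto simp: C_def)
    finally show ?case by simp
  next
    case (Suc k)
    have C0: "0 \<le> C" using Suc.prems c(1) by (simp add: C_def)
    have "flow_iter lam (Suc (Suc k)) s x t - flow_iter lam (Suc k) s x t =
        oint t s (\<lambda>r. lam (flow_iter lam (Suc k) r x t) r - lam (flow_iter lam k r x t) r)"
      by (simp add: oint_diff[OF lam_flow_iter_cont lam_flow_iter_cont] del: flow_iter.simps(2) add: flow_iter.simps(2)[of lam "Suc k"] flow_iter.simps(2)[of lam k s])
    also have "\<bar>\<dots>\<bar> \<le> (L * (C / 2 ^ k)) / (2 * L) * exp (2 * L * \<bar>s - t\<bar>)"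
    proof (rule oint_bound_exp)
      show "continuous_on UNIV (\<lambda>r. lam (flow_iter lam (Suc k) r x t) r - lam (flow_iter lam k r x t) r)"
        by (intro continuous_intros lam_flow_iter_cont)
      show "0 \<le> L * (C / 2 ^ k)" "0 < 2 * L" using L(1) C0 by auto
      fix r assume r: "r \<in> closed_segment t s"
      have rN: "\<bar>r\<bar> \<le> N" by (rule closed_segment_abs_le(1)[OF r that(3) Suc.prems])
      have "\<bar>lam (flow_iter lam (Suc k) r x t) r - lam (flow_iter lam k r x t) r\<bar> \<le>
          L * \<bar>flow_iter lam (Suc k) r x t - flow_iter lam k r x t\<bar>"
        by (intro L(2) inR rN that)
      also have "\<dots> \<le> L * (C / 2 ^ k * exp (2 * L * \<bar>r - t\<bar>))"
        using L(1) by (intro mult_left_mono Suc.IH rN) auto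
      finally show "\<bar>lam (flow_iter lam (Suc k) r x t) r - lam (flow_iter lam k r x t) r\<bar> \<le>
          L * (C / 2 ^ k) * exp (2 * L * \<bar>r - t\<bar>)" by (simp add: mult.assoc)
    qed
    also have "\<dots> = C / 2 ^ Suc k * exp (2 * L * \<bar>s - t\<bar>)" using L(1) by simp
    finally show ?case .
  qed
  define D where "D = C * exp (2 * L * (2 * N))"
  have main: "(\<lambda>k. flow_iter lam k s x t) \<longlonglongrightarrow> flow lam s x t \<and>
      (\<forall>k. \<bar>flow lam s x t - flow_iter lam k s x t\<bar> \<le> 2 * D / 2 ^ k)"
    if st: "\<bar>s\<bar> \<le> N" "\<bar>x\<bar> \<le> N" "\<bar>t\<bar> \<le> N" for s x t
  proof -
    have "\<bar>flow_iter lam (Suc k) s x t - flow_iter lam k s x t\<bar> \<le> D / 2 ^ k" for k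
    proof -
      have "C / 2 ^ k * exp (2 * L * \<bar>s - t\<bar>) \<le> C / 2 ^ k * exp (2 * L * (2 * N))"
        using st L(1) c(1) by (intro mult_left_mono) (auto simp: C_def)
      then show ?thesis using step[OF st, of k] by (simp add: D_def)
    qed
    from geometric_Cauchy[OF this] obtain l where l: "(\<lambda>k. flow_iter lam k s x t) \<longlonglongrightarrow> l"
      "\<forall>k. \<bar>l - flow_iter lam k s x t\<bar> \<le> 2 * D / 2 ^ k" by blast
    then show ?thesis unfolding flow_def using limI[OF l(1)] by simp
  qed
  show ?thesis
    by (intro exI[of _ "2 * D"] allI impI conjI main[THEN conjunct1] main[THEN conjunct2, THEN spec])
qed

lemma flow_approx:
  obtains C where "\<And>k s x t. \<bar>s\<bar> \<le> N \<Longrightarrow> \<bar>x\<bar> \<le> N \<Longrightarrow> \<bar>t\<bar> \<le> N \<Longrightarrow>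
    \<bar>flow lam s x t - flow_iter lam k s x t\<bar> \<le> C / 2 ^ k"
proof -
  from flow_iter_converges[of N] obtain C where
    "\<forall>k s x t. \<bar>s\<bar> \<le> N \<longrightarrow> \<bar>x\<bar> \<le> N \<longrightarrow> \<bar>t\<bar> \<le> N \<longrightarrow>
    (\<lambda>k. flow_iter lam k s x t) \<longlonglongrightarrow> flow lam s x t \<and> \<bar>flow lam s x t - flow_iter lam k s x t\<bar> \<le> C / 2 ^ k"
    by (elim exE)
  then show thesis by (intro that[of C]) simp
qed

lemma flow_LIMSEQ: "(\<lambda>k. flow_iter lam k s x t) \<longlonglongrightarrow> flow lam s x t"
proof -
  let ?N = "max \<bar>s\<bar> (max \<bar>x\<bar> \<bar>t\<bar>)"
  from flow_iter_converges[of ?N] obtain C where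
    "\<forall>k s x t. \<bar>s\<bar> \<le> ?N \<longrightarrow> \<bar>x\<bar> \<le> ?N \<longrightarrow> \<bar>t\<bar> \<le> ?N \<longrightarrow>
    (\<lambda>k. flow_iter lam k s x t) \<longlonglongrightarrow> flow lam s x t \<and> \<bar>flow lam s x t - flow_iter lam k s x t\<bar> \<le> C / 2 ^ k"
    by (elim exE)
  from this[rule_format, of s x t] show ?thesis by simp
qed

lemma flow_cont: "cont3 (flow lam)"
proof (rule continuous_on_geometric_limit[OF flow_iter_cont])
  fix N
  obtain C where C: "\<And>k s x t. \<bar>s\<bar> \<le> N \<Longrightarrow> \<bar>x\<bar> \<le> N \<Longrightarrow> \<bar>t\<bar> \<le> N \<Longrightarrow>
      \<bar>flow lam s x t - flow_iter lam k s x t\<bar> \<le> C / 2 ^ k"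
    by (rule flow_approx[of N]) (rule that)
  have "\<bar>fst z\<bar> \<le> N" "\<bar>fst (snd z)\<bar> \<le> N" "\<bar>snd (snd z)\<bar> \<le> N" if "norm z \<le> N" for z :: "real \<times> real \<times> real"
    using norm_fst_le[of "fst z" "snd z"] norm_snd_le[of "snd z" "fst z"] norm_fst_le[of "fst (snd z)" "snd (snd z)"]
      norm_snd_le[of "snd (snd z)" "fst (snd z)"] that by simp_all
  then show "\<exists>C. \<forall>n (z::real \<times> real \<times> real). norm z \<le> N \<longrightarrow>
     \<bar>flow lam (fst z) (fst (snd z)) (snd (snd z)) - flow_iter lam n (fst z) (fst (snd z)) (snd (snd z))\<bar> \<le> C / 2 ^ n"
    using C by (intro exI[of _ C]) blast
qed

lemma flow_speed: "\<exists>c\<ge>0. \<forall>s x t. \<bar>s\<bar> \<le> T \<longrightarrow> \<bar>t\<bar> \<le> T \<longrightarrow> \<bar>flow lam s x t - x\<bar> \<le> c * \<bar>s - t\<bar>"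
proof -
  obtain c where c: "\<And>x t. \<bar>t\<bar> \<le> T \<Longrightarrow> \<bar>lam x t\<bar> \<le> c" using lam_bounded[of T] by blast
  have "\<bar>flow lam s x t - x\<bar> \<le> \<bar>c\<bar> * \<bar>s - t\<bar>" if st: "\<bar>s\<bar> \<le> T" "\<bar>t\<bar> \<le> T" for s x t
  proof (rule LIMSEQ_le_const2)
    show "(\<lambda>k. \<bar>flow_iter lam k s x t - x\<bar>) \<longlonglongrightarrow> \<bar>flow lam s x t - x\<bar>"
      by (intro tendsto_intros flow_LIMSEQ)
    have "c * \<bar>s - t\<bar> \<le> \<bar>c\<bar> * \<bar>s - t\<bar>" by (intro mult_right_mono) auto
    then show "\<exists>N. \<forall>n\<ge>N. \<bar>flow_iter lam n s x t - x\<bar> \<le> \<bar>c\<bar> * \<bar>s - t\<bar>"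
      using flow_iter_speed[OF c st, of _ x] by (meson order_trans)
  qed
  then show ?thesis by (intro exI[of _ "\<bar>c\<bar>"]) simp
qed

lemma lam_flow_cont: "continuous_on UNIV (\<lambda>r. lam (flow lam r x t) r)"
  by (intro cont2D[OF lam] cont3D[OF flow_cont] continuous_intros)

lemma flow_integral: "flow lam s x t = x + oint t s (\<lambda>r. lam (flow lam r x t) r)"
proof -
  define N where "N = max \<bar>s\<bar> (max \<bar>x\<bar> \<bar>t\<bar>)"
  obtain C where C': "\<And>k s x t. \<bar>s\<bar> \<le> N \<Longrightarrow> \<bar>x\<bar> \<le> N \<Longrightarrow> \<bar>t\<bar> \<le> N \<Longrightarrow>
      \<bar>flow lam s x t - flow_iter lam k s x t\<bar> \<le> C / 2 ^ k"
    by (rule flow_approx[of N]) (rule that)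
  have xtN: "\<bar>s\<bar> \<le> N" "\<bar>x\<bar> \<le> N" "\<bar>t\<bar> \<le> N" by (auto simp: N_def)
  have C: "\<bar>flow lam r x t - flow_iter lam k r x t\<bar> \<le> C / 2 ^ k" if "\<bar>r\<bar> \<le> N" for k r
    by (rule C'[OF that xtN(2,3)])
  have "0 \<le> C / 2 ^ 0" by (rule order_trans[OF abs_ge_zero C[OF xtN(1)]])
  then have C0: "0 \<le> C" by simp
  from cont3_bounded[OF flow_cont, of N N N] obtain B where
    "B \<ge> 0 \<and> (\<forall>s x t. \<bar>s\<bar> \<le> N \<longrightarrow> \<bar>x\<bar> \<le> N \<longrightarrow> \<bar>t\<bar> \<le> N \<longrightarrow> \<bar>flow lam s x t\<bar> \<le> B)" by (elim exE)
  then have B: "\<And>r. \<bar>r\<bar> \<le> N \<Longrightarrow> \<bar>flow lam r x t\<bar> \<le> B" using xtN(2,3) by simp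
  obtain L where L: "L > 0" "\<And>y z r. \<bar>y\<bar> \<le> B + C \<Longrightarrow> \<bar>z\<bar> \<le> B + C \<Longrightarrow> \<bar>r\<bar> \<le> N \<Longrightarrow> \<bar>lam y r - lam z r\<bar> \<le> L * \<bar>y - z\<bar>"
    using lam_Lipschitz[of "B + C" N] by blast
  have le: "\<bar>(flow_iter lam (Suc k) s x t - x) - oint t s (\<lambda>r. lam (flow lam r x t) r)\<bar> \<le> (L * (C / 2 ^ k)) * \<bar>s - t\<bar>" for k
  proof -
    have "(flow_iter lam (Suc k) s x t - x) - oint t s (\<lambda>r. lam (flow lam r x t) r) =
        oint t s (\<lambda>r. lam (flow_iter lam k r x t) r - lam (flow lam r x t) r)"
      by (simp add: oint_diff[OF lam_flow_iter_cont lam_flow_cont])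
    also have "\<bar>\<dots>\<bar> \<le> (L * (C / 2 ^ k)) * \<bar>s - t\<bar>"
    proof (rule oint_bound)
      show "continuous_on UNIV (\<lambda>r. lam (flow_iter lam k r x t) r - lam (flow lam r x t) r)"
        by (intro continuous_intros lam_flow_iter_cont lam_flow_cont)
      fix r assume r: "r \<in> closed_segment t s"
      have rN: "\<bar>r\<bar> \<le> N" by (rule closed_segment_abs_le(1)[OF r]) (auto simp: N_def)
      have "C / 2 ^ k \<le> C" using C0 by (simp add: divide_le_eq mult_le_cancel_left1)
      then have "\<bar>lam (flow_iter lam k r x t) r - lam (flow lam r x t) r\<bar> \<le> L * \<bar>flow_iter lam k r x t - flow lam r x t\<bar>"
        using C[OF rN, of k] B[OF rN] C0 by (intro L(2) rN) linarith+
      also have "\<dots> \<le> L * (C / 2 ^ k)" using C[OF rN, of k] L(1) by (intro mult_left_mono) (auto simp: abs_minus_commute)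
      finally show "\<bar>lam (flow_iter lam k r x t) r - lam (flow lam r x t) r\<bar> \<le> L * (C / 2 ^ k)" .
    qed
    finally show ?thesis .
  qed
  have "(\<lambda>k. (flow_iter lam (Suc k) s x t - x) - oint t s (\<lambda>r. lam (flow lam r x t) r)) \<longlonglongrightarrow>
      (flow lam s x t - x) - oint t s (\<lambda>r. lam (flow lam r x t) r)"
    by (intro tendsto_intros LIMSEQ_Suc flow_LIMSEQ)
  moreover have "(\<lambda>k. (flow_iter lam (Suc k) s x t - x) - oint t s (\<lambda>r. lam (flow lam r x t) r)) \<longlonglongrightarrow> 0"
  proof (rule tendsto_rabs_zero_cancel, rule tendsto_sandwich[OF _ _ tendsto_const])
    show "\<forall>\<^sub>F n in sequentially. \<bar>(flow_iter lam (Suc n) s x t - x) - oint t s (\<lambda>r. lam (flow lam r x t) r)\<bar> \<le> (L * (C / 2 ^ n)) * \<bar>s - t\<bar>"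
      by (intro always_eventually allI le)
    show "(\<lambda>n. (L * (C / 2 ^ n)) * \<bar>s - t\<bar>) \<longlonglongrightarrow> 0" by real_asymp
  qed simp
  ultimately show ?thesis using LIMSEQ_unique by fastforce
qed

lemma flow_same [simp]: "flow lam t x t = x"
  using flow_integral[of t x t] by simp

lemma flow_DERIV: "((\<lambda>s. flow lam s x t) has_field_derivative lam (flow lam s x t) s) (at s)"
proof -
  have "((\<lambda>s. x + oint t s (\<lambda>r. lam (flow lam r x t) r)) has_field_derivative lam (flow lam s x t) s) (at s)"
    using DERIV_add[OF DERIV_const oint_deriv[OF lam_flow_cont]] by simp
  moreover have "(\<lambda>s. flow lam s x t) = (\<lambda>s. x + oint t s (\<lambda>r. lam (flow lam r x t) r))"
    by (rule ext) (rule flow_integral)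
  ultimately show ?thesis by (simp only:)
qed

lemma solution_diff:
  assumes y: "\<And>s. (y has_field_derivative lam (y s) s) (at s)" and z: "\<And>s. (z has_field_derivative lam (z s) s) (at s)"
  shows "y s - z s = (y t - z t) * exp (oint t s (\<lambda>r. divdiff lamx (y r) (z r) r))"
proof -
  have yc: "continuous_on UNIV y" and zc: "continuous_on UNIV z"
    by (intro continuous_at_imp_continuous_on ballI DERIV_isCont[OF y] DERIV_isCont[OF z])+
  let ?d = "\<lambda>r. divdiff lamx (y r) (z r) r"
  have d: "continuous_on UNIV ?d" by (intro divdiff_continuous lamx yc zc continuous_intros)
  define E where "E s = (y s - z s) * exp (- oint t s ?d)" for s
  have "(E has_field_derivative 0) (at s)" for s
  proof -
    have "(E has_field_derivative (lam (y s) s - lam (z s) s) * exp (- oint t s ?d) +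
        exp (- oint t s ?d) * (- ?d s) * (y s - z s)) (at s)"
      unfolding E_def by (intro DERIV_mult DERIV_diff y z DERIV_fun_exp DERIV_minus oint_deriv d)
    moreover have "lam (y s) s - lam (z s) s = ?d s * (y s - z s)" by (rule divdiff_eq[OF lam_DERIV])
    ultimately show ?thesis by (simp add: algebra_simps)
  qed
  then have "E s = E t" by (intro DERIV_isconst_all) auto
  then have "(y s - z s) * exp (- oint t s ?d) * exp (oint t s ?d) = (y t - z t) * exp (oint t s ?d)"
    by (simp add: E_def)
  then show ?thesis by (simp add: mult.assoc exp_add[symmetric])
qed

lemma flow_flow: "flow lam s (flow lam \<tau> x t) \<tau> = flow lam s x t"
  using solution_diff[OF flow_DERIV[of "flow lam \<tau> x t" \<tau>] flow_DERIV[of x t], of s \<tau>] by simp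

lemma lamx_flow_cont: "continuous_on UNIV (\<lambda>r. lamx (flow lam r x t) r)"
  by (intro cont2D[OF lamx] cont3D[OF flow_cont] continuous_intros)

lemma flow_deriv_cont: "cont3 (flow_deriv lam lamx)"
  unfolding flow_deriv_def
  by (intro continuous_on_exp oint_continuous cont2D[OF lamx] cont3D[OF flow_cont] continuous_intros)

lemma flow_DERIV_x: "((\<lambda>x. flow lam s x t) has_field_derivative flow_deriv lam lamx s x t) (at x)"
  unfolding CARAT_DERIV
proof (intro exI conjI allI)
  let ?g = "\<lambda>y. exp (oint t s (\<lambda>r. divdiff lamx (flow lam r y t) (flow lam r x t) r))"
  show "flow lam s y t - flow lam s x t = ?g y * (y - x)" for y
    using solution_diff[OF flow_DERIV[of y t] flow_DERIV[of x t], of s t] by (simp add: mult.commute)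
  have "continuous_on UNIV ?g"
    by (intro continuous_on_exp oint_continuous divdiff_continuous lamx cont3D[OF flow_cont] continuous_intros)
  then show "isCont ?g x" by (simp add: continuous_on_eq_continuous_at)
  show "?g x = flow_deriv lam lamx s x t" by (simp add: flow_deriv_def)
qed

lemma flow_deriv_cocycle:
  "flow_deriv lam lamx s (flow lam \<tau> x t) \<tau> * flow_deriv lam lamx \<tau> x t = flow_deriv lam lamx s x t"
  using oint_add[OF lamx_flow_cont, of t \<tau> x t s]
  by (simp add: flow_deriv_def flow_flow exp_add[symmetric] add.commute)

lemma flow_deriv_pos: "flow_deriv lam lamx s x t > 0"
  by (simp add: flow_deriv_def)

lemma flow_deriv_DERIV:
  "((\<lambda>s. flow_deriv lam lamx s x t) has_field_derivative
    flow_deriv lam lamx s x t * lamx (flow lam s x t) s) (at s)"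
  unfolding flow_deriv_def by (intro DERIV_fun_exp oint_deriv lamx_flow_cont)

end

section \<open>Linear Volterra equations along characteristics\<close>

primrec volterra_iter ::
    "('m \<Rightarrow> real \<Rightarrow> real \<Rightarrow> real \<Rightarrow> real) \<Rightarrow> ('m \<Rightarrow> 'm \<Rightarrow> real \<Rightarrow> real \<Rightarrow> real \<Rightarrow> real) \<Rightarrow>
      ('m \<Rightarrow> real \<Rightarrow> real \<Rightarrow> real \<Rightarrow> real) \<Rightarrow> nat \<Rightarrow> 'm::finite \<Rightarrow> real \<Rightarrow> real \<Rightarrow> real" where
  "volterra_iter \<gamma> K h 0 i x t = 0"
| "volterra_iter \<gamma> K h (Suc n) i x t =
    oint 0 t (\<lambda>s. (\<Sum>j\<in>UNIV. K i j s x t * volterra_iter \<gamma> K h n j (\<gamma> i s x t) s) + h i s x t)"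

definition volterra_sol ::
    "('m \<Rightarrow> real \<Rightarrow> real \<Rightarrow> real \<Rightarrow> real) \<Rightarrow> ('m \<Rightarrow> 'm \<Rightarrow> real \<Rightarrow> real \<Rightarrow> real \<Rightarrow> real) \<Rightarrow>
      ('m \<Rightarrow> real \<Rightarrow> real \<Rightarrow> real \<Rightarrow> real) \<Rightarrow> 'm::finite \<Rightarrow> real \<Rightarrow> real \<Rightarrow> real" where
  "volterra_sol \<gamma> K h i x t = lim (\<lambda>n. volterra_iter \<gamma> K h n i x t)"

locale volterra =
  fixes \<gamma> :: "'m::finite \<Rightarrow> real \<Rightarrow> real \<Rightarrow> real \<Rightarrow> real"
    and K :: "'m \<Rightarrow> 'm \<Rightarrow> real \<Rightarrow> real \<Rightarrow> real \<Rightarrow> real"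
    and h :: "'m \<Rightarrow> real \<Rightarrow> real \<Rightarrow> real \<Rightarrow> real"
  assumes \<gamma>: "\<And>i. cont3 (\<gamma> i)" and K: "\<And>i j. cont3 (K i j)" and h: "\<And>i. cont3 (h i)"
    and finite_speed: "\<And>i T. \<exists>c\<ge>0. \<forall>s x t. \<bar>s\<bar> \<le> T \<longrightarrow> \<bar>t\<bar> \<le> T \<longrightarrow> \<bar>\<gamma> i s x t - x\<bar> \<le> c * \<bar>s - t\<bar>"
begin

lemma integrand_cont:
  assumes "\<And>j. cont2 (w j)" "continuous_on S a" "continuous_on S b" "continuous_on S c"
  shows "continuous_on S (\<lambda>z. (\<Sum>j\<in>UNIV. K i j (a z) (b z) (c z) * w j (\<gamma> i (a z) (b z) (c z)) (a z)) + h i (a z) (b z) (c z))"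
  by (intro continuous_on_add continuous_on_sum continuous_on_mult cont3D[OF K] cont3D[OF h]
    cont2D[OF assms(1)] cont3D[OF \<gamma>] assms(2-4))

lemma volterra_iter_cont: "cont2 (volterra_iter \<gamma> K h n i)"
proof (induction n arbitrary: i)
  case (Suc n)
  have "continuous_on UNIV (\<lambda>z::real \<times> real. oint 0 (snd z)
      (\<lambda>s. (\<Sum>j\<in>UNIV. K i j s (fst z) (snd z) * volterra_iter \<gamma> K h n j (\<gamma> i s (fst z) (snd z)) s) + h i s (fst z) (snd z)))"
    by (rule oint_continuous) (intro integrand_cont[OF Suc] continuous_intros)+
  then show ?case by simp
qed (simp add: continuous_on_const)

definition step :: "('m \<Rightarrow> real \<Rightarrow> real \<Rightarrow> real) \<Rightarrow> 'm \<Rightarrow> real \<Rightarrow> real \<Rightarrow> real" where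
  "step w i x t = oint 0 t (\<lambda>s. (\<Sum>j\<in>UNIV. K i j s x t * w j (\<gamma> i s x t) s) + h i s x t)"

lemma volterra_iter_Suc: "volterra_iter \<gamma> K h (Suc n) i x t = step (volterra_iter \<gamma> K h n) i x t"
  by (simp add: step_def)

definition contracts :: "(real \<times> real) set \<Rightarrow> real \<Rightarrow> bool" where
  "contracts S \<Lambda> \<longleftrightarrow> (\<forall>v w C. (\<forall>j. cont2 (v j)) \<longrightarrow> (\<forall>j. cont2 (w j)) \<longrightarrow>
      (\<forall>j x t. (x, t) \<in> S \<longrightarrow> \<bar>v j x t - w j x t\<bar> \<le> C * exp (2 * \<Lambda> * \<bar>t\<bar>)) \<longrightarrow>
      (\<forall>i x t. (x, t) \<in> S \<longrightarrow> \<bar>step v i x t - step w i x t\<bar> \<le> C / 2 * exp (2 * \<Lambda> * \<bar>t\<bar>)))"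

lemmas contractsD = contracts_def[THEN iffD1, rule_format]

text \<open>One step of the iteration gains a factor \<open>1/2\<close> in the norm weighted by \<open>exp (2 \<Lambda> \<bar>t\<bar>)\<close>, on
  a domain of dependence of a given square.\<close>

lemma contractionE:
  obtains S \<Lambda> where "\<Lambda> > 0" "\<And>x t. (x, t) \<in> S \<Longrightarrow> \<bar>t\<bar> \<le> N" "\<And>x t. \<bar>x\<bar> \<le> N \<Longrightarrow> \<bar>t\<bar> \<le> N \<Longrightarrow> (x, t) \<in> S"
    "bounded S" "contracts S \<Lambda>"
proof -
  define c0 where "c0 i = (SOME c. c \<ge> 0 \<and> (\<forall>s x t. \<bar>s\<bar> \<le> N \<longrightarrow> \<bar>t\<bar> \<le> N \<longrightarrow> \<bar>\<gamma> i s x t - x\<bar> \<le> c * \<bar>s - t\<bar>))" for i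
  have c0: "c0 i \<ge> 0 \<and> (\<forall>s x t. \<bar>s\<bar> \<le> N \<longrightarrow> \<bar>t\<bar> \<le> N \<longrightarrow> \<bar>\<gamma> i s x t - x\<bar> \<le> c0 i * \<bar>s - t\<bar>)" for i
    using someI_ex[OF finite_speed[of N i]] unfolding c0_def by this
  define c where "c = (\<Sum>i\<in>UNIV. c0 i)"
  have c: "0 \<le> c" unfolding c_def using c0 by (intro sum_nonneg) simp
  have c0c: "c0 i \<le> c" for i unfolding c_def using c0 by (intro member_le_sum) auto
  have speed: "\<bar>\<gamma> i s x t - x\<bar> \<le> c * \<bar>s - t\<bar>" if "\<bar>s\<bar> \<le> N" "\<bar>t\<bar> \<le> N" for i s x t
  proof -
    have "\<bar>\<gamma> i s x t - x\<bar> \<le> c0 i * \<bar>s - t\<bar>" using c0[of i] that by simp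
    also have "\<dots> \<le> c * \<bar>s - t\<bar>" by (intro mult_right_mono c0c) simp
    finally show ?thesis .
  qed
  define B where "B = N + c * N"
  define k0 where "k0 i j = (SOME C. C \<ge> 0 \<and> (\<forall>s x t. \<bar>s\<bar> \<le> N \<longrightarrow> \<bar>x\<bar> \<le> B \<longrightarrow> \<bar>t\<bar> \<le> N \<longrightarrow> \<bar>K i j s x t\<bar> \<le> C))" for i j
  have k0: "k0 i j \<ge> 0 \<and> (\<forall>s x t. \<bar>s\<bar> \<le> N \<longrightarrow> \<bar>x\<bar> \<le> B \<longrightarrow> \<bar>t\<bar> \<le> N \<longrightarrow> \<bar>K i j s x t\<bar> \<le> k0 i j)" for i j
    using someI_ex[OF cont3_bounded[OF K, of N B N i j]] unfolding k0_def by this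
  define \<Lambda> where "\<Lambda> = 1 + (\<Sum>i\<in>UNIV. \<Sum>j\<in>UNIV. k0 i j)"
  have \<Lambda>: "\<Lambda> > 0" unfolding \<Lambda>_def using k0 by (intro add_pos_nonneg sum_nonneg) auto
  have k\<Lambda>: "(\<Sum>j\<in>UNIV. k0 i j) \<le> \<Lambda>" for i
    unfolding \<Lambda>_def using member_le_sum[of i UNIV "\<lambda>i. \<Sum>j\<in>UNIV. k0 i j"] k0 by (simp add: sum_nonneg)
  define S where "S = {z::real \<times> real. \<bar>snd z\<bar> \<le> N \<and> \<bar>fst z\<bar> \<le> N + c * (N - \<bar>snd z\<bar>)}"
  have SB: "\<bar>x\<bar> \<le> B" if "(x, t) \<in> S" for x t
  proof -
    have "c * (N - \<bar>t\<bar>) \<le> c * N" using c by (intro mult_left_mono) auto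
    then show ?thesis using that by (simp add: S_def B_def)
  qed
  show thesis
  proof (rule that[of \<Lambda> S])
    show "\<Lambda> > 0" by (rule \<Lambda>)
    show "\<bar>t\<bar> \<le> N" if "(x, t) \<in> S" for x t using that by (simp add: S_def)
    show "(x, t) \<in> S" if "\<bar>x\<bar> \<le> N" "\<bar>t\<bar> \<le> N" for x t
    proof -
      have "0 \<le> c * (N - \<bar>t\<bar>)" using that c by simp
      then show ?thesis using that by (simp add: S_def)
    qed
    have "S \<subseteq> cbox (- B, - N) (B, N)"
      using SB by (auto simp: S_def cbox_Pair_eq abs_le_iff) (smt (verit))+
    then show "bounded S" by (rule bounded_subset[OF bounded_cbox])
    show "contracts S \<Lambda>"
      unfolding contracts_def
    proof (intro allI impI)
      fix v w :: "'m \<Rightarrow> real \<Rightarrow> real \<Rightarrow> real" and C i x t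
      assume v: "\<forall>j. cont2 (v j)" and w: "\<forall>j. cont2 (w j)"
        and le: "\<forall>j x t. (x, t) \<in> S \<longrightarrow> \<bar>v j x t - w j x t\<bar> \<le> C * exp (2 * \<Lambda> * \<bar>t\<bar>)" and xt: "(x, t) \<in> S"
      have C: "0 \<le> C"
      proof -
        have "0 \<le> C * exp (2 * \<Lambda> * \<bar>t\<bar>)" using le xt abs_ge_zero order_trans by blast
        then show ?thesis by (simp add: zero_le_mult_iff)
      qed
      have vc: "continuous_on UNIV (\<lambda>s. (\<Sum>j\<in>UNIV. K i j s x t * v j (\<gamma> i s x t) s) + h i s x t)"
        by (rule integrand_cont) (use v in \<open>auto intro: continuous_intros\<close>)
      have wc: "continuous_on UNIV (\<lambda>s. (\<Sum>j\<in>UNIV. K i j s x t * w j (\<gamma> i s x t) s) + h i s x t)"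
        by (rule integrand_cont) (use w in \<open>auto intro: continuous_intros\<close>)
      define d where "d s = (\<Sum>j\<in>UNIV. K i j s x t * (v j (\<gamma> i s x t) s - w j (\<gamma> i s x t) s))" for s
      have d_eq: "d s = (\<Sum>j\<in>UNIV. K i j s x t * v j (\<gamma> i s x t) s) + h i s x t -
          ((\<Sum>j\<in>UNIV. K i j s x t * w j (\<gamma> i s x t) s) + h i s x t)" for s
        by (simp add: d_def right_diff_distrib sum_subtractf)
      have eq: "step v i x t - step w i x t = oint 0 t d"
        unfolding step_def d_eq by (rule oint_diff[OF vc wc, symmetric])
      have dc: "continuous_on UNIV d" unfolding d_eq by (intro continuous_on_diff vc wc)
      have "\<bar>oint 0 t d\<bar> \<le> (\<Lambda> * C) / (2 * \<Lambda>) * exp (2 * \<Lambda> * \<bar>t - 0\<bar>)"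
      proof (rule oint_bound_exp)
        show "0 \<le> \<Lambda> * C" "0 < 2 * \<Lambda>" using \<Lambda> C by auto
        show "continuous_on UNIV d" by (rule dc)
        fix r assume r: "r \<in> closed_segment 0 t"
        have tN: "\<bar>t\<bar> \<le> N" using xt by (simp add: S_def)
        have rN: "\<bar>r\<bar> \<le> N" "\<bar>r - t\<bar> = \<bar>t\<bar> - \<bar>r\<bar>"
          using r tN by (auto simp: closed_segment_eq_real_ivl split: if_splits)
        have inS: "(\<gamma> i r x t, r) \<in> S"
        proof -
          have "\<bar>\<gamma> i r x t\<bar> \<le> \<bar>x\<bar> + c * (\<bar>t\<bar> - \<bar>r\<bar>)" using speed[OF rN(1) tN, of i x] by (simp add: rN(2))
          also have "\<dots> \<le> N + c * (N - \<bar>t\<bar>) + c * (\<bar>t\<bar> - \<bar>r\<bar>)" using xt by (simp add: S_def)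
          finally show ?thesis using rN by (simp add: S_def algebra_simps)
        qed
        have "\<bar>d r\<bar> \<le> (\<Sum>j\<in>UNIV. \<bar>K i j r x t * (v j (\<gamma> i r x t) r - w j (\<gamma> i r x t) r)\<bar>)"
          unfolding d_def by (rule sum_abs)
        also have "\<dots> \<le> (\<Sum>j\<in>UNIV. k0 i j * (C * exp (2 * \<Lambda> * \<bar>r\<bar>)))"
          unfolding abs_mult using k0 rN tN SB[OF xt] le inS by (intro sum_mono mult_mono) auto
        also have "\<dots> \<le> \<Lambda> * (C * exp (2 * \<Lambda> * \<bar>r\<bar>))"
          unfolding sum_distrib_right[symmetric] using C by (intro mult_right_mono k\<Lambda>) auto
        finally show "\<bar>d r\<bar> \<le> \<Lambda> * C * exp (2 * \<Lambda> * \<bar>r - 0\<bar>)" by (simp add: mult.assoc)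
      qed
      also have "\<dots> = C / 2 * exp (2 * \<Lambda> * \<bar>t\<bar>)" using \<Lambda> by simp
      finally show "\<bar>step v i x t - step w i x t\<bar> \<le> C / 2 * exp (2 * \<Lambda> * \<bar>t\<bar>)"
        unfolding eq .
    qed
  qed
qed

end

context volterra
begin

lemma bounded_on:
  fixes w :: "'m \<Rightarrow> real \<Rightarrow> real \<Rightarrow> real"
  assumes S: "bounded S" and w: "\<And>j. cont2 (w j)"
  obtains C where "0 \<le> C" "\<And>j x t. (x, t) \<in> S \<Longrightarrow> \<bar>w j x t\<bar> \<le> C"
proof -
  from S[unfolded bounded_iff] obtain R where R: "\<forall>z\<in>S. norm z \<le> R" by (elim exE)
  have SR: "\<bar>x\<bar> \<le> R" "\<bar>t\<bar> \<le> R" if "(x, t) \<in> S" for x t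
    using bspec[OF R that] norm_fst_le[of x t] norm_snd_le[of t x] by simp_all
  define c where "c j = (SOME C. C \<ge> 0 \<and> (\<forall>x t. \<bar>x\<bar> \<le> R \<longrightarrow> \<bar>t\<bar> \<le> R \<longrightarrow> \<bar>w j x t\<bar> \<le> C))" for j
  have c: "c j \<ge> 0 \<and> (\<forall>x t. \<bar>x\<bar> \<le> R \<longrightarrow> \<bar>t\<bar> \<le> R \<longrightarrow> \<bar>w j x t\<bar> \<le> c j)" for j
    using someI_ex[OF cont2_bounded[OF w, of R R j]] unfolding c_def by this
  show thesis
  proof (rule that[of "\<Sum>j\<in>UNIV. c j"])
    show "0 \<le> (\<Sum>j\<in>UNIV. c j)" using c by (intro sum_nonneg) simp
    fix j x t assume "(x, t) \<in> S"
    then have "\<bar>w j x t\<bar> \<le> c j" using c[of j] SR by simp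
    also have "\<dots> \<le> (\<Sum>j\<in>UNIV. c j)" using c by (intro member_le_sum) auto
    finally show "\<bar>w j x t\<bar> \<le> (\<Sum>j\<in>UNIV. c j)" .
  qed
qed

lemma volterra_iter_converges:
  obtains C where "0 \<le> C" "\<And>n i x t. \<bar>x\<bar> \<le> N \<Longrightarrow> \<bar>t\<bar> \<le> N \<Longrightarrow>
      \<bar>volterra_sol \<gamma> K h i x t - volterra_iter \<gamma> K h n i x t\<bar> \<le> C / 2 ^ n"
    "\<And>i x t. \<bar>x\<bar> \<le> N \<Longrightarrow> \<bar>t\<bar> \<le> N \<Longrightarrow> (\<lambda>n. volterra_iter \<gamma> K h n i x t) \<longlonglongrightarrow> volterra_sol \<gamma> K h i x t"
proof -
  let ?w = "volterra_iter \<gamma> K h"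
  obtain S \<Lambda> where \<Lambda>: "\<Lambda> > 0" and St: "\<And>x t. (x, t) \<in> S \<Longrightarrow> \<bar>t\<bar> \<le> N"
    and NS: "\<And>x t. \<bar>x\<bar> \<le> N \<Longrightarrow> \<bar>t\<bar> \<le> N \<Longrightarrow> (x, t) \<in> S" and Sb: "bounded S"
    and con: "contracts S \<Lambda>"
    by (rule contractionE[of N]) (rule that)
  obtain C where C: "0 \<le> C" "\<And>j x t. (x, t) \<in> S \<Longrightarrow> \<bar>?w 1 j x t\<bar> \<le> C"
    by (rule bounded_on[OF Sb volterra_iter_cont]) (rule that)
  have st: "\<bar>?w (Suc n) i x t - ?w n i x t\<bar> \<le> C / 2 ^ n * exp (2 * \<Lambda> * \<bar>t\<bar>)" if "(x, t) \<in> S" for n i x t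
    using that
  proof (induction n arbitrary: i x t)
    case 0
    have "C * 1 \<le> C * exp (2 * \<Lambda> * \<bar>t\<bar>)" using C(1) \<Lambda> by (intro mult_left_mono) auto
    then show ?case using C(2)[OF 0, of i] by simp
  next
    case (Suc n)
    have "\<bar>step (?w (Suc n)) i x t - step (?w n) i x t\<bar> \<le> (C / 2 ^ n) / 2 * exp (2 * \<Lambda> * \<bar>t\<bar>)"
      by (rule contractsD[OF con volterra_iter_cont volterra_iter_cont Suc.IH Suc.prems])
    then show ?case by (simp add: volterra_iter_Suc[symmetric] del: volterra_iter.simps)
  qed
  define D where "D = C * exp (2 * \<Lambda> * \<bar>N\<bar>)"
  have main: "(\<lambda>n. ?w n i x t) \<longlonglongrightarrow> volterra_sol \<gamma> K h i x t \<and>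
      (\<forall>n. \<bar>volterra_sol \<gamma> K h i x t - ?w n i x t\<bar> \<le> 2 * D / 2 ^ n)" if xt: "\<bar>x\<bar> \<le> N" "\<bar>t\<bar> \<le> N" for i x t
  proof -
    have "\<bar>?w (Suc n) i x t - ?w n i x t\<bar> \<le> D / 2 ^ n" for n
    proof -
      have "C / 2 ^ n * exp (2 * \<Lambda> * \<bar>t\<bar>) \<le> C / 2 ^ n * exp (2 * \<Lambda> * \<bar>N\<bar>)"
        using xt \<Lambda> C(1) by (intro mult_left_mono) auto
      then show ?thesis using st[OF NS[OF xt], of n i] by (simp add: D_def del: volterra_iter.simps)
    qed
    from geometric_Cauchy[OF this] obtain l where l: "(\<lambda>n. ?w n i x t) \<longlonglongrightarrow> l"
      "\<forall>n. \<bar>l - ?w n i x t\<bar> \<le> 2 * D / 2 ^ n" by (elim exE conjE)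
    then show ?thesis unfolding volterra_sol_def using limI[OF l(1)] by simp
  qed
  show thesis
  proof (rule that[of "2 * D"])
    show "0 \<le> 2 * D" using C(1) by (simp add: D_def)
  qed (rule main[THEN conjunct2, THEN spec] main[THEN conjunct1]; assumption)+
qed

lemma volterra_iter_LIMSEQ: "(\<lambda>n. volterra_iter \<gamma> K h n i x t) \<longlonglongrightarrow> volterra_sol \<gamma> K h i x t"
proof -
  obtain C where "\<And>i y s. \<bar>y\<bar> \<le> max \<bar>x\<bar> \<bar>t\<bar> \<Longrightarrow> \<bar>s\<bar> \<le> max \<bar>x\<bar> \<bar>t\<bar> \<Longrightarrow>
      (\<lambda>n. volterra_iter \<gamma> K h n i y s) \<longlonglongrightarrow> volterra_sol \<gamma> K h i y s"
    by (rule volterra_iter_converges[of "max \<bar>x\<bar> \<bar>t\<bar>"]) (rule that)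
  then show ?thesis by simp
qed

lemma volterra_sol_cont: "cont2 (volterra_sol \<gamma> K h i)"
proof (rule continuous_on_geometric_limit[OF volterra_iter_cont])
  fix N
  obtain C where C: "\<And>n i x t. \<bar>x\<bar> \<le> N \<Longrightarrow> \<bar>t\<bar> \<le> N \<Longrightarrow>
      \<bar>volterra_sol \<gamma> K h i x t - volterra_iter \<gamma> K h n i x t\<bar> \<le> C / 2 ^ n"
    by (rule volterra_iter_converges[of N]) (rule that)
  have "\<bar>volterra_sol \<gamma> K h i (fst z) (snd z) - volterra_iter \<gamma> K h n i (fst z) (snd z)\<bar> \<le> C / 2 ^ n"
    if "norm z \<le> N" for n and z :: "real \<times> real"
    by (rule C) (use norm_fst_le[of "fst z" "snd z"] norm_snd_le[of "snd z" "fst z"] that in simp_all)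
  then show "\<exists>C. \<forall>n (z::real \<times> real). norm z \<le> N \<longrightarrow>
      \<bar>volterra_sol \<gamma> K h i (fst z) (snd z) - volterra_iter \<gamma> K h n i (fst z) (snd z)\<bar> \<le> C / 2 ^ n"
    by (intro exI[of _ C] allI impI)
qed

lemma volterra_sol_eq: "volterra_sol \<gamma> K h i x t = step (volterra_sol \<gamma> K h) i x t"
proof -
  let ?w = "volterra_iter \<gamma> K h" and ?N = "max \<bar>x\<bar> \<bar>t\<bar>"
  obtain S \<Lambda> where \<Lambda>: "\<Lambda> > 0"
    and NS: "\<And>x t. \<bar>x\<bar> \<le> ?N \<Longrightarrow> \<bar>t\<bar> \<le> ?N \<Longrightarrow> (x, t) \<in> S" and Sb: "bounded S"
    and con: "contracts S \<Lambda>"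
    by (rule contractionE[of ?N]) (rule that)
  from Sb[unfolded bounded_iff] obtain R where R: "\<forall>z\<in>S. norm z \<le> R" by (elim exE)
  have SR: "\<bar>x\<bar> \<le> R" "\<bar>t\<bar> \<le> R" if "(x, t) \<in> S" for x t
    using bspec[OF R that] norm_fst_le[of x t] norm_snd_le[of t x] by simp_all
  obtain C where C: "0 \<le> C" "\<And>n i x t. \<bar>x\<bar> \<le> R \<Longrightarrow> \<bar>t\<bar> \<le> R \<Longrightarrow> \<bar>volterra_sol \<gamma> K h i x t - ?w n i x t\<bar> \<le> C / 2 ^ n"
    by (rule volterra_iter_converges[of R]) (rule that)
  have xt: "(x, t) \<in> S" by (rule NS) auto
  have "\<bar>step (volterra_sol \<gamma> K h) i x t - step (?w n) i x t\<bar> \<le> (C / 2 * exp (2 * \<Lambda> * \<bar>t\<bar>)) / 2 ^ n" for n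
  proof -
    have "\<bar>step (volterra_sol \<gamma> K h) i x t - step (?w n) i x t\<bar> \<le> (C / 2 ^ n) / 2 * exp (2 * \<Lambda> * \<bar>t\<bar>)"
    proof (rule contractsD[OF con volterra_sol_cont volterra_iter_cont _ xt])
      fix j x t assume s: "(x, t) \<in> S"
      have "C / 2 ^ n * 1 \<le> C / 2 ^ n * exp (2 * \<Lambda> * \<bar>t\<bar>)" using C(1) \<Lambda> by (intro mult_left_mono) auto
      then show "\<bar>volterra_sol \<gamma> K h j x t - ?w n j x t\<bar> \<le> C / 2 ^ n * exp (2 * \<Lambda> * \<bar>t\<bar>)"
        using C(2)[OF SR[OF s], of j n] by simp
    qed
    then show ?thesis by (simp add: field_simps)
  qed
  then have "(\<lambda>n. step (?w n) i x t) \<longlonglongrightarrow> step (volterra_sol \<gamma> K h) i x t" by (rule LIMSEQ_geometric_bound)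
  moreover have "(\<lambda>n. step (?w n) i x t) \<longlonglongrightarrow> volterra_sol \<gamma> K h i x t"
    using LIMSEQ_Suc[OF volterra_iter_LIMSEQ] by (simp only: volterra_iter_Suc)
  ultimately show ?thesis by (rule LIMSEQ_unique[rotated])
qed

lemma volterra_sol_unique:
  assumes w: "\<And>j. cont2 (w j)" and eq: "\<And>j x t. w j x t = step w j x t"
  shows "w i x t = volterra_sol \<gamma> K h i x t"
proof -
  let ?w = "volterra_iter \<gamma> K h" and ?N = "max \<bar>x\<bar> \<bar>t\<bar>"
  obtain S \<Lambda> where \<Lambda>: "\<Lambda> > 0"
    and NS: "\<And>x t. \<bar>x\<bar> \<le> ?N \<Longrightarrow> \<bar>t\<bar> \<le> ?N \<Longrightarrow> (x, t) \<in> S" and Sb: "bounded S"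
    and con: "contracts S \<Lambda>"
    by (rule contractionE[of ?N]) (rule that)
  have xt: "(x, t) \<in> S" by (rule NS) auto
  obtain C where C: "0 \<le> C" "\<And>j x t. (x, t) \<in> S \<Longrightarrow> \<bar>w j x t\<bar> \<le> C" by (rule bounded_on[OF Sb w]) (rule that)
  have "\<bar>w j x t - ?w n j x t\<bar> \<le> C / 2 ^ n * exp (2 * \<Lambda> * \<bar>t\<bar>)" if "(x, t) \<in> S" for n j x t
    using that
  proof (induction n arbitrary: j x t)
    case 0
    have "C * 1 \<le> C * exp (2 * \<Lambda> * \<bar>t\<bar>)" using C(1) \<Lambda> by (intro mult_left_mono) auto
    then show ?case using C(2)[OF 0, of j] by simp
  next
    case (Suc n)
    have "\<bar>step w j x t - step (?w n) j x t\<bar> \<le> (C / 2 ^ n) / 2 * exp (2 * \<Lambda> * \<bar>t\<bar>)"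
      by (rule contractsD[OF con w volterra_iter_cont Suc.IH Suc.prems])
    then show ?case by (simp add: volterra_iter_Suc[symmetric] eq[symmetric] del: volterra_iter.simps)
  qed
  from this[OF xt] have "\<bar>w i x t - ?w n i x t\<bar> \<le> (C * exp (2 * \<Lambda> * \<bar>t\<bar>)) / 2 ^ n" for n by (simp add: field_simps)
  then have "(\<lambda>n. ?w n i x t) \<longlonglongrightarrow> w i x t" by (rule LIMSEQ_geometric_bound)
  then show ?thesis by (rule LIMSEQ_unique[OF _ volterra_iter_LIMSEQ])
qed

end

section \<open>Smooth solutions for a fixed path\<close>

definition tsol ::
    "('n \<Rightarrow> real \<Rightarrow> real \<Rightarrow> real) \<Rightarrow> ('n \<Rightarrow> 'n \<Rightarrow> real \<Rightarrow> real \<Rightarrow> real) \<Rightarrow> ('n \<Rightarrow> real \<Rightarrow> real \<Rightarrow> real) \<Rightarrow>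
      'n::finite \<Rightarrow> real \<Rightarrow> real \<Rightarrow> real" where
  "tsol lam f g = volterra_sol (\<lambda>i. flow (lam i)) (\<lambda>i j s x t. f i j (flow (lam i) s x t) s)
     (\<lambda>i s x t. g i (flow (lam i) s x t) s)"

locale transport =
  fixes lam lamx :: "'n::finite \<Rightarrow> real \<Rightarrow> real \<Rightarrow> real"
    and f :: "'n \<Rightarrow> 'n \<Rightarrow> real \<Rightarrow> real \<Rightarrow> real" and g :: "'n \<Rightarrow> real \<Rightarrow> real \<Rightarrow> real"
  assumes speed: "\<And>i. speed (lam i) (lamx i)" and f: "\<And>i j. cont2 (f i j)" and g: "\<And>i. cont2 (g i)"
begin

sublocale V: volterra "\<lambda>i. flow (lam i)" "\<lambda>i j s x t. f i j (flow (lam i) s x t) s" "\<lambda>i s x t. g i (flow (lam i) s x t) s"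
proof
  show c: "cont3 (flow (lam i))" for i by (rule speed.flow_cont[OF speed])
  show "cont3 (\<lambda>s x t. f i j (flow (lam i) s x t) s)" for i j
    by (intro cont2D[OF f] c continuous_intros)
  show "cont3 (\<lambda>s x t. g i (flow (lam i) s x t) s)" for i
    by (intro cont2D[OF g] c continuous_intros)
  show "\<exists>c\<ge>0. \<forall>s x t. \<bar>s\<bar> \<le> T \<longrightarrow> \<bar>t\<bar> \<le> T \<longrightarrow> \<bar>flow (lam i) s x t - x\<bar> \<le> c * \<bar>s - t\<bar>" for i T
    by (rule speed.flow_speed[OF speed])
qed

abbreviation rhs :: "('n \<Rightarrow> real \<Rightarrow> real \<Rightarrow> real) \<Rightarrow> 'n \<Rightarrow> real \<Rightarrow> real \<Rightarrow> real" where
  "rhs w i x t \<equiv> (\<Sum>j\<in>UNIV. f i j x t * w j x t) + g i x t"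

lemma tsol_cont: "cont2 (tsol lam f g i)"
  unfolding tsol_def by (rule V.volterra_sol_cont)

lemma tsol_eq: "tsol lam f g i x t = oint 0 t (\<lambda>s. rhs (tsol lam f g) i (flow (lam i) s x t) s)"
  unfolding tsol_def by (subst V.volterra_sol_eq) (simp add: V.step_def)

lemma tsol_init: "tsol lam f g i x 0 = 0"
  by (subst tsol_eq) simp

lemma rhs_cont:
  assumes "\<And>j. cont2 (w j)"
  shows "cont2 (rhs w i)"
  by (intro continuous_on_add continuous_on_sum continuous_on_mult f g assms)

lemma flow_cont1: "continuous_on UNIV (\<lambda>s. flow (lam i) s x t)"
  by (intro cont3D[OF speed.flow_cont[OF speed]] continuous_intros)

lemma tsol_DERIV_characteristic:
  "((\<lambda>\<tau>. tsol lam f g i (flow (lam i) \<tau> x t) \<tau>) has_field_derivative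
    rhs (tsol lam f g) i (flow (lam i) \<tau> x t) \<tau>) (at \<tau>)"
proof -
  have "(\<lambda>\<tau>. tsol lam f g i (flow (lam i) \<tau> x t) \<tau>) =
      (\<lambda>\<tau>. oint 0 \<tau> (\<lambda>s. rhs (tsol lam f g) i (flow (lam i) s x t) s))"
    by (rule ext, subst tsol_eq) (simp only: speed.flow_flow[OF speed])
  moreover have "((\<lambda>\<tau>. oint 0 \<tau> (\<lambda>s. rhs (tsol lam f g) i (flow (lam i) s x t) s)) has_field_derivative
      rhs (tsol lam f g) i (flow (lam i) \<tau> x t) \<tau>) (at \<tau>)"
    by (rule oint_deriv) (intro cont2D[OF rhs_cont] tsol_cont flow_cont1 continuous_on_id)
  ultimately show ?thesis by (simp only:)
qed

lemma tsol_unique: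
  assumes w: "\<And>j. cont2 (w j)" and init: "\<And>j x. w j x 0 = 0"
    and D: "\<And>i x t \<tau>. ((\<lambda>\<tau>. w i (flow (lam i) \<tau> x t) \<tau>) has_field_derivative
      rhs w i (flow (lam i) \<tau> x t) \<tau>) (at \<tau>)"
  shows "w i x t = tsol lam f g i x t"
  unfolding tsol_def
proof (rule V.volterra_sol_unique[OF w])
  show "w j x t = V.step w j x t" for j x t
    using oint_FTC[OF D[of j x t], of 0 t] by (simp add: V.step_def speed.flow_same[OF speed] init)
qed

end

lemma sum_UNIV_Plus:
  fixes \<phi> :: "'a::finite + 'b::finite \<Rightarrow> real"
  shows "(\<Sum>b\<in>UNIV. \<phi> b) = (\<Sum>i\<in>UNIV. \<phi> (Inl i)) + (\<Sum>j\<in>UNIV. \<phi> (Inr j))"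
  unfolding UNIV_Plus_UNIV[symmetric] by (subst sum.Plus) auto

locale transport_C1 = transport lam lamx f g
  for lam lamx :: "'n::finite \<Rightarrow> real \<Rightarrow> real \<Rightarrow> real" and f g +
  fixes fx :: "'n \<Rightarrow> 'n \<Rightarrow> real \<Rightarrow> real \<Rightarrow> real" and gx :: "'n \<Rightarrow> real \<Rightarrow> real \<Rightarrow> real"
  assumes fx: "\<And>i j. cont2 (fx i j)" and gx: "\<And>i. cont2 (gx i)"
    and f_DERIV: "\<And>i j x t. ((\<lambda>x. f i j x t) has_field_derivative fx i j x t) (at x)"
    and g_DERIV: "\<And>i x t. ((\<lambda>x. g i x t) has_field_derivative gx i x t) (at x)"
begin

abbreviation "fl i \<equiv> flow (lam i)"
abbreviation "fd i \<equiv> flow_deriv (lam i) (lamx i)"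

text \<open>The Volterra equation for the pair \<open>(u, \<partial>\<^sub>x u)\<close>: the second component of every iterate is the
  \<open>x\<close>-derivative of the first one.\<close>

definition \<gamma>2 :: "'n + 'n \<Rightarrow> real \<Rightarrow> real \<Rightarrow> real \<Rightarrow> real" where
  "\<gamma>2 a = (case a of Inl i \<Rightarrow> fl i | Inr i \<Rightarrow> fl i)"

definition K2 :: "'n + 'n \<Rightarrow> 'n + 'n \<Rightarrow> real \<Rightarrow> real \<Rightarrow> real \<Rightarrow> real" where
  "K2 a b = (case a of
     Inl i \<Rightarrow> (case b of Inl j \<Rightarrow> (\<lambda>s x t. f i j (fl i s x t) s) | Inr j \<Rightarrow> (\<lambda>s x t. 0))
   | Inr i \<Rightarrow> (case b of Inl j \<Rightarrow> (\<lambda>s x t. fx i j (fl i s x t) s * fd i s x t)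
       | Inr j \<Rightarrow> (\<lambda>s x t. f i j (fl i s x t) s * fd i s x t)))"

definition h2 :: "'n + 'n \<Rightarrow> real \<Rightarrow> real \<Rightarrow> real \<Rightarrow> real" where
  "h2 a = (case a of Inl i \<Rightarrow> (\<lambda>s x t. g i (fl i s x t) s) | Inr i \<Rightarrow> (\<lambda>s x t. gx i (fl i s x t) s * fd i s x t))"

sublocale V2: volterra \<gamma>2 K2 h2
proof
  have c: "cont3 (fl i)" and d: "cont3 (fd i)" for i
    by (rule speed.flow_cont[OF speed], rule speed.flow_deriv_cont[OF speed])
  show "cont3 (\<gamma>2 a)" for a by (cases a) (simp_all add: \<gamma>2_def c)
  show "cont3 (K2 a b)" for a b
    unfolding K2_def
    by (cases a; cases b) (simp_all, (intro continuous_on_mult cont2D[OF f] cont2D[OF fx] c d continuous_on_fst continuous_on_id continuous_on_const)+)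
  show "cont3 (h2 a)" for a
    unfolding h2_def
    by (cases a) (simp_all, (intro continuous_on_mult cont2D[OF g] cont2D[OF gx] c d continuous_on_fst continuous_on_id)+)
  show "\<exists>c\<ge>0. \<forall>s x t. \<bar>s\<bar> \<le> T \<longrightarrow> \<bar>t\<bar> \<le> T \<longrightarrow> \<bar>\<gamma>2 a s x t - x\<bar> \<le> c * \<bar>s - t\<bar>" for a T
    using speed.flow_speed[OF speed] by (cases a) (simp_all only: \<gamma>2_def sum.case)
qed

abbreviation "iter2 \<equiv> volterra_iter \<gamma>2 K2 h2"
abbreviation "sol2 \<equiv> volterra_sol \<gamma>2 K2 h2"

lemma iter2_Inl: "iter2 (Suc n) (Inl i) x t =
    oint 0 t (\<lambda>s. (\<Sum>j\<in>UNIV. f i j (fl i s x t) s * iter2 n (Inl j) (fl i s x t) s) + g i (fl i s x t) s)"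
  by (simp add: sum_UNIV_Plus \<gamma>2_def K2_def h2_def)

lemma iter2_Inr: "iter2 (Suc n) (Inr i) x t =
    oint 0 t (\<lambda>s. ((\<Sum>j\<in>UNIV. fx i j (fl i s x t) s * fd i s x t * iter2 n (Inl j) (fl i s x t) s) +
      (\<Sum>j\<in>UNIV. f i j (fl i s x t) s * fd i s x t * iter2 n (Inr j) (fl i s x t) s)) + gx i (fl i s x t) s * fd i s x t)"
  by (simp add: sum_UNIV_Plus \<gamma>2_def K2_def h2_def)

lemma iter2_DERIV: "((\<lambda>x. iter2 n (Inl i) x t) has_field_derivative iter2 n (Inr i) x t) (at x)"
proof (induction n arbitrary: i x t)
  case 0
  show ?case by simp
next
  case (Suc n)
  note c = speed.flow_cont[OF speed] and d = speed.flow_deriv_cont[OF speed] and i = V2.volterra_iter_cont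
  note ci = cont3D[OF c] cont3D[OF d] cont2D[OF f] cont2D[OF fx] cont2D[OF g] cont2D[OF gx] cont2D[OF i]
    continuous_on_fst continuous_on_snd continuous_on_id continuous_on_const continuous_on_add continuous_on_sum continuous_on_mult
  show ?case
    unfolding iter2_Inl iter2_Inr
  proof (rule oint_leibniz)
    fix x s
    note flx = speed.flow_DERIV_x[OF speed, of i s t x]
    have 1: "((\<lambda>x. f i j (fl i s x t) s * iter2 n (Inl j) (fl i s x t) s) has_field_derivative
        fx i j (fl i s x t) s * fd i s x t * iter2 n (Inl j) (fl i s x t) s +
        f i j (fl i s x t) s * fd i s x t * iter2 n (Inr j) (fl i s x t) s) (at x)" for j
      using DERIV_mult[OF DERIV_chain2[OF f_DERIV[of i j s "fl i s x t"] flx] DERIV_chain2[OF Suc[of j s "fl i s x t"] flx]]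
      by (simp add: algebra_simps)
    have 2: "((\<lambda>x. g i (fl i s x t) s) has_field_derivative gx i (fl i s x t) s * fd i s x t) (at x)"
      by (rule DERIV_chain2[OF g_DERIV flx])
    show "((\<lambda>x. (\<Sum>j\<in>UNIV. f i j (fl i s x t) s * iter2 n (Inl j) (fl i s x t) s) + g i (fl i s x t) s) has_field_derivative
      ((\<Sum>j\<in>UNIV. fx i j (fl i s x t) s * fd i s x t * iter2 n (Inl j) (fl i s x t) s) +
      (\<Sum>j\<in>UNIV. f i j (fl i s x t) s * fd i s x t * iter2 n (Inr j) (fl i s x t) s)) + gx i (fl i s x t) s * fd i s x t) (at x)"
      unfolding sum.distrib[symmetric] by (intro DERIV_add DERIV_sum 1 2)
  next
    show "cont2 (\<lambda>x s. (\<Sum>j\<in>UNIV. f i j (fl i s x t) s * iter2 n (Inl j) (fl i s x t) s) + g i (fl i s x t) s)"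
      by (intro ci)
    show "cont2 (\<lambda>x s. ((\<Sum>j\<in>UNIV. fx i j (fl i s x t) s * fd i s x t * iter2 n (Inl j) (fl i s x t) s) +
      (\<Sum>j\<in>UNIV. f i j (fl i s x t) s * fd i s x t * iter2 n (Inr j) (fl i s x t) s)) + gx i (fl i s x t) s * fd i s x t)"
      by (intro ci)
  qed
qed

lemma sol2_Inl: "sol2 (Inl i) x t = tsol lam f g i x t"
proof -
  have "iter2 n (Inl i) x t = volterra_iter (\<lambda>i. flow (lam i)) (\<lambda>i j s x t. f i j (flow (lam i) s x t) s)
     (\<lambda>i s x t. g i (flow (lam i) s x t) s) n i x t" for n
  proof (induction n arbitrary: i x t)
    case (Suc n)
    show ?case unfolding iter2_Inl Suc by simp
  qed simp
  then show ?thesis unfolding tsol_def volterra_sol_def by simp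
qed

definition tsol_x :: "'n \<Rightarrow> real \<Rightarrow> real \<Rightarrow> real" where
  "tsol_x i x t = sol2 (Inr i) x t"

lemma tsol_x_cont: "cont2 (tsol_x i)"
  unfolding tsol_x_def by (rule V2.volterra_sol_cont)

lemma tsol_DERIV_x: "((\<lambda>x. tsol lam f g i x t) has_field_derivative tsol_x i x t) (at x)"
proof -
  have cx: "continuous_on UNIV (\<lambda>y. w y t)" if "cont2 w" for w by (intro cont2D[OF that] continuous_intros)
  have eq: "tsol lam f g i x t - tsol lam f g i 0 t = oint 0 x (\<lambda>y. tsol_x i y t)" for x
  proof -
    let ?N = "max \<bar>x\<bar> \<bar>t\<bar>"
    obtain C where C: "\<And>n a x t. \<bar>x\<bar> \<le> ?N \<Longrightarrow> \<bar>t\<bar> \<le> ?N \<Longrightarrow> \<bar>sol2 a x t - iter2 n a x t\<bar> \<le> C / 2 ^ n"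
      by (rule V2.volterra_iter_converges[of ?N]) (rule that)
    have "\<bar>oint 0 x (\<lambda>y. tsol_x i y t) - oint 0 x (\<lambda>y. iter2 n (Inr i) y t)\<bar> \<le> (C * \<bar>x - 0\<bar>) / 2 ^ n" for n
    proof -
      have "\<bar>oint 0 x (\<lambda>y. tsol_x i y t - iter2 n (Inr i) y t)\<bar> \<le> (C / 2 ^ n) * \<bar>x - 0\<bar>"
      proof (rule oint_bound)
        show "continuous_on UNIV (\<lambda>y. tsol_x i y t - iter2 n (Inr i) y t)"
          by (intro continuous_on_diff cx tsol_x_cont V2.volterra_iter_cont)
        fix r assume r: "r \<in> closed_segment 0 x"
        have "\<bar>r\<bar> \<le> ?N" by (rule closed_segment_abs_le(1)[OF r]) auto
        then show "\<bar>tsol_x i r t - iter2 n (Inr i) r t\<bar> \<le> C / 2 ^ n"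
          unfolding tsol_x_def by (rule C) simp
      qed
      then show ?thesis
        by (simp add: oint_diff[OF cx[OF tsol_x_cont] cx[OF V2.volterra_iter_cont]])
    qed
    then have "(\<lambda>n. oint 0 x (\<lambda>y. iter2 n (Inr i) y t)) \<longlonglongrightarrow> oint 0 x (\<lambda>y. tsol_x i y t)"
      by (rule LIMSEQ_geometric_bound)
    moreover have "(\<lambda>n. oint 0 x (\<lambda>y. iter2 n (Inr i) y t)) = (\<lambda>n. iter2 n (Inl i) x t - iter2 n (Inl i) 0 t)"
      by (rule ext, rule oint_FTC, rule iter2_DERIV)
    moreover have "(\<lambda>n. iter2 n (Inl i) x t - iter2 n (Inl i) 0 t) \<longlonglongrightarrow> sol2 (Inl i) x t - sol2 (Inl i) 0 t"
      by (intro tendsto_diff V2.volterra_iter_LIMSEQ)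
    ultimately show ?thesis unfolding sol2_Inl using LIMSEQ_unique by fastforce
  qed
  have "((\<lambda>x. oint 0 x (\<lambda>y. tsol_x i y t) + tsol lam f g i 0 t) has_field_derivative tsol_x i x t + 0) (at x)"
    by (intro DERIV_add DERIV_const oint_deriv cx tsol_x_cont)
  moreover have "(\<lambda>x. oint 0 x (\<lambda>y. tsol_x i y t) + tsol lam f g i 0 t) = (\<lambda>x. tsol lam f g i x t)"
    by (rule ext) (simp add: eq[symmetric])
  ultimately show ?thesis by simp
qed

lemma tsol_DERIV_t:
  "((\<lambda>t. tsol lam f g i x t) has_field_derivative rhs (tsol lam f g) i x t - lam i x t * tsol_x i x t) (at t)"
proof -
  have same: "fl i t x t = x" by (rule speed.flow_same[OF speed])
  have 1: "((\<lambda>s. tsol lam f g i (fl i s x t) s) has_field_derivative rhs (tsol lam f g) i x t) (at t)"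
    using tsol_DERIV_characteristic[of i x t t] by (simp only: same)
  have "((\<lambda>s. fl i s x t) has_field_derivative lam i x t) (at t)"
    using speed.flow_DERIV[OF speed, of i x t t] by (simp only: same)
  from DERIV_along_curve[of "tsol lam f g i" "tsol_x i", OF tsol_DERIV_x tsol_x_cont this flow_cont1 same]
  have 2: "((\<lambda>s. tsol lam f g i (fl i s x t) s - tsol lam f g i x s) has_field_derivative tsol_x i x t * lam i x t) (at t)" .
  show ?thesis using DERIV_diff[OF 1 2] by (simp add: mult.commute)
qed

definition fd_coeff :: "'n \<Rightarrow> 'n \<Rightarrow> real \<Rightarrow> real \<Rightarrow> real" where
  "fd_coeff i j x t = f i j x t - (if i = j then lamx i x t else 0)"

definition gd_coeff :: "'n \<Rightarrow> real \<Rightarrow> real \<Rightarrow> real" where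
  "gd_coeff i x t = (\<Sum>j\<in>UNIV. fx i j x t * tsol lam f g j x t) + gx i x t"

lemma tsol_x_eq: "tsol_x i x t = tsol lam fd_coeff gd_coeff i x t"
proof -
  have lxc: "cont2 (lamx i)" for i using speed[of i] by (simp add: speed_def)
  have fdc: "cont2 (fd_coeff i j)" for i j
    unfolding fd_coeff_def by (cases "i = j") (simp_all add: continuous_on_diff f lxc)
  have gdc: "cont2 (gd_coeff i)" for i
    unfolding gd_coeff_def by (intro continuous_on_add continuous_on_sum continuous_on_mult fx gx tsol_cont)
  interpret D: transport lam lamx fd_coeff gd_coeff
    by (rule transport.intro[OF speed fdc gdc])
  define q where "q i y s = ((\<Sum>j\<in>UNIV. fx i j y s * tsol lam f g j y s) +
      (\<Sum>j\<in>UNIV. f i j y s * tsol_x j y s)) + gx i y s" for i y s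
  have qc: "cont2 (q i)" for i
    unfolding q_def by (intro continuous_on_add continuous_on_sum continuous_on_mult fx gx f tsol_cont tsol_x_cont)
  have eq: "tsol_x i x t = oint 0 t (\<lambda>s. q i (fl i s x t) s * fd i s x t)" for i x t
    unfolding tsol_x_def
    by (subst V2.volterra_sol_eq)
      (simp add: V2.step_def sum_UNIV_Plus \<gamma>2_def K2_def h2_def sol2_Inl tsol_x_def[symmetric] q_def
        distrib_left sum_distrib_left mult_ac)
  show ?thesis
  proof (rule D.tsol_unique[OF tsol_x_cont])
    show "tsol_x j x 0 = 0" for j x by (subst eq) simp
    fix i x t \<tau>
    define Q where "Q \<tau> = oint 0 \<tau> (\<lambda>s. q i (fl i s x t) s * fd i s x t)" for \<tau>
    define E where "E \<tau> = fd i \<tau> x t" for \<tau>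
    have E0: "E \<tau> \<noteq> 0" for \<tau> using speed.flow_deriv_pos[OF speed, of i \<tau> x t] by (simp add: E_def)
    have "tsol_x i (fl i \<tau> x t) \<tau> = Q \<tau> / E \<tau>" for \<tau>
    proof -
      have "fd i s (fl i \<tau> x t) \<tau> = fd i s x t / E \<tau>" for s
        using speed.flow_deriv_cocycle[OF speed, of i s \<tau> x t] E0[of \<tau>] by (simp add: E_def field_simps)
      then have "tsol_x i (fl i \<tau> x t) \<tau> = oint 0 \<tau> (\<lambda>s. 1 / E \<tau> * (q i (fl i s x t) s * fd i s x t))"
        by (subst eq) (simp add: speed.flow_flow[OF speed])
      then show ?thesis unfolding oint_cmult by (simp add: Q_def)
    qed
    then have W: "(\<lambda>\<tau>. tsol_x i (fl i \<tau> x t) \<tau>) = (\<lambda>\<tau>. Q \<tau> / E \<tau>)" by (rule ext)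
    have dQ: "(Q has_field_derivative q i (fl i \<tau> x t) \<tau> * E \<tau>) (at \<tau>)"
      unfolding Q_def E_def
      by (rule oint_deriv) (intro continuous_on_mult cont2D[OF qc] flow_cont1 cont3D[OF speed.flow_deriv_cont[OF speed]] continuous_intros)
    have dE: "(E has_field_derivative E \<tau> * lamx i (fl i \<tau> x t) \<tau>) (at \<tau>)"
      unfolding E_def by (rule speed.flow_deriv_DERIV[OF speed])
    have "((\<lambda>\<tau>. Q \<tau> / E \<tau>) has_field_derivative
        (q i (fl i \<tau> x t) \<tau> * E \<tau> * E \<tau> - Q \<tau> * (E \<tau> * lamx i (fl i \<tau> x t) \<tau>)) / (E \<tau> * E \<tau>)) (at \<tau>)"
      by (rule DERIV_divide[OF dQ dE E0])
    moreover have "(q i (fl i \<tau> x t) \<tau> * E \<tau> * E \<tau> - Q \<tau> * (E \<tau> * lamx i (fl i \<tau> x t) \<tau>)) / (E \<tau> * E \<tau>) =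
        q i (fl i \<tau> x t) \<tau> - lamx i (fl i \<tau> x t) \<tau> * tsol_x i (fl i \<tau> x t) \<tau>"
      using E0[of \<tau>] fun_cong[OF W, of \<tau>] by (simp add: field_simps)
    moreover have "\<dots> = D.rhs tsol_x i (fl i \<tau> x t) \<tau>"
      by (simp add: q_def gd_coeff_def fd_coeff_def left_diff_distrib sum_subtractf if_distrib[of "\<lambda>y. y * _"] cong: if_cong)
    ultimately show "((\<lambda>\<tau>. tsol_x i (fl i \<tau> x t) \<tau>) has_field_derivative D.rhs tsol_x i (fl i \<tau> x t) \<tau>) (at \<tau>)"
      unfolding W by simp
  qed
qed

end

definition plane_sol ::
    "('n \<Rightarrow> real^2 \<Rightarrow> real) \<Rightarrow> ('n \<Rightarrow> 'n \<Rightarrow> real^2 \<Rightarrow> real) \<Rightarrow> ('n \<Rightarrow> real^2 \<Rightarrow> real) \<Rightarrow>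
      'n::finite \<Rightarrow> real^2 \<Rightarrow> real" where
  "plane_sol l f g i z = tsol (\<lambda>i x t. l i (vector [x, t])) (\<lambda>i j x t. f i j (vector [x, t]))
     (\<lambda>i x t. g i (vector [x, t])) i (z $ 1) (z $ 2)"

lemma DERIV_vector1_Ck:
  fixes f :: "real^2 \<Rightarrow> real"
  assumes "Ck (Suc k) f"
  shows "((\<lambda>x. f (vector [x, t])) has_field_derivative pd 1 f (vector [x, t])) (at x)"
proof -
  have "((\<lambda>s. f (vector [s + x, t])) has_field_derivative pd 1 f (vector [x, t])) (at 0)"
    using Ck_Suc_DERIV[OF assms, of "vector [x, t]" 1] by (simp add: vector2_shift1 add.commute[of _ x])
  then show ?thesis using DERIV_shift[of "\<lambda>x. f (vector [x, t])" _ 0 x] by simp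
qed

lemma speed_vector:
  fixes l :: "real^2 \<Rightarrow> real"
  assumes l: "C_infinity l" and b: "\<And>T. \<exists>c. \<forall>z. \<bar>z $ 2\<bar> \<le> T \<longrightarrow> \<bar>l z\<bar> \<le> c"
  shows "speed (\<lambda>x t. l (vector [x, t])) (\<lambda>x t. pd 1 l (vector [x, t]))"
proof
  show "cont2 (\<lambda>x t. l (vector [x, t]))" "cont2 (\<lambda>x t. pd 1 l (vector [x, t]))"
    by (rule cont2_vector[OF C_infinity_continuous[OF l]] cont2_vector[OF C_infinity_continuous[OF C_infinity_pd[OF l]]])+
  show "((\<lambda>x. l (vector [x, t])) has_field_derivative pd 1 l (vector [x, t])) (at x)" for x t
    by (rule DERIV_vector1[OF l])
  show "\<exists>c. \<forall>x t. \<bar>t\<bar> \<le> T \<longrightarrow> \<bar>l (vector [x, t])\<bar> \<le> c" for T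
  proof -
    from b[of T] obtain c where "\<forall>z. \<bar>z $ 2\<bar> \<le> T \<longrightarrow> \<bar>l z\<bar> \<le> c" by (elim exE)
    then show ?thesis by (intro exI[of _ c]) simp
  qed
qed

locale plane_transport =
  fixes l :: "'n::finite \<Rightarrow> real^2 \<Rightarrow> real"
  assumes l: "\<And>i. C_infinity (l i)" and l_bounded: "\<And>i T. \<exists>c. \<forall>z. \<bar>z $ 2\<bar> \<le> T \<longrightarrow> \<bar>l i z\<bar> \<le> c"
begin

lemma transport_vector:
  fixes f :: "'n \<Rightarrow> 'n \<Rightarrow> real^2 \<Rightarrow> real" and g :: "'n \<Rightarrow> real^2 \<Rightarrow> real"
  assumes "\<And>i j. C_infinity (f i j)" "\<And>i. continuous_on UNIV (g i)"
  shows "transport (\<lambda>i x t. l i (vector [x, t])) (\<lambda>i x t. pd 1 (l i) (vector [x, t]))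
    (\<lambda>i j x t. f i j (vector [x, t])) (\<lambda>i x t. g i (vector [x, t]))"
  by (rule transport.intro[OF speed_vector[OF l l_bounded]]) (rule cont2_vector[OF C_infinity_continuous[OF assms(1)]] cont2_vector[OF assms(2)])+

lemma transport_C1_vector:
  fixes f :: "'n \<Rightarrow> 'n \<Rightarrow> real^2 \<Rightarrow> real" and g :: "'n \<Rightarrow> real^2 \<Rightarrow> real"
  assumes f: "\<And>i j. C_infinity (f i j)" and g: "\<And>i. Ck (Suc k) (g i)"
  shows "transport_C1 (\<lambda>i x t. l i (vector [x, t])) (\<lambda>i x t. pd 1 (l i) (vector [x, t]))
    (\<lambda>i j x t. f i j (vector [x, t])) (\<lambda>i x t. g i (vector [x, t]))
    (\<lambda>i j x t. pd 1 (f i j) (vector [x, t])) (\<lambda>i x t. pd 1 (g i) (vector [x, t]))"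
proof (intro transport_C1.intro transport_vector transport_C1_axioms.intro f)
  show "continuous_on UNIV (g i)" for i by (rule Ck_continuous[OF g])
  show "cont2 (\<lambda>x t. pd 1 (f i j) (vector [x, t]))" for i j
    by (rule cont2_vector[OF C_infinity_continuous[OF C_infinity_pd[OF f]]])
  show "cont2 (\<lambda>x t. pd 1 (g i) (vector [x, t]))" for i
    by (rule cont2_vector, rule Ck_continuous[of k]) (use g[of i] in simp)
  show "((\<lambda>x. f i j (vector [x, t])) has_field_derivative pd 1 (f i j) (vector [x, t])) (at x)" for i j x t
    by (rule DERIV_vector1[OF f])
  show "((\<lambda>x. g i (vector [x, t])) has_field_derivative pd 1 (g i) (vector [x, t])) (at x)" for i x t
    by (rule DERIV_vector1_Ck[OF g])
qed

definition f_diff where "f_diff f i j z = f i j z - (if i = j then pd 1 (l i) z else 0)"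
definition g_diff where "g_diff f g i z = (\<Sum>j\<in>UNIV. pd 1 (f i j) z * plane_sol l f g j z) + pd 1 (g i) z"

lemma plane_sol_DERIV:
  assumes f: "\<And>i j. C_infinity (f i j)" and g: "\<And>i. Ck (Suc k) (g i)"
  shows "((\<lambda>s. plane_sol l f g i (z + s *\<^sub>R axis 1 1)) has_field_derivative
      plane_sol l (f_diff f) (g_diff f g) i z) (at 0)" (is ?A)
    and "((\<lambda>s. plane_sol l f g i (z + s *\<^sub>R axis 2 1)) has_field_derivative
      (\<Sum>j\<in>UNIV. f i j z * plane_sol l f g j z) + g i z - l i z * plane_sol l (f_diff f) (g_diff f g) i z) (at 0)" (is ?B)
proof -
  interpret T: transport_C1 "\<lambda>i x t. l i (vector [x, t])" "\<lambda>i x t. pd 1 (l i) (vector [x, t])"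
    "\<lambda>i j x t. f i j (vector [x, t])" "\<lambda>i x t. g i (vector [x, t])"
    "\<lambda>i j x t. pd 1 (f i j) (vector [x, t])" "\<lambda>i x t. pd 1 (g i) (vector [x, t])"
    by (rule transport_C1_vector[OF f g])
  have fd: "T.fd_coeff = (\<lambda>i j x t. f_diff f i j (vector [x, t]))"
    by (intro ext) (simp add: T.fd_coeff_def f_diff_def)
  have gd: "T.gd_coeff = (\<lambda>i x t. g_diff f g i (vector [x, t]))"
    by (intro ext) (simp add: T.gd_coeff_def g_diff_def plane_sol_def)
  have x: "T.tsol_x i (z $ 1) (z $ 2) = plane_sol l (f_diff f) (g_diff f g) i z" for i
    unfolding plane_sol_def T.tsol_x_eq fd gd by (rule refl)
  show ?A
    unfolding plane_sol_def[of l f g] x[symmetric] by (rule DERIV_axis_components(1)) (rule T.tsol_DERIV_x)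
  show ?B
    unfolding plane_sol_def[of l f g] x[symmetric]
    by (rule DERIV_axis_components(2)) (use T.tsol_DERIV_t[of i "z $ 1" "z $ 2"] in \<open>simp only: vector2_components\<close>)
qed

lemma Ck_plane_sol:
  "(\<And>i j. C_infinity (f i j)) \<Longrightarrow> (\<And>i. Ck k (g i)) \<Longrightarrow> Ck k (plane_sol l f g i)"
proof (induction k arbitrary: f g i)
  case 0
  have "cont2 (tsol (\<lambda>i x t. l i (vector [x, t])) (\<lambda>i j x t. f i j (vector [x, t])) (\<lambda>i x t. g i (vector [x, t])) i)"
    by (rule transport.tsol_cont[OF transport_vector]) (use 0 in auto)
  then show ?case unfolding plane_sol_def by (simp add: continuous_on_components)
next
  case (Suc k)
  note f = Suc.prems(1) and g = Suc.prems(2)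
  have gk: "Ck k (g i)" for i by (rule Ck_Suc_imp_Ck[OF g])
  have uk: "Ck k (plane_sol l f g i)" for i by (rule Suc.IH[OF f gk])
  have f': "C_infinity (f_diff f i j)" for i j
    unfolding f_diff_def by (cases "i = j") (auto intro!: C_infinity_intros f l)
  have g': "Ck k (g_diff f g i)" for i
  proof -
    have "Ck k (pd 1 (f i j))" for j using C_infinity_pd[OF f] by (simp add: C_infinity_def)
    moreover have "Ck k (pd 1 (g i))" using g[of i] by simp
    ultimately show ?thesis unfolding g_diff_def by (intro Ck_add Ck_sum Ck_mult uk)
  qed
  have vk: "Ck k (plane_sol l (f_diff f) (g_diff f g) i)" for i by (rule Suc.IH[OF f' g'])
  have lk: "Ck k (l i)" and fk: "Ck k (f i j)" for i j using l f by (auto simp: C_infinity_def)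
  show ?case
  proof (rule Ck_SucI[where D = "\<lambda>m. if m = 1 then plane_sol l (f_diff f) (g_diff f g) i
      else (\<lambda>z. (\<Sum>j\<in>UNIV. f i j z * plane_sol l f g j z) + g i z + (- 1 * l i z) * plane_sol l (f_diff f) (g_diff f g) i z)"])
    show "continuous_on UNIV (plane_sol l f g i)" by (rule Ck_continuous[OF uk])
    fix m :: 2
    show "Ck k (if m = 1 then plane_sol l (f_diff f) (g_diff f g) i
      else (\<lambda>z. (\<Sum>j\<in>UNIV. f i j z * plane_sol l f g j z) + g i z + (- 1 * l i z) * plane_sol l (f_diff f) (g_diff f g) i z))"
    proof -
      have "Ck k (\<lambda>z. (\<Sum>j\<in>UNIV. f i j z * plane_sol l f g j z) + g i z + (- 1 * l i z) * plane_sol l (f_diff f) (g_diff f g) i z)"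
        by (intro Ck_add Ck_sum Ck_mult Ck_const vk uk gk lk fk)
      then show ?thesis using vk[of i] by simp
    qed
    fix z :: "real^2"
    consider "m = 1" | "m = 2" using exhaust_2 by blast
    then show "((\<lambda>s. plane_sol l f g i (z + s *\<^sub>R axis m 1)) has_field_derivative (if m = 1 then plane_sol l (f_diff f) (g_diff f g) i
      else (\<lambda>z. (\<Sum>j\<in>UNIV. f i j z * plane_sol l f g j z) + g i z + (- 1 * l i z) * plane_sol l (f_diff f) (g_diff f g) i z)) z) (at 0)"
      using plane_sol_DERIV[of f k g i z, OF f g] by cases simp_all
  qed
qed

lemma plane_sol_solves:
  assumes f: "\<And>i j. C_infinity (f i j)" and g: "\<And>i. C_infinity (g i)"
  shows "C_infinity (plane_sol l f g i)"
    and "pd 2 (plane_sol l f g i) z + l i z * pd 1 (plane_sol l f g i) z =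
      (\<Sum>j\<in>UNIV. f i j z * plane_sol l f g j z) + g i z"
    and "plane_sol l f g i (vector [x, 0]) = 0"
proof -
  have gk: "Ck k (g i)" for k i using g by (simp add: C_infinity_def)
  show "C_infinity (plane_sol l f g i)" unfolding C_infinity_def by (intro allI Ck_plane_sol f gk)
  show "pd 2 (plane_sol l f g i) z + l i z * pd 1 (plane_sol l f g i) z =
      (\<Sum>j\<in>UNIV. f i j z * plane_sol l f g j z) + g i z"
    using plane_sol_DERIV[of f 0 g i z, OF f gk, THEN pd_eqI] by simp
  show "plane_sol l f g i (vector [x, 0]) = 0"
    unfolding plane_sol_def
    using transport.tsol_init[OF transport_vector[of f g, OF f C_infinity_continuous[OF g]], of i x] by simp
qed

end

section \<open>Measurable dependence on the path\<close>

lemma flow_measurable: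
  assumes sp: "\<And>\<omega>. \<omega> \<in> space M \<Longrightarrow> speed (lam \<omega>) (lamx \<omega>)"
    and m: "\<And>x t. (\<lambda>\<omega>. lam \<omega> x t) \<in> borel_measurable M"
  shows "(\<lambda>\<omega>. flow (lam \<omega>) s x t) \<in> borel_measurable M"
proof (rule borel_measurable_LIMSEQ_real)
  show "(\<lambda>k. flow_iter (lam \<omega>) k s x t) \<longlonglongrightarrow> flow (lam \<omega>) s x t" if "\<omega> \<in> space M" for \<omega>
    by (rule speed.flow_LIMSEQ[OF sp[OF that]])
  show "(\<lambda>\<omega>. flow_iter (lam \<omega>) k s x t) \<in> borel_measurable M" for k
  proof (induction k arbitrary: s)
    case (Suc k)
    have "(\<lambda>\<omega>. oint t s (\<lambda>r. lam \<omega> (flow_iter (lam \<omega>) k r x t) r)) \<in> borel_measurable M"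
    proof (rule oint_measurable)
      show "continuous_on UNIV (\<lambda>r. lam \<omega> (flow_iter (lam \<omega>) k r x t) r)" if "\<omega> \<in> space M" for \<omega>
        by (rule speed.lam_flow_iter_cont[OF sp[OF that]])
      show "(\<lambda>\<omega>. lam \<omega> (flow_iter (lam \<omega>) k r x t) r) \<in> borel_measurable M" for r
      proof (rule measurable_at_random_point[where h = "\<lambda>y \<omega>. lam \<omega> y r", OF _ m Suc])
        show "continuous_on UNIV (\<lambda>y. lam \<omega> y r)" if "\<omega> \<in> space M" for \<omega>
          by (intro cont2D[OF speed.lam[OF sp[OF that]]] continuous_intros)
      qed
    qed
    then show ?case by simp
  qed simp
qed

lemma tsol_measurable:
  fixes lam lamx g :: "'w \<Rightarrow> 'n::finite \<Rightarrow> real \<Rightarrow> real \<Rightarrow> real"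
  assumes tr: "\<And>\<omega>. \<omega> \<in> space M \<Longrightarrow> transport (lam \<omega>) (lamx \<omega>) (f \<omega>) (g \<omega>)"
    and lam: "\<And>i x t. (\<lambda>\<omega>. lam \<omega> i x t) \<in> borel_measurable M"
    and f: "\<And>i j x t. (\<lambda>\<omega>. f \<omega> i j x t) \<in> borel_measurable M"
    and g: "\<And>i x t. (\<lambda>\<omega>. g \<omega> i x t) \<in> borel_measurable M"
  shows "(\<lambda>\<omega>. tsol (lam \<omega>) (f \<omega>) (g \<omega>) i x t) \<in> borel_measurable M"
  unfolding tsol_def
proof (rule borel_measurable_LIMSEQ_real)
  let ?w = "\<lambda>\<omega>. volterra_iter (\<lambda>i. flow (lam \<omega> i)) (\<lambda>i j s x t. f \<omega> i j (flow (lam \<omega> i) s x t) s)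
     (\<lambda>i s x t. g \<omega> i (flow (lam \<omega> i) s x t) s)"
  have V: "volterra (\<lambda>i. flow (lam \<omega> i)) (\<lambda>i j s x t. f \<omega> i j (flow (lam \<omega> i) s x t) s)
     (\<lambda>i s x t. g \<omega> i (flow (lam \<omega> i) s x t) s)" if "\<omega> \<in> space M" for \<omega>
  proof -
    interpret transport "lam \<omega>" "lamx \<omega>" "f \<omega>" "g \<omega>" by (rule tr[OF that])
    show ?thesis by (rule V.volterra_axioms)
  qed
  show "(\<lambda>n. ?w \<omega> n i x t) \<longlonglongrightarrow> volterra_sol (\<lambda>i. flow (lam \<omega> i)) (\<lambda>i j s x t. f \<omega> i j (flow (lam \<omega> i) s x t) s)
     (\<lambda>i s x t. g \<omega> i (flow (lam \<omega> i) s x t) s) i x t" if "\<omega> \<in> space M" for \<omega>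
    by (rule volterra.volterra_iter_LIMSEQ[OF V[OF that]])
  have fm: "(\<lambda>\<omega>. flow (lam \<omega> i) s x t) \<in> borel_measurable M" for i s x t
    by (rule flow_measurable[of M "\<lambda>\<omega>. lam \<omega> i" "\<lambda>\<omega>. lamx \<omega> i"]) (use tr lam in \<open>auto simp: transport_def\<close>)
  have at: "(\<lambda>\<omega>. h \<omega> (flow (lam \<omega> i) s x t) s) \<in> borel_measurable M"
    if "\<And>\<omega>. \<omega> \<in> space M \<Longrightarrow> cont2 (h \<omega>)" "\<And>x t. (\<lambda>\<omega>. h \<omega> x t) \<in> borel_measurable M"
    for h :: "'w \<Rightarrow> real \<Rightarrow> real \<Rightarrow> real" and i s x t
    by (rule measurable_at_random_point[where h = "\<lambda>y \<omega>. h \<omega> y s", OF _ that(2) fm])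
      (intro cont2D[OF that(1)] continuous_intros)
  show "(\<lambda>\<omega>. ?w \<omega> n i x t) \<in> borel_measurable M" for n
  proof (induction n arbitrary: i x t)
    case (Suc n)
    have "(\<lambda>\<omega>. oint 0 t (\<lambda>s. (\<Sum>j\<in>UNIV. f \<omega> i j (flow (lam \<omega> i) s x t) s * ?w \<omega> n j (flow (lam \<omega> i) s x t) s) +
        g \<omega> i (flow (lam \<omega> i) s x t) s)) \<in> borel_measurable M"
    proof (rule oint_measurable)
      show "continuous_on UNIV (\<lambda>s. (\<Sum>j\<in>UNIV. f \<omega> i j (flow (lam \<omega> i) s x t) s * ?w \<omega> n j (flow (lam \<omega> i) s x t) s) +
        g \<omega> i (flow (lam \<omega> i) s x t) s)" if w: "\<omega> \<in> space M" for \<omega>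
        by (rule volterra.integrand_cont[OF V[OF w], where w = "?w \<omega> n"])
          (auto intro: continuous_intros volterra.volterra_iter_cont[OF V[OF w]])
      show "(\<lambda>\<omega>. (\<Sum>j\<in>UNIV. f \<omega> i j (flow (lam \<omega> i) s x t) s * ?w \<omega> n j (flow (lam \<omega> i) s x t) s) +
        g \<omega> i (flow (lam \<omega> i) s x t) s) \<in> borel_measurable M" for s
      proof -
        have "(\<lambda>\<omega>. f \<omega> i j (flow (lam \<omega> i) s x t) s) \<in> borel_measurable M" for j
          by (rule at[of "\<lambda>\<omega>. f \<omega> i j", OF transport.f[OF tr] f])
        moreover have "(\<lambda>\<omega>. g \<omega> i (flow (lam \<omega> i) s x t) s) \<in> borel_measurable M"
          by (rule at[of "\<lambda>\<omega>. g \<omega> i", OF transport.g[OF tr] g])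
        moreover have "(\<lambda>\<omega>. ?w \<omega> n j (flow (lam \<omega> i) s x t) s) \<in> borel_measurable M" for j
          by (rule at[of "\<lambda>\<omega>. ?w \<omega> n j", OF volterra.volterra_iter_cont[OF V] Suc])
        ultimately show ?thesis by (intro borel_measurable_add borel_measurable_sum borel_measurable_times)
      qed
    qed
    then show ?case by simp
  qed simp
qed

context complete_measure
begin

lemma transport_existence0:
  fixes l g :: "'n::finite \<Rightarrow> ('a, 2) family"
  assumes l: "\<And>i. smooth_field M (l i)" and f: "\<And>i j. smooth_field M (f i j)" and g: "\<And>i. smooth_field M (g i)"
    and lb: "\<And>i T. \<exists>c. AE \<omega> in M. \<forall>\<epsilon>\<in>{0<..1}. \<forall>z. \<bar>z $ 2\<bar> \<le> T \<longrightarrow> \<bar>l i \<epsilon> z \<omega>\<bar> \<le> c"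
  shows "\<exists>u. (\<forall>i. smooth_field M (u i)) \<and> solves_transport M l f g u"
proof -
  define P where "P \<omega> \<longleftrightarrow> (\<forall>\<epsilon>\<in>{0<..1}. (\<forall>i. C_infinity (\<lambda>z. l i \<epsilon> z \<omega>)) \<and> (\<forall>i j. C_infinity (\<lambda>z. f i j \<epsilon> z \<omega>)) \<and>
    (\<forall>i. C_infinity (\<lambda>z. g i \<epsilon> z \<omega>)) \<and> (\<forall>i (n::nat). \<exists>c. \<forall>z. \<bar>z $ 2\<bar> \<le> real n \<longrightarrow> \<bar>l i \<epsilon> z \<omega>\<bar> \<le> c))" for \<omega>
  have AEP: "AE \<omega> in M. P \<omega>"
  proof -
    have 1: "AE \<omega> in M. \<forall>i. \<forall>\<epsilon>\<in>{0<..1}. C_infinity (\<lambda>z. l i \<epsilon> z \<omega>)" by (intro AE_all_finite smooth_fieldD l)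
    have 2: "AE \<omega> in M. \<forall>i j. \<forall>\<epsilon>\<in>{0<..1}. C_infinity (\<lambda>z. f i j \<epsilon> z \<omega>)" by (intro AE_all_finite smooth_fieldD f)
    have 3: "AE \<omega> in M. \<forall>i. \<forall>\<epsilon>\<in>{0<..1}. C_infinity (\<lambda>z. g i \<epsilon> z \<omega>)" by (intro AE_all_finite smooth_fieldD g)
    have 4: "AE \<omega> in M. \<forall>i (n::nat). \<forall>\<epsilon>\<in>{0<..1}. \<exists>c. \<forall>z. \<bar>z $ 2\<bar> \<le> real n \<longrightarrow> \<bar>l i \<epsilon> z \<omega>\<bar> \<le> c"
    proof (intro AE_all_finite, subst AE_all_countable, intro allI)
      fix i and n :: nat
      from lb[where T = "real n" and i = i] obtain c where "AE \<omega> in M. \<forall>\<epsilon>\<in>{0<..1}. \<forall>z. \<bar>z $ 2\<bar> \<le> real n \<longrightarrow> \<bar>l i \<epsilon> z \<omega>\<bar> \<le> c"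
        by (elim exE)
      then show "AE \<omega> in M. \<forall>\<epsilon>\<in>{0<..1}. \<exists>c. \<forall>z. \<bar>z $ 2\<bar> \<le> real n \<longrightarrow> \<bar>l i \<epsilon> z \<omega>\<bar> \<le> c"
        by eventually_elim blast
    qed
    from 1 2 3 4 show ?thesis unfolding P_def by eventually_elim simp
  qed
  define N where "N = {\<omega> \<in> space M. \<not> P \<omega>}"
  have N: "N \<in> sets M" using AEP unfolding AE_iff_null_sets N_def by auto
  have plane: "plane_transport (\<lambda>i z. l i \<epsilon> z \<omega>)" if "P \<omega>" "\<epsilon> \<in> {0<..1}" for \<omega> \<epsilon>
  proof
    show "C_infinity (\<lambda>z. l i \<epsilon> z \<omega>)" for i using that by (auto simp: P_def)
    show "\<exists>c. \<forall>z. \<bar>z $ 2\<bar> \<le> T \<longrightarrow> \<bar>l i \<epsilon> z \<omega>\<bar> \<le> c" for i T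
    proof -
      obtain n where n: "T \<le> real n" using real_arch_simple by blast
      have "\<exists>c. \<forall>z. \<bar>z $ 2\<bar> \<le> real n \<longrightarrow> \<bar>l i \<epsilon> z \<omega>\<bar> \<le> c" using that by (auto simp: P_def)
      then show ?thesis using n by (meson order_trans)
    qed
  qed
  define u where "u i \<epsilon> z \<omega> = (if \<omega> \<in> N then 0 else
    plane_sol (\<lambda>i z. l i \<epsilon> z \<omega>) (\<lambda>i j z. f i j \<epsilon> z \<omega>) (\<lambda>i z. g i \<epsilon> z \<omega>) i z)" for i \<epsilon> z \<omega>
  have sol: "C_infinity (\<lambda>z. u i \<epsilon> z \<omega>)"
    "pd 2 (\<lambda>z. u i \<epsilon> z \<omega>) z + l i \<epsilon> z \<omega> * pd 1 (\<lambda>z. u i \<epsilon> z \<omega>) z = (\<Sum>j\<in>UNIV. f i j \<epsilon> z \<omega> * u j \<epsilon> z \<omega>) + g i \<epsilon> z \<omega>"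
    "u i \<epsilon> (vector [x, 0]) \<omega> = 0"
    if w: "P \<omega>" and e: "\<epsilon> \<in> {0<..1}" for i \<epsilon> z \<omega> x
  proof -
    have ueq: "(\<lambda>z. u i \<epsilon> z \<omega>) = plane_sol (\<lambda>i z. l i \<epsilon> z \<omega>) (\<lambda>i j z. f i j \<epsilon> z \<omega>) (\<lambda>i z. g i \<epsilon> z \<omega>) i" for i
      using w by (intro ext) (simp add: u_def N_def)
    have fC: "C_infinity (\<lambda>z. f i j \<epsilon> z \<omega>)" and gC: "C_infinity (\<lambda>z. g i \<epsilon> z \<omega>)" for i j using w e by (auto simp: P_def)
    note S = plane_transport.plane_sol_solves[OF plane[OF w e], of "\<lambda>i j z. f i j \<epsilon> z \<omega>" "\<lambda>i z. g i \<epsilon> z \<omega>", OF fC gC]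
    show "C_infinity (\<lambda>z. u i \<epsilon> z \<omega>)" unfolding ueq by (rule S(1))
    show "pd 2 (\<lambda>z. u i \<epsilon> z \<omega>) z + l i \<epsilon> z \<omega> * pd 1 (\<lambda>z. u i \<epsilon> z \<omega>) z = (\<Sum>j\<in>UNIV. f i j \<epsilon> z \<omega> * u j \<epsilon> z \<omega>) + g i \<epsilon> z \<omega>"
      using S(2)[of i z] unfolding ueq by (simp only: fun_cong[OF ueq])
    show "u i \<epsilon> (vector [x, 0]) \<omega> = 0" using S(3)[of i x] by (simp only: fun_cong[OF ueq])
  qed
  have meas: "u i \<epsilon> z \<in> borel_measurable M" if e: "\<epsilon> \<in> {0<..1}" for i \<epsilon> z
  proof -
    define l' where "l' \<omega> i z = (if \<omega> \<in> N then 0 else l i \<epsilon> z \<omega>)" for \<omega> i and z :: "real^2"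
    define f' where "f' \<omega> i j z = (if \<omega> \<in> N then 0 else f i j \<epsilon> z \<omega>)" for \<omega> i j and z :: "real^2"
    define g' where "g' \<omega> i z = (if \<omega> \<in> N then 0 else g i \<epsilon> z \<omega>)" for \<omega> i and z :: "real^2"
    have "transport (\<lambda>i x t. l' \<omega> i (vector [x, t])) (\<lambda>i x t. pd 1 (l' \<omega> i) (vector [x, t]))
      (\<lambda>i j x t. f' \<omega> i j (vector [x, t])) (\<lambda>i x t. g' \<omega> i (vector [x, t]))" if w: "\<omega> \<in> space M" for \<omega>
    proof (rule plane_transport.transport_vector)
      have "l' \<omega> i = (if \<omega> \<in> N then (\<lambda>z. 0) else (\<lambda>z. l i \<epsilon> z \<omega>))" for i by (intro ext) (simp add: l'_def)
      then show "plane_transport (l' \<omega>)"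
        using plane[of \<omega> \<epsilon>] w e by (cases "\<omega> \<in> N") (auto simp: N_def plane_transport_def C_infinity_const)
      have "f' \<omega> i j = (if \<omega> \<in> N then (\<lambda>z. 0) else (\<lambda>z. f i j \<epsilon> z \<omega>))" for i j by (intro ext) (simp add: f'_def)
      then show "C_infinity (f' \<omega> i j)" for i j
        using w e by (cases "\<omega> \<in> N") (auto simp: N_def P_def C_infinity_const)
      have "g' \<omega> i = (if \<omega> \<in> N then (\<lambda>z. 0) else (\<lambda>z. g i \<epsilon> z \<omega>))" for i by (intro ext) (simp add: g'_def)
      then show "continuous_on UNIV (g' \<omega> i)" for i
        using w e by (cases "\<omega> \<in> N") (auto simp: N_def P_def C_infinity_continuous)
    qed
    moreover have "(\<lambda>\<omega>. l' \<omega> i z) \<in> borel_measurable M" "(\<lambda>\<omega>. f' \<omega> i j z) \<in> borel_measurable M"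
      "(\<lambda>\<omega>. g' \<omega> i z) \<in> borel_measurable M" for i j z
      unfolding l'_def f'_def g'_def using N
      by (auto intro!: measurable_If_set smooth_field_measurable[OF l e] smooth_field_measurable[OF f e]
        smooth_field_measurable[OF g e])
    ultimately have "(\<lambda>\<omega>. plane_sol (l' \<omega>) (f' \<omega>) (g' \<omega>) i z) \<in> borel_measurable M"
      unfolding plane_sol_def by (intro tsol_measurable) auto
    then have "(\<lambda>\<omega>. if \<omega> \<in> N then 0 else plane_sol (l' \<omega>) (f' \<omega>) (g' \<omega>) i z) \<in> borel_measurable M"
      using N by (intro measurable_If_set) auto
    moreover have "(\<lambda>\<omega>. if \<omega> \<in> N then 0 else plane_sol (l' \<omega>) (f' \<omega>) (g' \<omega>) i z) = u i \<epsilon> z"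
    proof (rule ext)
      fix \<omega>
      have "l' \<omega> = (\<lambda>i z. l i \<epsilon> z \<omega>)" "f' \<omega> = (\<lambda>i j z. f i j \<epsilon> z \<omega>)" "g' \<omega> = (\<lambda>i z. g i \<epsilon> z \<omega>)" if "\<omega> \<notin> N"
        using that by (intro ext, simp add: l'_def f'_def g'_def)+
      then show "(if \<omega> \<in> N then 0 else plane_sol (l' \<omega>) (f' \<omega>) (g' \<omega>) i z) = u i \<epsilon> z \<omega>"
        by (simp add: u_def)
    qed
    ultimately show ?thesis by simp
  qed
  show ?thesis
  proof (intro exI[of _ u] conjI allI)
    fix i
    show "smooth_field M (u i)"
      unfolding smooth_field_def
    proof (intro conjI allI ballI meas)
      show "AE \<omega> in M. \<forall>\<epsilon>\<in>{0<..1}. C_infinity (\<lambda>x. u i \<epsilon> x \<omega>)"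
        using AEP by eventually_elim (intro ballI sol(1))
    qed
  next
    show "solves_transport M l f g u"
      unfolding solves_cauchy_def fam_pds_singleton
    proof
      fix \<epsilon> :: real assume e: "\<epsilon> \<in> {0<..1}"
      show "AE \<omega> in M. (\<forall>i z. pd 2 (\<lambda>y. u i \<epsilon> y \<omega>) z + l i \<epsilon> z \<omega> * pd 1 (\<lambda>y. u i \<epsilon> y \<omega>) z =
          (\<Sum>j\<in>UNIV. f i j \<epsilon> z \<omega> * u j \<epsilon> z \<omega>) + g i \<epsilon> z \<omega>) \<and> (\<forall>i x. u i \<epsilon> (vector [x, 0]) \<omega> = 0)"
        using AEP by eventually_elim (intro conjI allI sol(2,3) e)
    qed
  qed
qed

end

section \<open>The Cauchy problem\<close>

lemma abs_le_mat_norm: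
  fixes a :: "'m::finite \<Rightarrow> 'n::finite \<Rightarrow> real"
  shows "\<bar>a i j\<bar> \<le> mat_norm a"
proof -
  have "\<bar>a i j\<bar> \<le> (\<Sum>j\<in>UNIV. \<bar>a i j\<bar>)" by (rule member_le_sum) auto
  also have "\<dots> \<le> mat_norm a" unfolding mat_norm_def by (rule Max_ge) auto
  finally show ?thesis .
qed

lemma log_bounded_log_type:
  fixes v :: "'m::finite \<Rightarrow> 'n::finite \<Rightarrow> ('w, 2) family"
  assumes "\<And>K. compact K \<Longrightarrow> \<exists>c>0. AE \<omega> in M. \<forall>\<epsilon>\<in>{0<..1}. \<forall>z\<in>K. mat_norm (\<lambda>i j. v i j \<epsilon> z \<omega>) \<le> c * \<bar>ln \<epsilon>\<bar>"
  shows "log_bounded M (v i j)"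
  unfolding log_bounded_def
proof (intro allI impI)
  fix K :: "(real^2) set" assume "compact K"
  from assms[OF this] obtain c where c: "c > 0"
    "AE \<omega> in M. \<forall>\<epsilon>\<in>{0<..1}. \<forall>z\<in>K. mat_norm (\<lambda>i j. v i j \<epsilon> z \<omega>) \<le> c * \<bar>ln \<epsilon>\<bar>"
    by (elim exE conjE)
  have "AE \<omega> in M. \<forall>z\<in>K. \<bar>v i j \<epsilon> z \<omega>\<bar> \<le> c * \<bar>ln \<epsilon>\<bar>" if e: "\<epsilon> \<in> {0<..1}" for \<epsilon>
    using c(2)
  proof eventually_elim
    case (elim \<omega>)
    show ?case using elim e abs_le_mat_norm[of "\<lambda>i j. v i j \<epsilon> _ \<omega>" i j] by (meson order_trans)
  qed
  then show "\<exists>\<kappa>. log_growth \<kappa> \<and> (\<forall>\<epsilon>\<in>{0<..1}. 0 \<le> \<kappa> \<epsilon> \<and> (AE \<omega> in M. \<forall>x\<in>K. \<bar>v i j \<epsilon> x \<omega>\<bar> \<le> \<kappa> \<epsilon>))"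
    using c(1) by (intro exI[of _ "\<lambda>\<epsilon>. c * \<bar>ln \<epsilon>\<bar>"] conjI ballI log_growth_ln mult_nonneg_nonneg) simp_all
qed

lemma log_bounded_negligible:
  fixes a :: "('w, 'd::finite) family"
  assumes "dom_fam M \<infinity> negligible_family a"
  shows "log_bounded M a"
  unfolding log_bounded_def
proof (intro allI impI)
  fix K :: "(real^'d) set" assume K: "compact K"
  have "loc_dom M \<infinity> negligible_family (fam_pds [] a)" using assms unfolding dom_fam_def by blast
  then have "loc_dom M \<infinity> negligible_family a" by simp
  from this K obtain c where "negligible_family c" "\<And>\<epsilon>. \<epsilon> \<in> {0<..1} \<Longrightarrow> 0 \<le> c \<epsilon>"
    "\<And>\<epsilon>. \<epsilon> \<in> {0<..1} \<Longrightarrow> AE \<omega> in M. \<forall>x\<in>K. \<bar>a \<epsilon> x \<omega>\<bar> \<le> c \<epsilon>"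
    by (rule loc_dom_infinity) (rule that)
  then show "\<exists>\<kappa>. log_growth \<kappa> \<and> (\<forall>\<epsilon>\<in>{0<..1}. 0 \<le> \<kappa> \<epsilon> \<and> (AE \<omega> in M. \<forall>x\<in>K. \<bar>a \<epsilon> x \<omega>\<bar> \<le> \<kappa> \<epsilon>))"
    by (intro exI[of _ c]) (simp add: log_growth_negligible)
qed

context lp_exponent
begin

text \<open>Subtracting an extension \<open>E\<close> of the initial data reduces to vanishing initial data.\<close>

definition shifted_source ::
    "('n::finite \<Rightarrow> ('w, 2) family) \<Rightarrow> ('n \<Rightarrow> 'n \<Rightarrow> ('w, 2) family) \<Rightarrow> ('n \<Rightarrow> ('w, 2) family) \<Rightarrow>
      ('n \<Rightarrow> ('w, 2) family) \<Rightarrow> 'n \<Rightarrow> ('w, 2) family" where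
  "shifted_source l f r E i = (\<lambda>\<epsilon> z \<omega>. (r i \<epsilon> z \<omega> + (\<Sum>j\<in>UNIV. f i j \<epsilon> z \<omega> * E j \<epsilon> z \<omega>)) -
     (fam_pds [2] (E i) \<epsilon> z \<omega> + l i \<epsilon> z \<omega> * fam_pds [1] (E i) \<epsilon> z \<omega>))"

lemma dom_fam_shifted_source:
  assumes F: "growth_class F" and l: "\<And>i. dom_fam M \<infinity> moderate (l i)"
    and f: "\<And>i j. dom_fam M \<infinity> moderate (f i j)" and r: "\<And>i. dom_fam M p F (r i)" and E: "\<And>i. dom_fam M p F (E i)"
  shows "dom_fam M p F (shifted_source l f r E i)"
  unfolding shifted_source_def
  by (intro dom_fam_diff[OF p F] dom_fam_add[OF p F] dom_fam_sum[OF p F] dom_fam_mult[OF p product_class_moderate[OF F]]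
    dom_fam_pds l f r E finite)

theorem dom_fam_cauchy_problem:
  fixes l r E u :: "'n::finite \<Rightarrow> ('w, 2) family"
  assumes F: "growth_class F"
    and l: "\<And>i. dom_fam M \<infinity> moderate (l i)" "\<And>i. strip_bounded M (l i)" "\<And>i. log_bounded M (fam_pds [1] (l i))"
    and f: "\<And>i j. dom_fam M \<infinity> moderate (f i j)" "\<And>i j. log_bounded M (f i j)"
    and u: "\<And>i. smooth_field M (u i)" and r: "\<And>i. dom_fam M p F (r i)" and E: "\<And>i. dom_fam M p F (E i)"
    and s: "solves_cauchy M l f r E u"
  shows "dom_fam M p F (u i)"
proof -
  define w where "w i = (\<lambda>\<epsilon> z \<omega>. u i \<epsilon> z \<omega> - E i \<epsilon> z \<omega>)" for i
  note Es = dom_fam_smooth[OF E]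
  have w: "smooth_field M (w i)" for i unfolding w_def by (intro smooth_field_diff u Es)
  have "solves_transport M l f (shifted_source l f r E) w"
    unfolding solves_cauchy_def
  proof
    fix \<epsilon> :: real assume e: "\<epsilon> \<in> {0<..1}"
    have 1: "AE \<omega> in M. \<forall>i. C_infinity (\<lambda>x. u i \<epsilon> x \<omega>)" by (intro AE_all_finite smooth_field_at[OF u e])
    have 2: "AE \<omega> in M. \<forall>i. C_infinity (\<lambda>x. E i \<epsilon> x \<omega>)" by (intro AE_all_finite smooth_field_at[OF Es e])
    from 1 2 solves_cauchyD[OF s e] show "AE \<omega> in M. (\<forall>i z. fam_pds [2] (w i) \<epsilon> z \<omega> + l i \<epsilon> z \<omega> * fam_pds [1] (w i) \<epsilon> z \<omega> =
       (\<Sum>j\<in>UNIV. f i j \<epsilon> z \<omega> * w j \<epsilon> z \<omega>) + shifted_source l f r E i \<epsilon> z \<omega>) \<and>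
       (\<forall>i x. w i \<epsilon> (vector [x, 0]) \<omega> = 0)"
    proof eventually_elim
      case (elim \<omega>)
      have pw: "fam_pds [m] (w i) \<epsilon> z \<omega> = fam_pds [m] (u i) \<epsilon> z \<omega> - fam_pds [m] (E i) \<epsilon> z \<omega>" for m i z
        using elim(1,2) by (simp add: w_def fam_pds_singleton pd_diff)
      have sw: "(\<Sum>j\<in>UNIV. f i j \<epsilon> z \<omega> * w j \<epsilon> z \<omega>) =
          (\<Sum>j\<in>UNIV. f i j \<epsilon> z \<omega> * u j \<epsilon> z \<omega>) - (\<Sum>j\<in>UNIV. f i j \<epsilon> z \<omega> * E j \<epsilon> z \<omega>)" for i z
        by (simp add: w_def right_diff_distrib sum_subtractf)
      show ?case
      proof (intro conjI allI)
        show "w i \<epsilon> (vector [x, 0]) \<omega> = 0" for i x using elim(3) by (simp add: w_def)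
        show "fam_pds [2] (w i) \<epsilon> z \<omega> + l i \<epsilon> z \<omega> * fam_pds [1] (w i) \<epsilon> z \<omega> =
          (\<Sum>j\<in>UNIV. f i j \<epsilon> z \<omega> * w j \<epsilon> z \<omega>) + shifted_source l f r E i \<epsilon> z \<omega>" for i z
          using elim(3)[THEN conjunct1, rule_format, of i z]
          unfolding pw sw shifted_source_def by (simp add: algebra_simps)
      qed
    qed
  qed
  from dom_fam_transport[OF F l f w dom_fam_shifted_source[OF F l(1) f(1) r E] this, of i]
  have "dom_fam M p F (\<lambda>\<epsilon> z \<omega>. w i \<epsilon> z \<omega> + E i \<epsilon> z \<omega>)" by (intro dom_fam_add[OF p F] E)
  then show ?thesis by (simp add: w_def)
qed

theorem cauchy_problem_existence:
  fixes l r E :: "'n::finite \<Rightarrow> ('w, 2) family"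
  assumes l: "\<And>i. smooth_field M (l i)" and f: "\<And>i j. smooth_field M (f i j)" and r: "\<And>i. smooth_field M (r i)"
    and E: "\<And>i. smooth_field M (E i)"
    and lb: "\<And>i T. \<exists>c. AE \<omega> in M. \<forall>\<epsilon>\<in>{0<..1}. \<forall>z. \<bar>z $ 2\<bar> \<le> T \<longrightarrow> \<bar>l i \<epsilon> z \<omega>\<bar> \<le> c"
  obtains u where "\<And>i. smooth_field M (u i)"
    "solves_cauchy M l f r E u"
proof -
  have src: "smooth_field M (shifted_source l f r E i)" for i
    unfolding shifted_source_def
    by (intro smooth_field_diff smooth_field_add smooth_field_sum smooth_field_mult smooth_field_pds l f r E)
  from transport_existence0[of l f "shifted_source l f r E", OF l f src lb] obtain w where
    "(\<forall>i. smooth_field M (w i)) \<and> solves_transport M l f (shifted_source l f r E) w" by (elim exE)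
  then have w: "\<And>i. smooth_field M (w i)" "solves_transport M l f (shifted_source l f r E) w" by simp_all
  define u where "u i = (\<lambda>\<epsilon> z \<omega>. w i \<epsilon> z \<omega> + E i \<epsilon> z \<omega>)" for i
  show thesis
  proof (rule that[of u])
    show "smooth_field M (u i)" for i unfolding u_def by (intro smooth_field_add w E)
    show "solves_cauchy M l f r E u"
      unfolding solves_cauchy_def
    proof
    fix \<epsilon> :: real assume e: "\<epsilon> \<in> {0<..1}"
    have 1: "AE \<omega> in M. \<forall>i. C_infinity (\<lambda>x. w i \<epsilon> x \<omega>)" by (intro AE_all_finite smooth_field_at[OF w(1) e])
    have 2: "AE \<omega> in M. \<forall>i. C_infinity (\<lambda>x. E i \<epsilon> x \<omega>)" by (intro AE_all_finite smooth_field_at[OF E e])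
    from 1 2 solves_cauchyD[OF w(2) e] show "AE \<omega> in M.
     (\<forall>i z. fam_pds [2] (u i) \<epsilon> z \<omega> + l i \<epsilon> z \<omega> * fam_pds [1] (u i) \<epsilon> z \<omega> =
       (\<Sum>j\<in>UNIV. f i j \<epsilon> z \<omega> * u j \<epsilon> z \<omega>) + r i \<epsilon> z \<omega>) \<and>
     (\<forall>i x. u i \<epsilon> (vector [x, 0]) \<omega> = E i \<epsilon> (vector [x, 0]) \<omega>)"
    proof eventually_elim
      case (elim \<omega>)
      have pu: "fam_pds [m] (u i) \<epsilon> z \<omega> = fam_pds [m] (w i) \<epsilon> z \<omega> + fam_pds [m] (E i) \<epsilon> z \<omega>" for m i z
        using elim(1,2) by (simp add: u_def fam_pds_singleton pd_add)
      have su: "(\<Sum>j\<in>UNIV. f i j \<epsilon> z \<omega> * u j \<epsilon> z \<omega>) =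
          (\<Sum>j\<in>UNIV. f i j \<epsilon> z \<omega> * w j \<epsilon> z \<omega>) + (\<Sum>j\<in>UNIV. f i j \<epsilon> z \<omega> * E j \<epsilon> z \<omega>)" for i z
        by (simp add: u_def distrib_left sum.distrib)
      show ?case
      proof (intro conjI allI)
        show "u i \<epsilon> (vector [x, 0]) \<omega> = E i \<epsilon> (vector [x, 0]) \<omega>" for i x using elim(3) by (simp add: u_def)
        show "fam_pds [2] (u i) \<epsilon> z \<omega> + l i \<epsilon> z \<omega> * fam_pds [1] (u i) \<epsilon> z \<omega> =
          (\<Sum>j\<in>UNIV. f i j \<epsilon> z \<omega> * u j \<epsilon> z \<omega>) + r i \<epsilon> z \<omega>" for i z
          using elim(3)[THEN conjunct1, rule_format, of i z]
          unfolding pu su shifted_source_def by (simp add: algebra_simps)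
      qed
    qed
    qed
  qed
qed

definition residual ::
    "('n::finite \<Rightarrow> ('w, 2) family) \<Rightarrow> ('n \<Rightarrow> 'n \<Rightarrow> ('w, 2) family) \<Rightarrow> ('n \<Rightarrow> ('w, 2) family) \<Rightarrow>
      ('n \<Rightarrow> ('w, 2) family) \<Rightarrow> 'n \<Rightarrow> ('w, 2) family" where
  "residual l f g u i = (\<lambda>\<epsilon> z \<omega>. (fam_pds [2] (u i) \<epsilon> z \<omega> + (\<Sum>j\<in>UNIV. (if i = j then l i \<epsilon> z \<omega> else 0) * fam_pds [1] (u j) \<epsilon> z \<omega>)) -
     ((\<Sum>j\<in>UNIV. f i j \<epsilon> z \<omega> * u j \<epsilon> z \<omega>) + g i \<epsilon> z \<omega>))"

lemma residual_eq:
  "residual l f g u i \<epsilon> z \<omega> = fam_pds [2] (u i) \<epsilon> z \<omega> + l i \<epsilon> z \<omega> * fam_pds [1] (u i) \<epsilon> z \<omega> -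
     ((\<Sum>j\<in>UNIV. f i j \<epsilon> z \<omega> * u j \<epsilon> z \<omega>) + g i \<epsilon> z \<omega>)"
  by (simp add: residual_def if_distrib[of "\<lambda>y. y * _"] cong: if_cong)

lemma smooth_field_residual:
  assumes "\<And>i. smooth_field M (l i)" "\<And>i j. smooth_field M (f i j)" "\<And>i. smooth_field M (g i)" "\<And>i. smooth_field M (u i)"
  shows "smooth_field M (residual l f g u i)"
  unfolding residual_eq[abs_def]
  by (intro smooth_field_diff smooth_field_add smooth_field_sum smooth_field_mult smooth_field_pds assms)

lemma equation_iff:
  assumes l: "\<And>i. dom_fam M \<infinity> moderate (l i)" and f: "\<And>i j. dom_fam M \<infinity> moderate (f i j)"
    and u: "\<And>i. dom_fam M p moderate (u i)" and g: "\<And>i. dom_fam M p moderate (g i)"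
  shows "G_add M p (G_dt M p (gcls M p (u i)))
      (G_matvec M p (G_diag M \<infinity> (\<lambda>i. gcls M \<infinity> (l i))) (\<lambda>j. G_dx M p (gcls M p (u j))) i) =
    G_add M p (G_matvec M p (\<lambda>i j. gcls M \<infinity> (f i j)) (\<lambda>j. gcls M p (u j)) i) (gcls M p (g i)) \<longleftrightarrow>
    dom_fam M p negligible_family (residual l f g u i)"
proof -
  interpret inf: lp_exponent M \<infinity> by unfold_locales simp
  note mm = product_class_moderate[OF growth_moderate]
  have diag: "G_diag M \<infinity> (\<lambda>i. gcls M \<infinity> (l i)) = (\<lambda>i j. gcls M \<infinity> (\<lambda>\<epsilon> x \<omega>. if i = j then l i \<epsilon> x \<omega> else 0))"
    by (intro ext inf.G_diag_gcls)
  have ld: "dom_fam M \<infinity> moderate (\<lambda>\<epsilon> x \<omega>. if i = j then l i \<epsilon> x \<omega> else 0)" for i j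
    using l dom_fam_const0[OF _ growth_moderate, of \<infinity> M] by (cases "i = j") auto
  have ud: "dom_fam M p moderate (fam_pds w (u i))" for w i by (rule dom_fam_pds[OF u])
  have s1: "dom_fam M p moderate (\<lambda>\<epsilon> z \<omega>. \<Sum>j\<in>UNIV. (if i = j then l i \<epsilon> z \<omega> else 0) * fam_pds [1] (u j) \<epsilon> z \<omega>)"
    by (intro dom_fam_sum[OF p growth_moderate] dom_fam_mult[OF p mm] ld ud finite)
  have s2: "dom_fam M p moderate (\<lambda>\<epsilon> z \<omega>. \<Sum>j\<in>UNIV. f i j \<epsilon> z \<omega> * u j \<epsilon> z \<omega>)"
    by (intro dom_fam_sum[OF p growth_moderate] dom_fam_mult[OF p mm] f u finite)
  show ?thesis
    unfolding G_dt_def G_dx_def diag G_pd_gcls[OF u] G_matvec_gcls[OF ld ud] G_matvec_gcls[OF f u]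
      G_add_gcls[OF ud s1] G_add_gcls[OF s2 g] residual_def
    by (rule gcls_eq_iff; intro dom_fam_add[OF p growth_moderate] ud s1 s2 g)
qed

end

theorem theorem5p2:
  fixes M :: "'w measure" and p :: ennreal
    and lam :: "'n::finite \<Rightarrow> ('w, 2) family set"
    and f :: "'n \<Rightarrow> 'n \<Rightarrow> ('w, 2) family set"
    and g :: "'n \<Rightarrow> ('w, 2) family set"
    and u\<^sub>0 :: "'n \<Rightarrow> ('w, 1) family set"
  assumes "prob_space M" and "complete_measure M"
    and "1 \<le> p"
    and "\<And>i. lam i \<in> G_space M \<infinity>"
    and "\<And>i j. f i j \<in> G_space M \<infinity>"
    and "uniformly_bounded_on_strips M (G_diag M \<infinity> lam)"
    and "uniform_local_log_type M (\<lambda>i j. G_dx M \<infinity> (G_diag M \<infinity> lam i j))"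
    and "uniform_local_log_type M f"
    and "\<And>i. g i \<in> G_space M p"
    and "\<And>i. u\<^sub>0 i \<in> G_space M p"
  shows "\<exists>!u :: 'n \<Rightarrow> ('w, 2) family set.
    (\<forall>i. u i \<in> G_space M p) \<and>
    (\<forall>i. G_add M p (G_dt M p (u i)) (G_matvec M p (G_diag M \<infinity> lam) (\<lambda>j. G_dx M p (u j)) i)
         = G_add M p (G_matvec M p f u i) (g i)) \<and>
    (\<forall>i. G_restrict0 M p (u i) = u\<^sub>0 i)"
proof -
  interpret lp_exponent M p
    by (rule lp_exponent.intro[OF assms(2)], unfold_locales) (rule assms(3))
  interpret inf: lp_exponent M \<infinity> by unfold_locales simp
  from assms(6)[unfolded uniformly_bounded_on_strips_def] obtain v where
    v0: "(\<forall>i j. v i j \<in> G_diag M \<infinity> lam i j) \<and>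
    (\<forall>a b. \<exists>c>0. AE \<omega> in M. \<forall>\<epsilon>\<in>{0<..1}. \<forall>x. \<forall>t\<in>{a..b}. mat_norm (\<lambda>i j. v i j \<epsilon> (vector [x, t]) \<omega>) \<le> c)"
    by (elim exE)
  note v = v0[THEN conjunct1, rule_format] v0[THEN conjunct2, rule_format]
  define l where "l i = v i i" for i
  have lin: "l i \<in> lam i" for i using v(1)[of i i] by (simp add: l_def G_diag_def)
  have l: "dom_fam M \<infinity> moderate (l i)" and lam_eq: "lam i = gcls M \<infinity> (l i)" for i
    using inf.G_spaceD[OF assms(4) lin] by auto
  have lb: "\<exists>c. AE \<omega> in M. \<forall>\<epsilon>\<in>{0<..1}. \<forall>z. \<bar>z $ 2\<bar> \<le> T \<longrightarrow> \<bar>l i \<epsilon> z \<omega>\<bar> \<le> c" for i T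
  proof -
    from v(2)[of "- T" T] obtain c where
      "AE \<omega> in M. \<forall>\<epsilon>\<in>{0<..1}. \<forall>x. \<forall>t\<in>{- T..T}. mat_norm (\<lambda>i j. v i j \<epsilon> (vector [x, t]) \<omega>) \<le> c"
      by (elim exE conjE)
    then have "AE \<omega> in M. \<forall>\<epsilon>\<in>{0<..1}. \<forall>z. \<bar>z $ 2\<bar> \<le> T \<longrightarrow> \<bar>l i \<epsilon> z \<omega>\<bar> \<le> c"
    proof eventually_elim
      case (elim \<omega>)
      show ?case
      proof (intro ballI allI impI)
        fix \<epsilon> :: real and z :: "real^2" assume e: "\<epsilon> \<in> {0<..1}" and z: "\<bar>z $ 2\<bar> \<le> T"
        have "mat_norm (\<lambda>i j. v i j \<epsilon> (vector [z $ 1, z $ 2]) \<omega>) \<le> c"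
          using elim[rule_format, OF e, of "z $ 2" "z $ 1"] z by (simp add: abs_le_iff minus_le_iff)
        with abs_le_mat_norm[of "\<lambda>i j. v i j \<epsilon> (vector [z $ 1, z $ 2]) \<omega>" i i]
        show "\<bar>l i \<epsilon> z \<omega>\<bar> \<le> c" by (simp add: l_def vector2_components)
      qed
    qed
    then show ?thesis by (rule exI)
  qed
  have sb: "strip_bounded M (l i)" for i
    unfolding strip_bounded_def
  proof
    fix T
    from lb[of T i] obtain c where c: "AE \<omega> in M. \<forall>\<epsilon>\<in>{0<..1}. \<forall>z. \<bar>z $ 2\<bar> \<le> T \<longrightarrow> \<bar>l i \<epsilon> z \<omega>\<bar> \<le> c"
      by (elim exE)
    have "AE \<omega> in M. \<forall>z. \<bar>z $ 2\<bar> \<le> T \<longrightarrow> \<bar>l i \<epsilon> z \<omega>\<bar> \<le> c" if "\<epsilon> \<in> {0<..1}" for \<epsilon>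
      using c by eventually_elim (use that in simp)
    then show "\<exists>c. \<forall>\<epsilon>\<in>{0<..1}. AE \<omega> in M. \<forall>z. \<bar>z $ 2\<bar> \<le> T \<longrightarrow> \<bar>l i \<epsilon> z \<omega>\<bar> \<le> c"
      by (intro exI[of _ c] ballI)
  qed
  from assms(7)[unfolded uniform_local_log_type_def] obtain d where
    d0: "(\<forall>i j. d i j \<in> G_dx M \<infinity> (G_diag M \<infinity> lam i j)) \<and>
    (\<forall>K. compact K \<longrightarrow> (\<exists>c>0. AE \<omega> in M. \<forall>\<epsilon>\<in>{0<..1}. \<forall>z\<in>K. mat_norm (\<lambda>i j. d i j \<epsilon> z \<omega>) \<le> c * \<bar>ln \<epsilon>\<bar>))"
    by (elim exE)
  note d = d0[THEN conjunct1, rule_format] d0[THEN conjunct2, rule_format]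
  have ll: "log_bounded M (fam_pds [1] (l i))" for i
  proof -
    have "d i i \<in> G_dx M \<infinity> (lam i)" using d(1)[of i i] by (simp add: G_diag_def)
    then have "d i i \<in> gcls M \<infinity> (fam_pds [1] (l i))"
      unfolding G_dx_def lam_eq inf.G_pd_gcls[OF l] .
    then have "dom_fam M \<infinity> negligible_family (\<lambda>\<epsilon> x \<omega>. fam_pds [1] (l i) \<epsilon> x \<omega> - d i i \<epsilon> x \<omega>)"
      unfolding inf.mem_gcls_iff by blast
    then have "log_bounded M (\<lambda>\<epsilon> x \<omega>. fam_pds [1] (l i) \<epsilon> x \<omega> - d i i \<epsilon> x \<omega>)" by (rule log_bounded_negligible)
    from log_bounded_diff[OF this log_bounded_diff[OF log_bounded_zero log_bounded_log_type[OF d(2)]], of i i]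
    show ?thesis by simp
  qed
  from assms(8)[unfolded uniform_local_log_type_def] obtain \<phi> where
    \<phi>0: "(\<forall>i j. \<phi> i j \<in> f i j) \<and>
    (\<forall>K. compact K \<longrightarrow> (\<exists>c>0. AE \<omega> in M. \<forall>\<epsilon>\<in>{0<..1}. \<forall>z\<in>K. mat_norm (\<lambda>i j. \<phi> i j \<epsilon> z \<omega>) \<le> c * \<bar>ln \<epsilon>\<bar>))"
    by (elim exE)
  note \<phi> = \<phi>0[THEN conjunct1, rule_format] \<phi>0[THEN conjunct2, rule_format]
  have \<phi>d: "dom_fam M \<infinity> moderate (\<phi> i j)" and f_eq: "f i j = gcls M \<infinity> (\<phi> i j)" for i j
    using inf.G_spaceD[OF assms(5) \<phi>(1)] by auto
  have \<phi>l: "log_bounded M (\<phi> i j)" for i j by (rule log_bounded_log_type[OF \<phi>(2)])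
  have "\<exists>G. \<forall>i. G i \<in> g i" by (rule choice) (meson G_space_nonempty assms(9))
  then obtain G where "\<And>i. G i \<in> g i" by blast
  then have Gd: "dom_fam M p moderate (G i)" and g_eq: "g i = gcls M p (G i)" for i
    using G_spaceD[OF assms(9)] by auto
  have "\<exists>B. \<forall>i. B i \<in> u\<^sub>0 i" by (rule choice) (meson G_space_nonempty assms(10))
  then obtain B where "\<And>i. B i \<in> u\<^sub>0 i" by blast
  then have Bd: "dom_fam M p moderate (B i)" and u0_eq: "u\<^sub>0 i = gcls M p (B i)" for i
    using G_spaceD[OF assms(10)] by auto
  define E where "E i = (\<lambda>\<epsilon> (z::real^2) \<omega>. B i \<epsilon> (vector [z $ 1]) \<omega>)" for i
  have Ed: "dom_fam M p moderate (E i)" for i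
    unfolding E_def by (rule dom_fam_extend[OF p growth_moderate Bd])
  note ls = dom_fam_smooth[OF l] and \<phi>s = dom_fam_smooth[OF \<phi>d] and Gs = dom_fam_smooth[OF Gd] and Es = dom_fam_smooth[OF Ed]
  obtain u where us: "\<And>i. smooth_field M (u i)" and sol: "solves_cauchy M l \<phi> G E u"
    by (rule cauchy_problem_existence[OF ls \<phi>s Gs Es lb]) (rule that)
  have ud: "dom_fam M p moderate (u i)" for i
    by (rule dom_fam_cauchy_problem[OF growth_moderate l sb ll \<phi>d \<phi>l us Gd Ed sol])
  have lam_eq': "lam = (\<lambda>i. gcls M \<infinity> (l i))" and f_eq': "f = (\<lambda>i j. gcls M \<infinity> (\<phi> i j))"
    by (intro ext lam_eq f_eq)+
  have eqn: "G_add M p (G_dt M p (gcls M p (w i))) (G_matvec M p (G_diag M \<infinity> lam) (\<lambda>j. G_dx M p (gcls M p (w j))) i)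
      = G_add M p (G_matvec M p f (\<lambda>j. gcls M p (w j)) i) (g i) \<longleftrightarrow>
      dom_fam M p negligible_family (residual l \<phi> G w i)"
    if "\<And>i. dom_fam M p moderate (w i)" for w i
    unfolding lam_eq' f_eq' g_eq by (rule equation_iff[OF l \<phi>d that Gd])
  have res_u: "dom_fam M p negligible_family (residual l \<phi> G u i)" for i
  proof (rule dom_fam_cong[OF dom_fam_const0[OF p growth_negligible] smooth_field_residual[OF ls \<phi>s Gs us]])
    fix \<epsilon> :: real assume "\<epsilon> \<in> {0<..1}"
    from solves_cauchyD[OF sol this] show "AE \<omega> in M. \<forall>z. residual l \<phi> G u i \<epsilon> z \<omega> = 0"
      by eventually_elim (simp add: residual_eq)
  qed
  have "\<And>i. G_restrict0 M p (gcls M p (u i)) = u\<^sub>0 i"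
  proof -
    fix i
    note ur = dom_fam_restrict[OF ud[of i]]
    have "dom_fam M p negligible_family (\<lambda>\<epsilon> (x::real^1) \<omega>. u i \<epsilon> (vector [x $ 1, 0]) \<omega> - B i \<epsilon> x \<omega>)"
    proof (rule dom_fam_cong[OF dom_fam_const0[OF p growth_negligible]])
      show "smooth_field M (\<lambda>\<epsilon> (x::real^1) \<omega>. u i \<epsilon> (vector [x $ 1, 0]) \<omega> - B i \<epsilon> x \<omega>)"
        by (rule smooth_field_diff[OF dom_fam_smooth[OF ur] dom_fam_smooth[OF Bd]])
      fix \<epsilon> :: real assume "\<epsilon> \<in> {0<..1}"
      from solves_cauchyD[OF sol this] show "AE \<omega> in M. \<forall>x::real^1. u i \<epsilon> (vector [x $ 1, 0]) \<omega> - B i \<epsilon> x \<omega> = 0"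
        by eventually_elim (simp add: E_def vector1_component)
    qed
    then show "G_restrict0 M p (gcls M p (u i)) = u\<^sub>0 i"
      unfolding G_restrict0_gcls[OF ud] u0_eq gcls_eq_iff[OF ur Bd] .
  qed
  note restr_u = this
  show ?thesis
  proof (rule ex1I[of _ "\<lambda>i. gcls M p (u i)"])
    show "(\<forall>i. gcls M p (u i) \<in> G_space M p) \<and>
      (\<forall>i. G_add M p (G_dt M p (gcls M p (u i))) (G_matvec M p (G_diag M \<infinity> lam) (\<lambda>j. G_dx M p (gcls M p (u j))) i)
         = G_add M p (G_matvec M p f (\<lambda>i. gcls M p (u i)) i) (g i)) \<and>
      (\<forall>i. G_restrict0 M p (gcls M p (u i)) = u\<^sub>0 i)"
      by (intro conjI allI G_space_gcls ud restr_u iffD2[OF eqn[of u, OF ud] res_u])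
  next
    fix V :: "'n \<Rightarrow> ('w, 2) family set"
    assume V: "(\<forall>i. V i \<in> G_space M p) \<and>
      (\<forall>i. G_add M p (G_dt M p (V i)) (G_matvec M p (G_diag M \<infinity> lam) (\<lambda>j. G_dx M p (V j)) i)
         = G_add M p (G_matvec M p f V i) (g i)) \<and>
      (\<forall>i. G_restrict0 M p (V i) = u\<^sub>0 i)"
    have "\<exists>v. \<forall>i. v i \<in> V i" by (rule choice) (meson G_space_nonempty V)
    then obtain v where vV: "\<And>i. v i \<in> V i" by blast
    have vd: "dom_fam M p moderate (v i)" and V_eq: "V i = gcls M p (v i)" for i
      using G_spaceD[OF _ vV] V by blast+
    have V_eq': "V = (\<lambda>i. gcls M p (v i))" by (intro ext V_eq)
    note vs = dom_fam_smooth[OF vd]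
    have res_v: "dom_fam M p negligible_family (residual l \<phi> G v i)" for i
      by (rule iffD1[OF eqn[of v, OF vd]]) (use V in \<open>simp only: V_eq'\<close>)
    define D where "D i = (\<lambda>\<epsilon> z \<omega>. v i \<epsilon> z \<omega> - u i \<epsilon> z \<omega>)" for i
    have Ds: "smooth_field M (D i)" for i unfolding D_def by (rule smooth_field_diff[OF vs us])
    define D0 where "D0 i = (\<lambda>\<epsilon> (z::real^2) \<omega>. D i \<epsilon> (vector [(vector [z $ 1] :: real^1) $ 1, 0]) \<omega>)" for i
    have D0: "dom_fam M p negligible_family (D0 i)" for i
    proof -
      note ur = dom_fam_restrict[OF ud[of i]] and vr = dom_fam_restrict[OF vd[of i]]
      have "G_restrict0 M p (gcls M p (v i)) = G_restrict0 M p (gcls M p (u i))"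
        using V restr_u by (simp add: V_eq[symmetric])
      then have "dom_fam M p negligible_family (\<lambda>\<epsilon> (x::real^1) \<omega>. v i \<epsilon> (vector [x $ 1, 0]) \<omega> - u i \<epsilon> (vector [x $ 1, 0]) \<omega>)"
        unfolding G_restrict0_gcls[OF ud] G_restrict0_gcls[OF vd] gcls_eq_iff[OF vr ur] .
      from dom_fam_extend[OF p growth_negligible this] show ?thesis by (simp only: D0_def D_def)
    qed
    define r where "r i = (\<lambda>\<epsilon> z \<omega>. residual l \<phi> G v i \<epsilon> z \<omega> - residual l \<phi> G u i \<epsilon> z \<omega>)" for i
    have r: "dom_fam M p negligible_family (r i)" for i
      unfolding r_def by (rule dom_fam_diff[OF p growth_negligible res_v res_u])
    have "solves_cauchy M l \<phi> r D0 D"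
      unfolding solves_cauchy_def
    proof
      fix \<epsilon> :: real assume e: "\<epsilon> \<in> {0<..1}"
      have 1: "AE \<omega> in M. \<forall>i. C_infinity (\<lambda>x. u i \<epsilon> x \<omega>)" by (intro AE_all_finite smooth_field_at[OF us e])
      have 2: "AE \<omega> in M. \<forall>i. C_infinity (\<lambda>x. v i \<epsilon> x \<omega>)" by (intro AE_all_finite smooth_field_at[OF vs e])
      from 1 2 show "AE \<omega> in M. (\<forall>i z. fam_pds [2] (D i) \<epsilon> z \<omega> + l i \<epsilon> z \<omega> * fam_pds [1] (D i) \<epsilon> z \<omega> =
         (\<Sum>j\<in>UNIV. \<phi> i j \<epsilon> z \<omega> * D j \<epsilon> z \<omega>) + r i \<epsilon> z \<omega>) \<and>
         (\<forall>i x. D i \<epsilon> (vector [x, 0]) \<omega> = D0 i \<epsilon> (vector [x, 0]) \<omega>)"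
      proof eventually_elim
        case (elim \<omega>)
        have pD: "fam_pds [m] (D i) \<epsilon> z \<omega> = fam_pds [m] (v i) \<epsilon> z \<omega> - fam_pds [m] (u i) \<epsilon> z \<omega>" for m i z
          using elim by (simp add: D_def fam_pds_singleton pd_diff)
        have sD: "(\<Sum>j\<in>UNIV. \<phi> i j \<epsilon> z \<omega> * D j \<epsilon> z \<omega>) =
            (\<Sum>j\<in>UNIV. \<phi> i j \<epsilon> z \<omega> * v j \<epsilon> z \<omega>) - (\<Sum>j\<in>UNIV. \<phi> i j \<epsilon> z \<omega> * u j \<epsilon> z \<omega>)" for i z
          by (simp add: D_def right_diff_distrib sum_subtractf)
        show ?case
        proof (intro conjI allI)
          show "D i \<epsilon> (vector [x, 0]) \<omega> = D0 i \<epsilon> (vector [x, 0]) \<omega>" for i x by (simp add: D0_def)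
          show "fam_pds [2] (D i) \<epsilon> z \<omega> + l i \<epsilon> z \<omega> * fam_pds [1] (D i) \<epsilon> z \<omega> =
            (\<Sum>j\<in>UNIV. \<phi> i j \<epsilon> z \<omega> * D j \<epsilon> z \<omega>) + r i \<epsilon> z \<omega>" for i z
            unfolding pD sD r_def residual_eq by (simp add: algebra_simps)
        qed
      qed
    qed
    then have "dom_fam M p negligible_family (D i)" for i
      by (rule dom_fam_cauchy_problem[OF growth_negligible l sb ll \<phi>d \<phi>l Ds r D0])
    then have "V i = gcls M p (u i)" for i
      unfolding V_eq D_def by (intro gcls_eqI vd ud)
    then show "V = (\<lambda>i. gcls M p (u i))" by (intro ext)
  qed
qed

end
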